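(* Let the weight $\mu$ be of one of the following two types. (D) Discrete distribution: $\mu(\beta)=\delta(\beta-\alpha)+\sum_{j=1}^m b_j\,\delta(\beta-\alpha_j)$, where $m\ge 0$, $1>\alpha>\alpha_1>\dots>\alpha_m>0$, $b_j>0$ for $j=1,\dots,m$, and $\delta$ is the Dirac delta. (C) Continuous distribution: $\mu\in C[0,1]$, $\mu(\beta)\ge 0$ for $\beta\in[0,1]$, $\mu\ne 0$ on a set of positive measure, and in addition $\mu\in C^3[0,1]$, $\mu(1)\neq 0$, and either $\mu(0)\ne 0$ or there are constants $c,\nu>0$ such that $\mu(\beta)=c\beta^\nu$ as $\beta\to 0$ (i.e. for all sufficiently small $\beta\ge 0$). Let $A$ be the generator of a bounded $C_0$-semigroup $T(t)$ on a Banach space $X$. Let $h(s)=\int_0^1\mu(\beta)s^\beta\,d\beta$, $g_1(s)=h(s)$, $g_2(s)=s/h(s)$. Let $S(t)$ be the solution operator of the distributed order problem in the Caputo sense, in which case put $g=g_1$, or of the distributed order problem in the Riemann-Liouville sense, in which case put $g=g_2$ (both problems are defined in the context). Then $S(t)$ satisfies the subordination identity $$S(t)=\int_0^\infty\varphi(t,\tau)T(\tau)\,d\tau,\quad t>0,$$ with the function $\varphi(t,\tau)$ defined by $$\varphi(t,\tau)=\frac{1}{2\pi\mathrm{i}}\int_{\gamma-\mathrm{i}\infty}^{\gamma+\mathrm{i}\infty}e^{st-\tau g(s)}\,\frac{g(s)}{s}\,ds,\qquad \gamma,t,\tau>0.$$ The function $\varphi(t,\tau)$ is a probability density function (in $\tau$),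 i.e. $$\varphi(t,\tau)\ge 0,\qquad \int_0^\infty\varphi(t,\tau)\,d\tau=1\qquad (t,\tau>0).$$ Moreover, in the discrete case (D) there exists $\theta_0\in(0,\pi/2)$ such that, for every $\tau>0$, $\varphi(t,\tau)$ as a function of $t$ admits an analytic extension to the sector $|\arg t|<\theta_0$ and is bounded on each subsector $|\arg t|\le\theta$ with $\theta<\theta_0$.
   Context: Complex powers are principal, $s^\beta=e^{\beta\log s}$ for $|\arg s|<\pi$, so that $h,g_1,g_2$ are defined on the line of integration. In case (D), $h(s)=s^\alpha+\sum_{j=1}^m b_js^{\alpha_j}$. Problems. With initial condition $u(0)=a\in X$, the Caputo problem is $$\int_0^1\mu(\beta)\,{}^{C}\!D_t^\beta u(t)\,d\beta=Au(t),\quad t>0,$$ and the Riemann-Liouville problem is $$u'(t)=\int_0^1\mu(\beta)\,D_t^\beta Au(t)\,d\beta,\quad t>0.$$ Here $J_t^\gamma f(t)=\frac1{\Gamma(\gamma)}\int_0^t(t-\tau)^{\gamma-1}f(\tau)\,d\tau$ for $\gamma>0$, ${}^{C}\!D_t^\beta=J_t^{1-\beta}\frac{d}{dt}$ and $D_t^\beta=\frac{d}{dt}J_t^{1-\beta}$ for $\beta\in(0,1)$, ${}^{C}\!D_t^0=D_t^0=I$, ${}^{C}\!D_t^1=D_t^1=d/dt$. Kernels. $k_1,k_2\in L^1_{loc}(\mathbb{R}_+)$, $\mathbb{R}_+=[0,\infty)$, are the functions with Laplace transforms $\widehat{k_1}(s)=1/h(s)$ and $\widehat{k_2}(s)=h(s)/s$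 for $s>0$, where $\widehat f(s)=\int_0^\infty e^{-st}f(t)\,dt$. Solution operators. For $k\in L^1_{loc}(\mathbb{R}_+)$ consider the Volterra equation $$u(t)=a+\int_0^tk(t-\tau)Au(\tau)\,d\tau,\quad t\ge 0.\qquad (\mathrm V_k)$$ A strong solution is a function $u\in C(\mathbb{R}_+;D(A))$ ($D(A)$ with the graph norm) for which $(\mathrm V_k)$ holds on $\mathbb{R}_+$. Equation $(\mathrm V_k)$ is well-posed if for each $a\in D(A)$ there is a unique strong solution $u(t;a)$, and $a_n\in D(A)$, $a_n\to 0$ imply $u(t;a_n)\to 0$ in $X$ uniformly on compact intervals. Its solution operator is $S(t)a=u(t;a)$, $a\in D(A)$, $t\ge 0$, extended by continuity to $X$. By definition, the Caputo (resp. Riemann-Liouville) problem is well-posed if $(\mathrm V_k)$ with $k=k_1$ (resp. $k=k_2$) is well-posed, and its solution operator is the solution operator of the corresponding equation $(\mathrm V_k)$. Under the hypotheses on $\mu$ and $A$ in the claim, both problems are well-posed. *)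

theory Defs
  imports "HOL-Analysis.Analysis"
begin

text \<open>\<open>Discrete \<alpha> m b a\<close> stands for \<open>\<delta>(\<beta> - \<alpha>) + (\<Sum>j=1..m. b j * \<delta>(\<beta> - a j))\<close>; only the values of
  \<open>b\<close> and \<open>a\<close> at \<open>1, \<dots>, m\<close> matter. Only the restriction of \<open>\<mu>\<close> to \<open>[0,1]\<close> matters in
  \<open>Continuous \<mu>\<close>.\<close>

datatype weight =
    is_Discrete: Discrete real nat "nat \<Rightarrow> real" "nat \<Rightarrow> real"
  | is_Continuous: Continuous "real \<Rightarrow> real"

definition C3_on :: "real set \<Rightarrow> (real \<Rightarrow> real) \<Rightarrow> bool" where
  "C3_on I f \<longleftrightarrow> (\<exists>f1 f2 f3.
     (\<forall>x\<in>I. (f has_real_derivative f1 x) (at x within I)) \<and>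
     (\<forall>x\<in>I. (f1 has_real_derivative f2 x) (at x within I)) \<and>
     (\<forall>x\<in>I. (f2 has_real_derivative f3 x) (at x within I)) \<and>
     continuous_on I f3)"

fun admissible_weight :: "weight \<Rightarrow> bool" where
  "admissible_weight (Discrete \<alpha> m b a) \<longleftrightarrow>
     0 < \<alpha> \<and> \<alpha> < 1 \<and>
     (\<forall>j\<in>{1..m}. 0 < b j \<and> 0 < a j \<and> a j < \<alpha>) \<and>
     (\<forall>i\<in>{1..m}. \<forall>j\<in>{1..m}. i < j \<longrightarrow> a j < a i)"
| "admissible_weight (Continuous \<mu>) \<longleftrightarrow>
     continuous_on {0..1} \<mu> \<and>
     (\<forall>\<beta>\<in>{0..1}. 0 \<le> \<mu> \<beta>) \<and>
     0 < emeasure lebesgue {\<beta>\<in>{0..1}. \<mu> \<beta> \<noteq> 0} \<and>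
     C3_on {0..1} \<mu> \<and>
     \<mu> 1 \<noteq> 0 \<and>
     (\<mu> 0 \<noteq> 0 \<or>
       (\<exists>c>0. \<exists>\<nu>>0. \<exists>\<epsilon>>0. \<forall>\<beta>\<in>{0..1}. \<beta> < \<epsilon> \<longrightarrow> \<mu> \<beta> = c * \<beta> powr \<nu>))"

text \<open>The function \<open>h(s) = \<integral>\<^sub>0\<^sup>1 \<mu>(\<beta>) s\<^sup>\<beta> d\<beta>\<close>, with principal powers.\<close>

fun weight_symbol :: "weight \<Rightarrow> complex \<Rightarrow> complex" where
  "weight_symbol (Discrete \<alpha> m b a) s =
     s powr complex_of_real \<alpha> +
     (\<Sum>j=1..m. complex_of_real (b j) * s powr complex_of_real (a j))"
| "weight_symbol (Continuous \<mu>) s =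
     integral {0..1} (\<lambda>\<beta>. complex_of_real (\<mu> \<beta>) * s powr complex_of_real \<beta>)"

definition bounded_C0_semigroup :: "(real \<Rightarrow> 'a::banach \<Rightarrow>\<^sub>L 'a) \<Rightarrow> bool" where
  "bounded_C0_semigroup T \<longleftrightarrow>
     T 0 = id_blinfun \<and>
     (\<forall>s\<ge>0. \<forall>t\<ge>0. T (s + t) = T s o\<^sub>L T t) \<and>
     (\<forall>x. ((\<lambda>t. T t x) \<longlongrightarrow> x) (at_right 0)) \<and>
     (\<exists>M. \<forall>t\<ge>0. norm (T t) \<le> M)"

text \<open>An unbounded operator is given by its domain \<open>D\<close> and a function \<open>A\<close> of which only the values
  on \<open>D\<close> are relevant.\<close>

definition is_generator :: "'a::banach set \<Rightarrow> ('a \<Rightarrow> 'a) \<Rightarrow> (real \<Rightarrow> 'a \<Rightarrow>\<^sub>L 'a) \<Rightarrow> bool" where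
  "is_generator D A T \<longleftrightarrow>
     D = {x. \<exists>y. ((\<lambda>r. (T r x - x) /\<^sub>R r) \<longlongrightarrow> y) (at_right 0)} \<and>
     (\<forall>x\<in>D. ((\<lambda>r. (T r x - x) /\<^sub>R r) \<longlongrightarrow> A x) (at_right 0))"

text \<open>The library's Bochner integral needs a second countable range space, so integrals with values
  in an arbitrary Banach space are gauge integrals, which extend the Bochner integral. In the
  equation below the integrand is an \<open>L\<^sup>1\<close> scalar function times a continuous function, hence
  Bochner integrable. Continuity into \<open>D\<close> with the graph norm is continuity of both \<open>u\<close> and
  \<open>A \<circ> u\<close>.\<close>

definition strong_solution ::
    "'a::banach set \<Rightarrow> ('a \<Rightarrow> 'a) \<Rightarrow> (real \<Rightarrow> real) \<Rightarrow> 'a \<Rightarrow> (real \<Rightarrow> 'a) \<Rightarrow> bool" where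
  "strong_solution D A k a u \<longleftrightarrow>
     (\<forall>t\<ge>0. u t \<in> D) \<and>
     continuous_on {0..} u \<and>
     continuous_on {0..} (\<lambda>t. A (u t)) \<and>
     (\<forall>t\<ge>0. ((\<lambda>\<tau>. k (t - \<tau>) *\<^sub>R A (u \<tau>)) has_integral (u t - a)) {0..t})"

definition volterra_well_posed :: "'a::banach set \<Rightarrow> ('a \<Rightarrow> 'a) \<Rightarrow> (real \<Rightarrow> real) \<Rightarrow> bool" where
  "volterra_well_posed D A k \<longleftrightarrow>
     (\<forall>a\<in>D. \<exists>u. strong_solution D A k a u \<and>
        (\<forall>v. strong_solution D A k a v \<longrightarrow> (\<forall>t\<ge>0. v t = u t))) \<and>
     (\<forall>(a :: nat \<Rightarrow> 'a) u.
        (\<forall>n. a n \<in> D) \<and> a \<longlonglongrightarrow> 0 \<and> (\<forall>n. strong_solution D A k (a n) (u n)) \<longrightarrow>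
        (\<forall>b\<ge>0. uniform_limit {0..b} u (\<lambda>_. 0) sequentially))"

definition volterra_solution_operator ::
    "'a::banach set \<Rightarrow> ('a \<Rightarrow> 'a) \<Rightarrow> (real \<Rightarrow> real) \<Rightarrow> (real \<Rightarrow> 'a \<Rightarrow>\<^sub>L 'a) \<Rightarrow> bool" where
  "volterra_solution_operator D A k S \<longleftrightarrow>
     volterra_well_posed D A k \<and>
     (\<forall>a\<in>D. \<forall>u. strong_solution D A k a u \<longrightarrow> (\<forall>t\<ge>0. S t a = u t))"

definition has_laplace_transform :: "(real \<Rightarrow> real) \<Rightarrow> (complex \<Rightarrow> complex) \<Rightarrow> bool" where
  "has_laplace_transform k F \<longleftrightarrow>
     (\<forall>b\<ge>0. set_integrable lebesgue {0..b} k) \<and>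
     (\<forall>s::real. s > 0 \<longrightarrow>
        set_integrable lebesgue {0..} (\<lambda>t. exp (- s * t) * k t) \<and>
        complex_of_real (LINT t:{0..}|lebesgue. exp (- s * t) * k t) = F (complex_of_real s))"

text \<open>The kernels are determined by their Laplace transforms up to null sets, which do not affect
  the Volterra equation.\<close>

definition caputo_solution_operator ::
    "weight \<Rightarrow> 'a::banach set \<Rightarrow> ('a \<Rightarrow> 'a) \<Rightarrow> (real \<Rightarrow> 'a \<Rightarrow>\<^sub>L 'a) \<Rightarrow> bool" where
  "caputo_solution_operator \<mu> D A S \<longleftrightarrow>
     (\<exists>k. has_laplace_transform k (\<lambda>s. 1 / weight_symbol \<mu> s) \<and>
          volterra_solution_operator D A k S)"

definition riemann_liouville_solution_operator ::
    "weight \<Rightarrow> 'a::banach set \<Rightarrow> ('a \<Rightarrow> 'a) \<Rightarrow> (real \<Rightarrow> 'a \<Rightarrow>\<^sub>L 'a) \<Rightarrow> bool" where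
  "riemann_liouville_solution_operator \<mu> D A S \<longleftrightarrow>
     (\<exists>k. has_laplace_transform k (\<lambda>s. weight_symbol \<mu> s / s) \<and>
          volterra_solution_operator D A k S)"

definition vertical_integrable :: "real \<Rightarrow> (complex \<Rightarrow> complex) \<Rightarrow> bool" where
  "vertical_integrable \<gamma> F \<longleftrightarrow> integrable lborel (\<lambda>\<omega>. F (Complex \<gamma> \<omega>))"

text \<open>\<open>\<integral> F(s) ds\<close> from \<open>\<gamma> - \<i>\<infinity>\<close> to \<open>\<gamma> + \<i>\<infinity>\<close>, with \<open>s = \<gamma> + \<i>\<omega>\<close>, \<open>ds = \<i> d\<omega>\<close>.\<close>

definition vertical_integral :: "real \<Rightarrow> (complex \<Rightarrow> complex) \<Rightarrow> complex" where
  "vertical_integral \<gamma> F = \<i> * (\<integral>\<omega>. F (Complex \<gamma> \<omega>) \<partial>lborel)"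

definition open_sector :: "real \<Rightarrow> complex set" where
  "open_sector \<theta> = {z. z \<noteq> 0 \<and> \<bar>Arg z\<bar> < \<theta>}"

definition closed_sector :: "real \<Rightarrow> complex set" where
  "closed_sector \<theta> = {z. z \<noteq> 0 \<and> \<bar>Arg z\<bar> \<le> \<theta>}"

end

theory Submission
  imports Defs "HOL-Complex_Analysis.Complex_Analysis" "HOL-Real_Asymp.Real_Asymp"
begin

text \<open>The function \<open>\<phi>(\<cdot>, \<tau>)\<close> is the inverse Laplace transform of \<open>exp (- \<tau> * g s) * g s / s\<close>. A continuous
  function is nonnegative if its Laplace transform, sampled at \<open>1, 2, \<dots>\<close>, is a Hausdorff moment
  sequence; \<open>exp (- \<tau> * g)\<close> and \<open>g s / s\<close> have this property because \<open>h\<close> is a mixture of the powers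
  \<open>s powr \<beta>\<close> with \<open>0 < \<beta> < 1\<close> and, for \<open>g s = s / h s\<close>, because of Kaluza's theorem on log-convex
  sequences. The tail \<open>\<psi>(t, \<sigma>)\<close> of \<open>\<phi>(t, \<cdot>)\<close> has Laplace transform \<open>exp (- \<sigma> * g s) / s\<close> in \<open>t\<close>, which gives
  total mass \<open>1\<close>. Since \<open>k\<close> has Laplace transform \<open>1 / g\<close>, the convolution of \<open>k\<close> with \<open>\<phi>(\<cdot>, \<sigma>)\<close> is
  \<open>\<psi>(\<cdot>, \<sigma>)\<close>. For \<open>a\<close> in the domain, integration by parts gives
  \<open>U t a - a = \<integral>\<^sub>0\<^sup>\<infinity> \<psi>(t, \<sigma>) T \<sigma> (A a) d\<sigma>\<close> for the subordinated operators \<open>U t a = \<integral>\<^sub>0\<^sup>\<infinity> \<phi>(t, \<tau>) T \<tau> a d\<tau>\<close>,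
  so \<open>U\<close> solves the Volterra equation and uniqueness identifies \<open>S\<close> with \<open>U\<close>. In the discrete case
  \<open>g\<close> maps a sector larger than the right half-plane into a smaller sector around the positive
  axis, and the line of integration can be turned into rays on which \<open>exp (s * t)\<close> stays bounded
  for all \<open>t\<close> in a sector.\<close>

section \<open>Laplace transforms and moment positivity\<close>

text \<open>Positivity of a density is usually drawn from Bernstein's theorem, which represents a
  completely monotone function by a measure. Here no measure is constructed: a functional that is
  nonnegative on the polynomials nonnegative over [0,1] carries enough information, and this
  property is stable under products, mixtures and pointwise limits. The samples start at 1 because
  the transforms are known for s > 0 only. The slowest decay is that of
  \<open>exp (- \<tau> * (s / h s))\<close> for a continuous weight: as the weight does not vanish
  at 1, h(s) is of order s / ln s, so s / h(s) grows only logarithmically and the integrand on a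
  vertical line decays like a power of exponent -1 - d with d possibly small. The contour estimates
  on half planes are built for this rate. X is an arbitrary Banach space, so vector-valued integrals
  are gauge integrals. Fubini and dominated convergence for them are replaced by step functions:
  scalar identities are proved by Laplace transforms and carried over cell by cell to the orbits of
  the semigroup.\<close>

definition moment_positive :: "(real \<Rightarrow> real) \<Rightarrow> bool" where
  "moment_positive F \<longleftrightarrow> (\<forall>n c. (\<forall>x\<in>{0..1}. 0 \<le> (\<Sum>i\<le>n. c i * x ^ i)) \<longrightarrow>
     0 \<le> (\<Sum>i\<le>n. c i * F (real i + 1)))"

lemma moment_positiveD:
  assumes "moment_positive F" and "\<And>x. 0 \<le> x \<Longrightarrow> x \<le> 1 \<Longrightarrow> 0 \<le> (\<Sum>i\<le>n. c i * x ^ i)"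
  shows "0 \<le> (\<Sum>i\<le>n. c i * F (real i + 1))"
  using assms unfolding moment_positive_def by auto

lemma moment_positive_cong:
  assumes "moment_positive F" and "\<And>s. s > 0 \<Longrightarrow> F s = G s"
  shows "moment_positive G"
proof -
  have "F (real i + 1) = G (real i + 1)" for i using assms(2) by simp
  then show ?thesis using assms(1) unfolding moment_positive_def by simp
qed

lemma moment_positive_add:
  assumes "moment_positive F" "moment_positive G"
  shows "moment_positive (\<lambda>s. F s + G s)"
  using assms unfolding moment_positive_def
  by (auto simp: distrib_left sum.distrib intro!: add_nonneg_nonneg)

text \<open>Termwise product of moment sequences: for fixed x in [0,1] the polynomial y -> p(x y) is
  nonnegative on [0,1], so the functional of \<open>G\<close> applied to it gives a polynomial in x
  that is again nonnegative on [0,1], to which the functional of \<open>F\<close> applies.\<close>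

lemma moment_positive_mult:
  assumes F: "moment_positive F" and G: "moment_positive G"
  shows "moment_positive (\<lambda>s. F s * G s)"
  unfolding moment_positive_def
proof (intro allI impI)
  fix n :: nat and c :: "nat \<Rightarrow> real"
  assume c: "\<forall>x\<in>{0..1}. 0 \<le> (\<Sum>i\<le>n. c i * x ^ i)"
  have "0 \<le> (\<Sum>i\<le>n. (c i * G (real i + 1)) * x ^ i)" if x: "0 \<le> x" "x \<le> 1" for x
  proof -
    have "0 \<le> (\<Sum>i\<le>n. (c i * x ^ i) * G (real i + 1))"
    proof (rule moment_positiveD[OF G])
      fix y :: real assume y: "0 \<le> y" "y \<le> 1"
      have "x * y \<in> {0..1}" using x y by (auto intro: mult_le_one)
      then have "0 \<le> (\<Sum>i\<le>n. c i * (x * y) ^ i)" using c by blast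
      then show "0 \<le> (\<Sum>i\<le>n. (c i * x ^ i) * y ^ i)" by (simp add: power_mult_distrib mult.assoc)
    qed
    then show ?thesis by (simp add: ac_simps)
  qed
  from moment_positiveD[OF F this]
  show "0 \<le> (\<Sum>i\<le>n. c i * (F (real i + 1) * G (real i + 1)))" by (simp add: ac_simps)
qed

lemma moment_positive_lim:
  assumes "\<And>n. moment_positive (F n)" and "\<And>s. s > 0 \<Longrightarrow> (\<lambda>n. F n s) \<longlonglongrightarrow> G s"
  shows "moment_positive G"
  unfolding moment_positive_def
proof (intro allI impI)
  fix n :: nat and c :: "nat \<Rightarrow> real"
  assume c: "\<forall>x\<in>{0..1}. 0 \<le> (\<Sum>i\<le>n. c i * x ^ i)"
  have "(\<lambda>m. \<Sum>i\<le>n. c i * F m (real i + 1)) \<longlonglongrightarrow> (\<Sum>i\<le>n. c i * G (real i + 1))"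
    by (intro tendsto_intros assms(2)) simp
  moreover have "0 \<le> (\<Sum>i\<le>n. c i * F m (real i + 1))" for m
    using assms(1)[of m] c unfolding moment_positive_def by blast
  ultimately show "0 \<le> (\<Sum>i\<le>n. c i * G (real i + 1))"
    by (intro LIMSEQ_le_const) auto
qed

lemma moment_positive_integral:
  assumes "AE x in N. moment_positive (F x)"
    and "\<And>s. s > 0 \<Longrightarrow> integrable N (\<lambda>x. F x s)"
  shows "moment_positive (\<lambda>s. \<integral>x. F x s \<partial>N)"
  unfolding moment_positive_def
proof (intro allI impI)
  fix n :: nat and c :: "nat \<Rightarrow> real"
  assume c: "\<forall>x\<in>{0..1}. 0 \<le> (\<Sum>i\<le>n. c i * x ^ i)"
  have "(\<Sum>i\<le>n. c i * (\<integral>x. F x (real i + 1) \<partial>N)) = (\<integral>x. (\<Sum>i\<le>n. c i * F x (real i + 1)) \<partial>N)"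
    by (subst Bochner_Integration.integral_sum) (auto intro!: integrable_mult_right assms(2))
  also have "0 \<le> \<dots>"
  proof (rule integral_nonneg_AE)
    show "AE x in N. 0 \<le> (\<Sum>i\<le>n. c i * F x (real i + 1))"
      using assms(1)
    proof eventually_elim
      case (elim x)
      then show ?case using c unfolding moment_positive_def by blast
    qed
  qed
  finally show "0 \<le> (\<Sum>i\<le>n. c i * (\<integral>x. F x (real i + 1) \<partial>N))" .
qed

lemma moment_positive_const: "c \<ge> 0 \<Longrightarrow> moment_positive (\<lambda>s. c)"
proof -
  assume c: "c \<ge> 0"
  have "0 \<le> (\<Sum>i\<le>n. d i * c)" if "\<forall>x\<in>{0..1}. 0 \<le> (\<Sum>i\<le>n. d i * x ^ i)" for n and d :: "nat \<Rightarrow> real"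
  proof -
    have "0 \<le> (\<Sum>i\<le>n. d i)" using that[rule_format, of 1] by simp
    then show ?thesis using c by (simp add: sum_distrib_right[symmetric])
  qed
  then show ?thesis unfolding moment_positive_def by blast
qed

text \<open>The samples are the moments of a point mass of weight \<open>exp (- a)\<close> at
  \<open>exp (- a)\<close>, which lies in [0,1] because a is nonnegative.\<close>

lemma moment_positive_exp:
  assumes "a \<ge> 0"
  shows "moment_positive (\<lambda>s. exp (- a * s))"
  unfolding moment_positive_def
proof (intro allI impI)
  fix n :: nat and c :: "nat \<Rightarrow> real"
  assume c: "\<forall>x\<in>{0..1}. 0 \<le> (\<Sum>i\<le>n. c i * x ^ i)"
  have "exp (- a * (real i + 1)) = exp (- a) * exp (- a) ^ i" for i
    by (simp add: exp_of_nat_mult[symmetric] exp_add[symmetric] algebra_simps)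
  then have "(\<Sum>i\<le>n. c i * exp (- a * (real i + 1))) = exp (-a) * (\<Sum>i\<le>n. c i * exp (-a) ^ i)"
    by (simp add: sum_distrib_left ac_simps)
  also have "\<dots> \<ge> 0" using c assms by simp
  finally show "0 \<le> (\<Sum>i\<le>n. c i * exp (- a * (real i + 1)))" .
qed

lemma moment_positive_cmult:
  "c \<ge> 0 \<Longrightarrow> moment_positive F \<Longrightarrow> moment_positive (\<lambda>s. c * F s)"
  by (intro moment_positive_mult moment_positive_const)

lemma moment_positive_power: "moment_positive F \<Longrightarrow> moment_positive (\<lambda>s. F s ^ n)"
  by (induction n) (auto intro: moment_positive_mult moment_positive_const)

lemma moment_positive_sum:
  "(\<And>i. i \<in> I \<Longrightarrow> moment_positive (F i)) \<Longrightarrow> moment_positive (\<lambda>s. \<Sum>i\<in>I. F i s)"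
  by (induction I rule: infinite_finite_induct)
     (auto intro: moment_positive_add moment_positive_const)

lemma moment_positive_suminf:
  assumes "\<And>i. moment_positive (F i)" and "\<And>s. s > 0 \<Longrightarrow> (\<lambda>i. F i s) sums G s"
  shows "moment_positive G"
proof (rule moment_positive_lim)
  show "moment_positive (\<lambda>s. \<Sum>i<n. F i s)" for n
    by (intro moment_positive_sum assms)
  show "(\<lambda>n. \<Sum>i<n. F i s) \<longlonglongrightarrow> G s" if "s > 0" for s
    using assms(2)[OF that] by (simp add: sums_def)
qed

lemma moment_positive_exp_comp:
  assumes "moment_positive P"
  shows "moment_positive (\<lambda>s. exp (P s))"
proof (rule moment_positive_suminf)
  show "moment_positive (\<lambda>s. inverse (fact i) * P s ^ i)" for i
    by (intro moment_positive_cmult moment_positive_power assms) simp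
  show "(\<lambda>i. inverse (fact i) * P s ^ i) sums exp (P s)" for s
    using exp_converges[of "P s"] by simp
qed

text \<open>After discretization a Bernstein function takes the form of a constant minus a moment
  positive function. In that form \<open>exp (- \<tau> * g)\<close> is a positive constant times the
  exponential of \<open>\<tau> * P\<close>, whose Taylor coefficients are nonnegative.\<close>

lemma moment_positive_exp_neg:
  assumes "moment_positive P" and "\<And>s. s > 0 \<Longrightarrow> g s = c - P s" and "\<tau> \<ge> 0"
  shows "moment_positive (\<lambda>s. exp (- \<tau> * g s))"
proof (rule moment_positive_cong)
  show "moment_positive (\<lambda>s. exp (- \<tau> * c) * exp (\<tau> * P s))"
    by (intro moment_positive_cmult moment_positive_exp_comp assms) (use assms in auto)
  show "exp (- \<tau> * c) * exp (\<tau> * P s) = exp (- \<tau> * g s)" if "s > 0" for s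
    unfolding assms(2)[OF that] by (simp add: exp_add[symmetric] algebra_simps)
qed

section \<open>One-sided Laplace transforms at real points\<close>

definition has_laplace :: "(real \<Rightarrow> real) \<Rightarrow> real \<Rightarrow> real \<Rightarrow> bool" where
  "has_laplace f s L \<longleftrightarrow> set_integrable lborel {0<..} (\<lambda>t. exp (- s * t) * f t) \<and>
     (LBINT t:{0<..}. exp (- s * t) * f t) = L"

lemma has_laplace_add:
  "has_laplace f s K \<Longrightarrow> has_laplace g s L \<Longrightarrow> has_laplace (\<lambda>t. f t + g t) s (K + L)"
  unfolding has_laplace_def by (auto simp: distrib_left set_integral_add)

lemma has_laplace_diff:
  "has_laplace f s K \<Longrightarrow> has_laplace g s L \<Longrightarrow> has_laplace (\<lambda>t. f t - g t) s (K - L)"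
  unfolding has_laplace_def by (auto simp: right_diff_distrib set_integral_diff)

lemma has_laplace_cmult:
  assumes "has_laplace f s K" shows "has_laplace (\<lambda>t. c * f t) s (c * K)"
proof -
  have eq: "(\<lambda>t. exp (- s * t) * (c * f t)) = (\<lambda>t. c * (exp (- s * t) * f t))" by (simp add: ac_simps)
  show ?thesis using assms unfolding has_laplace_def eq by simp
qed

lemma has_laplace_measurable:
  assumes "has_laplace f s L"
  shows "(\<lambda>t. indicator {0<..} t * f t) \<in> borel_measurable lborel"
proof -
  have "(\<lambda>t. indicator {0<..} t *\<^sub>R (exp (- s * t) * f t)) \<in> borel_measurable lborel"
    using assms unfolding has_laplace_def set_integrable_def by (auto intro: borel_measurable_integrable)
  then have "(\<lambda>t. exp (s * t) * (indicator {0<..} t *\<^sub>R (exp (- s * t) * f t))) \<in> borel_measurable lborel"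
    by measurable
  moreover have "(\<lambda>t. exp (s * t) * (indicator {0<..} t *\<^sub>R (exp (- s * t) * f t))) =
      (\<lambda>t. indicator {0<..} t * f t)"
    by (auto simp: fun_eq_iff indicator_def exp_minus)
  ultimately show ?thesis by simp
qed

text \<open>The transform is a mixture of the exponentials \<open>exp (- t * s)\<close> with
  nonnegative weights \<open>f t\<close>.\<close>

lemma moment_positive_laplace:
  assumes "\<And>t. t > 0 \<Longrightarrow> f t \<ge> 0" and "\<And>s. s > 0 \<Longrightarrow> has_laplace f s (F s)"
  shows "moment_positive F"
proof (rule moment_positive_cong)
  show "moment_positive (\<lambda>s. \<integral>t. indicator {0<..} t *\<^sub>R (exp (- s * t) * f t) \<partial>lborel)"
  proof (rule moment_positive_integral)
    show "AE t in lborel. moment_positive (\<lambda>s. indicator {0<..} t *\<^sub>R (exp (- s * t) * f t))"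
    proof (rule AE_I2)
      fix t :: real
      show "moment_positive (\<lambda>s. indicator {0<..} t *\<^sub>R (exp (- s * t) * f t))"
      proof (cases "t > 0")
        case True
        then have "moment_positive (\<lambda>s. f t * exp (- t * s))"
          by (intro moment_positive_cmult moment_positive_exp assms) auto
        then show ?thesis using True by (simp add: ac_simps)
      qed (simp add: moment_positive_const)
    qed
    show "integrable lborel (\<lambda>t. indicator {0<..} t *\<^sub>R (exp (- s * t) * f t))" if "s > 0" for s
      using assms(2)[OF that] unfolding has_laplace_def set_integrable_def by simp
  qed
  show "(\<integral>t. indicator {0<..} t *\<^sub>R (exp (- s * t) * f t) \<partial>lborel) = F s" if "s > 0" for s
    using assms(2)[OF that] unfolding has_laplace_def set_lebesgue_integral_def by simp
qed

text \<open>Substituting \<open>x = exp (- t)\<close>, the values of the transform at \<open>1, 2, \<dots>\<close> are the moments of \<open>f\<close>,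
  so moment positivity says that \<open>f\<close> integrates nonnegatively against polynomials in \<open>exp (- t)\<close> that
  are nonnegative on \<open>[0,1]\<close>, hence by Weierstrass against bump functions.\<close>

lemma laplace_nonneg:
  assumes lap: "\<And>k. has_laplace f (real k + 1) (F (real k + 1))" and pos: "moment_positive F"
    and t0: "t0 > 0" and cont: "isCont f t0"
  shows "f t0 \<ge> 0"
proof (rule ccontr)
  assume "\<not> f t0 \<ge> 0"
  then have neg: "f t0 < 0" by simp
  define I where "I = (LBINT t:{0<..}. \<bar>exp (- t) * f t\<bar>)"
  have int1: "set_integrable lborel {0<..} (\<lambda>t. exp (- t) * f t)"
    using lap[of 0] by (simp add: has_laplace_def)
  have int1a: "set_integrable lborel {0<..} (\<lambda>t. \<bar>exp (- t) * f t\<bar>)"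
    using set_integrable_abs[OF int1] .
  have I0: "I \<ge> 0" unfolding I_def unfolding set_lebesgue_integral_def by (rule integral_nonneg_AE) auto
  have meas: "(\<lambda>t. indicator {0<..} t * f t) \<in> borel_measurable lborel"
    using has_laplace_measurable[OF lap] .
  have intq: "set_integrable lborel {0<..} (\<lambda>t. exp (- t) * q (exp (- t)) * f t)"
    if q: "continuous_on {0..1} q" for q :: "real \<Rightarrow> real"
  proof -
    have "bounded (q ` {0..1})" using q compact_continuous_image compact_imp_bounded by blast
    then obtain B where B: "\<And>x. x \<in> {0..1} \<Longrightarrow> \<bar>q x\<bar> \<le> B" unfolding bounded_iff by (metis imageI real_norm_def)
    have "(\<lambda>x. indicator {0..1} x *\<^sub>R q x) \<in> borel_measurable borel"
      by (rule borel_measurable_continuous_on_indicator[OF _ q]) simp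
    then have "(\<lambda>t::real. indicator {0..1} (exp (-t)) *\<^sub>R q (exp (- t))) \<in> borel_measurable lborel"
      by (rule measurable_compose[rotated]) simp
    then have "(\<lambda>t. exp (- t) * (indicator {0..1} (exp (-t)) *\<^sub>R q (exp (- t))) * (indicator {0<..} t * f t)) \<in> borel_measurable lborel"
      by (intro borel_measurable_times[OF borel_measurable_times meas]) simp
    moreover have "(\<lambda>t. exp (- t) * (indicator {0..1} (exp (-t)) *\<^sub>R q (exp (- t))) * (indicator {0<..} t * f t))
       = (\<lambda>t. indicator {0<..} t *\<^sub>R (exp (- t) * q (exp (- t)) * f t))"
      by (auto simp: fun_eq_iff indicator_def)
    ultimately have "(\<lambda>t. indicator {0<..} t *\<^sub>R (exp (- t) * q (exp (- t)) * f t)) \<in> borel_measurable lborel"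
      by simp
    moreover have "set_integrable lborel {0<..} (\<lambda>t. B * \<bar>exp (- t) * f t\<bar>)" using int1a by simp
    ultimately show ?thesis unfolding set_integrable_def
    proof (elim Bochner_Integration.integrable_bound[rotated], intro AE_I2)
      fix t :: real
      show "norm (indicator {0<..} t *\<^sub>R (exp (- t) * q (exp (- t)) * f t))
        \<le> norm (indicator {0<..} t *\<^sub>R (B * \<bar>exp (- t) * f t\<bar>))"
        using B[of "exp (-t)"] by (auto simp: indicator_def abs_mult intro!: mult_mono mult_right_mono)
    qed
  qed
  have poly: "0 \<le> (LBINT t:{0<..}. exp (- t) * (\<Sum>i\<le>n. c i * exp (- t) ^ i) * f t)"
    if c: "\<And>x. 0 \<le> x \<Longrightarrow> x \<le> 1 \<Longrightarrow> 0 \<le> (\<Sum>i\<le>n. c i * x ^ i)" for n c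
  proof -
    have eq: "exp (- (real i + 1) * t) = exp (- t) * exp (- t) ^ i" for i t
      by (simp add: exp_of_nat_mult[symmetric] exp_add[symmetric] algebra_simps)
    define G where "G i t = indicator {0<..} t *\<^sub>R (exp (- (real i + 1) * t) * f t)" for i t
    have G: "integrable lborel (G i)" "integral\<^sup>L lborel (G i) = F (real i + 1)" for i
      using lap[of i] unfolding G_def has_laplace_def set_integrable_def set_lebesgue_integral_def by auto
    have "(\<Sum>i\<le>n. c i * F (real i + 1)) = (\<integral>t. (\<Sum>i\<le>n. c i * G i t) \<partial>lborel)"
      by (subst Bochner_Integration.integral_sum) (auto intro!: integrable_mult_right simp: G)
    also have "\<dots> = (LBINT t:{0<..}. exp (- t) * (\<Sum>i\<le>n. c i * exp (- t) ^ i) * f t)"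
      unfolding set_lebesgue_integral_def G_def eq
      by (intro Bochner_Integration.integral_cong) (auto simp: sum_distrib_left sum_distrib_right ac_simps)
    finally show ?thesis using moment_positiveD[OF pos c] by simp
  qed
  have q_pos: "0 \<le> (LBINT t:{0<..}. exp (- t) * q (exp (- t)) * f t)"
    if q: "continuous_on {0..1} q" and q0: "\<And>x. 0 \<le> x \<Longrightarrow> x \<le> 1 \<Longrightarrow> 0 \<le> q x" for q :: "real \<Rightarrow> real"
  proof (rule field_le_epsilon)
    fix e :: real assume e: "0 < e"
    \<comment> \<open>The polynomial approximation is corrected upwards: \<open>p + d\<close> is
      nonnegative on [0,1] and exceeds \<open>q\<close> by less than \<open>2 * d\<close>, so the
      integrals differ by at most \<open>2 * d * I\<close>; the \<open>+ 1\<close> avoids division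
      by zero.\<close>
    define d where "d = e / (2 * (I + 1))"
    have d: "d > 0" using e I0 by (simp add: d_def)
    obtain p where p: "real_polynomial_function p" "\<And>x. x \<in> {0..1} \<Longrightarrow> \<bar>q x - p x\<bar> < d"
      using Stone_Weierstrass_real_polynomial_function[OF _ q d] by auto
    have "real_polynomial_function (\<lambda>x. p x + d)" by (intro real_polynomial_function.intros(2,3) p(1))
    then obtain c n where cn: "(\<lambda>x. p x + d) = (\<lambda>x. \<Sum>i\<le>n. c i * x ^ i)"
      unfolding real_polynomial_function_iff_sum by blast
    have "0 \<le> (\<Sum>i\<le>n. c i * x ^ i)" if "0 \<le> x" "x \<le> 1" for x
      using p(2)[of x] q0[of x] that fun_cong[OF cn, of x] by auto
    from poly[OF this] have "0 \<le> (LBINT t:{0<..}. exp (- t) * (p (exp (- t)) + d) * f t)"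
      using fun_cong[OF cn] by simp
    also have "\<dots> \<le> (LBINT t:{0<..}. exp (- t) * q (exp (- t)) * f t + 2 * d * \<bar>exp (- t) * f t\<bar>)"
    proof (rule set_integral_mono)
      show "set_integrable lborel {0<..} (\<lambda>t. exp (- t) * (p (exp (- t)) + d) * f t)"
        by (rule intq[where q="\<lambda>x. p x + d"])
          (intro continuous_on_add continuous_on_const
             continuous_on_polymonial_function p(1)[unfolded real_polynomial_function_eq])
      show "set_integrable lborel {0<..} (\<lambda>t. exp (- t) * q (exp (- t)) * f t + 2 * d * \<bar>exp (- t) * f t\<bar>)"
        using intq[OF q] int1a by (intro set_integral_add) auto
      fix t :: real assume "t \<in> {0<..}"
      then have "\<bar>q (exp (-t)) - p (exp (-t))\<bar> < d" by (intro p) auto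
      then have "(p (exp (-t)) + d - q (exp (-t))) * f t \<le> 2 * d * \<bar>f t\<bar>"
        by - (rule order.trans[OF abs_ge_self], auto simp: abs_mult intro!: mult_right_mono)
      then have "exp (- t) * ((p (exp (-t)) + d - q (exp (-t))) * f t) \<le> exp (- t) * (2 * d * \<bar>f t\<bar>)"
        by simp
      then show "exp (- t) * (p (exp (- t)) + d) * f t
          \<le> exp (- t) * q (exp (- t)) * f t + 2 * d * \<bar>exp (- t) * f t\<bar>"
        by (simp add: algebra_simps abs_mult)
    qed
    also have "\<dots> = (LBINT t:{0<..}. exp (- t) * q (exp (- t)) * f t) + 2 * d * I"
      unfolding I_def using intq[OF q] int1a by (subst set_integral_add) auto
    also have "2 * d * I \<le> e" using e I0 by (simp add: d_def field_simps)
    finally show "0 \<le> (LBINT t:{0<..}. exp (- t) * q (exp (- t)) * f t) + e" by simp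
  qed
  define x0 where "x0 = exp (- t0)"
  have ev1: "\<forall>\<^sub>F t in nhds t0. f t < f t0 / 2"
    using order_tendstoD(2)[OF cont[unfolded isCont_def tendsto_at_iff_tendsto_nhds], of "f t0 / 2"] neg by simp
  have ev2: "\<forall>\<^sub>F t in nhds t0. t0 / 2 < t" using t0 by (intro order_tendstoD(1)[OF filterlim_ident]) auto
  obtain \<eta> where \<eta>: "\<eta> > 0" "\<And>t. dist t t0 < \<eta> \<Longrightarrow> f t < f t0 / 2 \<and> t0 / 2 < t"
    using eventually_conj[OF ev1 ev2] unfolding eventually_nhds_metric by blast
  have lncont: "isCont ln x0" by (intro isCont_ln) (simp add: x0_def)
  then obtain \<rho> where \<rho>: "\<rho> > 0" "\<And>x. dist x x0 < \<rho> \<Longrightarrow> dist (ln x) (ln x0) < \<eta>"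
    using \<eta>(1) unfolding continuous_at_eps_delta dist_real_def by blast
  have fneg: "f t < f t0 / 2" if "\<bar>exp (- t) - x0\<bar> < \<rho>" for t
    using \<rho>(2)[of "exp (- t)"] \<eta>(2)[of t] that by (auto simp: x0_def dist_real_def abs_minus_commute)
  \<comment> \<open>A tent in the variable x = exp(-t), supported where f < f t0 / 2. The integrand
    is therefore never positive, and it is strictly negative near t0.\<close>
  define q where "q x = max 0 (\<rho> - \<bar>x - x0\<bar>)" for x
  have "isCont (\<lambda>t. exp (- t)) t0" by (intro continuous_intros)
  moreover have "\<rho> / 2 > 0" using \<rho>(1) by simp
  ultimately obtain \<kappa> where \<kappa>: "\<kappa> > 0" "\<And>t. dist t t0 < \<kappa> \<Longrightarrow> \<bar>exp (- t) - x0\<bar> < \<rho> / 2"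
    unfolding continuous_at_eps_delta dist_real_def x0_def by blast
  define \<xi> where "\<xi> = min \<kappa> \<eta> / 2"
  have \<xi>: "0 < \<xi>" "\<xi> < \<kappa>" "\<xi> < \<eta>" using \<kappa>(1) \<eta>(1) by (auto simp: \<xi>_def)
  \<comment> \<open>Upper bound of the integrand on the window of radius \<open>\<xi>\<close> around
    t0: least value of the exponential, tent at least \<open>\<rho> / 2\<close>, and f at most
    \<open>f t0 / 2\<close>, which is negative.\<close>
  define K where "K = exp (- (t0 + \<xi>)) * (\<rho> / 2) * (f t0 / 2)"
  have K: "K < 0" using neg \<rho>(1) by (simp add: K_def mult_pos_neg)
  have qc: "continuous_on {0..1} q" unfolding q_def by (intro continuous_intros)
  have "0 \<le> (LBINT t:{0<..}. exp (- t) * q (exp (- t)) * f t)"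
    by (rule q_pos[OF qc]) (simp add: q_def)
  also have "\<dots> \<le> (\<integral>t. indicator {t0 - \<xi>..t0 + \<xi>} t *\<^sub>R K \<partial>lborel)"
    unfolding set_lebesgue_integral_def
  proof (rule integral_mono)
    show "integrable lborel (\<lambda>t. indicator {0<..} t *\<^sub>R (exp (- t) * q (exp (- t)) * f t))"
      using intq[OF qc] unfolding set_integrable_def .
    show "integrable lborel (\<lambda>t. indicator {t0 - \<xi>..t0 + \<xi>} t *\<^sub>R K)"
      by (intro integrable_scaleR_left integrable_real_indicator) (auto simp: emeasure_lborel_Icc_eq)
    fix t :: real
    have le0: "exp (- t) * q (exp (- t)) * f t \<le> 0"
    proof (cases "\<bar>exp (- t) - x0\<bar> < \<rho>")
      case True
      then have "f t \<le> 0" using fneg[OF True] neg by simp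
      then show ?thesis by (intro mult_nonneg_nonpos) (auto simp: q_def)
    qed (simp add: q_def)
    show "indicator {0<..} t *\<^sub>R (exp (- t) * q (exp (- t)) * f t) \<le> indicator {t0 - \<xi>..t0 + \<xi>} t *\<^sub>R K"
    proof (cases "t \<in> {t0 - \<xi>..t0 + \<xi>}")
      case True
      then have t: "dist t t0 < \<kappa>" "dist t t0 < \<eta>" using \<xi> by (auto simp: dist_real_def)
      have "t > 0" "f t \<le> f t0 / 2" using \<eta>(2)[OF t(2)] t0 by auto
      have "\<rho> / 2 \<le> q (exp (- t))" using \<kappa>(2)[OF t(1)] by (simp add: q_def max_def)
      then have "exp (- (t0 + \<xi>)) * (\<rho> / 2) * (- f t0 / 2) \<le> exp (- t) * q (exp (- t)) * (- f t)"
        using True \<open>f t \<le> f t0 / 2\<close> neg \<rho>(1) by (intro mult_mono) auto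
      then show ?thesis using True \<open>t > 0\<close> by (simp add: K_def)
    qed (use le0 in \<open>auto simp: indicator_def\<close>)
  qed
  also have "\<dots> = K * (2 * \<xi>)" using \<xi>(1) by simp
  also have "\<dots> < 0" using K \<xi>(1) by (simp add: mult_neg_pos)
  finally show False by simp
qed

lemma has_laplace_shift:
  "has_laplace f (s0 + s) L \<longleftrightarrow> has_laplace (\<lambda>t. exp (- s0 * t) * f t) s L"
proof -
  have "exp (- (s0 + s) * t) * f t = exp (- s * t) * (exp (- s0 * t) * f t)" for t
    by (simp add: exp_add[symmetric] mult.assoc[symmetric]) (simp add: algebra_simps)
  then show ?thesis unfolding has_laplace_def by presburger
qed

text \<open>The difference damped by \<open>exp (- s0 * t)\<close>, and its negative, have vanishing
  transforms at 1, 2, ..., and zero is moment positive; \<open>laplace_nonneg\<close> then gives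
  both signs at the point of continuity.\<close>

lemma laplace_unique:
  assumes "\<And>s. s > s0 \<Longrightarrow> has_laplace f s (F s)" and "\<And>s. s > s0 \<Longrightarrow> has_laplace g s (F s)"
    and "t > 0" "isCont f t" "isCont g t"
  shows "f t = g t"
proof -
  have z: "moment_positive (\<lambda>s. 0)" by (rule moment_positive_const) simp
  define d where "d t = exp (- s0 * t) * (f t - g t)" for t
  have "has_laplace d (real k + 1) 0" for k
    using has_laplace_diff[OF assms(1,2), of "s0 + (real k + 1)"]
    unfolding d_def by (subst has_laplace_shift[symmetric]) simp
  moreover from has_laplace_cmult[OF this, of "-1"] have "has_laplace (\<lambda>t. - d t) (real k + 1) 0" for k by simp
  moreover have "isCont d t" unfolding d_def using assms by (intro continuous_intros)
  moreover from this have "isCont (\<lambda>t. - d t) t" by (intro continuous_intros)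
  ultimately have "d t \<ge> 0" "- d t \<ge> 0"
    using laplace_nonneg[where F="\<lambda>_. 0" and f=d, OF _ z assms(3)]
      laplace_nonneg[where F="\<lambda>_. 0" and f="\<lambda>t. - d t", OF _ z assms(3)] by blast+
  then show ?thesis by (simp add: d_def)
qed

section \<open>Inverse Laplace transforms along vertical lines\<close>

lemma exp_decay_integrable:
  fixes w :: complex
  assumes "Re w > 0"
  shows "set_integrable lborel {0<..} (\<lambda>t. exp (- w * complex_of_real t))"
    and "(LBINT t:{0<..}. exp (- w * complex_of_real t)) = 1 / w"
proof -
  define c where "c = Re w"
  have c: "c > 0" using assms by (simp add: c_def)
  have ein: "einterval 0 \<infinity> = {0<..}" by (auto simp: einterval_def)
  have lim0: "((\<lambda>t. exp (- c * t)) \<longlongrightarrow> 0) at_top" using c by real_asymp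
  have "set_integrable lborel (einterval 0 \<infinity>) (\<lambda>t. exp (- c * t))"
  proof (rule interval_integral_FTC_nonneg(1)[where F="\<lambda>t. - exp (- c * t) / c" and A="-1/c" and B=0])
    show "DERIV (\<lambda>t. - exp (- c * t) / c) x :> exp (- c * x)" for x
      using c by (auto intro!: derivative_eq_intros)
    show "isCont (\<lambda>t. exp (- c * t)) x" for x by (intro continuous_intros)
    show "(((\<lambda>t. - exp (- c * t) / c) \<circ> real_of_ereal) \<longlongrightarrow> - 1 / c) (at_right 0)"
      unfolding zero_ereal_def ereal_tendsto_simps using c by (auto intro!: tendsto_eq_intros)
    show "(((\<lambda>t. - exp (- c * t) / c) \<circ> real_of_ereal) \<longlongrightarrow> 0) (at_left \<infinity>)"
      unfolding ereal_tendsto_simps using c by real_asymp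
  qed auto
  then have i: "set_integrable lborel {0<..} (\<lambda>t. exp (- c * t))" unfolding ein .
  show int: "set_integrable lborel {0<..} (\<lambda>t. exp (- w * complex_of_real t))"
    unfolding set_integrable_def
  proof (rule Bochner_Integration.integrable_bound[OF i[unfolded set_integrable_def]])
    show "(\<lambda>t. indicator {0<..} t *\<^sub>R exp (- w * complex_of_real t)) \<in> borel_measurable lborel"
      by measurable
  qed (auto simp: indicator_def c_def)
  have "(LBINT t=0..\<infinity>. exp (- w * complex_of_real t)) = 0 - (- 1 / w)"
  proof (rule interval_integral_FTC_integrable[where F="\<lambda>t. - exp (- w * complex_of_real t) / w"])
    have w0: "w \<noteq> 0" using assms by auto
    show "((\<lambda>t. - exp (- w * complex_of_real t) / w) has_vector_derivative exp (- w * complex_of_real x)) (at x)" for x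
    proof -
      have "((\<lambda>z. - exp (- w * z) / w) has_field_derivative exp (- w * complex_of_real x)) (at (complex_of_real x))"
        using w0 by (auto intro!: derivative_eq_intros)
      then show ?thesis by (rule has_vector_derivative_real_field)
    qed
    show "isCont (\<lambda>t. exp (- w * complex_of_real t)) x" for x by (intro continuous_intros)
    show "set_integrable lborel (einterval 0 \<infinity>) (\<lambda>t. exp (- w * complex_of_real t))"
      unfolding ein by (rule int)
    show "(((\<lambda>t. - exp (- w * complex_of_real t) / w) \<circ> real_of_ereal) \<longlongrightarrow> - 1 / w) (at_right 0)"
      unfolding zero_ereal_def ereal_tendsto_simps using w0 by (auto intro!: tendsto_eq_intros)
    have "((\<lambda>t. - exp (- w * complex_of_real t) / w) \<longlongrightarrow> 0) at_top"
    proof (rule tendsto_norm_zero_cancel)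
      have "((\<lambda>t. exp (- c * t) / norm w) \<longlongrightarrow> 0 / norm w) at_top" by (intro tendsto_intros lim0) (use w0 in simp)
      then show "((\<lambda>t. norm (- exp (- w * complex_of_real t) / w)) \<longlongrightarrow> 0) at_top"
        by (simp add: norm_divide c_def)
    qed
    then show "(((\<lambda>t. - exp (- w * complex_of_real t) / w) \<circ> real_of_ereal) \<longlongrightarrow> 0) (at_left \<infinity>)"
      unfolding ereal_tendsto_simps .
  qed auto
  then show "(LBINT t:{0<..}. exp (- w * complex_of_real t)) = 1 / w"
    unfolding zero_ereal_def interval_integral_to_infinity_eq by - (erule trans, simp)
qed

lemma has_laplace_exp: 
  assumes "a < s" shows "has_laplace (\<lambda>t. exp (a * t)) s (1 / (s - a))"
proof -
  have "Re (complex_of_real (s - a)) > 0" using assms by simp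
  note * = exp_decay_integrable[OF this]
  have eq: "exp (- complex_of_real (s - a) * complex_of_real t) = complex_of_real (exp (- s * t) * exp (a * t))" for t
    by (simp add: exp_add[symmetric] exp_of_real[symmetric] algebra_simps)
  define f where "f t = indicator {0<..} t *\<^sub>R (exp (- s * t) * exp (a * t))" for t
  have f: "indicator {0<..} t *\<^sub>R exp (- complex_of_real (s - a) * complex_of_real t) = complex_of_real (f t)" for t
    unfolding eq f_def by (simp add: scaleR_conv_of_real)
  have "integrable lborel (\<lambda>t. complex_of_real (f t))"
    using *(1) unfolding set_integrable_def f .
  then have "integrable lborel f" by (simp only: complex_of_real_integrable_eq)
  moreover have "complex_of_real (integral\<^sup>L lborel f) = complex_of_real (1 / (s - a))"
    using *(2) unfolding set_lebesgue_integral_def f integral_complex_of_real by simp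
  ultimately show ?thesis
    unfolding has_laplace_def set_integrable_def set_lebesgue_integral_def f_def[symmetric] of_real_eq_iff by simp
qed

lemma powr_tail_integrable:
  fixes d :: real
  assumes "d > 0"
  shows "integrable lborel (\<lambda>x::real. indicator {1..} x * x powr (- 1 - d))"
proof -
  have "(\<lambda>x::real. x powr (- 1 - d)) absolutely_integrable_on {1..}"
    using has_integral_powr_to_inf[of "-1-d" 1] assms
    by (intro nonnegative_absolutely_integrable_1) (auto simp: has_integral_iff)
  then have "integrable lebesgue (\<lambda>x. indicator {1..} x * x powr (- 1 - d))"
    unfolding set_integrable_def by simp
  then show ?thesis by (subst (asm) integrable_completion) auto
qed

lemma vertical_powr_integrable:
  fixes d :: real
  assumes "d > 0" "\<gamma> > 0"
  shows "integrable lborel (\<lambda>\<omega>. norm (Complex \<gamma> \<omega>) powr (- 1 - d))"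
proof -
  note i = powr_tail_integrable[OF assms(1)]
  have i2: "integrable lborel (\<lambda>x. indicator {1..} (-x) * (-x) powr (- 1 - d))"
    using lborel_integrable_real_affine[OF i, of "-1" 0] by simp
  have i3: "integrable lborel (\<lambda>x::real. indicator {-1..1} x * \<gamma> powr (- 1 - d))"
    by (intro integrable_mult_left) (auto intro!: integrable_real_indicator)
  \<comment> \<open>The modulus is at least |\<omega>| on the two tails and at least
    \<open>\<gamma>\<close> on the middle interval, and the exponent is negative.\<close>
  note bd = Bochner_Integration.integrable_add[OF Bochner_Integration.integrable_add[OF i i2] i3]
  show ?thesis
  proof (rule Bochner_Integration.integrable_bound[OF bd])
    show "(\<lambda>\<omega>. norm (Complex \<gamma> \<omega>) powr (- 1 - d)) \<in> borel_measurable lborel"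
      unfolding complex_norm by measurable
    show "AE \<omega> in lborel. norm (norm (Complex \<gamma> \<omega>) powr (- 1 - d)) \<le>
      norm (indicator {1..} \<omega> * \<omega> powr (- 1 - d) + indicator {1..} (-\<omega>) * (-\<omega>) powr (- 1 - d)
        + indicator {-1..1} \<omega> * \<gamma> powr (- 1 - d))"
    proof (rule AE_I2)
      fix \<omega> :: real
      have n: "\<gamma> \<le> norm (Complex \<gamma> \<omega>)" "\<bar>\<omega>\<bar> \<le> norm (Complex \<gamma> \<omega>)"
        using abs_Re_le_cmod[of "Complex \<gamma> \<omega>"] abs_Im_le_cmod[of "Complex \<gamma> \<omega>"] by auto
      have a: "norm (Complex \<gamma> \<omega>) powr (- 1 - d) \<le> \<gamma> powr (- 1 - d)"
        using n assms by (intro powr_mono2') auto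
      have b: "norm (Complex \<gamma> \<omega>) powr (- 1 - d) \<le> \<bar>\<omega>\<bar> powr (- 1 - d)" if "\<omega> \<noteq> 0"
        using n assms that by (intro powr_mono2') auto
      have nn: "0 \<le> indicator {1..} \<omega> * \<omega> powr (- 1 - d)" "0 \<le> indicator {1..} (-\<omega>) * (-\<omega>) powr (- 1 - d)"
        "0 \<le> indicator {-1..1} \<omega> * \<gamma> powr (- 1 - d)" by auto
      consider "\<omega> \<in> {-1..1}" | "\<omega> > 1" | "\<omega> < -1" by fastforce
      then have "norm (Complex \<gamma> \<omega>) powr (- 1 - d) \<le>
        indicator {1..} \<omega> * \<omega> powr (- 1 - d) + indicator {1..} (-\<omega>) * (-\<omega>) powr (- 1 - d)
        + indicator {-1..1} \<omega> * \<gamma> powr (- 1 - d)"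
        using a b nn by cases (auto simp: indicator_def abs_if split: if_splits)
      then show "norm (norm (Complex \<gamma> \<omega>) powr (- 1 - d)) \<le>
        norm (indicator {1..} \<omega> * \<omega> powr (- 1 - d) + indicator {1..} (-\<omega>) * (-\<omega>) powr (- 1 - d)
        + indicator {-1..1} \<omega> * \<gamma> powr (- 1 - d))" by simp
    qed
  qed
qed

text \<open>The condition \<open>cnj\<close> is the reflection symmetry that makes the inverse
  transform real. The exponent d may depend on \<open>\<gamma>\<close> and be arbitrarily small; it
  gives absolute convergence on vertical lines and lets contours be closed at infinity.\<close>

locale vertical_decay =
  fixes F :: "complex \<Rightarrow> complex"
  assumes holo: "F holomorphic_on {z. 0 < Re z}"
    and decay: "\<And>\<gamma>. \<gamma> > 0 \<Longrightarrow> \<exists>C d. d > 0 \<and> (\<forall>z. \<gamma> \<le> Re z \<longrightarrow> norm (F z) \<le> C * norm z powr (- 1 - d))"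
    and cnj: "\<And>z. Re z > 0 \<Longrightarrow> F (cnj z) = cnj (F z)"
begin

lemma cont_line: "\<gamma> > 0 \<Longrightarrow> continuous_on UNIV (\<lambda>\<omega>. F (Complex \<gamma> \<omega>))"
proof -
  assume "\<gamma> > 0"
  then show ?thesis
    by (intro continuous_on_compose2[OF holomorphic_on_imp_continuous_on[OF holo]])
       (auto simp: Complex_eq intro!: continuous_intros)
qed

lemma meas_line: "\<gamma> > 0 \<Longrightarrow> (\<lambda>\<omega>. F (Complex \<gamma> \<omega>)) \<in> borel_measurable borel"
  using cont_line by (rule borel_measurable_continuous_onI)

lemma integrable_line: assumes "\<gamma> > 0" shows "integrable lborel (\<lambda>\<omega>. F (Complex \<gamma> \<omega>))"
proof -
  obtain C d where Cd: "d > 0" "\<And>z. \<gamma> \<le> Re z \<Longrightarrow> norm (F z) \<le> C * norm z powr (- 1 - d)"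
    using decay[OF assms] by blast
  have "integrable lborel (\<lambda>\<omega>. C * norm (Complex \<gamma> \<omega>) powr (- 1 - d))"
    using vertical_powr_integrable[OF Cd(1) assms] by simp
  then show ?thesis
  proof (rule Bochner_Integration.integrable_bound)
    show "(\<lambda>\<omega>. F (Complex \<gamma> \<omega>)) \<in> borel_measurable lborel" using meas_line[OF assms] by simp
    show "AE \<omega> in lborel. norm (F (Complex \<gamma> \<omega>)) \<le> norm (C * norm (Complex \<gamma> \<omega>) powr (- 1 - d))"
    proof (rule AE_I2)
      fix \<omega>
      have "norm (F (Complex \<gamma> \<omega>)) \<le> C * norm (Complex \<gamma> \<omega>) powr (- 1 - d)" by (rule Cd(2)) simp
      also have "\<dots> \<le> norm (C * norm (Complex \<gamma> \<omega>) powr (- 1 - d))" by simp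
      finally show "norm (F (Complex \<gamma> \<omega>)) \<le> norm (C * norm (Complex \<gamma> \<omega>) powr (- 1 - d))" .
    qed
  qed
qed

text \<open>Cauchy's formula on rectangles whose left side lies on the line Re z = \<gamma>; the
  other three sides contribute nothing in the limit. The line is traversed downwards, which accounts
  for the denominator s - z in place of z - s.\<close>

lemma half_plane_Cauchy:
  assumes g: "\<gamma> > 0" and s: "s > \<gamma>"
  shows "F (complex_of_real s) =
    1 / (2 * pi) * (\<integral>\<omega>. F (Complex \<gamma> \<omega>) / (complex_of_real s - Complex \<gamma> \<omega>) \<partial>lborel)"
proof -
  obtain C d where Cd: "d > 0" "\<And>z. \<gamma> \<le> Re z \<Longrightarrow> norm (F z) \<le> C * norm z powr (- 1 - d)"
    using decay[OF g] by blast
  have C: "C \<ge> 0"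
  proof -
    have "0 \<le> norm (F (of_real \<gamma>))" by simp
    also have "\<dots> \<le> C * \<gamma> powr (- 1 - d)" using Cd(2)[of "of_real \<gamma>"] g by simp
    finally show ?thesis using g by (simp add: zero_le_mult_iff)
  qed
  define G where "G w = F w / (w - of_real s)" for w
  define J where "J R = integral {- R..R} (\<lambda>\<omega>. G (Complex \<gamma> \<omega>))" for R
  have Gc: "continuous_on ({z. 0 < Re z} - {of_real s}) G"
    unfolding G_def by (intro continuous_intros continuous_on_subset[OF holomorphic_on_imp_continuous_on[OF holo]]) auto
  \<comment> \<open>The 12 collects three sides of length at most \<open>2 * R\<close> on which the
    integrand is at most \<open>C * R powr (- 1 - d) / (R / 2)\<close>; the condition
    \<open>R > 2 * s\<close> keeps these sides at distance at least \<open>R / 2\<close> from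
    s.\<close>
  have bound: "norm (2 * pi * \<i> * F (of_real s) + \<i> * J R) \<le> 12 * C * R powr (- 1 - d)"
    if R: "R > 2 * s" for R
  proof -
    define a1 a2 a3 a4 where "a1 = Complex \<gamma> (- R)" and "a2 = Complex R (- R)"
      and "a3 = Complex R R" and "a4 = Complex \<gamma> R"
    note a_def = a1_def a2_def a3_def a4_def
    have R0: "R > 0" "R > \<gamma>" using R s g by auto
    have rp: "rectpath a1 a3 = linepath a1 a2 +++ linepath a2 a3 +++ linepath a3 a4 +++ linepath a4 a1"
      by (simp add: rectpath_def a_def Let_def)
    have sbox: "complex_of_real s \<in> box a1 a3" using R s g by (simp add: a_def in_box_complex_iff)
    have img: "path_image (rectpath a1 a3) \<subseteq> {z. 0 < Re z} - {of_real s}"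
    proof -
      have "path_image (rectpath a1 a3) \<subseteq> cbox a1 a3"
        using R0 by (intro path_image_rectpath_subset_cbox) (auto simp: a_def)
      moreover have "path_image (rectpath a1 a3) \<inter> box a1 a3 = {}"
        using R0 by (intro path_image_rectpath_inter_box) (auto simp: a_def)
      ultimately show ?thesis using sbox g by (fastforce simp: in_cbox_complex_iff a_def)
    qed
    have "((\<lambda>w. F w / (w - of_real s)) has_contour_integral
        (2 * pi * \<i> * winding_number (rectpath a1 a3) (of_real s) * F (of_real s))) (rectpath a1 a3)"
    proof (rule Cauchy_integral_formula_convex_simple[OF convex_halfspace_Re_gt holo])
      show "complex_of_real s \<in> interior {z. 0 < Re z}"
        using g s open_halfspace_Re_gt[of 0] by (simp add: interior_open)
    qed (use img in auto)
    then have ci: "contour_integral (rectpath a1 a3) G = 2 * of_real pi * \<i> * F (of_real s)"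
      using winding_number_rectpath[OF sbox] unfolding G_def by (simp add: contour_integral_unique)
    have img': "closed_segment a1 a2 \<subseteq> {z. 0 < Re z} - {of_real s}" "closed_segment a2 a3 \<subseteq> {z. 0 < Re z} - {of_real s}"
      "closed_segment a3 a4 \<subseteq> {z. 0 < Re z} - {of_real s}" "closed_segment a4 a1 \<subseteq> {z. 0 < Re z} - {of_real s}"
      using img unfolding rp by (auto simp: path_image_join)
    have ints: "G contour_integrable_on (linepath a1 a2)" "G contour_integrable_on (linepath a2 a3)"
      "G contour_integrable_on (linepath a3 a4)" "G contour_integrable_on (linepath a4 a1)"
      by (intro contour_integrable_continuous_linepath continuous_on_subset[OF Gc] img')+
    have sum: "contour_integral (rectpath a1 a3) G = contour_integral (linepath a1 a2) G +
       contour_integral (linepath a2 a3) G + contour_integral (linepath a3 a4) G + contour_integral (linepath a4 a1) G"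
      unfolding rp using ints by (simp add: contour_integrable_joinI valid_path_join)
    have left: "contour_integral (linepath a4 a1) G = - (\<i> * J R)"
    proof -
      have "contour_integral (linepath a4 a1) G = - contour_integral (linepath a1 a4) G"
        by (rule contour_integral_reverse_linepath) (rule continuous_on_subset[OF Gc img'(4)])
      also have "contour_integral (linepath a1 a4) G = \<i> * J R"
        unfolding J_def by (rule contour_integral_linepath_same_Re) (use R0 in \<open>auto simp: a_def\<close>)
      finally show ?thesis by simp
    qed
    define B where "B = C * R powr (- 1 - d) / (R / 2)"
    have B0: "B \<ge> 0" using C R0 by (simp add: B_def)
    have Gb: "norm (G w) \<le> B" if "R \<le> norm w" "\<gamma> \<le> Re w" for w
    proof -
      have "norm (F w) \<le> C * norm w powr (- 1 - d)" using Cd(2) that by blast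
      also have "\<dots> \<le> C * R powr (- 1 - d)" using that C R0 Cd(1) by (intro mult_left_mono powr_mono2') auto
      finally have 1: "norm (F w) \<le> C * R powr (- 1 - d)" .
      have "norm w - norm (complex_of_real s) \<le> norm (w - of_real s)" by (rule norm_triangle_ineq2)
      then have "R / 2 \<le> norm (w - of_real s)" using that R s g by simp
      then show ?thesis unfolding G_def B_def norm_divide using 1 R0 C by (intro frac_le) auto
    qed
    have seg: "norm (contour_integral (linepath p q) G) \<le> B * (2 * R)"
      if "G contour_integrable_on (linepath p q)" "norm (q - p) \<le> 2 * R"
        "\<And>w. w \<in> closed_segment p q \<Longrightarrow> R \<le> norm w \<and> \<gamma> \<le> Re w" for p q
    proof -
      have "norm (contour_integral (linepath p q) G) \<le> B * norm (q - p)"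
        using that Gb by (intro contour_integral_bound_linepath B0) auto
      also have "\<dots> \<le> B * (2 * R)" using that B0 by (intro mult_left_mono)
      finally show ?thesis .
    qed
    have Rn: "R \<le> norm w" if "\<bar>Re w\<bar> = R \<or> \<bar>Im w\<bar> = R" for w
      using that abs_Re_le_cmod[of w] abs_Im_le_cmod[of w] by auto
    have len: "norm (Complex R y - Complex \<gamma> y) \<le> 2 * R" "norm (Complex \<gamma> y - Complex R y) \<le> 2 * R"
      "norm (Complex R R - Complex R (- R)) \<le> 2 * R" for y
      using R0 g cmod_le[of "Complex R y - Complex \<gamma> y"] cmod_le[of "Complex \<gamma> y - Complex R y"]
        cmod_le[of "Complex R R - Complex R (- R)"] by auto
    have "norm (contour_integral (linepath a1 a2) G) \<le> B * (2 * R)"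
      using ints(1) len Rn R0 by (intro seg) (auto simp: a_def closed_segment_same_Im closed_segment_eq_real_ivl)
    moreover have "norm (contour_integral (linepath a2 a3) G) \<le> B * (2 * R)"
      using ints(2) len Rn R0 by (intro seg) (auto simp: a_def closed_segment_same_Re closed_segment_eq_real_ivl)
    moreover have "norm (contour_integral (linepath a3 a4) G) \<le> B * (2 * R)"
      using ints(3) len Rn R0 by (intro seg) (auto simp: a_def closed_segment_same_Im closed_segment_eq_real_ivl)
    ultimately have "norm (contour_integral (linepath a1 a2) G + contour_integral (linepath a2 a3) G
       + contour_integral (linepath a3 a4) G) \<le> 3 * (B * (2 * R))"
      using norm_triangle_ineq[of "contour_integral (linepath a1 a2) G + contour_integral (linepath a2 a3) G" "contour_integral (linepath a3 a4) G"]
        norm_triangle_ineq[of "contour_integral (linepath a1 a2) G" "contour_integral (linepath a2 a3) G"] by linarith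
    also have "3 * (B * (2 * R)) = 12 * C * R powr (- 1 - d)" using R0 by (simp add: B_def)
    finally show ?thesis using ci sum left by (simp add: algebra_simps)
  qed
  have lineG: "integrable lborel (\<lambda>\<omega>. G (Complex \<gamma> \<omega>))"
  proof (rule Bochner_Integration.integrable_bound)
    show "integrable lborel (\<lambda>\<omega>. F (Complex \<gamma> \<omega>) / of_real (s - \<gamma>))" using integrable_line[OF g] by simp
    have "continuous_on UNIV (\<lambda>\<omega>. G (Complex \<gamma> \<omega>))"
      unfolding G_def using s by (intro continuous_intros cont_line[OF g]) (auto simp: complex_eq_iff Complex_eq intro!: continuous_intros)
    then show "(\<lambda>\<omega>. G (Complex \<gamma> \<omega>)) \<in> borel_measurable lborel"
      by (simp add: borel_measurable_continuous_onI)
    have "s - \<gamma> \<le> norm (Complex \<gamma> \<omega> - of_real s)" for \<omega>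
      using abs_Re_le_cmod[of "Complex \<gamma> \<omega> - of_real s"] s by simp
    then show "AE \<omega> in lborel. norm (G (Complex \<gamma> \<omega>)) \<le> norm (F (Complex \<gamma> \<omega>) / of_real (s - \<gamma>))"
      unfolding G_def norm_divide norm_of_real using s by (intro AE_I2 frac_le) auto
  qed
  have J_lim: "(\<lambda>n. J (real n)) \<longlonglongrightarrow> (\<integral>\<omega>. G (Complex \<gamma> \<omega>) \<partial>lborel)"
  proof -
    have Jeq: "J (real n) = (\<integral>\<omega>. indicator {- real n..real n} \<omega> *\<^sub>R G (Complex \<gamma> \<omega>) \<partial>lborel)" for n
      unfolding J_def set_lebesgue_integral_def[symmetric]
      by (rule set_borel_integral_eq_integral(2)[symmetric])
         (auto simp: set_integrable_def intro!: integrable_mult_indicator lineG)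
    show ?thesis unfolding Jeq
    proof (rule integral_dominated_convergence[where w="\<lambda>\<omega>. norm (G (Complex \<gamma> \<omega>))"])
      show "AE \<omega> in lborel. (\<lambda>n. indicator {- real n..real n} \<omega> *\<^sub>R G (Complex \<gamma> \<omega>)) \<longlonglongrightarrow> G (Complex \<gamma> \<omega>)"
      proof (rule AE_I2, rule tendsto_eventually)
        fix \<omega> :: real
        have "\<forall>\<^sub>F n in sequentially. real n \<ge> \<bar>\<omega>\<bar>" by real_asymp
        then show "\<forall>\<^sub>F n in sequentially. indicator {- real n..real n} \<omega> *\<^sub>R G (Complex \<gamma> \<omega>) = G (Complex \<gamma> \<omega>)"
          by eventually_elim (auto simp: indicator_def)
      qed
    qed (use lineG in \<open>auto simp: indicator_def intro!: borel_measurable_integrable\<close>)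
  qed
  have "(\<lambda>n. norm (2 * pi * \<i> * F (of_real s) + \<i> * J (real n))) \<longlonglongrightarrow>
      norm (2 * pi * \<i> * F (of_real s) + \<i> * (\<integral>\<omega>. G (Complex \<gamma> \<omega>) \<partial>lborel))"
    by (intro tendsto_intros J_lim)
  moreover have "(\<lambda>n. norm (2 * pi * \<i> * F (of_real s) + \<i> * J (real n))) \<longlonglongrightarrow> 0"
  proof (rule tendsto_sandwich[OF _ _ tendsto_const])
    show "(\<lambda>n. 12 * C * real n powr (- 1 - d)) \<longlonglongrightarrow> 0" using Cd(1) by real_asymp
    have "\<forall>\<^sub>F n in sequentially. real n > 2 * s" by real_asymp
    then show "\<forall>\<^sub>F n in sequentially. norm (2 * pi * \<i> * F (of_real s) + \<i> * J (real n)) \<le> 12 * C * real n powr (- 1 - d)"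
      by eventually_elim (use bound in simp)
  qed auto
  ultimately have "norm (2 * pi * \<i> * F (of_real s) + \<i> * (\<integral>\<omega>. G (Complex \<gamma> \<omega>) \<partial>lborel)) = 0"
    by (rule LIMSEQ_unique)
  then have "2 * pi * F (of_real s) + (\<integral>\<omega>. G (Complex \<gamma> \<omega>) \<partial>lborel) = 0"
    by (simp add: mult.assoc mult.left_commute[of _ \<i>] distrib_left[symmetric])
  moreover have "(\<integral>\<omega>. G (Complex \<gamma> \<omega>) \<partial>lborel) = - (\<integral>\<omega>. F (Complex \<gamma> \<omega>) / (of_real s - Complex \<gamma> \<omega>) \<partial>lborel)"
    unfolding G_def by (subst Bochner_Integration.integral_minus[symmetric])
      (metis (no_types) minus_diff_eq minus_divide_right)
  ultimately show ?thesis by (simp add: field_simps)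
qed

text \<open>The Bromwich integral; the factor \<i> of ds cancels that of 2 \<pi> \<i>. Taking the
  real part loses nothing, by \<open>of_real_inv_laplace\<close>.\<close>

definition inv_laplace :: "real \<Rightarrow> real \<Rightarrow> real" where
  "inv_laplace \<gamma> t = Re (1 / (2 * pi) * (\<integral>\<omega>. exp (Complex \<gamma> \<omega> * of_real t) * F (Complex \<gamma> \<omega>) \<partial>lborel))"

lemma integrable_exp_line:
  assumes "\<gamma> > 0" shows "integrable lborel (\<lambda>\<omega>. exp (Complex \<gamma> \<omega> * of_real t) * F (Complex \<gamma> \<omega>))"
proof (rule Bochner_Integration.integrable_bound)
  show "integrable lborel (\<lambda>\<omega>. of_real (exp (\<gamma> * t)) * F (Complex \<gamma> \<omega>))"
    using integrable_line[OF assms] by (intro integrable_mult_right)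
  note meas_line[OF assms, measurable]
  show "(\<lambda>\<omega>. exp (Complex \<gamma> \<omega> * of_real t) * F (Complex \<gamma> \<omega>)) \<in> borel_measurable lborel"
    unfolding Complex_eq[of \<gamma> _, THEN arg_cong[where f="\<lambda>z. exp (z * of_real t)"]] by measurable
qed (auto simp: norm_mult)

text \<open>The reflection \<omega> -> -\<omega> conjugates the integrand, so the integral equals
  its own conjugate.\<close>

lemma of_real_inv_laplace:
  assumes "\<gamma> > 0"
  shows "of_real (inv_laplace \<gamma> t) = 1 / (2 * pi) * (\<integral>\<omega>. exp (Complex \<gamma> \<omega> * of_real t) * F (Complex \<gamma> \<omega>) \<partial>lborel)"
proof -
  define f where "f \<omega> = exp (Complex \<gamma> \<omega> * of_real t) * F (Complex \<gamma> \<omega>)" for \<omega>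
  have f_cnj: "f (- \<omega>) = cnj (f \<omega>)" for \<omega>
  proof -
    have "Complex \<gamma> (- \<omega>) = cnj (Complex \<gamma> \<omega>)" by (simp add: complex_eq_iff)
    then show ?thesis using cnj[of "Complex \<gamma> \<omega>"] assms by (simp add: f_def exp_cnj)
  qed
  have "(\<integral>\<omega>. f \<omega> \<partial>lborel) = (\<integral>\<omega>. f (- \<omega>) \<partial>lborel)"
    using lborel_integral_real_affine[of "-1" f 0] by simp
  also have "\<dots> = cnj (\<integral>\<omega>. f \<omega> \<partial>lborel)" unfolding f_cnj by simp
  finally have "(\<integral>\<omega>. f \<omega> \<partial>lborel) \<in> \<real>" by (simp add: Reals_cnj_iff)
  then obtain r where "(\<integral>\<omega>. f \<omega> \<partial>lborel) = of_real r" by (rule Reals_cases)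
  then show ?thesis unfolding inv_laplace_def f_def[symmetric] by simp
qed

lemma isCont_inv_laplace:
  assumes "\<gamma> > 0"
  shows "isCont (inv_laplace \<gamma>) t"
  unfolding continuous_at_sequentially
proof (intro allI impI)
  fix X :: "nat \<Rightarrow> real" assume X: "X \<longlonglongrightarrow> t"
  then have "bounded (range X)" by (rule convergent_imp_bounded)
  then obtain B where B: "\<And>n. \<bar>X n\<bar> \<le> B" unfolding bounded_iff by auto
  note meas_line[OF assms, measurable]
  have "(\<lambda>n. \<integral>\<omega>. exp (Complex \<gamma> \<omega> * of_real (X n)) * F (Complex \<gamma> \<omega>) \<partial>lborel)
    \<longlonglongrightarrow> (\<integral>\<omega>. exp (Complex \<gamma> \<omega> * of_real t) * F (Complex \<gamma> \<omega>) \<partial>lborel)"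
  proof (rule integral_dominated_convergence[where w="\<lambda>\<omega>. exp (\<gamma> * B) * norm (F (Complex \<gamma> \<omega>))"])
    show "AE \<omega> in lborel. (\<lambda>n. exp (Complex \<gamma> \<omega> * of_real (X n)) * F (Complex \<gamma> \<omega>)) \<longlonglongrightarrow>
        exp (Complex \<gamma> \<omega> * of_real t) * F (Complex \<gamma> \<omega>)"
      by (intro AE_I2 tendsto_intros X)
    show "AE \<omega> in lborel. norm (exp (Complex \<gamma> \<omega> * of_real (X n)) * F (Complex \<gamma> \<omega>))
        \<le> exp (\<gamma> * B) * norm (F (Complex \<gamma> \<omega>))" for n
    proof (intro AE_I2)
      fix \<omega>
      have "\<gamma> * X n \<le> \<gamma> * B" using B[of n] assms by (intro mult_left_mono) auto
      then show "norm (exp (Complex \<gamma> \<omega> * of_real (X n)) * F (Complex \<gamma> \<omega>)) \<le> exp (\<gamma> * B) * norm (F (Complex \<gamma> \<omega>))"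
        by (auto simp: norm_mult intro!: mult_right_mono)
    qed
    show "integrable lborel (\<lambda>\<omega>. exp (\<gamma> * B) * norm (F (Complex \<gamma> \<omega>)))"
      using integrable_line[OF assms] by simp
  qed (use integrable_exp_line[OF assms] in \<open>auto intro: borel_measurable_integrable\<close>)
  then show "(inv_laplace \<gamma> \<circ> X) \<longlonglongrightarrow> inv_laplace \<gamma> t"
    unfolding o_def inv_laplace_def by (intro tendsto_intros)
qed

text \<open>Fubini: since s > \<gamma>, the integral over t converges and produces the Cauchy kernel
  \<open>1 / (of_real s - Complex \<gamma> \<omega>)\<close>; what remains is
  \<open>half_plane_Cauchy\<close>.\<close>

lemma has_laplace_inv_laplace:
  assumes g: "\<gamma> > 0" and s: "s > \<gamma>"
  shows "has_laplace (inv_laplace \<gamma>) s (Re (F (of_real s)))"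
proof -
  define K where "K = (\<lambda>(t::real, \<omega>). indicator {0<..} t *\<^sub>R
     (exp (- (of_real s - Complex \<gamma> \<omega>) * of_real t) * F (Complex \<gamma> \<omega>)))"
  note meas_line[OF g, measurable]
  have Cmeas[measurable]: "(\<lambda>x. Complex \<gamma> x) \<in> borel_measurable borel"
    unfolding Complex_eq by measurable
  have Kmeas: "K \<in> borel_measurable (lborel \<Otimes>\<^sub>M lborel)"
    unfolding K_def by measurable
  have es: "has_laplace (\<lambda>t. exp (\<gamma> * t)) s (1 / (s - \<gamma>))" by (rule has_laplace_exp[OF s])
  have Kint: "integrable (lborel \<Otimes>\<^sub>M lborel) K"
  proof (rule lborel_pair.Fubini_integrable[OF Kmeas])
    have nK: "norm (K (t, \<omega>)) = indicator {0<..} t * (exp (- s * t) * exp (\<gamma> * t)) * norm (F (Complex \<gamma> \<omega>))" for t \<omega>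
      by (simp add: K_def norm_mult exp_add[symmetric] algebra_simps)
    show "integrable lborel (\<lambda>t. \<integral>\<omega>. norm (K (t, \<omega>)) \<partial>lborel)"
      unfolding nK using es unfolding has_laplace_def set_integrable_def by simp
    show "AE t in lborel. integrable lborel (\<lambda>\<omega>. K (t, \<omega>))"
    proof (rule AE_I2)
      fix t :: real
      show "integrable lborel (\<lambda>\<omega>. K (t, \<omega>))"
      proof (rule Bochner_Integration.integrable_bound)
        show "integrable lborel (\<lambda>\<omega>. indicator {0<..} t * (exp (- s * t) * exp (\<gamma> * t)) * norm (F (Complex \<gamma> \<omega>)))"
          using integrable_line[OF g] by (intro integrable_mult_right) auto
        show "(\<lambda>\<omega>. K (t, \<omega>)) \<in> borel_measurable lborel" unfolding K_def split_conv by measurable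
      qed (simp add: nK)
    qed
  qed
  have inner1: "(\<integral>\<omega>. K (t, \<omega>) \<partial>lborel) = indicator {0<..} t *\<^sub>R (exp (- s * t) * (2 * pi * inv_laplace \<gamma> t))" for t
  proof -
    have "(\<integral>\<omega>. K (t, \<omega>) \<partial>lborel) = (\<integral>\<omega>. indicator {0<..} t *\<^sub>R (exp (- of_real (s * t)) * (exp (Complex \<gamma> \<omega> * of_real t) * F (Complex \<gamma> \<omega>))) \<partial>lborel)"
      unfolding K_def by (intro Bochner_Integration.integral_cong) (auto simp: exp_add[symmetric] algebra_simps)
    also have "\<dots> = indicator {0<..} t *\<^sub>R (exp (- complex_of_real (s * t)) * (complex_of_real (2 * pi) * complex_of_real (inv_laplace \<gamma> t)))"
      unfolding of_real_inv_laplace[OF g] by simp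
    finally show ?thesis by (simp add: exp_of_real[symmetric] scaleR_conv_of_real)
  qed
  have inner2: "(\<integral>t. K (t, \<omega>) \<partial>lborel) = F (Complex \<gamma> \<omega>) / (of_real s - Complex \<gamma> \<omega>)" for \<omega>
  proof -
    have r: "Re (of_real s - Complex \<gamma> \<omega>) > 0" using s by simp
    have "(\<integral>t. K (t, \<omega>) \<partial>lborel) = (\<integral>t. (indicator {0<..} t *\<^sub>R exp (- (of_real s - Complex \<gamma> \<omega>) * of_real t)) * F (Complex \<gamma> \<omega>) \<partial>lborel)"
      unfolding K_def by simp
    also have "\<dots> = (\<integral>t. (indicator {0<..} t *\<^sub>R exp (- (of_real s - Complex \<gamma> \<omega>) * of_real t)) \<partial>lborel) * F (Complex \<gamma> \<omega>)"
      by (rule Bochner_Integration.integral_mult_left) (use exp_decay_integrable(1)[OF r] in \<open>simp add: set_integrable_def\<close>)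
    also have "\<dots> = F (Complex \<gamma> \<omega>) / (of_real s - Complex \<gamma> \<omega>)"
      using exp_decay_integrable(2)[OF r] by (simp add: set_lebesgue_integral_def)
    finally show ?thesis .
  qed
  have "integrable lborel (\<lambda>t. \<integral>\<omega>. K (t, \<omega>) \<partial>lborel)"
    using lborel_pair.integrable_fst[of "\<lambda>t \<omega>. K (t, \<omega>)"] Kint by simp
  from integrable_Re[OF this] have "integrable lborel (\<lambda>t. 1 / (2 * pi) * Re (\<integral>\<omega>. K (t, \<omega>) \<partial>lborel))"
    by (rule integrable_mult_right)
  moreover have eq: "1 / (2 * pi) * Re (\<integral>\<omega>. K (t, \<omega>) \<partial>lborel) = indicator {0<..} t *\<^sub>R (exp (- s * t) * inv_laplace \<gamma> t)" for t
    unfolding inner1 by simp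
  ultimately have int: "set_integrable lborel {0<..} (\<lambda>t. exp (- s * t) * inv_laplace \<gamma> t)"
    unfolding set_integrable_def by simp
  have "(\<integral>t. \<integral>\<omega>. K (t, \<omega>) \<partial>lborel \<partial>lborel) = (\<integral>\<omega>. \<integral>t. K (t, \<omega>) \<partial>lborel \<partial>lborel)"
    using lborel_pair.Fubini_integral[of "\<lambda>t \<omega>. K (t, \<omega>)"] Kint by simp
  also have "\<dots> = 2 * pi * F (of_real s)"
    unfolding inner2 using half_plane_Cauchy[OF g s] by simp
  finally have "1 / (2 * pi) * Re (\<integral>t. \<integral>\<omega>. K (t, \<omega>) \<partial>lborel \<partial>lborel) = Re (F (of_real s))" by simp
  moreover have "1 / (2 * pi) * Re (\<integral>t. \<integral>\<omega>. K (t, \<omega>) \<partial>lborel \<partial>lborel)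
     = (\<integral>t. 1 / (2 * pi) * Re (\<integral>\<omega>. K (t, \<omega>) \<partial>lborel) \<partial>lborel)"
    using \<open>integrable lborel (\<lambda>t. \<integral>\<omega>. K (t, \<omega>) \<partial>lborel)\<close> by simp
  ultimately have "(LBINT t:{0<..}. exp (- s * t) * inv_laplace \<gamma> t) = Re (F (of_real s))"
    unfolding set_lebesgue_integral_def eq by simp
  with int show ?thesis unfolding has_laplace_def by simp
qed

text \<open>No contour is moved: both functions are continuous and have the same transform for all s
  beyond \<open>max \<gamma> \<gamma>'\<close>.\<close>

lemma inv_laplace_indep:
  assumes "\<gamma> > 0" "\<gamma>' > 0" "t > 0"
  shows "inv_laplace \<gamma> t = inv_laplace \<gamma>' t"
  by (rule laplace_unique[of "max \<gamma> \<gamma>'" _ "\<lambda>s. Re (F (of_real s))"])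
     (use assms in \<open>auto intro!: has_laplace_inv_laplace isCont_inv_laplace\<close>)

text \<open>The restriction s > \<gamma> disappears by computing on the line through s / 2
  instead.\<close>

lemma has_laplace_inv_laplace':
  assumes g: "\<gamma> > 0" and s: "s > 0"
  shows "has_laplace (inv_laplace \<gamma>) s (Re (F (of_real s)))"
proof -
  have *: "has_laplace (inv_laplace (s / 2)) s (Re (F (of_real s)))"
    using s by (intro has_laplace_inv_laplace) auto
  have "indicator {0<..} t *\<^sub>R (exp (- s * t) * inv_laplace \<gamma> t) =
        indicator {0<..} t *\<^sub>R (exp (- s * t) * inv_laplace (s / 2) t)" for t
    using inv_laplace_indep[OF g, of "s/2" t] s by (auto simp: indicator_def)
  then show ?thesis using * unfolding has_laplace_def set_integrable_def set_lebesgue_integral_def by presburger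
qed

lemma inv_laplace_nonneg:
  assumes "moment_positive (\<lambda>s. Re (F (of_real s)))" "\<gamma> > 0" "t > 0"
  shows "inv_laplace \<gamma> t \<ge> 0"
proof (rule laplace_nonneg[OF _ assms(1,3)])
  show "has_laplace (inv_laplace \<gamma>) (real k + 1) (Re (F (of_real (real k + 1))))" for k
    using assms(2) by (rule has_laplace_inv_laplace') simp
qed (rule isCont_inv_laplace[OF assms(2)])

end

section \<open>Power series and fractional powers\<close>

text \<open>Stated over a general field so that it serves real derivatives in the subordination
  parameter as well as complex derivatives in s and t. The majorant of the derivative bounds the
  difference quotients through the mean value inequality on the ball, so dominated convergence
  applies along sequences.\<close>

lemma integral_has_field_derivative:
  fixes f :: "'a::{real_normed_field,banach,second_countable_topology} \<Rightarrow> 'b \<Rightarrow> 'a"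
  assumes e: "e > 0" and meas': "f' x \<in> borel_measurable N"
    and meas: "\<And>y. y \<in> ball x e \<Longrightarrow> f y \<in> borel_measurable N"
    and int: "integrable N (f x)" and w: "integrable N w"
    and der: "AE t in N. \<forall>y\<in>ball x e. ((\<lambda>y. f y t) has_field_derivative f' y t) (at y) \<and> norm (f' y t) \<le> w t"
  shows "((\<lambda>y. \<integral>t. f y t \<partial>N) has_field_derivative (\<integral>t. f' x t \<partial>N)) (at x)"
proof -
  have lip: "AE t in N. \<forall>y\<in>ball x e. norm (f y t - f x t) \<le> w t * norm (y - x)"
    using der
  proof eventually_elim
    case (elim t)
    have "norm (f y t - f x t) \<le> w t * norm (y - x)" if "y \<in> ball x e" for y
      by (rule field_differentiable_bound[of "ball x e" "\<lambda>y. f y t" "\<lambda>y. f' y t"])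
         (use elim that e in \<open>auto intro: has_field_derivative_at_within\<close>)
    then show ?case by blast
  qed
  have inty: "integrable N (f y)" if y: "y \<in> ball x e" for y
  proof -
    have "integrable N (\<lambda>t. f y t - f x t)"
    proof (rule Bochner_Integration.integrable_bound)
      show "integrable N (\<lambda>t. w t * norm (y - x))" using w by simp
      show "(\<lambda>t. f y t - f x t) \<in> borel_measurable N" using meas y e by (auto intro!: borel_measurable_diff)
      show "AE t in N. norm (f y t - f x t) \<le> norm (w t * norm (y - x))"
        using lip
      proof eventually_elim
        case (elim t)
        then have "norm (f y t - f x t) \<le> w t * norm (y - x)" using y by blast
        also have "\<dots> \<le> norm (w t * norm (y - x))" by (simp only: real_norm_def abs_ge_self)
        finally show ?case .
      qed
    qed
    from Bochner_Integration.integrable_add[OF this int] show ?thesis by simp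
  qed
  show ?thesis
    unfolding has_field_derivative_iff tendsto_at_iff_sequentially
  proof (intro allI impI)
    fix X assume X: "\<forall>i. X i \<in> UNIV - {x}" "X \<longlonglongrightarrow> x"
    have "\<forall>\<^sub>F n in sequentially. X n \<in> ball x e"
      using X(2) e by (intro topological_tendstoD) auto
    then obtain n0 where n0: "\<And>n. n \<ge> n0 \<Longrightarrow> X n \<in> ball x e" unfolding eventually_sequentially by blast
    define Y where "Y n = X (n + n0)" for n
    have Y: "Y n \<in> ball x e" "Y n \<noteq> x" for n using n0 X(1) by (auto simp: Y_def)
    have Ylim: "Y \<longlonglongrightarrow> x" unfolding Y_def using X(2) by (rule LIMSEQ_ignore_initial_segment)
    have "(\<lambda>n. \<integral>t. (f (Y n) t - f x t) / (Y n - x) \<partial>N) \<longlonglongrightarrow> (\<integral>t. f' x t \<partial>N)"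
    proof (rule integral_dominated_convergence[OF _ _ w])
      show lim: "AE t in N. (\<lambda>n. (f (Y n) t - f x t) / (Y n - x)) \<longlonglongrightarrow> f' x t"
        using der
      proof eventually_elim
        case (elim t)
        then have "((\<lambda>y. f y t) has_field_derivative f' x t) (at x)" using e by auto
        then show ?case
          unfolding has_field_derivative_iff tendsto_at_iff_sequentially o_def using Ylim Y by auto
      qed
      show m: "(\<lambda>t. (f (Y n) t - f x t) / (Y n - x)) \<in> borel_measurable N" for n
        using meas Y e by (auto intro!: borel_measurable_diff borel_measurable_divide)
      show "AE t in N. norm ((f (Y n) t - f x t) / (Y n - x)) \<le> w t" for n
        using lip by eventually_elim (use Y in \<open>auto simp: norm_divide field_simps\<close>)
    qed (rule meas')
    moreover have "(\<integral>t. (f (Y n) t - f x t) / (Y n - x) \<partial>N) =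
        ((\<integral>t. f (Y n) t \<partial>N) - (\<integral>t. f x t \<partial>N)) / (Y n - x)" for n
      using inty Y int by simp
    ultimately have "(\<lambda>n. ((\<integral>t. f (Y n) t \<partial>N) - (\<integral>t. f x t \<partial>N)) / (Y n - x)) \<longlonglongrightarrow> (\<integral>t. f' x t \<partial>N)"
      by (simp only:)
    then have "(\<lambda>n. ((\<lambda>y. ((\<integral>t. f y t \<partial>N) - (\<integral>t. f x t \<partial>N)) / (y - x)) \<circ> X) (n + n0)) \<longlonglongrightarrow> (\<integral>t. f' x t \<partial>N)"
      by (simp add: Y_def o_def)
    then show "((\<lambda>y. ((\<integral>t. f y t \<partial>N) - (\<integral>t. f x t \<partial>N)) / (y - x)) \<circ> X) \<longlonglongrightarrow> (\<integral>t. f' x t \<partial>N)"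
      by (rule LIMSEQ_offset)
  qed
qed

text \<open>At \<open>x = exp (- \<epsilon> * s)\<close>, this makes \<open>1 / A 0 - 1 / P\<close> completely monotone in \<open>s\<close>.\<close>

lemma kaluza:
  fixes A :: "nat \<Rightarrow> real"
  assumes pos: "\<And>n. A n > 0" and logconvex: "\<And>n. A (Suc n) ^ 2 \<le> A n * A (Suc (Suc n))"
    and sums: "\<And>x. 0 \<le> x \<Longrightarrow> x < 1 \<Longrightarrow> (\<lambda>n. A n * x ^ n) sums P x"
  shows "\<exists>B. (\<forall>n. 0 \<le> B n) \<and> (\<forall>x. 0 \<le> x \<and> x < 1 \<longrightarrow> (\<lambda>n. B n * x ^ n) sums (1 / A 0 - 1 / P x))"
proof -
  define G where "G = fps_nth (inverse (Abs_fps A))"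
  have G0: "G 0 = 1 / A 0" by (simp add: G_def inverse_eq_divide)
  have conv: "(\<Sum>i\<le>n. G i * A (n - i)) = (if n = 0 then 1 else 0)" for n
  proof -
    have "inverse (Abs_fps A) * Abs_fps A = 1" using pos[of 0] by (intro inverse_mult_eq_1) auto
    then have "fps_nth (inverse (Abs_fps A) * Abs_fps A) n = fps_nth 1 n" by simp
    then show ?thesis by (simp add: fps_mult_nth G_def atLeast0AtMost)
  qed
  have ratio: "A (Suc m) / A m \<le> A (Suc n) / A n" if "m \<le> n" for m n
  proof (rule lift_Suc_mono_le[of "\<lambda>m. A (Suc m) / A m", OF _ that])
    show "A (Suc n) / A n \<le> A (Suc (Suc n)) / A (Suc n)" for n
      using logconvex[of n] pos[of n] pos[of "Suc n"] by (simp add: field_simps power2_eq_square)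
  qed
  have conv_Suc: "G (Suc n) * A 0 = - G 0 * A (Suc n) - (\<Sum>i\<in>{1..n}. G i * A (Suc n - i))" for n
  proof -
    have "(\<Sum>i\<le>Suc n. G i * A (Suc n - i)) = 0" using conv[of "Suc n"] by simp
    moreover have "{..Suc n} = insert 0 (insert (Suc n) {1..n})" by auto
    ultimately show ?thesis by simp
  qed
  have neg: "n \<ge> 1 \<Longrightarrow> G n \<le> 0" for n
  proof (induction n rule: less_induct)
    case (less n)
    then obtain m where n: "n = Suc m" by (cases n) auto
    have "G n * A 0 \<le> 0"
    proof (cases "m = 0")
      case True
      then show ?thesis using conv_Suc[of 0] pos[of 0] pos[of 1] G0 by (simp add: n)
    next
      case False
      then obtain k where m: "m = Suc k" by (cases m) auto
      \<comment> \<open>Log-convexity makes the ratios \<open>A (Suc j) / A j\<close> increase, so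
        together with \<open>G i \<le> 0\<close> each term of the convolution identity of index
        \<open>m\<close>, multiplied by \<open>\<rho>\<close>, lies below the corresponding term of
        index \<open>Suc m\<close>. With this ratio the two contributions of \<open>G 0\<close>
        cancel.\<close>
      define \<rho> where "\<rho> = A (Suc m) / A m"
      have "(\<Sum>i\<le>m. G i * A (m - i)) = 0" using conv[of m] False by simp
      moreover have "{..m} = insert 0 {1..m}" by auto
      ultimately have s: "(\<Sum>i\<in>{1..m}. G i * A (m - i)) = - G 0 * A m" by simp
      have "(\<Sum>i\<in>{1..m}. \<rho> * (G i * A (m - i))) \<le> (\<Sum>i\<in>{1..m}. G i * A (Suc m - i))"
      proof (rule sum_mono)
        fix i assume i: "i \<in> {1..m}"
        have "A (Suc (m - i)) / A (m - i) \<le> \<rho>" unfolding \<rho>_def by (rule ratio) simp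
        then have "A (Suc m - i) \<le> \<rho> * A (m - i)"
          using pos[of "m - i"] i by (simp add: field_simps Suc_diff_le)
        moreover have "G i \<le> 0" using i less.IH[of i] by (simp add: n)
        ultimately have "G i * (\<rho> * A (m - i)) \<le> G i * A (Suc m - i)" by (rule mult_left_mono_neg)
        then show "\<rho> * (G i * A (m - i)) \<le> G i * A (Suc m - i)" by (simp add: ac_simps)
      qed
      then have "\<rho> * (- G 0 * A m) \<le> (\<Sum>i\<in>{1..m}. G i * A (Suc m - i))"
        unfolding sum_distrib_left[symmetric] s .
      moreover have "\<rho> * (- G 0 * A m) = - G 0 * A (Suc m)" using pos[of m] by (simp add: \<rho>_def)
      ultimately have "- G 0 * A (Suc m) \<le> (\<Sum>i\<in>{1..m}. G i * A (Suc m - i))" by (simp only:)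
      then show ?thesis unfolding n conv_Suc[of m] by linarith
    qed
    then show ?case using pos[of 0] by (simp add: mult_le_0_iff)
  qed
  define B where "B n = (if n = 0 then 0 else - G n)" for n
  have B: "0 \<le> B n" for n using neg[of n] by (simp add: B_def)
  \<comment> \<open>Comparison with the series of \<open>A\<close> itself yields convergence on all
    of [0,1).\<close>
  have Bbound: "B n \<le> A n / A 0 ^ 2" for n
  proof (cases n)
    case 0 then show ?thesis using pos[of 0] by (simp add: B_def)
  next
    case (Suc m)
    have "(\<Sum>i\<in>{1..m}. G i * A (Suc m - i)) \<le> 0"
      using neg pos by (intro sum_nonpos mult_nonpos_nonneg) (auto intro: less_imp_le)
    then have "B n * A 0 \<le> A n / A 0" using conv_Suc[of m] G0 by (simp add: B_def Suc)
    then show ?thesis using pos[of 0] by (simp add: field_simps power2_eq_square)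
  qed
  have "(\<lambda>n. B n * x ^ n) sums (1 / A 0 - 1 / P x)" if x: "0 \<le> x" "x < 1" for x
  proof -
    have sA: "summable (\<lambda>n. A n * x ^ n)" "(\<Sum>n. A n * x ^ n) = P x"
      using sums[OF x] by (auto simp: sums_iff)
    have sB: "summable (\<lambda>n. B n * x ^ n)"
    proof (rule summable_comparison_test')
      show "summable (\<lambda>n. 1 / A 0 ^ 2 * (A n * x ^ n))" using sA(1) by (rule summable_mult)
      show "norm (B n * x ^ n) \<le> 1 / A 0 ^ 2 * (A n * x ^ n)" for n
        using mult_right_mono[OF Bbound[of n], of "x ^ n"] x B[of n] by simp
    qed
    have "(\<lambda>n. (if n = 0 then G 0 else 0) - B n * x ^ n) sums (G 0 - (\<Sum>n. B n * x ^ n))"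
      using sB by (intro sums_diff summable_sums sums_single)
    moreover have "(\<lambda>n. (if n = 0 then G 0 else 0) - B n * x ^ n) = (\<lambda>n. G n * x ^ n)"
      by (auto simp: B_def fun_eq_iff)
    ultimately have sG: "(\<lambda>n. G n * x ^ n) sums (G 0 - (\<Sum>n. B n * x ^ n))" by simp
    have nG: "summable (\<lambda>n. norm (G n * x ^ n))"
    proof (rule summable_comparison_test')
      show "summable (\<lambda>n. (if n = 0 then G 0 else 0) + B n * x ^ n)"
        using sB by (intro summable_add sums_summable[OF sums_single])
      show "norm (norm (G n * x ^ n)) \<le> (if n = 0 then G 0 else 0) + B n * x ^ n" for n
        using x B[of n] pos[of 0] G0 by (auto simp: B_def abs_mult)
    qed
    have nA: "summable (\<lambda>n. norm (A n * x ^ n))"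
      using sA(1) x pos by (simp add: abs_mult less_imp_le)
    have "(\<lambda>k. \<Sum>i\<le>k. G i * x ^ i * (A (k - i) * x ^ (k - i))) sums
        ((\<Sum>n. G n * x ^ n) * (\<Sum>n. A n * x ^ n))"
      by (rule Cauchy_product_sums[OF nG nA])
    moreover have "(\<Sum>i\<le>k. G i * x ^ i * (A (k - i) * x ^ (k - i))) = (if k = 0 then 1 else 0)" for k
    proof -
      have "(\<Sum>i\<le>k. G i * x ^ i * (A (k - i) * x ^ (k - i))) = (\<Sum>i\<le>k. G i * A (k - i) * x ^ k)"
        by (intro sum.cong refl) (simp add: power_add[symmetric] mult.assoc mult.left_commute)
      then show ?thesis using conv[of k] by (simp add: sum_distrib_right[symmetric])
    qed
    ultimately have "(\<lambda>k. if k = 0 then 1 else 0) sums ((G 0 - (\<Sum>n. B n * x ^ n)) * P x)"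
      using sG sA(2) by (simp add: sums_iff)
    moreover have "(\<lambda>k::nat. if k = 0 then 1 else (0::real)) sums 1" by (rule sums_single)
    ultimately have "(G 0 - (\<Sum>n. B n * x ^ n)) * P x = 1" using sums_unique2 by blast
    then have "G 0 - (\<Sum>n. B n * x ^ n) = 1 / P x"
      by (metis mult_zero_right nonzero_eq_divide_eq zero_neq_one)
    then show ?thesis using summable_sums[OF sB] G0 by (simp add: algebra_simps)
  qed
  then show ?thesis using B by blast
qed

text \<open>The Taylor coefficients of \<open>(1 - x) powr (- a)\<close>.\<close>

definition negbinom_coeff :: "real \<Rightarrow> nat \<Rightarrow> real" where
  "negbinom_coeff a n = pochhammer a n / fact n"

lemma negbinom_coeff_0 [simp]: "negbinom_coeff a 0 = 1"
  by (simp add: negbinom_coeff_def)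

lemma negbinom_coeff_Suc: "negbinom_coeff a (Suc n) = negbinom_coeff a n * (a + real n) / (real n + 1)"
  by (simp add: negbinom_coeff_def pochhammer_Suc)

lemma negbinom_coeff_pos: "a > 0 \<Longrightarrow> negbinom_coeff a n > 0"
  by (simp add: negbinom_coeff_def pochhammer_pos)

lemma negbinom_coeff_le_1: "0 < a \<Longrightarrow> a \<le> 1 \<Longrightarrow> negbinom_coeff a n \<le> 1"
proof (induction n)
  case (Suc n)
  have "negbinom_coeff a n * ((a + real n) / (real n + 1)) \<le> 1 * 1"
    using Suc by (intro mult_mono) auto
  then show ?case by (simp add: negbinom_coeff_Suc)
qed simp

text \<open>The quotient (a + n) / (n + 1) of consecutive coefficients is nondecreasing in n when a
  \<le> 1.\<close>

lemma negbinom_coeff_logconvex: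
  assumes "0 < a" "a \<le> 1"
  shows "negbinom_coeff a (Suc n) ^ 2 \<le> negbinom_coeff a n * negbinom_coeff a (Suc (Suc n))"
proof -
  define c where "c = negbinom_coeff a n"
  have c: "c > 0" using negbinom_coeff_pos assms by (simp add: c_def)
  have "(a + real n) / (real n + 1) \<le> (a + real n + 1) / (real n + 2)"
    using assms by (simp add: field_simps)
  then have "c * c * ((a + real n) / (real n + 1)) * ((a + real n) / (real n + 1))
      \<le> c * c * ((a + real n) / (real n + 1)) * ((a + real n + 1) / (real n + 2))"
    using c assms by (intro mult_left_mono) auto
  then show ?thesis by (simp add: negbinom_coeff_Suc c_def power2_eq_square ac_simps)
qed

lemma negbinom_coeff_sums:
  assumes "0 \<le> x" "x < 1"
  shows "(\<lambda>n. negbinom_coeff a n * x ^ n) sums ((1 - x) powr (- a))"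
proof -
  have "(\<lambda>n. ((- a) gchoose n) * (- x) ^ n) sums (1 + (- x)) powr (- a)"
    using assms by (intro gen_binomial_real) auto
  moreover have "((- a) gchoose n) * (- x) ^ n = negbinom_coeff a n * x ^ n" for n
  proof -
    have "((- a) gchoose n) * (- x) ^ n = ((- 1) ^ n * (- 1) ^ n) * (negbinom_coeff a n * x ^ n)"
      by (simp add: negbinom_coeff_def gbinomial_pochhammer power_minus[of x])
    then show ?thesis by (simp add: power_mult_distrib[symmetric])
  qed
  ultimately show ?thesis by simp
qed

text \<open>A function of \<open>s\<close> is approximated by replacing \<open>s\<close> with \<open>(1 - exp (- \<epsilon> * s)) / \<epsilon>\<close>, which makes
  it a power series in \<open>exp (- \<epsilon> * s)\<close>.\<close>

lemma moment_positive_discretize: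
  assumes "\<And>\<epsilon>. \<epsilon> > 0 \<Longrightarrow> moment_positive (\<lambda>s. G ((1 - exp (- \<epsilon> * s)) / \<epsilon>))"
    and "continuous_on {0<..} G"
  shows "moment_positive G"
proof (rule moment_positive_lim)
  show "moment_positive (\<lambda>s. G ((1 - exp (- (1 / real (Suc n)) * s)) / (1 / real (Suc n))))" for n
    by (rule assms(1)) simp
  fix s :: real assume s: "s > 0"
  have "(\<lambda>n. (1 - exp (- (1 / real (Suc n)) * s)) / (1 / real (Suc n))) \<longlonglongrightarrow> s"
    using s by real_asymp
  moreover have "isCont G s" using assms(2) s by (simp add: continuous_on_eq_continuous_at)
  ultimately show "(\<lambda>n. G ((1 - exp (- (1 / real (Suc n)) * s)) / (1 / real (Suc n)))) \<longlonglongrightarrow> G s"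
    by (rule isCont_tendsto_compose[rotated])
qed

lemma exp_discretize:
  assumes "\<epsilon> > 0" "s > (0::real)"
  shows "0 \<le> exp (- \<epsilon> * s)" "exp (- \<epsilon> * s) < 1" "(1 - exp (- \<epsilon> * s)) / \<epsilon> > 0"
  using assms by auto

lemma moment_positive_power_series:
  assumes "\<And>n. B n \<ge> 0" "\<epsilon> > 0"
    and "\<And>x. 0 \<le> x \<Longrightarrow> x < 1 \<Longrightarrow> (\<lambda>n. B n * x ^ n) sums Q x"
  shows "moment_positive (\<lambda>s. Q (exp (- \<epsilon> * s)))"
proof (rule moment_positive_suminf)
  show "moment_positive (\<lambda>s. B n * exp (- \<epsilon> * s) ^ n)" for n
    using assms by (intro moment_positive_cmult moment_positive_power moment_positive_exp) auto
  show "(\<lambda>i. B i * exp (- \<epsilon> * s) ^ i) sums Q (exp (- \<epsilon> * s))" if "s > 0" for s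
    using exp_discretize[OF assms(2) that] by (intro assms(3))
qed

text \<open>With s replaced by \<open>(1 - x) / \<epsilon>\<close> the function becomes a binomial
  series in x with positive coefficients.\<close>

lemma moment_positive_neg_powr:
  assumes "0 < a" "a \<le> 1"
  shows "moment_positive (\<lambda>s. s powr (- a))"
proof (rule moment_positive_discretize)
  fix \<epsilon> :: real assume e: "\<epsilon> > 0"
  have "moment_positive (\<lambda>s. \<epsilon> powr a * (1 - exp (- \<epsilon> * s)) powr (- a))"
    by (intro moment_positive_cmult moment_positive_power_series[where B="negbinom_coeff a"] negbinom_coeff_sums)
       (use e assms in \<open>auto intro: less_imp_le negbinom_coeff_pos\<close>)
  then show "moment_positive (\<lambda>s. ((1 - exp (- \<epsilon> * s)) / \<epsilon>) powr (- a))"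
  proof (rule moment_positive_cong)
    fix s :: real assume "s > 0"
    then show "\<epsilon> powr a * (1 - exp (- \<epsilon> * s)) powr (- a) = ((1 - exp (- \<epsilon> * s)) / \<epsilon>) powr (- a)"
      using e by (simp add: powr_divide powr_minus field_simps)
  qed
qed (intro continuous_intros; simp)

text \<open>The discretized power is the reciprocal of a log-convex binomial series in x =
  exp(-\<epsilon> s), so by \<open>kaluza\<close> it is its value
  \<open>\<epsilon> powr (- a)\<close> at x = 0 minus a series with nonnegative coefficients. This
  is the Bernstein property of \<open>s powr a\<close> in discrete form.\<close>

lemma moment_positive_powr_aux:
  assumes "0 < a" "a \<le> 1" "\<epsilon> > 0"
  shows "moment_positive (\<lambda>s. \<epsilon> powr (- a) - ((1 - exp (- \<epsilon> * s)) / \<epsilon>) powr a)"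
proof -
  define A where "A n = \<epsilon> powr a * negbinom_coeff a n" for n
  have "\<exists>B. (\<forall>n. 0 \<le> B n) \<and> (\<forall>x. 0 \<le> x \<and> x < 1 \<longrightarrow>
      (\<lambda>n. B n * x ^ n) sums (1 / A 0 - 1 / (\<epsilon> powr a * (1 - x) powr (- a))))"
  proof (rule kaluza)
    show "A n > 0" for n using assms negbinom_coeff_pos by (simp add: A_def)
    show "(A (Suc n))\<^sup>2 \<le> A n * A (Suc (Suc n))" for n
      using mult_left_mono[OF negbinom_coeff_logconvex[OF assms(1,2), of n], of "(\<epsilon> powr a)\<^sup>2"]
      by (simp add: A_def power2_eq_square ac_simps)
    show "(\<lambda>n. A n * x ^ n) sums (\<epsilon> powr a * (1 - x) powr - a)" if "0 \<le> x" "x < 1" for x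
      using sums_mult[OF negbinom_coeff_sums[OF that, of a], of "\<epsilon> powr a"] by (simp add: A_def mult.assoc)
  qed
  then obtain B where B: "\<And>n. 0 \<le> B n"
    "\<And>x. 0 \<le> x \<Longrightarrow> x < 1 \<Longrightarrow> (\<lambda>n. B n * x ^ n) sums (1 / A 0 - 1 / (\<epsilon> powr a * (1 - x) powr (- a)))"
    by blast
  have "moment_positive (\<lambda>s. 1 / A 0 - 1 / (\<epsilon> powr a * (1 - exp (- \<epsilon> * s)) powr (- a)))"
    by (rule moment_positive_power_series[OF B(1) assms(3) B(2)])
  then show ?thesis
  proof (rule moment_positive_cong)
    fix s :: real assume "s > 0"
    then show "1 / A 0 - 1 / (\<epsilon> powr a * (1 - exp (- \<epsilon> * s)) powr (- a)) =
        \<epsilon> powr (- a) - ((1 - exp (- \<epsilon> * s)) / \<epsilon>) powr a"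
      using assms by (simp add: A_def powr_divide powr_minus field_simps)
  qed
qed

text \<open>The moment positivity conditions stand for complete monotonicity of
  \<open>exp (- \<tau> * g)\<close> and of g(s) / s. The logarithmic lower bound on Re g makes
  \<open>exp (- \<tau> * g)\<close> decay like a power of |z|. The square in the second bound
  accommodates symbols for which |g| exceeds Re g by an unbounded factor near the imaginary axis:
  for a continuous weight |h| is of order r / ln r there, Re h only of order r / (ln r)^2.\<close>

locale subordinator_symbol =
  fixes g :: "complex \<Rightarrow> complex"
  assumes g_holo: "g holomorphic_on {z. 0 < Re z}"
    and g_cnj: "\<And>z. 0 < Re z \<Longrightarrow> g (cnj z) = cnj (g z)"
    and g_Re_pos: "\<And>z. 0 < Re z \<Longrightarrow> 0 < Re (g z)"
    and g_growth: "\<exists>R C. \<forall>z. 0 < Re z \<longrightarrow> R \<le> norm z \<longrightarrow>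
       ln (norm z) \<le> C * Re (g z) \<and> norm (g z) \<le> C * (1 + Re (g z))\<^sup>2"
    and g_exp_mp: "\<And>\<tau>. \<tau> \<ge> 0 \<Longrightarrow> moment_positive (\<lambda>s. exp (- \<tau> * Re (g (of_real s))))"
    and g_div_mp: "moment_positive (\<lambda>s. Re (g (of_real s)) / s)"

section \<open>Symbols of weights\<close>

text \<open>Concavity of the cosine on [0, pi/2]: its graph lies above the chord from (0,1) to
  (pi/2,0).\<close>

lemma cos_ge_one_minus:
  assumes "0 \<le> b" "b \<le> 1" "\<bar>\<theta>\<bar> \<le> pi / 2"
  shows "1 - b \<le> cos (b * \<theta>)"
proof -
  have "convex_on {0..pi/2} (\<lambda>x. - cos x)"
  proof (rule f''_ge0_imp_convex[where f'="\<lambda>x. sin x" and f''="\<lambda>x. cos x"])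
    show "((\<lambda>x. - cos x) has_real_derivative sin x) (at x)" for x by (auto intro!: derivative_eq_intros)
    show "(sin has_real_derivative cos x) (at x)" for x by (auto intro!: derivative_eq_intros)
    show "0 \<le> cos x" if "x \<in> {0..pi/2}" for x using that by (intro cos_ge_zero) auto
  qed simp
  from convex_onD[OF this, of b 0 "pi/2"] have "1 - b \<le> cos (b * (pi / 2))" using assms by simp
  also have "\<dots> \<le> cos \<bar>b * \<theta>\<bar>"
  proof (rule cos_monotone_0_pi_le)
    show "\<bar>b * \<theta>\<bar> \<le> b * (pi / 2)" using mult_left_mono[OF assms(3,1)] assms(1) by (simp add: abs_mult)
    have "b * (pi / 2) \<le> 1 * pi" using assms by (intro mult_mono) auto
    then show "b * (pi / 2) \<le> pi" by simp
  qed simp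
  finally show ?thesis by simp
qed

lemma powr_of_real_polar:
  fixes z :: complex
  assumes "z \<noteq> 0"
  shows "z powr of_real b = of_real (norm z powr b) * cis (b * Arg z)"
proof -
  have "Ln z = of_real (ln (norm z)) + \<i> * of_real (Arg z)"
    using assms by (simp add: complex_eq_iff Arg_eq_Im_Ln)
  then have "z powr of_real b = exp (of_real (b * ln (norm z)) + \<i> * of_real (b * Arg z))"
    using assms by (simp add: powr_def distrib_left mult.left_commute)
  also have "\<dots> = of_real (exp (b * ln (norm z))) * cis (b * Arg z)"
    by (simp only: exp_add cis_conv_exp exp_of_real)
  finally show ?thesis using assms by (simp add: powr_def)
qed

lemma Arg_half_plane: "0 < Re z \<Longrightarrow> \<bar>Arg z\<bar> < pi / 2"
  using Re_Ln_pos_lt[of z] by (cases "z = 0") (auto simp: Arg_eq_Im_Ln)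

text \<open>Both kinds of weight become a measure N, so that h is a mixture of powers.
  \<open>grow1\<close> is what g = h needs for \<open>g_growth\<close>, \<open>grow2\<close> what g
  = s / h needs; the factor 1 - b is the lower bound for cos(b Arg z) in the right half
  plane.\<close>

locale weight_measure = finite_measure N for N :: "real measure" +
  assumes sets_N [measurable_cong, simp]: "sets N = sets borel"
    and supp: "AE b in N. 0 < b \<and> b < 1"
    and nz: "measure N (space N) > 0"
    and grow1: "\<exists>R C. \<forall>r\<ge>R. ln r \<le> C * (\<integral>b. (1 - b) * r powr b \<partial>N) \<and>
       (\<integral>b. r powr b \<partial>N) \<le> C * (1 + (\<integral>b. (1 - b) * r powr b \<partial>N))\<^sup>2"
    and grow2: "\<exists>R C. \<forall>r\<ge>R. (\<integral>b. r powr b \<partial>N) * ln r \<le> C * r"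
begin

definition h :: "complex \<Rightarrow> complex" where
  "h z = (\<integral>b. z powr of_real b \<partial>N)"

definition H :: "real \<Rightarrow> real" where
  "H r = (\<integral>b. r powr b \<partial>N)"

lemma integrable_bdd:
  fixes f :: "real \<Rightarrow> 'c::{banach,second_countable_topology}"
  assumes "f \<in> borel_measurable borel" "\<And>b. 0 < b \<Longrightarrow> b < 1 \<Longrightarrow> norm (f b) \<le> B"
  shows "integrable N f"
proof (rule integrable_const_bound)
  show "AE b in N. norm (f b) \<le> B" using supp by eventually_elim (use assms in auto)
  show "f \<in> borel_measurable N" using assms(1) by simp
qed

lemma integral_pos:
  fixes f :: "real \<Rightarrow> real"
  assumes i: "integrable N f" and p: "\<And>b. 0 < b \<Longrightarrow> b < 1 \<Longrightarrow> 0 < f b"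
  shows "0 < (\<integral>b. f b \<partial>N)"
proof -
  have ae: "AE b in N. 0 < f b" using supp by eventually_elim (use p in auto)
  then have ae': "AE b in N. 0 \<le> f b" by eventually_elim simp
  have "(\<integral>b. f b \<partial>N) \<noteq> 0"
  proof
    assume "(\<integral>b. f b \<partial>N) = 0"
    then have "AE b in N. f b = 0" using integral_nonneg_eq_0_iff_AE[OF i ae'] by simp
    then have "AE b in N. False" using ae by eventually_elim simp
    then have "ae_filter N = bot" by (simp only: eventually_False)
    then show False using nz by (simp add: ae_filter_eq_bot_iff measure_def)
  qed
  moreover have "0 \<le> (\<integral>b. f b \<partial>N)" by (rule integral_nonneg_AE[OF ae'])
  ultimately show ?thesis by simp
qed

lemma integral_mono_supp:
  fixes f k :: "real \<Rightarrow> real"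
  assumes "integrable N f" "integrable N k" "\<And>b. 0 < b \<Longrightarrow> b < 1 \<Longrightarrow> f b \<le> k b"
  shows "(\<integral>b. f b \<partial>N) \<le> (\<integral>b. k b \<partial>N)"
proof (rule integral_mono_AE[OF assms(1,2)])
  show "AE b in N. f b \<le> k b" using supp by eventually_elim (use assms in auto)
qed

lemma powr_le_max: "0 < r \<Longrightarrow> 0 < b \<Longrightarrow> b < 1 \<Longrightarrow> r powr b \<le> max 1 (r::real)"
proof (cases "r \<ge> 1")
  case True
  assume "b < 1" then show ?thesis using powr_mono[of b 1 r] True by simp
next
  case False
  assume "0 < r" "0 < b" then show ?thesis using powr_mono'[of 0 b r] False by simp
qed

lemma int_powr: assumes "r > 0"
  shows "integrable N (\<lambda>b. r powr b)" "integrable N (\<lambda>b. (1 - b) * r powr b)" "integrable N (\<lambda>b. b * r powr b)"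
proof -
  have "(1 - b) * r powr b \<le> 1 * max 1 r" "b * r powr b \<le> 1 * max 1 r" if "0 < b" "b < 1" for b
    using powr_le_max[OF assms that] that by (intro mult_mono; simp)+
  then show "integrable N (\<lambda>b. r powr b)" "integrable N (\<lambda>b. (1 - b) * r powr b)" "integrable N (\<lambda>b. b * r powr b)"
    using powr_le_max[OF assms] by (auto intro!: integrable_bdd[where B="max 1 r"] simp: abs_mult)
qed

lemma measurable_cpowr [measurable]: "(\<lambda>b. z powr complex_of_real b) \<in> borel_measurable borel"
  unfolding powr_def by measurable

lemma int_cpowr: fixes z :: complex assumes "z \<noteq> 0" shows "integrable N (\<lambda>b. z powr of_real b)"
proof (rule integrable_bdd[OF measurable_cpowr])
  show "norm (z powr of_real b) \<le> max 1 (norm z)" if "0 < b" "b < 1" for b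
    using assms powr_le_max[of "norm z", OF _ that] by (simp add: powr_of_real_polar norm_mult)
qed

lemma H_pos: "r > 0 \<Longrightarrow> H r > 0"
  unfolding H_def by (intro integral_pos int_powr) auto

lemma h_of_real: "r > 0 \<Longrightarrow> h (of_real r) = of_real (H r)"
  unfolding h_def H_def by (simp add: powr_of_real flip: integral_complex_of_real)

lemma norm_h_le: "z \<noteq> 0 \<Longrightarrow> norm (h z) \<le> H (norm z)"
proof -
  assume "z \<noteq> 0"
  then have "norm (z powr of_real b) = norm z powr b" for b by (simp add: powr_of_real_polar norm_mult)
  then show ?thesis unfolding h_def H_def using integral_norm_bound[of N "\<lambda>b. z powr of_real b"] by simp
qed

lemma h_cnj: assumes "z \<notin> \<real>\<^sub>\<le>\<^sub>0" shows "h (cnj z) = cnj (h z)"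
proof -
  have "cnj z powr of_real b = cnj (z powr of_real b)" for b
    using assms by (subst cnj_powr) (auto simp: complex_nonpos_Reals_iff)
  then show ?thesis unfolding h_def by simp
qed

lemma h_holo: "h holomorphic_on (- \<real>\<^sub>\<le>\<^sub>0)"
proof (subst holomorphic_on_open)
  show "open (- \<real>\<^sub>\<le>\<^sub>0 :: complex set)" by (simp add: open_Compl)
  show "\<forall>z\<in>- \<real>\<^sub>\<le>\<^sub>0. \<exists>f'. (h has_field_derivative f') (at z)"
  proof
    fix z :: complex assume z: "z \<in> - \<real>\<^sub>\<le>\<^sub>0"
    then have z0: "z \<noteq> 0" by auto
    obtain e1 where e1: "e1 > 0" "ball z e1 \<subseteq> - \<real>\<^sub>\<le>\<^sub>0"
      using z open_contains_ball[of "- \<real>\<^sub>\<le>\<^sub>0 :: complex set"] by (auto simp: open_Compl)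
    define e where "e = min e1 (norm z / 2)"
    have e: "e > 0" using e1 z0 by (simp add: e_def)
    have big: "norm y > norm z / 2" "y \<notin> \<real>\<^sub>\<le>\<^sub>0" if "y \<in> ball z e" for y
    proof -
      have "norm z - norm y \<le> dist z y" by (simp add: dist_norm norm_triangle_ineq2)
      then show "norm y > norm z / 2" using that by (simp add: e_def)
      show "y \<notin> \<real>\<^sub>\<le>\<^sub>0" using that e1 by (auto simp: e_def)
    qed
    \<comment> \<open>On the ball |y| > |z| / 2, so the modulus of y^(b-1) is at most (2 /
      |z|)^(1-b), whose exponent lies between 0 and 1.\<close>
    define W where "W = max 1 (2 / norm z)"
    have "(h has_field_derivative (\<integral>b. of_real b * z powr (of_real b - 1) \<partial>N)) (at z)"
      unfolding h_def
    proof (rule integral_has_field_derivative[OF e, where w="\<lambda>_. W"])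
      show "integrable N (\<lambda>b. z powr of_real b)" by (rule int_cpowr[OF z0])
      show "(\<lambda>b. of_real b * z powr (of_real b - 1)) \<in> borel_measurable N"
        unfolding powr_def by measurable
      show "(\<lambda>b. y powr of_real b) \<in> borel_measurable N" for y :: complex by measurable
      show "AE b in N. \<forall>y\<in>ball z e. ((\<lambda>y. y powr of_real b) has_field_derivative of_real b * y powr (of_real b - 1)) (at y)
           \<and> norm (of_real b * y powr (of_real b - 1)) \<le> W"
        using supp
      proof eventually_elim
        case (elim b)
        show ?case
        proof (intro ballI conjI)
          fix y assume y: "y \<in> ball z e"
          show "((\<lambda>y. y powr of_real b) has_field_derivative of_real b * y powr (of_real b - 1)) (at y)"
            by (rule has_field_derivative_powr[OF big(2)[OF y]])
          have y0: "norm y > 0" using big(1)[OF y] z0 by (smt (verit) half_gt_zero zero_less_norm_iff)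
          have "norm (y powr (of_real b - 1)) = norm y powr (b - 1)"
            using y0 powr_of_real_polar[of y "b - 1"] by (simp add: norm_mult)
          also have "\<dots> \<le> (norm z / 2) powr (b - 1)"
            using big(1)[OF y] z0 elim by (intro powr_mono2') auto
          also have "\<dots> = (2 / norm z) powr (1 - b)"
            using z0 by (simp add: powr_divide powr_diff mult.commute)
          also have "\<dots> \<le> W" unfolding W_def using z0 elim by (intro powr_le_max) auto
          finally have "norm (y powr (of_real b - 1)) \<le> W" .
          then have "b * norm (y powr (of_real b - 1)) \<le> 1 * W" using elim by (intro mult_mono) auto
          then show "norm (of_real b * y powr (of_real b - 1)) \<le> W" using elim by (simp add: norm_mult)
        qed
      qed
    qed (use e in auto)
    then show "\<exists>f'. (h has_field_derivative f') (at z)" ..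
  qed
qed

lemma H_continuous: "continuous_on {0<..} H"
proof -
  have "continuous_on {0<..} (\<lambda>r. Re (h (of_real r)))"
    by (intro continuous_on_Re continuous_on_compose2[OF holomorphic_on_imp_continuous_on[OF h_holo]])
       (auto intro!: continuous_intros)
  then show ?thesis by (rule continuous_on_eq) (simp add: h_of_real)
qed

lemma Re_h: assumes "z \<noteq> 0" shows "Re (h z) = (\<integral>b. norm z powr b * cos (b * Arg z) \<partial>N)"
proof -
  have "Re (h z) = (\<integral>b. Re (z powr of_real b) \<partial>N)"
    unfolding h_def using int_cpowr[OF assms] by simp
  then show ?thesis using assms by (simp add: powr_of_real_polar)
qed

lemma Re_mult_cnj_h:
  assumes "z \<noteq> 0"
  shows "Re (z * cnj (h z)) = norm z * (\<integral>b. norm z powr b * cos ((1 - b) * Arg z) \<partial>N)"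
proof -
  have eq: "Re (z * cnj (z powr of_real b)) = norm z * (norm z powr b * cos ((1 - b) * Arg z))" for b
  proof -
    have "z = of_real (norm z) * cis (Arg z)" using rcis_cmod_Arg[of z] by (simp add: rcis_def)
    then have "z * cnj (z powr of_real b) = of_real (norm z * norm z powr b) * (cis (Arg z) * cis (- (b * Arg z)))"
      using assms by (subst powr_of_real_polar) (auto simp: cis_cnj)
    then show ?thesis by (simp only: cis_mult) (simp add: algebra_simps)
  qed
  have "Re (z * cnj (h z)) = (\<integral>b. Re (z * cnj (z powr of_real b)) \<partial>N)"
    unfolding h_def using int_cpowr[OF assms]
    by (subst integral_Re) (auto simp flip: integral_cnj intro!: integrable_mult_right)
  then show ?thesis unfolding eq by simp
qed

lemma int_powr_cos:
  assumes "r > 0"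
  shows "integrable N (\<lambda>b. r powr b * cos (b * \<theta>))" "integrable N (\<lambda>b. r powr b * cos ((1 - b) * \<theta>))"
proof -
  have "r powr b * \<bar>cos x\<bar> \<le> max 1 r * 1" if "0 < b" "b < 1" for b x
    using powr_le_max[OF assms that] by (intro mult_mono) auto
  then show "integrable N (\<lambda>b. r powr b * cos (b * \<theta>))" "integrable N (\<lambda>b. r powr b * cos ((1 - b) * \<theta>))"
    by (auto intro!: integrable_bdd[where B="max 1 r"] simp: abs_mult)
qed

text \<open>The argument of \<open>z powr b\<close> is b Arg z with |Arg z| < pi/2, so its cosine is
  at least 1 - b, uniformly up to the imaginary axis.\<close>

lemma Re_h_ge:
  assumes "0 < Re z" shows "(\<integral>b. (1 - b) * norm z powr b \<partial>N) \<le> Re (h z)"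
proof -
  have z: "z \<noteq> 0" using assms by auto
  show ?thesis unfolding Re_h[OF z]
    using z Arg_half_plane[OF assms]
    by (intro integral_mono_supp int_powr int_powr_cos)
       (auto simp: mult.commute[of "norm z powr _"] intro!: mult_right_mono cos_ge_one_minus)
qed

text \<open>Serves z / h, whose real part is \<open>Re (z * cnj (h z))\<close> up to a positive
  factor; here a power contributes the angle (1 - b) Arg z, with cosine at least b.\<close>

lemma Re_mult_cnj_h_ge:
  assumes "0 < Re z" shows "norm z * (\<integral>b. b * norm z powr b \<partial>N) \<le> Re (z * cnj (h z))"
proof -
  have z: "z \<noteq> 0" using assms by auto
  have "(\<integral>b. b * norm z powr b \<partial>N) \<le> (\<integral>b. norm z powr b * cos ((1 - b) * Arg z) \<partial>N)"
  proof (intro integral_mono_supp int_powr int_powr_cos)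
    fix b :: real assume "0 < b" "b < 1"
    then have "b \<le> cos ((1 - b) * Arg z)"
      using cos_ge_one_minus[of "1 - b" "Arg z"] Arg_half_plane[OF assms] by simp
    then show "b * norm z powr b \<le> norm z powr b * cos ((1 - b) * Arg z)"
      using mult_left_mono[of b "cos ((1 - b) * Arg z)" "norm z powr b"] by (simp add: mult.commute)
  qed (use z in auto)
  then show ?thesis unfolding Re_mult_cnj_h[OF z] by (rule mult_left_mono) simp
qed

lemma integral_one_minus_pos: "r > 0 \<Longrightarrow> 0 < (\<integral>b. (1 - b) * r powr b \<partial>N)"
  by (intro integral_pos int_powr) auto

lemma Re_h_pos: assumes "0 < Re z" shows "0 < Re (h z)"
proof -
  have "norm z > 0" using assms by auto
  then show ?thesis using Re_h_ge[OF assms] integral_one_minus_pos[of "norm z"] by simp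
qed

lemma h_nonzero: "0 < Re z \<Longrightarrow> h z \<noteq> 0"
  using Re_h_pos[of z] by auto

lemma Re_div_h: "Re (z / h z) = Re (z * cnj (h z)) / (norm (h z))\<^sup>2"
  by (subst complex_div_cnj) (simp flip: of_real_power)

lemma Re_div_h_pos:
  assumes "0 < Re z" shows "0 < Re (z / h z)"
proof -
  have "z \<noteq> 0" using assms by auto
  then have "0 < norm z * (\<integral>b. b * norm z powr b \<partial>N)"
    by (intro mult_pos_pos integral_pos int_powr) auto
  then show ?thesis unfolding Re_div_h using Re_mult_cnj_h_ge[OF assms] h_nonzero[OF assms]
    by (intro divide_pos_pos) auto
qed

definition mean :: real where "mean = (\<integral>b. b \<partial>N) / measure N (space N)"

lemma int_id: "integrable N (\<lambda>b. b)" by (rule integrable_bdd[where B=1]) auto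

lemma mean_pos: "mean > 0"
  unfolding mean_def using nz by (intro divide_pos_pos integral_pos int_id) auto

text \<open>Chebyshev's association: \<open>b\<close> and \<open>r powr b\<close> are similarly ordered when \<open>r \<ge> 1\<close>.\<close>

lemma mean_H_le:
  assumes "r \<ge> 1" shows "mean * H r \<le> (\<integral>b. b * r powr b \<partial>N)"
proof -
  have r: "r > 0" using assms by simp
  have "0 \<le> (\<integral>b. (b - mean) * (r powr b - r powr mean) \<partial>N)"
  proof (rule integral_nonneg_AE, rule AE_I2)
    fix b
    show "0 \<le> (b - mean) * (r powr b - r powr mean)"
      using assms powr_mono[of mean b r] powr_mono[of b mean r] linear[of mean b] by (auto simp: zero_le_mult_iff)
  qed
  also have "(\<lambda>b. (b - mean) * (r powr b - r powr mean)) =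
      (\<lambda>b. b * r powr b - mean * r powr b - r powr mean * b + r powr mean * mean)"
    by (auto simp: fun_eq_iff algebra_simps)
  also have "(\<integral>b. b * r powr b - mean * r powr b - r powr mean * b + r powr mean * mean \<partial>N) =
      (\<integral>b. b * r powr b \<partial>N) - mean * H r - r powr mean * (\<integral>b. b \<partial>N) + r powr mean * mean * measure N (space N)"
    using int_powr[OF r] int_id unfolding H_def
    by (simp add: Bochner_Integration.integral_add Bochner_Integration.integral_diff)
  also have "r powr mean * mean * measure N (space N) = r powr mean * (\<integral>b. b \<partial>N)"
    using nz by (simp add: mean_def)
  finally show ?thesis by simp
qed

section \<open>Moment positivity of the symbols on the positive axis\<close>

lemma moment_positive_H_div: "moment_positive (\<lambda>s. H s / s)"
proof (rule moment_positive_cong)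
  show "moment_positive (\<lambda>s. \<integral>b. s powr (- (1 - b)) \<partial>N)"
  proof (rule moment_positive_integral)
    show "AE b in N. moment_positive (\<lambda>s. s powr (- (1 - b)))"
      using supp by eventually_elim (intro moment_positive_neg_powr; simp)
    fix s :: real assume s: "s > 0"
    have eq: "s powr - (1 - b) = s powr b / s" for b using s by (simp add: powr_diff)
    show "integrable N (\<lambda>b. s powr (- (1 - b)))" unfolding eq using int_powr(1)[OF s] by simp
  qed
  fix s :: real assume s: "s > 0"
  have eq: "s powr - (1 - b) = s powr b / s" for b using s by (simp add: powr_diff)
  show "(\<integral>b. s powr (- (1 - b)) \<partial>N) = H s / s" unfolding eq H_def by simp
qed

text \<open>After discretization each power is a constant minus a moment positive function, and both
  parts can be integrated against N.\<close>

lemma moment_positive_exp_H: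
  assumes "\<tau> \<ge> 0" shows "moment_positive (\<lambda>s. exp (- \<tau> * H s))"
proof (rule moment_positive_discretize)
  show "continuous_on {0<..} (\<lambda>s. exp (- \<tau> * H s))" by (intro continuous_intros H_continuous)
  fix \<epsilon> :: real assume e: "\<epsilon> > 0"
  define w where "w s = (1 - exp (- \<epsilon> * s)) / \<epsilon>" for s
  have w: "w s > 0" if "s > 0" for s unfolding w_def by (rule exp_discretize[OF e that])
  have ie: "integrable N (\<lambda>b. \<epsilon> powr (- b))"
    using int_powr(1)[of "1 / \<epsilon>"] e by (simp add: powr_divide powr_minus_divide)
  show "moment_positive (\<lambda>s. exp (- \<tau> * H ((1 - exp (- \<epsilon> * s)) / \<epsilon>)))"
  proof (rule moment_positive_exp_neg[OF _ _ assms])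
    show "moment_positive (\<lambda>s. \<integral>b. \<epsilon> powr (- b) - w s powr b \<partial>N)"
    proof (rule moment_positive_integral)
      show "AE b in N. moment_positive (\<lambda>s. \<epsilon> powr (- b) - w s powr b)"
        unfolding w_def using supp by eventually_elim (intro moment_positive_powr_aux; use e in simp)
      show "integrable N (\<lambda>b. \<epsilon> powr (- b) - w s powr b)" if "s > 0" for s
        using ie int_powr(1)[OF w[OF that]] by (rule Bochner_Integration.integrable_diff)
    qed
    show "H ((1 - exp (- \<epsilon> * s)) / \<epsilon>) = (\<integral>b. \<epsilon> powr (- b) \<partial>N) - (\<integral>b. \<epsilon> powr (- b) - w s powr b \<partial>N)"
      if "s > 0" for s
      using ie int_powr(1)[OF w[OF that]] by (simp add: H_def w_def)
  qed
qed

text \<open>The reciprocal s / H(s) is not a mixture of powers. Instead the discretized H(s) / s is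
  expanded as one power series whose coefficients \<open>A n\<close> average those of the powers
  \<open>s powr (- (1 - b))\<close>; log-convexity survives the averaging, and \<open>kaluza\<close>
  handles the reciprocal.\<close>

lemma moment_positive_exp_div_H:
  assumes "\<tau> \<ge> 0" shows "moment_positive (\<lambda>s. exp (- \<tau> * (s / H s)))"
proof (rule moment_positive_discretize)
  show "continuous_on {0<..} (\<lambda>s. exp (- \<tau> * (s / H s)))"
    using H_pos by (intro continuous_intros H_continuous) (auto simp: less_imp_neq[symmetric])
  fix \<epsilon> :: real assume e: "\<epsilon> > 0"
  define c where "c n b = \<epsilon> powr (1 - b) * negbinom_coeff (1 - b) n" for n b
  define K where "K = max 1 \<epsilon>"
  have c_meas[measurable]: "c n \<in> borel_measurable borel" for n
    unfolding c_def negbinom_coeff_def pochhammer_prod by measurable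
  have c_pos: "c n b > 0" and c_le: "c n b \<le> K" if "0 < b" "b < 1" for n b
  proof -
    show "c n b > 0" using that e negbinom_coeff_pos[of "1 - b" n] by (simp add: c_def)
    have "c n b \<le> K * 1" unfolding c_def K_def
      using that e powr_le_max[of \<epsilon> "1 - b"] negbinom_coeff_le_1[of "1 - b" n] negbinom_coeff_pos[of "1 - b" n]
      by (intro mult_mono) auto
    then show "c n b \<le> K" by simp
  qed
  have c_int: "integrable N (c n)" for n
    by (rule integrable_bdd[where B=K]) (use c_pos c_le in \<open>auto simp: abs_of_pos\<close>)
  define A where "A n = (\<integral>b. c n b \<partial>N)" for n
  have A_pos: "A n > 0" for n unfolding A_def by (rule integral_pos[OF c_int c_pos])
  have A_logconvex: "(A (Suc n))\<^sup>2 \<le> A n * A (Suc (Suc n))" for n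
  proof -
    \<comment> \<open>Cauchy-Schwarz through a quadratic: \<open>l\<close> minimizes
      \<open>l\<^sup>2 * A n - 2 * l * A (Suc n) + A (Suc (Suc n))\<close>, which is nonnegative
      because for each b the sequence of \<open>c n b\<close> is log-convex.\<close>
    define l where "l = A (Suc n) / A n"
    have "0 \<le> (\<integral>b. l\<^sup>2 * c n b - 2 * l * c (Suc n) b + c (Suc (Suc n)) b \<partial>N)"
    proof (rule integral_nonneg_AE)
      show "AE b in N. 0 \<le> l\<^sup>2 * c n b - 2 * l * c (Suc n) b + c (Suc (Suc n)) b"
        using supp
      proof eventually_elim
        case (elim b)
        note p = c_pos[of b n] 
        have "(c (Suc n) b)\<^sup>2 \<le> c n b * c (Suc (Suc n)) b"
          using mult_left_mono[OF negbinom_coeff_logconvex[of "1 - b" n], of "(\<epsilon> powr (1 - b))\<^sup>2"] elim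
          by (simp add: c_def power2_eq_square ac_simps)
        then have "0 \<le> (l * c n b - c (Suc n) b)\<^sup>2 + (c n b * c (Suc (Suc n)) b - (c (Suc n) b)\<^sup>2)" by simp
        also have "\<dots> = c n b * (l\<^sup>2 * c n b - 2 * l * c (Suc n) b + c (Suc (Suc n)) b)"
          by (simp add: power2_eq_square algebra_simps)
        finally show ?case using p elim by (simp add: zero_le_mult_iff)
      qed
    qed
    also have "\<dots> = l\<^sup>2 * A n - 2 * l * A (Suc n) + A (Suc (Suc n))"
      using c_int unfolding A_def by (simp add: Bochner_Integration.integral_add Bochner_Integration.integral_diff)
    finally have "0 \<le> A n * (l\<^sup>2 * A n - 2 * l * A (Suc n) + A (Suc (Suc n)))"
      using A_pos[of n] by simp
    also have "\<dots> = (l * A n)\<^sup>2 - 2 * (l * A n) * A (Suc n) + A n * A (Suc (Suc n))"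
      by (simp add: power2_eq_square algebra_simps)
    also have "l * A n = A (Suc n)" using A_pos[of n] by (simp add: l_def)
    finally show ?thesis by (simp add: power2_eq_square)
  qed
  have sums: "(\<lambda>n. A n * x ^ n) sums (H ((1 - x) / \<epsilon>) / ((1 - x) / \<epsilon>))" if x: "0 \<le> x" "x < 1" for x
  proof -
    have geo: "summable (\<lambda>n. K * x ^ n)" using x by (intro summable_mult summable_geometric) auto
    have c_sums: "(\<lambda>n. c n b * x ^ n) sums (\<epsilon> powr (1 - b) * (1 - x) powr (- (1 - b)))" for b
      using sums_mult[OF negbinom_coeff_sums[OF x, of "1 - b"], of "\<epsilon> powr (1 - b)"] by (simp add: c_def mult.assoc)
    have "(\<lambda>n. \<integral>b. c n b * x ^ n \<partial>N) sums (\<integral>b. (\<Sum>n. c n b * x ^ n) \<partial>N)"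
    proof (rule sums_integral)
      show "integrable N (\<lambda>b. c n b * x ^ n)" for n using c_int by simp
      show "AE b in N. summable (\<lambda>n. norm (c n b * x ^ n))"
        using supp
      proof eventually_elim
        case (elim b)
        show ?case
          by (rule summable_comparison_test'[OF geo])
             (use elim c_pos[of b] c_le[of b] x in \<open>auto simp: abs_mult abs_of_pos intro!: mult_right_mono\<close>)
      qed
      have "(\<integral>b. norm (c n b * x ^ n) \<partial>N) \<le> (\<integral>b. K * x ^ n \<partial>N)" for n
        by (rule integral_mono_supp)
           (use c_int c_pos c_le x in \<open>auto simp: abs_mult abs_of_pos intro!: mult_right_mono\<close>)
      then show "summable (\<lambda>n. \<integral>b. norm (c n b * x ^ n) \<partial>N)"
        by (intro summable_comparison_test'[OF summable_mult[OF geo, of "measure N (space N)"]])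
           (auto simp: ac_simps)
    qed
    also have "(\<integral>b. (\<Sum>n. c n b * x ^ n) \<partial>N) = (\<integral>b. ((1 - x) / \<epsilon>) powr b / ((1 - x) / \<epsilon>) \<partial>N)"
    proof (intro Bochner_Integration.integral_cong refl)
      fix b
      have "(\<Sum>n. c n b * x ^ n) = \<epsilon> powr (1 - b) * (1 - x) powr (- (1 - b))" using c_sums by (simp add: sums_iff)
      also have "\<dots> = ((1 - x) / \<epsilon>) powr b / ((1 - x) / \<epsilon>)"
        using x e by (simp add: powr_divide powr_diff powr_minus field_simps)
      finally show "(\<Sum>n. c n b * x ^ n) = ((1 - x) / \<epsilon>) powr b / ((1 - x) / \<epsilon>)" .
    qed
    also have "\<dots> = H ((1 - x) / \<epsilon>) / ((1 - x) / \<epsilon>)" by (simp only: H_def integral_divide_zero)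
    also have "(\<lambda>n. \<integral>b. c n b * x ^ n \<partial>N) = (\<lambda>n. A n * x ^ n)" by (simp only: A_def integral_mult_left_zero)
    finally show ?thesis .
  qed
  obtain B where B: "\<And>n. 0 \<le> B n" "\<And>x. 0 \<le> x \<Longrightarrow> x < 1 \<Longrightarrow>
      (\<lambda>n. B n * x ^ n) sums (1 / A 0 - 1 / (H ((1 - x) / \<epsilon>) / ((1 - x) / \<epsilon>)))"
    using kaluza[OF A_pos A_logconvex sums] by blast
  show "moment_positive (\<lambda>s. exp (- \<tau> * ((1 - exp (- \<epsilon> * s)) / \<epsilon> / H ((1 - exp (- \<epsilon> * s)) / \<epsilon>))))"
    by (rule moment_positive_exp_neg[where c="1 / A 0", OF moment_positive_power_series[OF B(1) e B(2)] _ assms])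
       (auto simp: mult.commute)
qed

text \<open>1 / H(s) is the integral of exp(-t H(s)) over t > 0, a mixture of functions already
  known to be moment positive.\<close>

lemma moment_positive_inverse_H: "moment_positive (\<lambda>s. 1 / H s)"
proof (rule moment_positive_cong)
  have lap: "has_laplace (\<lambda>t. exp (0 * t)) (H s) (1 / (H s - 0))" if "s > 0" for s
    using that by (intro has_laplace_exp H_pos)
  show "moment_positive (\<lambda>s. \<integral>t. indicator {0<..} t *\<^sub>R (exp (- H s * t) * exp (0 * t)) \<partial>lborel)"
  proof (rule moment_positive_integral, intro AE_I2)
    fix t :: real
    show "moment_positive (\<lambda>s. indicator {0<..} t *\<^sub>R (exp (- H s * t) * exp (0 * t)))"
    proof (cases "t > 0")
      case True
      then show ?thesis using moment_positive_exp_H[of t] by (simp add: mult.commute)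
    qed (simp add: moment_positive_const)
  qed (use lap in \<open>simp add: has_laplace_def set_integrable_def\<close>)
  show "(\<integral>t. indicator {0<..} t *\<^sub>R (exp (- H s * t) * exp (0 * t)) \<partial>lborel) = 1 / H s" if "s > 0" for s
    using lap[OF that] by (simp add: has_laplace_def set_lebesgue_integral_def)
qed

lemma half_plane_subset: "{z. 0 < Re z} \<subseteq> - \<real>\<^sub>\<le>\<^sub>0"
  by (auto simp: complex_nonpos_Reals_iff)

lemma symbol_h: "subordinator_symbol h"
proof
  show "h holomorphic_on {z. 0 < Re z}" by (rule holomorphic_on_subset[OF h_holo half_plane_subset])
  show "h (cnj z) = cnj (h z)" if "0 < Re z" for z using h_cnj[of z] half_plane_subset that by auto
  show "0 < Re (h z)" if "0 < Re z" for z by (rule Re_h_pos[OF that])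
  show "moment_positive (\<lambda>s. exp (- \<tau> * Re (h (of_real s))))" if "\<tau> \<ge> 0" for \<tau>
    by (rule moment_positive_cong[OF moment_positive_exp_H[OF that]]) (simp add: h_of_real)
  show "moment_positive (\<lambda>s. Re (h (of_real s)) / s)"
    by (rule moment_positive_cong[OF moment_positive_H_div]) (simp add: h_of_real)
  obtain R C where RC: "\<And>r. r \<ge> R \<Longrightarrow> ln r \<le> C * (\<integral>b. (1 - b) * r powr b \<partial>N)"
    "\<And>r. r \<ge> R \<Longrightarrow> H r \<le> C * (1 + (\<integral>b. (1 - b) * r powr b \<partial>N))\<^sup>2"
    using grow1 unfolding H_def by blast
  show "\<exists>R C. \<forall>z. 0 < Re z \<longrightarrow> R \<le> norm z \<longrightarrow> ln (norm z) \<le> C * Re (h z) \<and> norm (h z) \<le> C * (1 + Re (h z))\<^sup>2"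
  proof (intro exI allI impI conjI)
    fix z assume z: "0 < Re z" "R \<le> norm z"
    define k where "k = (\<integral>b. (1 - b) * norm z powr b \<partial>N)"
    have "norm z > 0" using z(1) by auto
    then have k0: "0 \<le> k" unfolding k_def using integral_one_minus_pos[of "norm z"] by simp
    have k: "k \<le> Re (h z)" unfolding k_def by (rule Re_h_ge[OF z(1)])
    have "ln (norm z) \<le> C * k" unfolding k_def by (rule RC(1)[OF z(2)])
    also have "\<dots> \<le> max C 0 * Re (h z)" using k k0 by (intro mult_mono) auto
    finally show "ln (norm z) \<le> max C 0 * Re (h z)" .
    have "norm (h z) \<le> H (norm z)" using z by (intro norm_h_le) auto
    also have "\<dots> \<le> C * (1 + k)\<^sup>2" unfolding k_def by (rule RC(2)[OF z(2)])
    also have "\<dots> \<le> max C 0 * (1 + Re (h z))\<^sup>2" using k k0 by (intro mult_mono power_mono) auto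
    finally show "norm (h z) \<le> max C 0 * (1 + Re (h z))\<^sup>2" .
  qed
qed

text \<open>By \<open>mean_H_le\<close> the bound \<open>Re_mult_cnj_h_ge\<close> becomes mean |z /
  h z| \<le> Re (z / h z) for |z| \<ge> 1, so large z are mapped into a proper sector around the
  positive axis; the same estimate combined with \<open>grow2\<close> bounds ln |z|.\<close>

lemma symbol_div_h: "subordinator_symbol (\<lambda>z. z / h z)"
proof
  have "h holomorphic_on {z. 0 < Re z}" by (rule holomorphic_on_subset[OF h_holo half_plane_subset])
  then show "(\<lambda>z. z / h z) holomorphic_on {z. 0 < Re z}"
    by (intro holomorphic_intros) (use h_nonzero in auto)
  show "cnj z / h (cnj z) = cnj (z / h z)" if "0 < Re z" for z using h_cnj[of z] half_plane_subset that by auto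
  show "0 < Re (z / h z)" if "0 < Re z" for z by (rule Re_div_h_pos[OF that])
  show "moment_positive (\<lambda>s. exp (- \<tau> * Re (of_real s / h (of_real s))))" if "\<tau> \<ge> 0" for \<tau>
    by (rule moment_positive_cong[OF moment_positive_exp_div_H[OF that]]) (simp add: h_of_real flip: of_real_divide)
  show "moment_positive (\<lambda>s. Re (of_real s / h (of_real s)) / s)"
    by (rule moment_positive_cong[OF moment_positive_inverse_H]) (simp add: h_of_real flip: of_real_divide)
  obtain R C where RC: "\<And>r. r \<ge> R \<Longrightarrow> H r * ln r \<le> C * r" using grow2 unfolding H_def by blast
  define C' where "C' = max 1 C / mean + 1 / mean"
  show "\<exists>R C. \<forall>z. 0 < Re z \<longrightarrow> R \<le> norm z \<longrightarrow> ln (norm z) \<le> C * Re (z / h z) \<and> norm (z / h z) \<le> C * (1 + Re (z / h z))\<^sup>2"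
  proof (intro exI allI impI)
    fix z assume z: "0 < Re z" "max 1 R \<le> norm z"
    define r where "r = norm z"
    define \<rho> where "\<rho> = Re (z / h z)"
    have r: "r \<ge> 1" "r \<ge> R" using z(2) by (auto simp: r_def)
    have z0: "z \<noteq> 0" using z by auto
    have hz: "norm (h z) > 0" using h_nonzero[OF z(1)] by simp
    have hH: "norm (h z) \<le> H r" unfolding r_def by (rule norm_h_le[OF z0])
    have \<rho>: "\<rho> > 0" unfolding \<rho>_def by (rule Re_div_h_pos[OF z(1)])
    have "r * (mean * H r) \<le> Re (z * cnj (h z))"
      using order.trans[OF mult_left_mono[OF mean_H_le[OF r(1)]] Re_mult_cnj_h_ge[OF z(1), folded r_def]] r by simp
    also have "\<dots> = \<rho> * (norm (h z))\<^sup>2" unfolding \<rho>_def Re_div_h using hz by simp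
    finally have *: "r * (mean * H r) \<le> \<rho> * (norm (h z))\<^sup>2" .
    have "r * (mean * norm (h z)) \<le> r * (mean * H r)" using hH r mean_pos by (intro mult_left_mono) auto
    also note *
    finally have "mean * r \<le> \<rho> * norm (h z)" using hz by (simp add: power2_eq_square ac_simps)
    then have nb: "norm (z / h z) \<le> \<rho> / mean" and **: "mean * r \<le> \<rho> * H r"
      using hz mean_pos hH \<rho> by (auto simp: norm_divide r_def field_simps intro: order.trans[OF _ mult_left_mono])
    have "mean * (ln r * H r) \<le> mean * (C * r)" using RC[OF r(2)] mean_pos by (simp add: mult.commute)
    also have "\<dots> \<le> max 1 C * (mean * r)" using mean_pos r by (simp add: mult.left_commute mult_right_mono)
    also have "\<dots> \<le> max 1 C * (\<rho> * H r)" using ** by (intro mult_left_mono) auto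
    finally have "mean * ln r \<le> max 1 C * \<rho>" using H_pos[of r] r by (simp add: mult.assoc[symmetric])
    then have "ln r \<le> max 1 C / mean * \<rho>" using mean_pos by (simp add: field_simps)
    also have "\<dots> \<le> C' * \<rho>" unfolding C'_def using \<rho> mean_pos by (intro mult_right_mono) auto
    finally have 1: "ln r \<le> C' * \<rho>" .
    have "\<rho> / mean = (1 / mean) * \<rho>" by simp
    also have "\<dots> \<le> C' * (1 + \<rho>)\<^sup>2"
      unfolding C'_def using \<rho> mean_pos by (intro mult_mono) (auto simp: power2_eq_square algebra_simps)
    finally have 2: "norm (z / h z) \<le> C' * (1 + \<rho>)\<^sup>2" using nb by simp
    show "ln (norm z) \<le> C' * Re (z / h z) \<and> norm (z / h z) \<le> C' * (1 + Re (z / h z))\<^sup>2"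
      using 1 2 by (simp add: r_def \<rho>_def)
  qed
qed

end

section \<open>The subordination density\<close>

lemma has_laplace_mono:
  assumes "has_laplace f s K" "has_laplace g s L" "\<And>t. t > 0 \<Longrightarrow> f t \<le> g t"
  shows "K \<le> L"
proof -
  have "(LBINT t:{0<..}. exp (- s * t) * f t) \<le> (LBINT t:{0<..}. exp (- s * t) * g t)"
    using assms unfolding has_laplace_def by (intro set_integral_mono) auto
  then show ?thesis using assms unfolding has_laplace_def by simp
qed

lemma has_laplace_cong:
  assumes "has_laplace f s L" "\<And>t. t > 0 \<Longrightarrow> f t = g t"
  shows "has_laplace g s L"
proof -
  have "indicator {0<..} t *\<^sub>R (exp (- s * t) * f t) = indicator {0<..} t *\<^sub>R (exp (- s * t) * g t)" for t
    using assms(2)[of t] by (auto simp: indicator_def)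
  then show ?thesis using assms(1) unfolding has_laplace_def set_integrable_def set_lebesgue_integral_def by presburger
qed

lemma has_laplace_const:
  assumes "s > 0" shows "has_laplace (\<lambda>_. c) s (c / s)"
  using has_laplace_cmult[OF has_laplace_exp[of 0 s], of c] assms by simp

lemma has_laplace_delay:
  assumes "has_laplace f s L" "d \<ge> 0"
  shows "has_laplace (\<lambda>t. if t > d then f (t - d) else 0) s (exp (- d * s) * L)"
proof -
  define G where "G v = indicator {0<..} v *\<^sub>R (exp (- s * v) * f v)" for v
  have G: "integrable lborel G" "integral\<^sup>L lborel G = L"
    using assms(1) unfolding has_laplace_def set_integrable_def set_lebesgue_integral_def G_def by auto
  have G2: "integrable lborel (\<lambda>x. G (- d + 1 * x))" by (rule lborel_integrable_real_affine[OF G(1)]) simp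
  have G3: "(\<integral>x. G (- d + 1 * x) \<partial>lborel) = L"
    using lborel_integral_real_affine[of 1 G "- d"] G(2) by simp
  have eq: "indicator {0<..} t *\<^sub>R (exp (- s * t) * (if t > d then f (t - d) else 0)) = exp (- d * s) * G (- d + 1 * t)" for t
    using assms(2) by (auto simp: G_def indicator_def exp_add[symmetric] algebra_simps)
  show ?thesis
    unfolding has_laplace_def set_integrable_def set_lebesgue_integral_def eq using G2 G3 by simp
qed

text \<open>The transform of the indicator function of (0, d].\<close>

lemma moment_positive_one_minus_exp_div:
  assumes "d \<ge> 0" shows "moment_positive (\<lambda>s. (1 - exp (- d * s)) / s)"
proof (rule moment_positive_laplace)
  show "0 \<le> 1 - (if t > d then 1 else 0 :: real)" for t by simp
  show "has_laplace (\<lambda>t. 1 - (if t > d then 1 else 0)) s ((1 - exp (- d * s)) / s)" if "s > 0" for s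
    using has_laplace_diff[OF has_laplace_const[OF that, of 1] has_laplace_delay[OF has_laplace_const[OF that, of 1] assms]]
    by (simp add: diff_divide_distrib)
qed

section \<open>Decay of the symbol and the family of damped inverse transforms\<close>

context subordinator_symbol
begin

definition gr :: "real \<Rightarrow> real" where "gr s = Re (g (of_real s))"

lemma g_of_real: "s > 0 \<Longrightarrow> g (of_real s) = of_real (gr s)"
  using g_cnj[of "of_real s"] by (auto simp: gr_def complex_eq_iff)

lemma gr_pos: "s > 0 \<Longrightarrow> gr s > 0"
  unfolding gr_def by (rule g_Re_pos) simp

lemma gr_at_top: "filterlim gr at_top at_top"
proof -
  obtain R C where RC: "\<And>z. 0 < Re z \<Longrightarrow> R \<le> norm z \<Longrightarrow> ln (norm z) \<le> C * Re (g z)" using g_growth by blast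
  have C: "C > 0"
  proof -
    have "0 < ln (max R 2)" by simp
    also have "\<dots> \<le> C * gr (max R 2)" using RC[of "of_real (max R 2)"] by (simp add: gr_def)
    finally have "0 < C * gr (max R 2)" .
    moreover have "gr (max R 2) > 0" by (rule gr_pos) simp
    ultimately show ?thesis by (simp add: zero_less_mult_iff)
  qed
  have "filterlim (\<lambda>s. ln s / C) at_top at_top" using C by real_asymp
  moreover have "\<forall>\<^sub>F s in at_top. ln s / C \<le> gr s"
    using eventually_ge_at_top[of "max R 1"]
  proof eventually_elim
    case (elim s)
    then have "ln s \<le> C * gr s" using RC[of "of_real s"] by (simp add: gr_def)
    then show ?case using C by (simp add: field_simps)
  qed
  ultimately show ?thesis by (rule filterlim_at_top_mono)
qed

lemma compact_part: "compact ({z. \<gamma> \<le> Re z} \<inter> cball 0 R)"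
  by (intro closed_Int_compact compact_cball closed_halfspace_Re_ge)

text \<open>Compactness handles bounded |z| and logarithmic growth the rest. The bound is what makes
  \<open>1 / g\<close> an admissible multiplier.\<close>

lemma g_lower:
  assumes "\<gamma> > 0" shows "\<exists>c>0. \<forall>z. \<gamma> \<le> Re z \<longrightarrow> c \<le> Re (g z)"
proof -
  obtain R C where RC: "\<And>z. 0 < Re z \<Longrightarrow> R \<le> norm z \<Longrightarrow> ln (norm z) \<le> C * Re (g z)" using g_growth by blast
  \<comment> \<open>\<open>exp 1\<close> ensures ln |z| \<ge> 1 outside \<open>K\<close>, and
    \<open>\<gamma>\<close> that \<open>K\<close> is not empty.\<close>
  define R' where "R' = max (max R (exp 1)) \<gamma>"
  define K where "K = {z. \<gamma> \<le> Re z} \<inter> cball 0 R'"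
  have "continuous_on K (\<lambda>z. Re (g z))" unfolding K_def using assms
    by (intro continuous_on_Re continuous_on_subset[OF holomorphic_on_imp_continuous_on[OF g_holo]]) auto
  moreover have "complex_of_real \<gamma> \<in> K" using assms by (simp add: K_def R'_def)
  ultimately obtain z0 where z0: "z0 \<in> K" "\<And>z. z \<in> K \<Longrightarrow> Re (g z0) \<le> Re (g z)"
    using continuous_attains_inf[of K "\<lambda>z. Re (g z)"] compact_part[of \<gamma> R'] unfolding K_def by blast
  define c where "c = min (Re (g z0)) (1 / max C 1)"
  have "Re (g z0) > 0" using z0(1) assms by (intro g_Re_pos) (auto simp: K_def)
  then have "c > 0" by (simp add: c_def)
  moreover have "c \<le> Re (g z)" if z: "\<gamma> \<le> Re z" for z
  proof (cases "norm z \<le> R'")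
    case True
    then show ?thesis using z0(2)[of z] z by (auto simp: K_def c_def)
  next
    case False
    have p: "0 < Re (g z)" using z assms by (intro g_Re_pos) auto
    have "exp 1 \<le> norm z" using False by (simp add: R'_def)
    then have "1 \<le> ln (norm z)" by (subst ln_ge_iff) (auto intro: less_le_trans[OF exp_gt_zero])
    also have "\<dots> \<le> C * Re (g z)" using False z assms by (intro RC) (auto simp: R'_def)
    also have "\<dots> \<le> max C 1 * Re (g z)" using p by (intro mult_right_mono) auto
    finally have "1 / max C 1 \<le> Re (g z)" by (simp add: field_simps)
    then show ?thesis by (simp add: c_def)
  qed
  ultimately show ?thesis by blast
qed

lemma g_decay:
  assumes "\<gamma> > 0" "\<tau> > 0"
  shows "\<exists>C d. d > 0 \<and> C \<ge> 0 \<and> (\<forall>z. \<gamma> \<le> Re z \<longrightarrow> exp (- \<tau> * Re (g z)) * (1 + norm (g z)) \<le> C * norm z powr (- d))"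
proof -
  obtain R C0 where RC: "\<And>z. 0 < Re z \<Longrightarrow> R \<le> norm z \<Longrightarrow> ln (norm z) \<le> C0 * Re (g z) \<and> norm (g z) \<le> C0 * (1 + Re (g z))\<^sup>2"
    using g_growth by blast
  define C R' where "C = max C0 1" and "R' = max R 1"
  have C: "C > 0" by (simp add: C_def)
  \<comment> \<open>The exponential is split: one half supplies the power of |z| through the
    logarithmic bound, the other half absorbs |g|, which is at most quadratic in its real
    part.\<close>
  define d where "d = \<tau> / (2 * C)"
  have d: "d > 0" using assms C by (simp add: d_def)
  \<comment> \<open>Chosen so that \<open>q * (1 + \<rho>) \<le> exp (\<tau> / 4 * \<rho>)\<close>
    with \<rho> = Re g; squaring gives the half exponential that absorbs |g|.\<close>
  define q where "q = min 1 (\<tau> / 4)"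
  have q: "q > 0" using assms by (simp add: q_def)
  define K where "K = {z. \<gamma> \<le> Re z} \<inter> cball 0 R'"
  have "continuous_on K g" unfolding K_def using assms
    by (intro continuous_on_subset[OF holomorphic_on_imp_continuous_on[OF g_holo]]) auto
  then have "bounded (g ` K)" using compact_part[of \<gamma> R'] unfolding K_def
    by (intro compact_imp_bounded compact_continuous_image) auto
  then obtain B where B: "\<And>z. z \<in> K \<Longrightarrow> norm (g z) \<le> B" unfolding bounded_iff by auto
  define D where "D = max ((1 + max B 0) * R' powr d) (1 + C / q\<^sup>2)"
  have D: "D \<ge> 0" unfolding D_def using C q by (intro max.coboundedI2) simp
  have "exp (- \<tau> * Re (g z)) * (1 + norm (g z)) \<le> D * norm z powr (- d)" if z: "\<gamma> \<le> Re z" for z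
  proof -
    define \<rho> where "\<rho> = Re (g z)"
    have \<rho>: "\<rho> > 0" unfolding \<rho>_def using z assms by (intro g_Re_pos) auto
    have z0: "norm z > 0" using z assms by auto
    show ?thesis
    proof (cases "norm z \<le> R'")
      case True
      have "exp (- \<tau> * \<rho>) * (1 + norm (g z)) \<le> 1 * (1 + max B 0)"
        using B[of z] True z \<rho> assms by (intro mult_mono) (auto simp: K_def)
      also have "\<dots> = (1 + max B 0) * (norm z powr d * norm z powr (- d))" using z0 by (simp add: powr_minus)
      also have "\<dots> \<le> (1 + max B 0) * (R' powr d * norm z powr (- d))"
        using True z0 d by (intro mult_left_mono mult_right_mono powr_mono2) auto
      also have "\<dots> \<le> D * norm z powr (- d)" unfolding D_def mult.assoc[symmetric]
        by (intro mult_right_mono) auto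
      finally show ?thesis unfolding \<rho>_def .
    next
      case False
      then have l: "ln (norm z) \<le> C0 * \<rho>" "norm (g z) \<le> C0 * (1 + \<rho>)\<^sup>2"
        using RC[of z] z assms by (auto simp: \<rho>_def R'_def)
      have l1: "ln (norm z) \<le> C * \<rho>"
        by (rule order.trans[OF l(1) mult_right_mono]) (use \<rho> in \<open>auto simp: C_def\<close>)
      have l2: "norm (g z) \<le> C * (1 + \<rho>)\<^sup>2"
        by (rule order.trans[OF l(2) mult_right_mono]) (auto simp: C_def)
      have e1: "exp (- (\<tau> / 2) * \<rho>) \<le> norm z powr (- d)"
      proof -
        have "d * ln (norm z) \<le> d * (C * \<rho>)" using l1 d by (intro mult_left_mono) auto
        also have "\<dots> = \<tau> / 2 * \<rho>" using C by (simp add: d_def)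
        finally show ?thesis using z0 by (simp add: powr_def)
      qed
      have "q * (1 + \<rho>) \<le> 1 + \<tau> / 4 * \<rho>"
        using \<rho> mult_right_mono[of q "\<tau> / 4" \<rho>] by (simp add: q_def distrib_left min_def)
      also have "\<dots> \<le> exp (\<tau> / 4 * \<rho>)" by (rule exp_ge_add_one_self)
      finally have "(q * (1 + \<rho>))\<^sup>2 \<le> (exp (\<tau> / 4 * \<rho>))\<^sup>2" using q \<rho> by (intro power_mono) auto
      also have "\<dots> = exp (\<tau> / 2 * \<rho>)" by (simp add: power2_eq_square exp_add[symmetric])
      finally have "(1 + \<rho>)\<^sup>2 \<le> exp (\<tau> / 2 * \<rho>) / q\<^sup>2"
        using q by (simp add: pos_le_divide_eq power_mult_distrib mult.commute)
      then have "C * (1 + \<rho>)\<^sup>2 \<le> C * (exp (\<tau> / 2 * \<rho>) / q\<^sup>2)" using C by (intro mult_left_mono) auto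
      moreover have "1 \<le> exp (\<tau> / 2 * \<rho>)" using assms \<rho> by simp
      ultimately have "1 + norm (g z) \<le> exp (\<tau> / 2 * \<rho>) + C * (exp (\<tau> / 2 * \<rho>) / q\<^sup>2)"
        using l2 by linarith
      then have "1 + norm (g z) \<le> (1 + C / q\<^sup>2) * exp (\<tau> / 2 * \<rho>)"
        by (simp add: distrib_right)
      then have "exp (- \<tau> * \<rho>) * (1 + norm (g z)) \<le> exp (- \<tau> * \<rho>) * ((1 + C / q\<^sup>2) * exp (\<tau> / 2 * \<rho>))"
        by (intro mult_left_mono) auto
      also have "\<dots> = (1 + C / q\<^sup>2) * exp (- (\<tau> / 2) * \<rho>)"
        by (simp add: mult.left_commute exp_add[symmetric])
      also have "\<dots> \<le> D * norm z powr (- d)"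
        using e1 D by (intro mult_mono) (auto simp: D_def)
      finally show ?thesis unfolding \<rho>_def .
    qed
  qed
  then show ?thesis using d D by blast
qed

text \<open>Admits \<open>g\<close>, 1 and \<open>1 / g\<close>, which give the density, its tail
  and, up to sign, an antiderivative of the tail. The growth condition allows one factor g, which
  \<open>g_decay\<close> absorbs.\<close>

definition multiplier :: "(complex \<Rightarrow> complex) \<Rightarrow> bool" where
  "multiplier m \<longleftrightarrow> m holomorphic_on {z. 0 < Re z} \<and> (\<forall>z. 0 < Re z \<longrightarrow> m (cnj z) = cnj (m z)) \<and>
     (\<forall>\<gamma>>0. \<exists>C\<ge>0. \<forall>z. \<gamma> \<le> Re z \<longrightarrow> norm (m z) \<le> C * (1 + norm (g z)))"

lemma multiplier_g: "multiplier g"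
  unfolding multiplier_def using g_holo g_cnj by (auto intro!: exI[of _ 1])

lemma multiplier_1: "multiplier (\<lambda>_. 1)"
  unfolding multiplier_def by (auto intro!: exI[of _ 1])

lemma multiplier_inverse: "multiplier (\<lambda>z. 1 / g z)"
  unfolding multiplier_def
proof (intro conjI allI impI)
  show "(\<lambda>z. 1 / g z) holomorphic_on {z. 0 < Re z}"
    by (intro holomorphic_intros g_holo) (use g_Re_pos in force)
  show "1 / g (cnj z) = cnj (1 / g z)" if "0 < Re z" for z using g_cnj[OF that] by simp
  fix \<gamma> :: real assume g: "\<gamma> > 0"
  obtain c where c: "c > 0" "\<And>z. \<gamma> \<le> Re z \<Longrightarrow> c \<le> Re (g z)" using g_lower[OF g] by blast
  have "norm (1 / g z) \<le> 1 / c * (1 + norm (g z))" if "\<gamma> \<le> Re z" for z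
  proof -
    have "c \<le> norm (g z)" using c(2)[OF that] complex_Re_le_cmod[of "g z"] by simp
    then have "norm (1 / g z) \<le> 1 / c" using c(1) by (simp add: norm_divide frac_le)
    also have "\<dots> \<le> 1 / c * (1 + norm (g z))" using c(1) by (simp add: field_simps)
    finally show ?thesis .
  qed
  then show "\<exists>C\<ge>0. \<forall>z. \<gamma> \<le> Re z \<longrightarrow> norm (1 / g z) \<le> C * (1 + norm (g z))"
    using c(1) by (intro exI[of _ "1 / c"]) auto
qed

definition Jf :: "(complex \<Rightarrow> complex) \<Rightarrow> real \<Rightarrow> complex \<Rightarrow> complex" where
  "Jf m \<sigma> z = exp (- of_real \<sigma> * g z) * (m z / z)"

lemma vertical_decay_Jf:
  assumes m: "multiplier m" and \<sigma>: "\<sigma> > 0"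
  shows "vertical_decay (Jf m \<sigma>)"
proof
  show "Jf m \<sigma> holomorphic_on {z. 0 < Re z}"
    unfolding Jf_def using m g_holo by (intro holomorphic_intros) (auto simp: multiplier_def)
  show "Jf m \<sigma> (cnj z) = cnj (Jf m \<sigma> z)" if "0 < Re z" for z
    using m that g_cnj[OF that] by (simp add: Jf_def multiplier_def exp_cnj)
  fix \<gamma> :: real assume g: "\<gamma> > 0"
  obtain C d where Cd: "d > 0" "C \<ge> 0"
    "\<And>z. \<gamma> \<le> Re z \<Longrightarrow> exp (- \<sigma> * Re (g z)) * (1 + norm (g z)) \<le> C * norm z powr (- d)"
    using g_decay[OF g \<sigma>] by blast
  obtain K where K: "K \<ge> 0" "\<And>z. \<gamma> \<le> Re z \<Longrightarrow> norm (m z) \<le> K * (1 + norm (g z))"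
    using m g unfolding multiplier_def by blast
  have "norm (Jf m \<sigma> z) \<le> (K * C) * norm z powr (- 1 - d)" if z: "\<gamma> \<le> Re z" for z
  proof -
    have z0: "norm z > 0" using z g by auto
    have "norm (Jf m \<sigma> z) = exp (- \<sigma> * Re (g z)) * norm (m z) / norm z"
      by (simp add: Jf_def norm_mult norm_divide)
    also have "\<dots> \<le> exp (- \<sigma> * Re (g z)) * (K * (1 + norm (g z))) / norm z"
      using K(2)[OF z] by (intro divide_right_mono mult_left_mono) auto
    also have "\<dots> = K * (exp (- \<sigma> * Re (g z)) * (1 + norm (g z))) / norm z" by simp
    also have "\<dots> \<le> K * (C * norm z powr (- d)) / norm z"
      using Cd(3)[OF z] K(1) by (intro divide_right_mono mult_left_mono) auto
    also have "\<dots> = (K * C) * norm z powr (- 1 - d)"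
      using z0 by (simp add: powr_diff powr_minus field_simps)
    finally show ?thesis .
  qed
  then show "\<exists>C d. d > 0 \<and> (\<forall>z. \<gamma> \<le> Re z \<longrightarrow> norm (Jf m \<sigma> z) \<le> C * norm z powr (- 1 - d))"
    using Cd(1) by blast
qed

text \<open>The line Re z = 1 is a normalization; by \<open>inv_laplace_indep\<close> every positive
  abscissa gives the same value for t > 0.\<close>

definition J :: "(complex \<Rightarrow> complex) \<Rightarrow> real \<Rightarrow> real \<Rightarrow> real" where
  "J m t \<sigma> = vertical_decay.inv_laplace (Jf m \<sigma>) 1 t"

definition Jint :: "(complex \<Rightarrow> complex) \<Rightarrow> real \<Rightarrow> real \<Rightarrow> real \<Rightarrow> real" where
  "Jint m t \<sigma> \<omega> = Re (1 / (2 * pi) * (exp (Complex 1 \<omega> * of_real t) * Jf m \<sigma> (Complex 1 \<omega>)))"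

lemma
  assumes m: "multiplier m" and \<sigma>: "\<sigma> > 0"
  shows J_eq: "J m t \<sigma> = (\<integral>\<omega>. Jint m t \<sigma> \<omega> \<partial>lborel)"
    and Jint_integrable: "integrable lborel (Jint m t \<sigma>)"
    and J_laplace: "s > 0 \<Longrightarrow> has_laplace (\<lambda>t. J m t \<sigma>) s (Re (Jf m \<sigma> (of_real s)))"
    and J_cont_t: "isCont (\<lambda>t. J m t \<sigma>) t"
proof -
  interpret vertical_decay "Jf m \<sigma>" by (rule vertical_decay_Jf[OF m \<sigma>])
  have i: "integrable lborel (\<lambda>\<omega>. 1 / (2 * pi) * (exp (Complex 1 \<omega> * of_real t) * Jf m \<sigma> (Complex 1 \<omega>)))"
    using integrable_exp_line[of 1 t] by (intro integrable_mult_right) auto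
  show "integrable lborel (Jint m t \<sigma>)" unfolding Jint_def using i by (rule integrable_Re)
  show "J m t \<sigma> = (\<integral>\<omega>. Jint m t \<sigma> \<omega> \<partial>lborel)"
    unfolding J_def inv_laplace_def Jint_def integral_Re[OF i] by simp
  show "s > 0 \<Longrightarrow> has_laplace (\<lambda>t. J m t \<sigma>) s (Re (Jf m \<sigma> (of_real s)))"
    unfolding J_def using has_laplace_inv_laplace'[of 1 s] by simp
  show "isCont (\<lambda>t. J m t \<sigma>) t" unfolding J_def by (rule isCont_inv_laplace) simp
qed

lemma Jf_real: "s > 0 \<Longrightarrow> m (of_real s) = of_real x \<Longrightarrow> Re (Jf m \<sigma> (of_real s)) = exp (- \<sigma> * gr s) * x / s"
  by (simp add: Jf_def g_of_real exp_of_real flip: of_real_mult of_real_minus of_real_divide)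

text \<open>Since Re g > 0 the damping increases with \<open>\<sigma>\<close>, so a smaller
  \<open>\<sigma>0\<close> provides a majorant uniform over all larger parameters.\<close>

lemma Jint_bound:
  assumes "\<sigma>0 \<le> \<sigma>"
  shows "\<bar>Jint m t \<sigma> \<omega>\<bar> \<le> exp t * norm (Jf m \<sigma>0 (Complex 1 \<omega>))"
proof -
  have "0 < Re (g (Complex 1 \<omega>))" by (rule g_Re_pos) simp
  then have "exp (- \<sigma> * Re (g (Complex 1 \<omega>))) \<le> exp (- \<sigma>0 * Re (g (Complex 1 \<omega>)))"
    using assms by (simp add: mult_right_mono)
  then have 1: "norm (Jf m \<sigma> (Complex 1 \<omega>)) \<le> norm (Jf m \<sigma>0 (Complex 1 \<omega>))"
    unfolding Jf_def norm_mult by (intro mult_right_mono) auto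
  have "\<bar>Jint m t \<sigma> \<omega>\<bar> \<le> norm (1 / (2 * pi) * (exp (Complex 1 \<omega> * of_real t) * Jf m \<sigma> (Complex 1 \<omega>)))"
    unfolding Jint_def by (rule abs_Re_le_cmod)
  also have "\<dots> = 1 / (2 * pi) * (exp t * norm (Jf m \<sigma> (Complex 1 \<omega>)))"
    by (simp add: norm_mult norm_divide)
  also have "\<dots> \<le> 1 * (exp t * norm (Jf m \<sigma>0 (Complex 1 \<omega>)))"
    using pi_gt3 1 by (intro mult_mono) auto
  finally show ?thesis by simp
qed

lemma Jf_dominating:
  assumes "multiplier m" "\<sigma> > 0"
  shows "integrable lborel (\<lambda>\<omega>. exp t * norm (Jf m \<sigma> (Complex 1 \<omega>)))"
proof -
  interpret vertical_decay "Jf m \<sigma>" by (rule vertical_decay_Jf[OF assms])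
  show ?thesis using integrable_line[of 1] by simp
qed

lemma J_cont:
  assumes m: "multiplier m" and \<sigma>: "\<sigma> > 0"
  shows "isCont (J m t) \<sigma>"
  unfolding continuous_at_sequentially
proof (intro allI impI)
  fix X :: "nat \<Rightarrow> real" assume X: "X \<longlonglongrightarrow> \<sigma>"
  have "\<forall>\<^sub>F n in sequentially. \<sigma> / 2 < X n" using \<sigma> by (intro order_tendstoD(1)[OF X]) simp
  then obtain n0 where n0: "\<And>n. n \<ge> n0 \<Longrightarrow> \<sigma> / 2 < X n" unfolding eventually_sequentially by blast
  have big: "X (n + n0) > \<sigma> / 2" for n using n0 by simp
  have "(\<lambda>n. \<integral>\<omega>. Jint m t (X (n + n0)) \<omega> \<partial>lborel) \<longlonglongrightarrow> (\<integral>\<omega>. Jint m t \<sigma> \<omega> \<partial>lborel)"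
  proof (rule integral_dominated_convergence)
    show "integrable lborel (\<lambda>\<omega>. exp t * norm (Jf m (\<sigma> / 2) (Complex 1 \<omega>)))"
      using \<sigma> by (intro Jf_dominating m) auto
    show "AE \<omega> in lborel. (\<lambda>n. Jint m t (X (n + n0)) \<omega>) \<longlonglongrightarrow> Jint m t \<sigma> \<omega>"
      unfolding Jint_def Jf_def by (intro AE_I2 tendsto_intros LIMSEQ_ignore_initial_segment[OF X])
    show "AE \<omega> in lborel. norm (Jint m t (X (n + n0)) \<omega>) \<le> exp t * norm (Jf m (\<sigma> / 2) (Complex 1 \<omega>))" for n
      using Jint_bound[OF less_imp_le[OF big[of n]]] by (intro AE_I2) simp
    show "Jint m t (X (n + n0)) \<in> borel_measurable lborel" for n
      by (rule borel_measurable_integrable, rule Jint_integrable[OF m]) (use big[of n] \<sigma> in linarith)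
    show "Jint m t \<sigma> \<in> borel_measurable lborel"
      by (rule borel_measurable_integrable, rule Jint_integrable[OF m \<sigma>])
  qed
  moreover have "J m t (X (n + n0)) = (\<integral>\<omega>. Jint m t (X (n + n0)) \<omega> \<partial>lborel)" for n
    by (rule J_eq[OF m]) (use big[of n] \<sigma> in linarith)
  ultimately have "(\<lambda>n. (J m t \<circ> X) (n + n0)) \<longlonglongrightarrow> J m t \<sigma>" by (simp add: J_eq[OF m \<sigma>])
  then show "(J m t \<circ> X) \<longlonglongrightarrow> J m t \<sigma>" by (rule LIMSEQ_offset)
qed

text \<open>Differentiating the damping factor multiplies the integrand by -g. The chain of
  multipliers \<open>1 / g\<close>, 1, \<open>g\<close> thus links \<open>chi\<close>,
  \<open>psi\<close> and \<open>phi\<close> by derivatives in \<open>\<sigma>\<close>.\<close>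

lemma J_deriv:
  assumes m: "multiplier m" and m': "multiplier m'" and eq: "\<And>z. 0 < Re z \<Longrightarrow> m' z = m z * g z"
    and \<sigma>: "\<sigma> > 0"
  shows "(J m t has_real_derivative - J m' t \<sigma>) (at \<sigma>)"
proof -
  have "((\<lambda>\<sigma>. \<integral>\<omega>. Jint m t \<sigma> \<omega> \<partial>lborel) has_real_derivative (\<integral>\<omega>. - Jint m' t \<sigma> \<omega> \<partial>lborel)) (at \<sigma>)"
  \<comment> \<open>The radius \<open>\<sigma> / 2\<close> keeps every nearby parameter above
    \<open>\<sigma> / 2\<close>, where \<open>Jint_bound\<close> supplies one majorant.\<close>
  proof (rule integral_has_field_derivative[where e="\<sigma> / 2"])
    show "(\<lambda>\<omega>. - Jint m' t \<sigma> \<omega>) \<in> borel_measurable lborel"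
      using Jint_integrable[OF m' \<sigma>] by (intro borel_measurable_uminus borel_measurable_integrable)
    show "Jint m t y \<in> borel_measurable lborel" if "y \<in> ball \<sigma> (\<sigma> / 2)" for y
      by (rule borel_measurable_integrable, rule Jint_integrable[OF m]) (use that \<sigma> in \<open>auto simp: dist_real_def abs_if split: if_splits\<close>)
    show "integrable lborel (\<lambda>\<omega>. exp t * norm (Jf m' (\<sigma> / 2) (Complex 1 \<omega>)))"
      using \<sigma> by (intro Jf_dominating m') auto
    show "AE \<omega> in lborel. \<forall>y\<in>ball \<sigma> (\<sigma> / 2). ((\<lambda>y. Jint m t y \<omega>) has_real_derivative - Jint m' t y \<omega>) (at y) \<and>
        norm (- Jint m' t y \<omega>) \<le> exp t * norm (Jf m' (\<sigma> / 2) (Complex 1 \<omega>))"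
    proof (intro AE_I2 ballI conjI)
      fix \<omega> y assume y: "y \<in> ball \<sigma> (\<sigma> / 2)"
      then have "\<sigma> / 2 \<le> y" by (auto simp: dist_real_def abs_if split: if_splits)
      from Jint_bound[OF this] show "norm (- Jint m' t y \<omega>) \<le> exp t * norm (Jf m' (\<sigma> / 2) (Complex 1 \<omega>))" by simp
      define z where "z = Complex 1 \<omega>"
      have mz: "m' z = m z * g z" by (rule eq) (simp add: z_def)
      define c where "c = 1 / (2 * pi) * (exp (z * of_real t) * (m z / z))"
      have "((\<lambda>x. c * exp (- x * g z)) has_field_derivative c * (exp (- of_real y * g z) * (- g z))) (at (of_real y))"
        by (auto intro!: derivative_eq_intros)
      then have "((\<lambda>x. c * exp (- of_real x * g z)) has_vector_derivative c * (exp (- of_real y * g z) * (- g z))) (at y)"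
        by (rule has_vector_derivative_real_field)
      then have "((\<lambda>x. Re (c * exp (- of_real x * g z))) has_real_derivative Re (c * (exp (- of_real y * g z) * (- g z)))) (at y)"
        by (rule has_field_derivative_Re)
      moreover have "Re (c * exp (- of_real x * g z)) = Jint m t x \<omega>" for x
        unfolding Jint_def Jf_def c_def z_def[symmetric] by (simp only: ac_simps)
      moreover have "c * (exp (- of_real y * g z) * (- g z)) = - (1 / (2 * pi) * (exp (z * of_real t) * Jf m' y z))"
        unfolding Jf_def c_def mz by (simp add: ac_simps)
      ultimately have "((\<lambda>x. Jint m t x \<omega>) has_real_derivative
          Re (- (1 / (2 * pi) * (exp (z * of_real t) * Jf m' y z)))) (at y)"
        by (simp only:)
      then show "((\<lambda>y. Jint m t y \<omega>) has_real_derivative - Jint m' t y \<omega>) (at y)"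
        by (simp only: Jint_def z_def uminus_complex.sel)
    qed
  qed (use \<sigma> Jint_integrable[OF m \<sigma>] in auto)
  then have "((\<lambda>\<sigma>. \<integral>\<omega>. Jint m t \<sigma> \<omega> \<partial>lborel) has_real_derivative - J m' t \<sigma>) (at \<sigma>)"
    by (simp add: J_eq[OF m' \<sigma>])
  then show ?thesis
  proof (rule has_field_derivative_transform_within_open[where S="{0<..}"])
    show "(\<integral>\<omega>. Jint m t x \<omega> \<partial>lborel) = J m t x" if "x \<in> {0<..}" for x
      using J_eq[OF m, of x t] that by simp
  qed (use \<sigma> in auto)
qed

section \<open>The density, its tail and the antiderivative of the tail\<close>

definition phi :: "real \<Rightarrow> real \<Rightarrow> real" where "phi = J g"

text \<open>For t > 0 this is the mass of \<open>phi t\<close> beyond \<open>\<sigma>\<close>. The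
  value 1 for \<open>\<sigma> \<le> 0\<close> and the value 0 for
  \<open>t \<le> 0 < \<sigma>\<close> describe a unit mass at 0 at time t = 0, which makes
  \<open>psi\<close> continuous in t \<ge> 0.\<close>

definition psi :: "real \<Rightarrow> real \<Rightarrow> real" where
  "psi t \<sigma> = (if \<sigma> \<le> 0 then 1 else if t \<le> 0 then 0 else J (\<lambda>_. 1) t \<sigma>)"

definition chi :: "real \<Rightarrow> real \<Rightarrow> real" where "chi = J (\<lambda>z. 1 / g z)"

lemma phi_formula:
  assumes "\<gamma> > 0" "t > 0" "\<tau> > 0"
  shows "integrable lborel (\<lambda>\<omega>. exp (Complex \<gamma> \<omega> * of_real t) * Jf g \<tau> (Complex \<gamma> \<omega>))"
    and "of_real (phi t \<tau>) = 1 / (2 * pi) * (\<integral>\<omega>. exp (Complex \<gamma> \<omega> * of_real t) * Jf g \<tau> (Complex \<gamma> \<omega>) \<partial>lborel)"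
proof -
  interpret vertical_decay "Jf g \<tau>" by (rule vertical_decay_Jf[OF multiplier_g assms(3)])
  show "integrable lborel (\<lambda>\<omega>. exp (Complex \<gamma> \<omega> * of_real t) * Jf g \<tau> (Complex \<gamma> \<omega>))"
    by (rule integrable_exp_line[OF assms(1)])
  have "phi t \<tau> = inv_laplace \<gamma> t"
    unfolding phi_def J_def by (rule inv_laplace_indep) (use assms in auto)
  then show "of_real (phi t \<tau>) = 1 / (2 * pi) * (\<integral>\<omega>. exp (Complex \<gamma> \<omega> * of_real t) * Jf g \<tau> (Complex \<gamma> \<omega>) \<partial>lborel)"
    using of_real_inv_laplace[OF assms(1), of t] by simp
qed

lemma phi_nonneg:
  assumes "t > 0" "\<tau> > 0" shows "phi t \<tau> \<ge> 0"
proof -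
  interpret vertical_decay "Jf g \<tau>" by (rule vertical_decay_Jf[OF multiplier_g assms(2)])
  have "moment_positive (\<lambda>s. exp (- \<tau> * gr s) * (gr s / s))"
    unfolding gr_def using g_exp_mp g_div_mp assms by (intro moment_positive_mult) auto
  then have "moment_positive (\<lambda>s. Re (Jf g \<tau> (of_real s)))"
    by (rule moment_positive_cong) (simp add: Jf_real g_of_real)
  then show ?thesis unfolding phi_def J_def using assms by (intro inv_laplace_nonneg) auto
qed

lemma moment_positive_psi:
  "\<sigma> \<ge> 0 \<Longrightarrow> d \<ge> 0 \<Longrightarrow> moment_positive (\<lambda>s. exp (- \<sigma> * gr s) * ((1 - exp (- d * s)) / s))"
  using g_exp_mp moment_positive_one_minus_exp_div unfolding gr_def by (intro moment_positive_mult) auto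

lemma psi_laplace:
  assumes "\<sigma> \<ge> 0" "s > 0" shows "has_laplace (\<lambda>t. psi t \<sigma>) s (exp (- \<sigma> * gr s) / s)"
proof (cases "\<sigma> = 0")
  case True
  then show ?thesis using has_laplace_const[OF assms(2), of 1] by (simp add: psi_def)
next
  case False
  then have s: "\<sigma> > 0" using assms by simp
  have "has_laplace (\<lambda>t. J (\<lambda>_. 1) t \<sigma>) s (exp (- \<sigma> * gr s) / s)"
    using J_laplace[OF multiplier_1 s assms(2)] Jf_real[OF assms(2), of "\<lambda>_. 1" 1] by simp
  then show ?thesis by (rule has_laplace_cong) (use s in \<open>simp add: psi_def\<close>)
qed

lemma psi_isCont_t:
  assumes "t > 0" shows "isCont (\<lambda>t. psi t \<sigma>) t"
proof (cases "\<sigma> > 0")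
  case True
  have "\<forall>\<^sub>F u in nhds t. 0 < u" using assms by (intro order_tendstoD(1)[OF filterlim_ident])
  then have "\<forall>\<^sub>F u in nhds t. psi u \<sigma> = J (\<lambda>_. 1) u \<sigma>"
    by eventually_elim (use True in \<open>simp add: psi_def\<close>)
  then show ?thesis using J_cont_t[OF multiplier_1 True, of t] by (subst isCont_cong) auto
qed (simp add: psi_def)

lemma psi_nonneg: "0 \<le> psi t \<sigma>"
proof (cases "\<sigma> > 0 \<and> t > 0")
  case True
  interpret vertical_decay "Jf (\<lambda>_. 1) \<sigma>" by (rule vertical_decay_Jf[OF multiplier_1]) (use True in auto)
  have one: "moment_positive (\<lambda>s. 1 / s)"
    by (rule moment_positive_laplace[where f="\<lambda>_. 1"]) (auto intro!: has_laplace_const)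
  have "moment_positive (\<lambda>s. exp (- \<sigma> * gr s) * (1 / s))"
    unfolding gr_def using g_exp_mp one True by (intro moment_positive_mult) auto
  then have "moment_positive (\<lambda>s. Re (Jf (\<lambda>_. 1) \<sigma> (of_real s)))"
    by (rule moment_positive_cong) (simp add: Jf_real[where x=1])
  then have "0 \<le> J (\<lambda>_. 1) t \<sigma>" unfolding J_def using True by (intro inv_laplace_nonneg) auto
  then show ?thesis by (simp add: psi_def)
qed (auto simp: psi_def)

text \<open>The increment of \<open>psi\<close> over a delay d, with the delayed term cut off before
  d, has the transform treated in \<open>moment_positive_psi\<close>, a product of moment positive
  factors.\<close>

lemma psi_mono_t:
  assumes "t \<le> t'" shows "psi t \<sigma> \<le> psi t' \<sigma>"
proof (cases "\<sigma> > 0 \<and> 0 < t \<and> t < t'")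
  case True
  then have \<sigma>: "\<sigma> > 0" and t: "0 < t" "t < t'" by auto
  define d where "d = t' - t"
  define f where "f u = psi u \<sigma> - (if u > d then psi (u - d) \<sigma> else 0)" for u
  have "0 \<le> f t'"
  proof (rule laplace_nonneg[where f=f and ?t0.0=t', OF _ moment_positive_psi[of \<sigma> d]])
    show "has_laplace f (real k + 1) (exp (- \<sigma> * gr (real k + 1)) * ((1 - exp (- d * (real k + 1))) / (real k + 1)))" for k
    proof -
      have k: "real k + 1 > 0" by simp
      have "has_laplace f (real k + 1) (exp (- \<sigma> * gr (real k + 1)) / (real k + 1)
          - exp (- d * (real k + 1)) * (exp (- \<sigma> * gr (real k + 1)) / (real k + 1)))"
        unfolding f_def using t \<sigma> k
        by (intro has_laplace_diff has_laplace_delay psi_laplace) (auto simp: d_def)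
      then show ?thesis by (simp add: diff_divide_distrib right_diff_distrib mult.commute)
    qed
    have "\<forall>\<^sub>F u in nhds t'. d < u" using t by (intro order_tendstoD(1)[OF filterlim_ident]) (simp add: d_def)
    then have "\<forall>\<^sub>F u in nhds t'. f u = psi u \<sigma> - psi (u - d) \<sigma>" by eventually_elim (simp add: f_def)
    moreover have "isCont (\<lambda>u. psi u \<sigma> - psi (u - d) \<sigma>) t'"
    proof (intro continuous_diff psi_isCont_t)
      show "isCont (\<lambda>u. psi (u - d) \<sigma>) t'"
        by (rule isCont_o2[where g="\<lambda>u. psi u \<sigma>"]) (use t in \<open>auto intro!: continuous_intros psi_isCont_t simp: d_def\<close>)
    qed (use t in auto)
    ultimately show "isCont f t'" by (subst isCont_cong) auto
  qed (use \<sigma> t in \<open>auto simp: d_def\<close>)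
  moreover have "t' > d" using t by (simp add: d_def)
  ultimately show ?thesis by (simp add: f_def d_def)
next
  case False
  then consider "\<sigma> \<le> 0" | "\<sigma> > 0" "t \<le> 0" | "t = t'" using assms by linarith
  then show ?thesis
  proof cases
    case 2 then have "psi t \<sigma> = 0" by (simp add: psi_def)
    then show ?thesis using psi_nonneg by simp
  qed (auto simp: psi_def)
qed

text \<open>A Chernoff-type bound: by monotonicity in time, \<open>psi\<close> dominates the step
  function that jumps at t from 0 to \<open>psi t \<sigma>\<close>; compare the transforms at
  s.\<close>

lemma psi_le_exp:
  assumes s: "s > 0" and t: "t \<ge> 0" and \<sigma>: "\<sigma> \<ge> 0"
  shows "psi t \<sigma> \<le> exp (s * t - \<sigma> * gr s)"
proof -
  have "exp (- t * s) * (psi t \<sigma> / s) \<le> exp (- \<sigma> * gr s) / s"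
  proof (rule has_laplace_mono[OF has_laplace_delay[OF has_laplace_const[OF s] t] psi_laplace[OF \<sigma> s]])
    show "(if t < u then psi t \<sigma> else 0) \<le> psi u \<sigma>" if "u > 0" for u
      using psi_mono_t[of t u] psi_nonneg by auto
  qed
  then have "exp (- t * s) * psi t \<sigma> \<le> exp (- \<sigma> * gr s)" using s by (simp add: field_simps)
  then have "exp (t * s) * (exp (- t * s) * psi t \<sigma>) \<le> exp (t * s) * exp (- \<sigma> * gr s)" by (intro mult_left_mono) auto
  also have "exp (t * s) * exp (- \<sigma> * gr s) = exp (s * t - \<sigma> * gr s)"
    by (simp add: exp_add[symmetric] algebra_simps)
  also have "exp (t * s) * (exp (- t * s) * psi t \<sigma>) = psi t \<sigma>" by (simp add: exp_minus)
  finally show ?thesis .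
qed

text \<open>Drop the damping in the exponential bound and let s tend to 0.\<close>

lemma psi_le_1: "psi t \<sigma> \<le> 1"
proof (cases "\<sigma> > 0 \<and> t > 0")
  case True
  have "psi t \<sigma> \<le> exp (s * t)" if "s > 0" for s
  proof -
    have "psi t \<sigma> \<le> exp (s * t - \<sigma> * gr s)" using True that by (intro psi_le_exp) auto
    also have "\<dots> \<le> exp (s * t)" using gr_pos[OF that] True by simp
    finally show ?thesis .
  qed
  then have "\<forall>\<^sub>F s in at_right 0. psi t \<sigma> \<le> exp (s * t)" by (auto simp: eventually_at_filter)
  moreover have "((\<lambda>s. exp (s * t)) \<longlongrightarrow> exp (0 * t)) (at_right 0)" by (intro tendsto_intros)
  ultimately show ?thesis using tendsto_lowerbound[of "\<lambda>s. exp (s * t)" "exp (0 * t)" "at_right 0"] by simp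
qed (auto simp: psi_def)

lemma psi_tendsto_1:
  assumes t: "t > 0" shows "(psi t \<longlongrightarrow> 1) (at_right 0)"
proof -
  \<comment> \<open>Up to time t \<open>psi\<close> is at most its value at t, afterwards at most 1.
    Comparing transforms at s = 1 and solving for \<open>psi t \<sigma>\<close> gives the lower
    bound.\<close>
  have low: "(exp (- \<sigma> * gr 1) - exp (- t)) / (1 - exp (- t)) \<le> psi t \<sigma>" if \<sigma>: "\<sigma> > 0" for \<sigma>
  proof -
    have "exp (- \<sigma> * gr 1) / 1 \<le> psi t \<sigma> / 1 + exp (- t * 1) * ((1 - psi t \<sigma>) / 1)"
    proof (rule has_laplace_mono[OF psi_laplace has_laplace_add[OF has_laplace_const has_laplace_delay[OF has_laplace_const]]])
      show "psi u \<sigma> \<le> psi t \<sigma> + (if t < u then 1 - psi t \<sigma> else 0)" for u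
        using psi_mono_t[of u t] psi_le_1 by auto
    qed (use \<sigma> t in auto)
    then have "exp (- \<sigma> * gr 1) - exp (- t) \<le> psi t \<sigma> * (1 - exp (- t))" by (simp add: algebra_simps)
    then show ?thesis using t by (simp add: divide_le_eq)
  qed
  show ?thesis
  proof (rule tendsto_sandwich)
    show "\<forall>\<^sub>F \<sigma> in at_right 0. (exp (- \<sigma> * gr 1) - exp (- t)) / (1 - exp (- t)) \<le> psi t \<sigma>"
      using low by (auto simp: eventually_at_filter)
    have "((\<lambda>\<sigma>. (exp (- \<sigma> * gr 1) - exp (- t)) / (1 - exp (- t))) \<longlongrightarrow> (exp (- 0 * gr 1) - exp (- t)) / (1 - exp (- t))) (at_right 0)"
      using t by (intro tendsto_intros) auto
    then show "((\<lambda>\<sigma>. (exp (- \<sigma> * gr 1) - exp (- t)) / (1 - exp (- t))) \<longlongrightarrow> 1) (at_right 0)"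
      using t by simp
  qed (auto simp: psi_le_1)
qed

lemma psi_tendsto_0: "(psi t \<longlongrightarrow> 0) at_top"
proof (cases "t > 0")
  case True
  show ?thesis
  proof (rule tendsto_sandwich[OF _ _ tendsto_const])
    show "\<forall>\<^sub>F \<sigma> in at_top. psi t \<sigma> \<le> exp (1 * t - \<sigma> * gr 1)"
      using eventually_ge_at_top[of 0] by eventually_elim (use True in \<open>intro psi_le_exp; simp\<close>)
    have "((\<lambda>\<sigma>. exp (1 * t - \<sigma> * c)) \<longlongrightarrow> 0) at_top" if "c > 0" for c :: real
      using that by real_asymp
    then show "((\<lambda>\<sigma>. exp (1 * t - \<sigma> * gr 1)) \<longlongrightarrow> 0) at_top" using gr_pos[of 1] by simp
  qed (auto simp: psi_nonneg)
next
  case False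
  have "\<forall>\<^sub>F \<sigma> in at_top. psi t \<sigma> = 0"
    using eventually_gt_at_top[of 0] by eventually_elim (use False in \<open>simp add: psi_def\<close>)
  then show ?thesis by (rule tendsto_eventually)
qed

lemma psi_continuous_t: "continuous_on {0..} (\<lambda>t. psi t \<sigma>)"
proof (cases "\<sigma> > 0")
  case True
  have "continuous (at t within {0..}) (\<lambda>t. psi t \<sigma>)" if "t \<ge> 0" for t
  proof (cases "t = 0")
    case False
    then have "isCont (\<lambda>t. psi t \<sigma>) t" using that by (intro psi_isCont_t) auto
    then show ?thesis by (rule continuous_at_imp_continuous_at_within)
  next
    case t0: True
    have "((\<lambda>t. psi t \<sigma>) \<longlongrightarrow> 0) (at 0 within {0..})"
    proof (rule tendstoI)
      fix e :: real assume e: "e > 0"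
      \<comment> \<open>As \<open>gr\<close> is unbounded, some s makes the exponential bound
        smaller than e at t = 0; this s is then kept fixed while t tends to 0.\<close>
      have "filterlim (\<lambda>s. \<sigma> * gr s) at_top at_top"
        by (rule filterlim_tendsto_pos_mult_at_top[OF tendsto_const True gr_at_top])
      then have "((\<lambda>s. exp (- (\<sigma> * gr s))) \<longlongrightarrow> 0) at_top"
        unfolding filterlim_uminus_at_top by (rule filterlim_compose[OF exp_at_bot])
      then have "\<forall>\<^sub>F s in at_top. exp (- (\<sigma> * gr s)) < e" using e by (rule order_tendstoD(2))
      then have "\<forall>\<^sub>F s in at_top. exp (- (\<sigma> * gr s)) < e \<and> s > 0" using eventually_gt_at_top[of 0] by (rule eventually_conj)
      then obtain s where s: "exp (- (\<sigma> * gr s)) < e" "s > 0" by (auto simp: eventually_at_top_linorder)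
      have "((\<lambda>t. exp (s * t - \<sigma> * gr s)) \<longlongrightarrow> exp (s * 0 - \<sigma> * gr s)) (at 0 within {0..})" by (intro tendsto_intros)
      then have "\<forall>\<^sub>F t in at 0 within {0..}. exp (s * t - \<sigma> * gr s) < e" using s(1) by (intro order_tendstoD(2)) auto
      moreover have "\<forall>\<^sub>F t in at 0 within {0::real..}. t \<in> {0..}" by (simp add: eventually_at_filter)
      ultimately show "\<forall>\<^sub>F t in at 0 within {0..}. dist (psi t \<sigma>) 0 < e"
      proof eventually_elim
        case (elim t)
        then have "psi t \<sigma> \<le> exp (s * t - \<sigma> * gr s)" using s True by (intro psi_le_exp) auto
        then show ?case using elim psi_nonneg[of t \<sigma>] by simp
      qed
    qed
    then show ?thesis using t0 True by (simp add: continuous_within psi_def)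
  qed
  then show ?thesis by (simp add: continuous_on_eq_continuous_within)
qed (simp add: psi_def)

lemma psi_deriv:
  assumes "t > 0" "\<sigma> > 0" shows "(psi t has_real_derivative - phi t \<sigma>) (at \<sigma>)"
  unfolding phi_def
proof (rule has_field_derivative_transform_within_open[where S="{0<..}"])
  show "(J (\<lambda>_. 1) t has_real_derivative - J g t \<sigma>) (at \<sigma>)"
    by (rule J_deriv[OF multiplier_1 multiplier_g]) (use assms in auto)
qed (use assms in \<open>auto simp: psi_def\<close>)

lemma chi_deriv:
  assumes "t > 0" "\<sigma> > 0" shows "(chi t has_real_derivative - psi t \<sigma>) (at \<sigma>)"
proof -
  have "(J (\<lambda>z. 1 / g z) t has_real_derivative - J (\<lambda>_. 1) t \<sigma>) (at \<sigma>)"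
    by (rule J_deriv[OF multiplier_inverse multiplier_1]) (use assms g_Re_pos in force)+
  then show ?thesis using assms by (simp add: chi_def psi_def)
qed

lemma chi_laplace:
  assumes "\<sigma> > 0" "s > 0" shows "has_laplace (\<lambda>t. chi t \<sigma>) s (exp (- \<sigma> * gr s) / (s * gr s))"
proof -
  have "1 / g (of_real s) = of_real (1 / gr s)" using g_of_real[OF assms(2)] by simp
  from J_laplace[OF multiplier_inverse assms] Jf_real[OF assms(2), of "\<lambda>z. 1 / g z", OF this, of \<sigma>]
  show ?thesis unfolding chi_def by (simp add: mult.commute)
qed

lemma phi_isCont: "\<sigma> > 0 \<Longrightarrow> isCont (phi t) \<sigma>"
  unfolding phi_def by (rule J_cont[OF multiplier_g])

lemma psi_isCont: "t > 0 \<Longrightarrow> \<sigma> > 0 \<Longrightarrow> isCont (psi t) \<sigma>"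
  using DERIV_isCont[OF psi_deriv] .

text \<open>Fundamental theorem on the open half-line with antiderivative \<open>- psi t\<close>: as
  \<open>phi\<close> is nonnegative, the limits at both ends yield integrability together with the
  total mass.\<close>

lemma phi_integral:
  assumes "t > 0"
  shows "set_integrable lborel {0<..} (phi t)" "(LBINT \<tau>:{0<..}. phi t \<tau>) = 1"
proof -
  have ein: "einterval 0 \<infinity> = {0<..}" by (auto simp: einterval_def)
  have D: "((\<lambda>\<sigma>. - psi t \<sigma>) has_real_derivative phi t x) (at x)" if "(0::ereal) < ereal x" for x
    using DERIV_minus[OF psi_deriv[OF assms, of x]] that by simp
  have c: "isCont (phi t) x" if "(0::ereal) < ereal x" for x using that phi_isCont by simp
  have nn: "AE x in lborel. (0::ereal) < ereal x \<longrightarrow> ereal x < \<infinity> \<longrightarrow> 0 \<le> phi t x"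
    using phi_nonneg[OF assms] by auto
  have l0: "(((\<lambda>\<sigma>. - psi t \<sigma>) \<circ> real_of_ereal) \<longlongrightarrow> -1) (at_right 0)"
    unfolding zero_ereal_def ereal_tendsto_simps by (intro tendsto_minus psi_tendsto_1 assms)
  have l1: "(((\<lambda>\<sigma>. - psi t \<sigma>) \<circ> real_of_ereal) \<longlongrightarrow> 0) (at_left \<infinity>)"
    unfolding ereal_tendsto_simps using tendsto_minus[OF psi_tendsto_0] by simp
  show "set_integrable lborel {0<..} (phi t)"
    using interval_integral_FTC_nonneg(1)[OF _ D c nn l0 l1] unfolding ein by simp
  have "(LBINT x=0..\<infinity>. phi t x) = 0 - (-1)"
    by (rule interval_integral_FTC_nonneg(2)[OF _ D c nn l0 l1]) simp
  then show "(LBINT \<tau>:{0<..}. phi t \<tau>) = 1"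
    unfolding zero_ereal_def interval_integral_to_infinity_eq by simp
qed

lemma psi_has_integral:
  assumes "t > 0" "0 < a" "a \<le> b" shows "(psi t has_integral (chi t a - chi t b)) {a..b}"
proof -
  have "(psi t has_integral (- chi t b - (- chi t a))) {a..b}"
  proof (rule fundamental_theorem_of_calculus[OF assms(3)])
    fix x assume "x \<in> {a..b}"
    then have "((\<lambda>\<sigma>. - chi t \<sigma>) has_real_derivative psi t x) (at x)"
      using DERIV_minus[OF chi_deriv[OF assms(1), of x]] assms by simp
    then show "((\<lambda>\<sigma>. - chi t \<sigma>) has_vector_derivative psi t x) (at x within {a..b})"
      by (simp add: has_real_derivative_iff_has_vector_derivative has_vector_derivative_at_within)
  qed
  then show ?thesis by simp
qed

end

section \<open>Weighted integrals of Banach space valued functions\<close>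

text \<open>The Cauchy criterion for gauge integrals holds in any Banach space: Riemann sums of F
  and G differ by at most the Riemann sum of the real majorant W, which is close to its small
  integral. \<open>R\<close> and \<open>R1\<close> extend by zero, so that boxes are treated first
  and S afterwards.\<close>

lemma integrable_L1_limit:
  fixes F :: "'n::euclidean_space \<Rightarrow> 'a::banach"
  assumes ap: "\<And>e. e > 0 \<Longrightarrow> \<exists>G W. G integrable_on S \<and> W integrable_on S \<and>
    (\<forall>x\<in>S. norm (F x - G x) \<le> W x) \<and> integral S W \<le> e"
  shows "F integrable_on S"
proof -
  define R where "R f x = (if x \<in> S then f x else 0)" for f :: "'n \<Rightarrow> 'a" and x
  define R1 where "R1 f x = (if x \<in> S then f x else 0)" for f :: "'n \<Rightarrow> real" and x
  define Ap where "Ap e G W \<longleftrightarrow> G integrable_on S \<and> (\<forall>a b. R G integrable_on cbox a b) \<and> (\<forall>a b. R1 W integrable_on cbox a b) \<and>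
      (\<forall>x. norm (R F x - R G x) \<le> R1 W x) \<and> (\<forall>a b. integral (cbox a b) (R1 W) \<le> e)" for e G W
  have ApD: "G integrable_on S" "R G integrable_on cbox a b" "R1 W integrable_on cbox a b"
    "norm (R F x - R G x) \<le> R1 W x" "integral (cbox a b) (R1 W) \<le> e" if "Ap e G W" for e G W a b x
    using that unfolding Ap_def by auto
  have ap': "\<exists>G W. Ap e G W" if e: "e > 0" for e
  proof -
    obtain G W where GW: "G integrable_on S" "W integrable_on S"
      "\<And>x. x \<in> S \<Longrightarrow> norm (F x - G x) \<le> W x" "integral S W \<le> e" using ap[OF e] by blast
    have 1: "R G integrable_on cbox a b" "R1 W integrable_on cbox a b" for a b
      using GW(1,2) unfolding integrable_alt[of _ S] R_def R1_def by auto
    have 2: "norm (R F x - R G x) \<le> R1 W x" for x using GW(3) by (simp add: R_def R1_def)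
    have 3: "integral (cbox a b) (R1 W) \<le> e" for a b
    proof -
      have W: "R1 W integrable_on UNIV" "integral UNIV (R1 W) = integral S W"
        using GW(2) unfolding R1_def by (auto simp: integrable_restrict_UNIV integral_restrict_UNIV)
      have "integral (cbox a b) (R1 W) \<le> integral UNIV (R1 W)"
        using 1 W order.trans[OF norm_ge_zero 2] by (intro integral_subset_le) auto
      then show ?thesis using GW(4) W by simp
    qed
    have "Ap e G W" unfolding Ap_def using GW(1) 1 2 3 by auto
    then show ?thesis by blast
  qed
  have box: "R F integrable_on cbox a b" for a b
    unfolding integrable_Cauchy
  proof (intro allI impI)
    fix e :: real assume e: "e > 0"
    \<comment> \<open>One share each for the gauge error of G, the gauge error of W and the integral
      of W; together they stay below e / 2 for each of the two divisions compared.\<close>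
    then have e6: "e / 6 > 0" by simp
    obtain G W where "Ap (e / 6) G W" using ap'[OF e6] by blast
    note GW = ApD(2-)[OF this]
    obtain g1 where g1': "gauge g1 \<and> (\<forall>D. D tagged_division_of cbox a b \<and> g1 fine D \<longrightarrow>
        norm ((\<Sum>(x, K)\<in>D. measure lborel K *\<^sub>R R G x) - integral (cbox a b) (R G)) < e / 6)"
      using has_integral[THEN iffD1, OF integrable_integral[OF GW(1)[of a b]], THEN spec, THEN mp, OF e6] by (elim exE)
    note g1 = g1'[THEN conjunct1] g1'[THEN conjunct2, rule_format, OF conjI]
    obtain g2 where g2': "gauge g2 \<and> (\<forall>D. D tagged_division_of cbox a b \<and> g2 fine D \<longrightarrow>
        norm ((\<Sum>(x, K)\<in>D. measure lborel K *\<^sub>R R1 W x) - integral (cbox a b) (R1 W)) < e / 6)"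
      using has_integral[THEN iffD1, OF integrable_integral[OF GW(2)[of a b]], THEN spec, THEN mp, OF e6] by (elim exE)
    note g2 = g2'[THEN conjunct1] g2'[THEN conjunct2, rule_format, OF conjI]
    have close: "norm ((\<Sum>(x, K)\<in>D. measure lborel K *\<^sub>R R F x) - integral (cbox a b) (R G)) < e / 2"
      if D: "D tagged_division_of cbox a b" "(\<lambda>x. g1 x \<inter> g2 x) fine D" for D
    proof -
      have f: "g1 fine D" "g2 fine D" using D(2) by (auto simp: fine_Int)
      have "norm ((\<Sum>(x, K)\<in>D. measure lborel K *\<^sub>R R F x) - (\<Sum>(x, K)\<in>D. measure lborel K *\<^sub>R R G x))
          = norm (\<Sum>(x, K)\<in>D. measure lborel K *\<^sub>R (R F x - R G x))"
        by (simp add: sum_subtractf[symmetric] case_prod_beta scaleR_diff_right)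
      also have "\<dots> \<le> (\<Sum>(x, K)\<in>D. measure lborel K *\<^sub>R R1 W x)"
        using GW(3) by (intro sum_norm_le) (auto simp: case_prod_beta intro!: mult_left_mono)
      also have "\<dots> \<le> e / 3" using g2(2)[OF D(1) f(2), unfolded real_norm_def] GW(4)[of a b] by linarith
      finally have "norm ((\<Sum>(x, K)\<in>D. measure lborel K *\<^sub>R R F x) - (\<Sum>(x, K)\<in>D. measure lborel K *\<^sub>R R G x)) \<le> e / 3" .
      then show ?thesis using g1(2)[OF D(1) f(1)]
        norm_triangle_ineq[of "(\<Sum>(x, K)\<in>D. measure lborel K *\<^sub>R R F x) - (\<Sum>(x, K)\<in>D. measure lborel K *\<^sub>R R G x)"
          "(\<Sum>(x, K)\<in>D. measure lborel K *\<^sub>R R G x) - integral (cbox a b) (R G)"] by simp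
    qed
    show "\<exists>\<gamma>. gauge \<gamma> \<and> (\<forall>D1 D2. D1 tagged_division_of cbox a b \<and> \<gamma> fine D1 \<and> D2 tagged_division_of cbox a b \<and> \<gamma> fine D2 \<longrightarrow>
        norm ((\<Sum>(x, K)\<in>D1. measure lborel K *\<^sub>R R F x) - (\<Sum>(x, K)\<in>D2. measure lborel K *\<^sub>R R F x)) < e)"
    proof (intro exI[of _ "\<lambda>x. g1 x \<inter> g2 x"] conjI allI impI gauge_Int[OF g1(1) g2(1)])
      fix D1 D2 assume "D1 tagged_division_of cbox a b \<and> (\<lambda>x. g1 x \<inter> g2 x) fine D1 \<and> D2 tagged_division_of cbox a b \<and> (\<lambda>x. g1 x \<inter> g2 x) fine D2"
      then have "norm ((\<Sum>(x, K)\<in>D1. measure lborel K *\<^sub>R R F x) - integral (cbox a b) (R G)) < e / 2"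
        "norm ((\<Sum>(x, K)\<in>D2. measure lborel K *\<^sub>R R F x) - integral (cbox a b) (R G)) < e / 2" using close by auto
      then show "norm ((\<Sum>(x, K)\<in>D1. measure lborel K *\<^sub>R R F x) - (\<Sum>(x, K)\<in>D2. measure lborel K *\<^sub>R R F x)) < e"
        by (rule norm_triangle_half_l)
    qed
  qed
  have tri: "norm (x - y) \<le> norm (x - u) + norm (u - v) + norm (y - v)" for x y u v :: 'a
    using norm_triangle_ineq[of "x - u" "u - v"] norm_triangle_ineq[of "x - v" "v - y"]
    by (simp add: norm_minus_commute)
  show ?thesis
    unfolding integrable_alt[of F S] R_def[symmetric]
  proof (intro conjI allI impI box)
    fix e :: real assume e: "e > 0"
    then have e4: "e / 4 > 0" by simp
    obtain G W where "Ap (e / 4) G W" using ap'[OF e4] by blast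
    note GW = ApD[OF this]
    obtain B where B: "B > 0" "\<And>a b c d. ball 0 B \<subseteq> cbox a b \<Longrightarrow> ball 0 B \<subseteq> cbox c d \<Longrightarrow>
        norm (integral (cbox a b) (R G) - integral (cbox c d) (R G)) < e / 4"
      using integrable_altD(2)[OF GW(1) e4] unfolding R_def[symmetric] by blast
    have d: "norm (integral (cbox a b) (R F) - integral (cbox a b) (R G)) \<le> e / 4" for a b
    proof -
      have "norm (integral (cbox a b) (\<lambda>x. R F x - R G x)) \<le> integral (cbox a b) (R1 W)"
        by (intro integral_norm_bound_integral integrable_diff box GW)
      then show ?thesis using GW(5)[of a b] Henstock_Kurzweil_Integration.integral_diff[OF box[of a b] GW(2)[of a b]] by simp
    qed
    show "\<exists>B>0. \<forall>a b c d. ball 0 B \<subseteq> cbox a b \<and> ball 0 B \<subseteq> cbox c d \<longrightarrow>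
        norm (integral (cbox a b) (R F) - integral (cbox c d) (R F)) < e"
    proof (intro exI[of _ B] conjI allI impI B(1))
      fix a b c d :: 'n assume "ball 0 B \<subseteq> cbox a b \<and> ball 0 B \<subseteq> cbox c d"
      then have "norm (integral (cbox a b) (R G) - integral (cbox c d) (R G)) < e / 4" using B(2) by blast
      moreover note d[of a b] d[of c d]
      moreover note tri[of "integral (cbox a b) (R F)" "integral (cbox c d) (R F)" "integral (cbox a b) (R G)" "integral (cbox c d) (R G)"]
      ultimately show "norm (integral (cbox a b) (R F) - integral (cbox c d) (R F)) < e" using e by linarith
    qed
  qed
qed

text \<open>Stands in for dominated convergence of vector-valued gauge integrals: the errors are
  bounded by real functions whose integrals tend to 0.\<close>

lemma L1_limit:
  fixes F :: "'n::euclidean_space \<Rightarrow> 'a::banach"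
  assumes G: "\<And>n. (G n has_integral I n) S" and W: "\<And>n. (W n has_integral w n) S"
    and le: "\<forall>\<^sub>F n in sequentially. \<forall>x\<in>S. norm (F x - G n x) \<le> W n x" and lim: "w \<longlonglongrightarrow> 0"
  shows "F integrable_on S" "I \<longlonglongrightarrow> integral S F"
proof -
  show int: "F integrable_on S"
  proof (rule integrable_L1_limit)
    fix e :: real assume "e > 0"
    then have "\<forall>\<^sub>F n in sequentially. w n < e" using lim by (rule order_tendstoD(2)[rotated])
    then have "\<exists>n. (\<forall>x\<in>S. norm (F x - G n x) \<le> W n x) \<and> w n < e"
      using eventually_happens[OF eventually_conj[OF le]] by auto
    then obtain n where n: "\<forall>x\<in>S. norm (F x - G n x) \<le> W n x" "w n < e" by blast
    show "\<exists>G W. G integrable_on S \<and> W integrable_on S \<and> (\<forall>x\<in>S. norm (F x - G x) \<le> W x) \<and> integral S W \<le> e"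
      using n has_integral_integrable[OF G[of n]] has_integral_integrable[OF W[of n]] integral_unique[OF W[of n]]
      by (intro exI[of _ "G n"] exI[of _ "W n"]) auto
  qed
  have "\<forall>\<^sub>F n in sequentially. norm (I n - integral S F) \<le> w n"
    using le
  proof eventually_elim
    case (elim n)
    have "norm (integral S (\<lambda>x. F x - G n x)) \<le> integral S (W n)"
      using int has_integral_integrable[OF G[of n]] has_integral_integrable[OF W[of n]] elim
      by (intro integral_norm_bound_integral integrable_diff) auto
    then show ?case
      using Henstock_Kurzweil_Integration.integral_diff[OF int has_integral_integrable[OF G[of n]]]
        integral_unique[OF W[of n]] integral_unique[OF G[of n]] by (simp add: norm_minus_commute)
  qed
  then show "I \<longlonglongrightarrow> integral S F" using Lim_null_comparison[of "\<lambda>n. I n - integral S F" w] lim LIM_zero_cancel by blast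
qed

text \<open>Half-open, so that cells of the same n do not overlap; for n > 0 those with j < n * n
  partition (0, n].\<close>

definition cell :: "nat \<Rightarrow> nat \<Rightarrow> real set" where
  "cell n j = {real j / real n <.. real (Suc j) / real n}"

lemma cell_unique:
  assumes "n > 0" "x > 0" "x \<le> real n"
  shows "\<exists>j<n * n. x \<in> cell n j \<and> (\<forall>i. x \<in> cell n i \<longrightarrow> i = j)"
proof -
  define j where "j = nat (\<lceil>x * real n\<rceil> - 1)"
  have p: "x * real n > 0" using assms by simp
  have c: "\<lceil>x * real n\<rceil> \<ge> 1" using p by linarith
  have j: "real j < x * real n" "x * real n \<le> real j + 1" using c p unfolding j_def by (auto simp: of_nat_nat) linarith+
  have "x * real n \<le> real n * real n" using assms by (intro mult_right_mono) auto
  with j have "real j < real (n * n)" by simp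
  then have "j < n * n" by (simp only: of_nat_less_iff)
  moreover have iff: "x \<in> cell n i \<longleftrightarrow> real i < x * real n \<and> x * real n \<le> real i + 1" for i
    using assms by (auto simp: cell_def field_simps)
  moreover have "i = j" if "real i < x * real n" "x * real n \<le> real i + 1" for i
    using that j by linarith
  ultimately show ?thesis using j by blast
qed

lemma cell_sum:
  fixes v :: "nat \<Rightarrow> 'a::real_vector"
  assumes "n > 0" "x > 0"
  shows "(\<Sum>j<n * n. indicator (cell n j) x *\<^sub>R v j) = (if x \<le> real n then v (THE j. x \<in> cell n j) else 0)"
proof (cases "x \<le> real n")
  case True
  then obtain j where j: "j < n * n" "x \<in> cell n j" "\<And>i. x \<in> cell n i \<Longrightarrow> i = j"
    using cell_unique[OF assms True] by blast
  have iff: "x \<in> cell n i \<longleftrightarrow> i = j" for i using j(2) j(3)[of i] by metis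
  have "(THE j. x \<in> cell n j) = j" by (simp add: iff)
  moreover have "(\<Sum>i<n * n. indicator (cell n i) x *\<^sub>R v i) = (\<Sum>i<n * n. if i = j then v j else 0)"
    by (intro sum.cong refl) (simp add: indicator_def iff)
  ultimately show ?thesis using True j(1) by simp
next
  case False
  have "x \<notin> cell n j" if "j < n * n" for j
  proof
    assume "x \<in> cell n j"
    then have "x \<le> real (Suc j) / real n" by (simp add: cell_def)
    also have "\<dots> \<le> real (n * n) / real n" using that by (intro divide_right_mono) (auto simp del: of_nat_mult)
    also have "\<dots> = real n" using assms by simp
    finally show False using False by simp
  qed
  then show ?thesis using False by simp
qed

text \<open>Integrals of an integrable weight against a bounded, uniformly continuous Banach space valued
  function are limits of sums over cells, which reduces identities for them to scalar ones.\<close>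

locale bounded_uc =
  fixes f :: "real \<Rightarrow> 'a::banach" and M :: real
  assumes f_bound: "\<And>x. x \<ge> 0 \<Longrightarrow> norm (f x) \<le> M"
    and f_uc: "\<And>e. e > 0 \<Longrightarrow> \<exists>\<delta>>0. \<forall>x\<ge>0. \<forall>d. 0 \<le> d \<and> d \<le> \<delta> \<longrightarrow> norm (f (x + d) - f x) \<le> e"
begin

text \<open>The modulus of continuity of f for step size 1 / n, which uniform continuity sends to
  0.\<close>

definition osc :: "nat \<Rightarrow> real" where
  "osc n = (SUP p \<in> {0..} \<times> {0..1 / real n}. norm (f (fst p + snd p) - f (fst p)))"

lemma osc_bdd: "bdd_above ((\<lambda>p. norm (f (fst p + snd p) - f (fst p))) ` ({0..} \<times> {0..1 / real n}))"
proof (rule bdd_aboveI2)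
  fix p :: "real \<times> real" assume "p \<in> {0..} \<times> {0..1 / real n}"
  then have "norm (f (fst p + snd p)) \<le> M" "norm (f (fst p)) \<le> M" by (auto intro!: f_bound)
  then show "norm (f (fst p + snd p) - f (fst p)) \<le> 2 * M"
    using norm_triangle_ineq4[of "f (fst p + snd p)" "f (fst p)"] by linarith
qed

lemma osc_upper: "x \<ge> 0 \<Longrightarrow> 0 \<le> d \<Longrightarrow> d \<le> 1 / real n \<Longrightarrow> norm (f (x + d) - f x) \<le> osc n"
  unfolding osc_def using cSUP_upper[OF _ osc_bdd, of "(x, d)" n] by simp

lemma osc_nonneg: "osc n \<ge> 0"
  using osc_upper[of 0 0 n] by simp

lemma osc_tendsto: "osc \<longlonglongrightarrow> 0"
proof (rule LIMSEQ_I)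
  fix e :: real assume e: "e > 0"
  obtain \<delta> where \<delta>: "\<delta> > 0" "\<And>x d. x \<ge> 0 \<Longrightarrow> 0 \<le> d \<Longrightarrow> d \<le> \<delta> \<Longrightarrow> norm (f (x + d) - f x) \<le> e / 2"
    using f_uc[of "e / 2"] e by auto
  obtain n0 where n0: "n0 > 0" "1 / real n0 < \<delta>" using \<delta>(1) reals_Archimedean2[of "1 / \<delta>"]
    by (metis divide_less_eq less_divide_eq mult.commute of_nat_0_less_iff zero_less_divide_1_iff order.strict_trans)
  have "osc n < e" if n: "n \<ge> n0" for n
  proof -
    have "1 / real n \<le> 1 / real n0" using n n0 by (intro divide_left_mono) auto
    then have "osc n \<le> e / 2" unfolding osc_def using n0 \<delta>
      by (intro cSUP_least) auto
    then show ?thesis using e by simp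
  qed
  then show "\<exists>no. \<forall>n\<ge>no. norm (osc n - 0) < e" using osc_nonneg by auto
qed

lemma M_nonneg: "M \<ge> 0" using f_bound[of 0] norm_ge_zero[of "f 0"] by linarith

definition cell_mean :: "(real \<Rightarrow> real) \<Rightarrow> nat \<Rightarrow> 'a" where
  "cell_mean w n = (\<Sum>j<n * n. (LBINT x:cell n j. w x) *\<^sub>R f (real j / real n))"

text \<open>\<open>G\<close> freezes f at the left end points of the cells. On (0, n] the error in f
  is at most \<open>osc n\<close>; beyond n the step function vanishes and the error is f itself, at
  most M.\<close>

lemma weighted_step:
  assumes w: "set_integrable lborel {0<..} w" and n: "n > 0"
  defines "G \<equiv> \<lambda>x. \<Sum>j<n * n. (indicator (cell n j) x * w x) *\<^sub>R f (real j / real n)"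
    and "W \<equiv> \<lambda>x. osc n * \<bar>w x\<bar> + M * (indicator {real n<..} x * \<bar>w x\<bar>)"
  shows "(G has_integral cell_mean w n) {0<..}"
    and "(W has_integral (osc n * (LBINT x:{0<..}. \<bar>w x\<bar>) + M * (LBINT x:{real n<..}. \<bar>w x\<bar>))) {0<..}"
    and "x > 0 \<Longrightarrow> norm (w x *\<^sub>R f x - G x) \<le> W x"
proof -
  have sub: "cell n j \<subseteq> {0<..}" for j by (auto simp: cell_def intro: le_less_trans[rotated])
  have ind: "((\<lambda>x. indicator A x * u x) has_integral (LBINT x:A. u x)) {0<..}"
    if u: "set_integrable lborel {0<..} u" and A: "A \<subseteq> {0<..}" "A \<in> sets borel" for A :: "real set" and u :: "real \<Rightarrow> real"
  proof -
    have "set_integrable lborel A u" by (rule set_integrable_subset[OF u]) (use A in auto)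
    from set_borel_integral_eq_integral[OF this] have "(u has_integral (LBINT x:A. u x)) A" by (simp add: has_integral_iff)
    then have "((\<lambda>x. if x \<in> A then u x else 0) has_integral (LBINT x:A. u x)) {0<..}" using A(1) by simp
    moreover have "(\<lambda>x. if x \<in> A then u x else 0) = (\<lambda>x. indicator A x * u x)" by (auto simp: indicator_def)
    ultimately show ?thesis by simp
  qed
  show "(G has_integral cell_mean w n) {0<..}"
    unfolding G_def cell_mean_def
    by (intro has_integral_sum has_integral_scaleR_left ind w sub) (auto simp: cell_def)
  have wa: "set_integrable lborel {0<..} (\<lambda>x. \<bar>w x\<bar>)" by (rule set_integrable_abs[OF w])
  have "((\<lambda>x. \<bar>w x\<bar>) has_integral (LBINT x:{0<..}. \<bar>w x\<bar>)) {0<..}"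
    using set_borel_integral_eq_integral[OF wa] by (simp add: has_integral_iff)
  then show "(W has_integral (osc n * (LBINT x:{0<..}. \<bar>w x\<bar>) + M * (LBINT x:{real n<..}. \<bar>w x\<bar>))) {0<..}"
    unfolding W_def by (intro has_integral_add has_integral_mult_right ind wa) auto
  assume x: "x > 0"
  have G: "G x = w x *\<^sub>R (if x \<le> real n then f (real (THE j. x \<in> cell n j) / real n) else 0)"
  proof -
    have "G x = w x *\<^sub>R (\<Sum>j<n * n. indicator (cell n j) x *\<^sub>R f (real j / real n))"
      unfolding G_def scaleR_sum_right by (simp add: mult.commute)
    then show ?thesis unfolding cell_sum[OF n x] .
  qed
  show "norm (w x *\<^sub>R f x - G x) \<le> W x"
  proof (cases "x \<le> real n")
    case True
    obtain j where j: "x \<in> cell n j" "\<And>i. x \<in> cell n i \<Longrightarrow> i = j" using cell_unique[OF n x True] by blast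
    have the: "(THE j. x \<in> cell n j) = j" by (rule the_equality) (use j in blast)+
    have "norm (f (real j / real n + (x - real j / real n)) - f (real j / real n)) \<le> osc n"
      using j(1) by (intro osc_upper) (auto simp: cell_def add_divide_distrib)
    then have "norm (w x *\<^sub>R (f x - f (real j / real n))) \<le> \<bar>w x\<bar> * osc n" by (simp add: mult_left_mono)
    then show ?thesis unfolding G the using True by (simp add: W_def scaleR_diff_right mult.commute)
  next
    case False
    have "\<bar>w x\<bar> * norm (f x) \<le> \<bar>w x\<bar> * M" using f_bound[of x] x by (intro mult_left_mono) auto
    then show ?thesis unfolding G W_def using False osc_nonneg[of n]
      by (simp add: mult.commute add_increasing)
  qed
qed

lemma tail_tendsto:
  fixes w :: "real \<Rightarrow> real"
  assumes w: "set_integrable lborel {0<..} w"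
  shows "(\<lambda>n. LBINT x:{real n<..}. \<bar>w x\<bar>) \<longlonglongrightarrow> 0"
proof -
  have i: "integrable lborel (\<lambda>x. indicator {0<..} x *\<^sub>R \<bar>w x\<bar>)"
    using set_integrable_abs[OF w] unfolding set_integrable_def .
  have eq: "indicator {real n<..} x *\<^sub>R \<bar>w x\<bar> = indicator {real n<..} x *\<^sub>R (indicator {0<..} x *\<^sub>R \<bar>w x\<bar>)" for n x
    by (auto simp: indicator_def)
  have "(\<lambda>n. \<integral>x. indicator {real n<..} x *\<^sub>R (indicator {0<..} x *\<^sub>R \<bar>w x\<bar>) \<partial>lborel) \<longlonglongrightarrow> (\<integral>x. 0 \<partial>(lborel :: real measure))"
  proof (rule integral_dominated_convergence[OF _ _ i])
    show "AE x in lborel. (\<lambda>n. indicator {real n<..} x *\<^sub>R (indicator {0<..} x *\<^sub>R \<bar>w x\<bar>)) \<longlonglongrightarrow> 0"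
    proof (intro AE_I2 tendsto_eventually)
      fix x :: real
      have "\<forall>\<^sub>F n in sequentially. real n \<ge> x" by real_asymp
      then show "\<forall>\<^sub>F n in sequentially. indicator {real n<..} x *\<^sub>R (indicator {0<..} x *\<^sub>R \<bar>w x\<bar>) = 0"
        by eventually_elim (simp add: indicator_def)
    qed
    show "(\<lambda>x. indicator {real n<..} x *\<^sub>R (indicator {0<..} x *\<^sub>R \<bar>w x\<bar>)) \<in> borel_measurable lborel" for n
      by (intro borel_measurable_scaleR borel_measurable_integrable[OF i]) auto
  qed (auto simp: indicator_def)
  then show ?thesis unfolding set_lebesgue_integral_def eq by simp
qed

lemma weighted_limit:
  assumes w: "set_integrable lborel {0<..} w"
  shows "(\<lambda>x. w x *\<^sub>R f x) integrable_on {0<..}"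
    and "cell_mean w \<longlonglongrightarrow> integral {0<..} (\<lambda>x. w x *\<^sub>R f x)"
proof -
  define G where "G n = (\<lambda>x. \<Sum>j<n * n. (indicator (cell n j) x * w x) *\<^sub>R f (real j / real n))" for n
  define W where "W n = (\<lambda>x. osc n * \<bar>w x\<bar> + M * (indicator {real n<..} x * \<bar>w x\<bar>))" for n
  have G: "(G (Suc n) has_integral cell_mean w (Suc n)) {0<..}" for n
    unfolding G_def by (rule weighted_step(1)[OF w]) simp
  have W: "(W (Suc n) has_integral (osc (Suc n) * (LBINT x:{0<..}. \<bar>w x\<bar>) + M * (LBINT x:{real (Suc n)<..}. \<bar>w x\<bar>))) {0<..}" for n
    unfolding W_def by (rule weighted_step(2)[OF w]) simp
  have le: "\<forall>\<^sub>F n in sequentially. \<forall>x\<in>{0<..}. norm (w x *\<^sub>R f x - G (Suc n) x) \<le> W (Suc n) x"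
    unfolding G_def W_def by (intro always_eventually allI ballI weighted_step(3)[OF w]) auto
  have "(\<lambda>n. osc (Suc n) * (LBINT x:{0<..}. \<bar>w x\<bar>) + M * (LBINT x:{real (Suc n)<..}. \<bar>w x\<bar>)) \<longlonglongrightarrow> 0 * (LBINT x:{0<..}. \<bar>w x\<bar>) + M * 0"
    by (intro tendsto_intros LIMSEQ_Suc[OF osc_tendsto] LIMSEQ_Suc[OF tail_tendsto[OF w]])
  then have lim: "(\<lambda>n. osc (Suc n) * (LBINT x:{0<..}. \<bar>w x\<bar>) + M * (LBINT x:{real (Suc n)<..}. \<bar>w x\<bar>)) \<longlonglongrightarrow> 0"
    by (simp only: mult_zero_left mult_zero_right add_0)
  note A = L1_limit[where G="\<lambda>n. G (Suc n)" and W="\<lambda>n. W (Suc n)", OF G W le lim]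
  show "(\<lambda>x. w x *\<^sub>R f x) integrable_on {0<..}" by (rule A(1))
  show "cell_mean w \<longlonglongrightarrow> integral {0<..} (\<lambda>x. w x *\<^sub>R f x)" by (rule LIMSEQ_imp_Suc[OF A(2)])
qed

text \<open>The explicit dependence on w lets the error be made uniform over a family of weights,
  such as \<open>phi t\<close> for t in a bounded interval.\<close>

lemma weighted_error:
  assumes w: "set_integrable lborel {0<..} w" and n: "n > 0"
  shows "norm (integral {0<..} (\<lambda>x. w x *\<^sub>R f x) - cell_mean w n) \<le>
    osc n * (LBINT x:{0<..}. \<bar>w x\<bar>) + M * (LBINT x:{real n<..}. \<bar>w x\<bar>)"
proof -
  note st = weighted_step[OF w n]
  have "norm (integral {0<..} (\<lambda>x. w x *\<^sub>R f x - (\<Sum>j<n * n. (indicator (cell n j) x * w x) *\<^sub>R f (real j / real n))))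
     \<le> integral {0<..} (\<lambda>x. osc n * \<bar>w x\<bar> + M * (indicator {real n<..} x * \<bar>w x\<bar>))"
    by (rule integral_norm_bound_integral[OF integrable_diff[OF weighted_limit(1)[OF w] has_integral_integrable[OF st(1)]]
          has_integral_integrable[OF st(2)] st(3)]) simp
  then show ?thesis
    using Henstock_Kurzweil_Integration.integral_diff[OF weighted_limit(1)[OF w] has_integral_integrable[OF st(1)]]
      integral_unique[OF st(1)] integral_unique[OF st(2)] by simp
qed

lemma weighted_norm_le:
  assumes w: "set_integrable lborel {0<..} w"
  shows "norm (integral {0<..} (\<lambda>x. w x *\<^sub>R f x)) \<le> M * (LBINT x:{0<..}. \<bar>w x\<bar>)"
proof -
  have wa: "set_integrable lborel {0<..} (\<lambda>x. \<bar>w x\<bar>)" by (rule set_integrable_abs[OF w])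
  have i: "((\<lambda>x. M * \<bar>w x\<bar>) has_integral (M * (LBINT x:{0<..}. \<bar>w x\<bar>))) {0<..}"
    using set_borel_integral_eq_integral[OF wa] by (intro has_integral_mult_right) (simp add: has_integral_iff)
  have "norm (integral {0<..} (\<lambda>x. w x *\<^sub>R f x)) \<le> integral {0<..} (\<lambda>x. M * \<bar>w x\<bar>)"
    by (rule integral_norm_bound_integral[OF weighted_limit(1)[OF w] has_integral_integrable[OF i]])
       (use f_bound in \<open>auto simp: mult.commute[of M] intro!: mult_left_mono\<close>)
  then show ?thesis unfolding integral_unique[OF i] .
qed

end

section \<open>Subordinated semigroups\<close>

lemma has_vector_derivative_quotient_at_right:
  fixes f :: "real \<Rightarrow> 'a::real_normed_vector"
  assumes "(f has_vector_derivative D) (at h within {h..h + 1})"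
  shows "((\<lambda>r. (f (h + r) - f h) /\<^sub>R r) \<longlongrightarrow> D) (at_right 0)"
proof (rule tendstoI)
  fix e :: real assume e: "e > 0"
  then have e2: "e / 2 > 0" by simp
  from assms e2 obtain d where d: "d > 0"
    "\<And>y. y \<in> {h..h + 1} \<Longrightarrow> norm (y - h) < d \<Longrightarrow> norm (f y - f h - (y - h) *\<^sub>R D) \<le> e / 2 * norm (y - h)"
    unfolding has_vector_derivative_def has_derivative_within_alt by blast
  have "dist ((f (h + r) - f h) /\<^sub>R r) D < e" if r: "0 < r" "r < min d 1" for r
  proof -
    define v where "v = f (h + r) - f h - r *\<^sub>R D"
    have "norm v \<le> e / 2 * r" using d(2)[of "h + r"] r by (simp add: v_def)
    moreover have "(f (h + r) - f h) /\<^sub>R r - D = v /\<^sub>R r"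
      using r by (simp add: scaleR_diff_right v_def)
    moreover have "norm (v /\<^sub>R r) = norm v / r" using r by (simp add: divide_inverse mult.commute)
    ultimately have "dist ((f (h + r) - f h) /\<^sub>R r) D \<le> e / 2"
      using r by (simp add: dist_norm pos_divide_le_eq)
    then show ?thesis using e by simp
  qed
  then show "\<forall>\<^sub>F r in at_right 0. dist ((f (h + r) - f h) /\<^sub>R r) D < e"
    unfolding eventually_at_right_field using d(1) by (intro exI[of _ "min d 1"]) auto
qed

section \<open>Orbits of a bounded semigroup and its generator\<close>

locale bounded_semigroup =
  fixes T :: "real \<Rightarrow> 'a::banach \<Rightarrow>\<^sub>L 'a"
  assumes semigroup: "bounded_C0_semigroup T"
begin

definition M :: real where "M = (SOME M. \<forall>t\<ge>0. norm (T t) \<le> M)"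

lemma norm_T_le: "t \<ge> 0 \<Longrightarrow> norm (T t) \<le> M"
proof -
  have "\<exists>M. \<forall>t\<ge>0. norm (T t) \<le> M" using semigroup by (simp add: bounded_C0_semigroup_def)
  from someI_ex[OF this] show "t \<ge> 0 \<Longrightarrow> norm (T t) \<le> M" by (simp add: M_def)
qed

lemma M_nonneg: "M \<ge> 0"
  using norm_T_le[of 0] norm_ge_zero[of "T 0"] by linarith

lemma T_le: "t \<ge> 0 \<Longrightarrow> norm (T t x) \<le> M * norm x"
  using norm_blinfun[of "T t" x] mult_right_mono[OF norm_T_le[of t], of "norm x"] by simp

lemma T_0 [simp]: "T 0 x = x"
  using semigroup by (simp add: bounded_C0_semigroup_def)

lemma T_add: "s \<ge> 0 \<Longrightarrow> t \<ge> 0 \<Longrightarrow> T (s + t) x = T s (T t x)"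
  using semigroup by (simp add: bounded_C0_semigroup_def)

lemma T_right: "((\<lambda>t. T t x) \<longlongrightarrow> x) (at_right 0)"
  using semigroup by (simp add: bounded_C0_semigroup_def)

text \<open>\<open>T (x + d) y - T x y = T x (T d y - y)\<close>, so continuity at 0 and the uniform
  bound on the semigroup give a step size independent of x.\<close>

lemma T_uc:
  assumes "e > 0"
  shows "\<exists>\<delta>>0. \<forall>x\<ge>0. \<forall>d. 0 \<le> d \<and> d \<le> \<delta> \<longrightarrow> norm (T (x + d) y - T x y) \<le> e"
proof -
  have M1: "M + 1 > 0" using M_nonneg by simp
  then have "e / (M + 1) > 0" using assms by simp
  from tendstoD[OF T_right[of y] this] obtain b where b: "b > 0" "\<And>d. 0 < d \<Longrightarrow> d < b \<Longrightarrow> dist (T d y) y < e / (M + 1)"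
    unfolding eventually_at_right_field by auto
  have "norm (T (x + d) y - T x y) \<le> e" if "x \<ge> 0" "0 \<le> d" "d \<le> b / 2" for x d
  proof -
    have "norm (T d y - y) \<le> e / (M + 1)"
      using b(2)[of d] that b(1) assms M1 by (cases "d = 0") (auto simp: dist_norm)
    then have "M * norm (T d y - y) \<le> (M + 1) * (e / (M + 1))"
      using M_nonneg by (intro mult_mono) auto
    moreover have "T (x + d) y - T x y = T x (T d y - y)" using T_add that by (simp add: blinfun.diff_right)
    ultimately show ?thesis using T_le[OF that(1), of "T d y - y"] M1 by simp
  qed
  then show ?thesis using b(1) by (intro exI[of _ "b / 2"]) auto
qed

lemma orbit: "bounded_uc (\<lambda>\<tau>. T \<tau> y) (M * norm y)"
  by standard (use T_le T_uc in auto)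

lemma orbit_continuous: "continuous_on {0..} (\<lambda>\<tau>. T \<tau> y)"
  unfolding continuous_on_iff
proof (intro ballI allI impI)
  fix x e :: real assume x: "x \<in> {0..}" and e: "e > 0"
  obtain \<delta> where \<delta>: "\<delta> > 0" "\<And>x d. x \<ge> 0 \<Longrightarrow> 0 \<le> d \<Longrightarrow> d \<le> \<delta> \<Longrightarrow> norm (T (x + d) y - T x y) \<le> e / 2"
    using T_uc[of "e / 2" y] e by auto
  have "dist (T x' y) (T x y) < e" if x': "x' \<in> {0..}" "dist x' x < \<delta>" for x'
  proof (cases "x' \<ge> x")
    case True
    then show ?thesis using \<delta>(2)[of x "x' - x"] x x' e by (auto simp: dist_norm)
  next
    case False
    then show ?thesis using \<delta>(2)[of x' "x - x'"] x x' e by (auto simp: dist_norm norm_minus_commute)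
  qed
  then show "\<exists>d>0. \<forall>x'\<in>{0..}. dist x' x < d \<longrightarrow> dist (T x' y) (T x y) < e" using \<delta>(1) by blast
qed

end

locale semigroup_generator = bounded_semigroup T
  for T :: "real \<Rightarrow> 'a::banach \<Rightarrow>\<^sub>L 'a" +
  fixes D :: "'a set" and A :: "'a \<Rightarrow> 'a"
  assumes generator: "is_generator D A T"
begin

lemma generator_limit: "a \<in> D \<Longrightarrow> ((\<lambda>r. (T r a - a) /\<^sub>R r) \<longlongrightarrow> A a) (at_right 0)"
  using generator by (auto simp: is_generator_def)

lemma generatorI:
  assumes "((\<lambda>r. (T r a - a) /\<^sub>R r) \<longlongrightarrow> y) (at_right 0)"
  shows "a \<in> D" "A a = y"
proof -
  show D: "a \<in> D" using generator assms by (auto simp: is_generator_def)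
  show "A a = y" using tendsto_unique[OF _ generator_limit[OF D] assms] by simp
qed

text \<open>The generator controls right difference quotients at every base point y, with an error
  uniform in y. A left quotient at x is a right quotient at some y < x, whose derivative
  \<open>T y (A a)\<close> is exchanged for \<open>T x (A a)\<close> by uniform continuity.\<close>

lemma orbit_deriv:
  assumes a: "a \<in> D" and x: "x \<ge> 0"
  shows "((\<lambda>\<tau>. T \<tau> a) has_vector_derivative T x (A a)) (at x within {0..})"
  unfolding has_vector_derivative_def has_derivative_within_alt
proof (intro conjI allI impI bounded_linear_scaleR_left)
  fix e :: real assume e: "e > 0"
  define e' where "e' = e / (2 * (M + 1))"
  have M1: "M + 1 > 0" using M_nonneg by simp
  have e': "e' > 0" using e M1 by (simp add: e'_def)
  have Me: "M * e' \<le> e / 2"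
  proof -
    have "M * e' \<le> (M + 1) * e'" using e' by (intro mult_right_mono) auto
    also have "(M + 1) * e' = e / 2" using M1 by (simp add: e'_def field_simps)
    finally show ?thesis .
  qed
  obtain b where b: "b > 0" "\<And>d. 0 < d \<Longrightarrow> d < b \<Longrightarrow> dist ((T d a - a) /\<^sub>R d) (A a) < e'"
    using tendstoD[OF generator_limit[OF a] e'] unfolding eventually_at_right_field by auto
  have q: "norm (T (y + d) a - T y a - d *\<^sub>R T y (A a)) \<le> e / 2 * d" if "y \<ge> 0" "0 < d" "d < b" for y d
  proof -
    have "T d a - a - d *\<^sub>R A a = d *\<^sub>R ((T d a - a) /\<^sub>R d - A a)"
      using that by (simp add: scaleR_diff_right)
    then have "norm (T d a - a - d *\<^sub>R A a) = d * dist ((T d a - a) /\<^sub>R d) (A a)"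
      using that by (simp add: dist_norm)
    also have "\<dots> \<le> d * e'" using b(2)[of d] that by (intro mult_left_mono) auto
    finally have "norm (T d a - a - d *\<^sub>R A a) \<le> d * e'" .
    then have "M * norm (T d a - a - d *\<^sub>R A a) \<le> M * (d * e')" using M_nonneg by (rule mult_left_mono)
    also have "\<dots> \<le> e / 2 * d" using mult_right_mono[OF Me, of d] that by (simp add: ac_simps)
    finally have "norm (T y (T d a - a - d *\<^sub>R A a)) \<le> e / 2 * d"
      using T_le[OF that(1), of "T d a - a - d *\<^sub>R A a"] by simp
    moreover have "T y (T d a - a - d *\<^sub>R A a) = T (y + d) a - T y a - d *\<^sub>R T y (A a)"
      using T_add that by (simp add: blinfun.diff_right blinfun.scaleR_right)
    ultimately show ?thesis by simp
  qed
  obtain \<delta> where \<delta>: "\<delta> > 0" "\<And>x d. x \<ge> 0 \<Longrightarrow> 0 \<le> d \<Longrightarrow> d \<le> \<delta> \<Longrightarrow> norm (T (x + d) (A a) - T x (A a)) \<le> e / 2"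
    using T_uc[of "e / 2" "A a"] e by auto
  have "norm (T y a - T x a - (y - x) *\<^sub>R T x (A a)) \<le> e * norm (y - x)"
    if y: "y \<in> {0..}" "norm (y - x) < min b \<delta>" for y
  proof -
    consider "y = x" | "y > x" | "y < x" by linarith
    then show ?thesis
    proof cases
      case 2
      have "norm (T y a - T x a - (y - x) *\<^sub>R T x (A a)) \<le> e / 2 * (y - x)"
        using q[of x "y - x"] 2 x y by simp
      also have "\<dots> \<le> e * norm (y - x)" using e 2 by (intro mult_mono) auto
      finally show ?thesis .
    next
      case 3
      define d where "d = x - y"
      have d: "d > 0" "x = y + d" "d < b" "d \<le> \<delta>" using 3 y by (auto simp: d_def)
      have y0: "y \<ge> 0" using y by simp
      have n1: "norm (T x a - T y a - d *\<^sub>R T y (A a)) \<le> e / 2 * d" using q[of y d] y0 d by simp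
      have "norm (d *\<^sub>R (T x (A a) - T y (A a))) \<le> d * (e / 2)"
        using \<delta>(2)[of y d] y0 d by (simp add: mult_left_mono)
      then have n2: "norm (d *\<^sub>R (T x (A a) - T y (A a))) \<le> e / 2 * d" by (simp add: mult.commute)
      have "T y a - T x a - (y - x) *\<^sub>R T x (A a) =
          d *\<^sub>R (T x (A a) - T y (A a)) - (T x a - T y a - d *\<^sub>R T y (A a))"
        by (simp add: d_def algebra_simps)
      then have "norm (T y a - T x a - (y - x) *\<^sub>R T x (A a)) \<le> e / 2 * d + e / 2 * d"
        by (simp only: order.trans[OF norm_triangle_ineq4 add_mono[OF n2 n1]])
      also have "\<dots> = e * norm (y - x)" using 3 by (simp add: d_def algebra_simps)
      finally show ?thesis .
    qed simp
  qed
  then show "\<exists>d>0. \<forall>y\<in>{0..}. norm (y - x) < d \<longrightarrow> norm (T y a - T x a - (y - x) *\<^sub>R T x (A a)) \<le> e * norm (y - x)"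
    using b(1) \<delta>(1) by (intro exI[of _ "min b \<delta>"]) auto
qed

text \<open>The averages of the orbit of x over [0, h] lie in the domain and tend to x as h tends to
  0.\<close>

lemma dense_domain: "\<exists>a. (\<forall>n::nat. a n \<in> D) \<and> a \<longlonglongrightarrow> x"
proof -
  define I where "I t = integral {0..t} (\<lambda>\<sigma>. T \<sigma> x)" for t
  have cont: "continuous_on {c..b} (\<lambda>\<sigma>. T \<sigma> x)" if "c \<ge> 0" for b c
    by (rule continuous_on_subset[OF orbit_continuous]) (use that in auto)
  have int: "(\<lambda>\<sigma>. T \<sigma> x) integrable_on {c..b}" if "c \<ge> 0" for b c
    by (rule integrable_continuous_interval[OF cont[OF that]])
  have I_right: "((\<lambda>r. (I (h + r) - I h) /\<^sub>R r) \<longlongrightarrow> T h x) (at_right 0)" if h: "h \<ge> 0" for h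
  proof -
    have "(I has_vector_derivative T h x) (at h within {0..h + 1})"
      unfolding I_def by (rule integral_has_vector_derivative[OF cont]) (use h in auto)
    then have "(I has_vector_derivative T h x) (at h within {h..h + 1})"
      by (rule has_vector_derivative_within_subset) (use h in auto)
    then show ?thesis by (rule has_vector_derivative_quotient_at_right)
  qed
  have inD: "I h \<in> D" if h: "h > 0" for h
  proof (rule generatorI(1))
    \<comment> \<open>Because \<open>T r\<close> shifts the orbit, \<open>T r (I h) - I h\<close> is
      the increment of \<open>I\<close> at h minus its increment at 0.\<close>
    have "((\<lambda>r. (I (h + r) - I h) /\<^sub>R r - (I (0 + r) - I 0) /\<^sub>R r) \<longlongrightarrow> T h x - T 0 x) (at_right 0)"
      using h by (intro tendsto_diff I_right) auto
    moreover have "\<forall>\<^sub>F r in at_right 0. (I (h + r) - I h) /\<^sub>R r - (I (0 + r) - I 0) /\<^sub>R r = (T r (I h) - I h) /\<^sub>R r"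
    proof -
      have "(I (h + r) - I h) /\<^sub>R r - (I (0 + r) - I 0) /\<^sub>R r = (T r (I h) - I h) /\<^sub>R r" if r: "r > 0" for r
      proof -
        have "T r (I h) = integral {0..h} (\<lambda>\<sigma>. T r (T \<sigma> x))"
          unfolding I_def using integral_linear[OF int[of 0 h] blinfun.bounded_linear_right[of "T r"]]
          by (simp add: o_def)
        also have "\<dots> = integral {0..h} (\<lambda>\<sigma>. T (\<sigma> + r) x)"
        proof (rule Henstock_Kurzweil_Integration.integral_cong)
          show "T r (T \<sigma> x) = T (\<sigma> + r) x" if "\<sigma> \<in> {0..h}" for \<sigma>
            using T_add[of r \<sigma> x] that r by (simp add: add.commute)
        qed
        also have "\<dots> = integral {r..h + r} (\<lambda>\<sigma>. T \<sigma> x)"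
          using integral_shift_Icc_real[of 0 h "\<lambda>\<sigma>. T \<sigma> x" r] by (simp add: o_def add.commute)
        also have "\<dots> = I (h + r) - I r"
          unfolding I_def using Henstock_Kurzweil_Integration.integral_combine[of 0 r "h + r" "\<lambda>\<sigma>. T \<sigma> x"] int[of 0 "h + r"] r h
          by (simp add: algebra_simps)
        finally have "T r (I h) = I (h + r) - I r" .
        moreover have "I 0 = 0" by (simp add: I_def)
        ultimately show ?thesis by (simp add: scaleR_diff_right[symmetric])
      qed
      then show ?thesis by (auto simp: eventually_at_filter)
    qed
    ultimately show "((\<lambda>r. (T r (I h) - I h) /\<^sub>R r) \<longlongrightarrow> T h x - T 0 x) (at_right 0)"
      by (rule Lim_transform_eventually)
  qed
  have scale: "c *\<^sub>R a \<in> D" if "a \<in> D" for c a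
  proof (rule generatorI(1))
    show "((\<lambda>r. (T r (c *\<^sub>R a) - c *\<^sub>R a) /\<^sub>R r) \<longlongrightarrow> c *\<^sub>R A a) (at_right 0)"
      using tendsto_scaleR[OF tendsto_const[of c] generator_limit[OF that]]
      by (simp add: blinfun.scaleR_right scaleR_diff_right mult.commute)
  qed
  have "((\<lambda>r. (I (0 + r) - I 0) /\<^sub>R r) \<longlongrightarrow> T 0 x) (at_right 0)" by (rule I_right) simp
  then have lim: "((\<lambda>r. I r /\<^sub>R r) \<longlongrightarrow> x) (at_right 0)" by (simp add: I_def)
  have "filterlim (\<lambda>n. 1 / real (Suc n)) (at_right 0) sequentially" by real_asymp
  from filterlim_compose[OF lim this] have "(\<lambda>n. I (1 / real (Suc n)) /\<^sub>R (1 / real (Suc n))) \<longlonglongrightarrow> x" .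
  then show ?thesis using scale[OF inD] by (intro exI[of _ "\<lambda>n. I (1 / real (Suc n)) /\<^sub>R (1 / real (Suc n))"]) auto
qed

end

section \<open>The subordinated operators\<close>

locale subordination = semigroup_generator T D A + subordinator_symbol g
  for T :: "real \<Rightarrow> 'a::banach \<Rightarrow>\<^sub>L 'a" and D A g
begin

lemma psi_0 [simp]: "psi t 0 = 1" by (simp add: psi_def)

lemma phi_tail:
  assumes t: "t > 0" and N: "N \<ge> 0" shows "(LBINT x:{N<..}. phi t x) = psi t N"
proof (cases "N = 0")
  case True
  then show ?thesis using phi_integral(2)[OF t] by simp
next
  case False
  then have N0: "N > 0" using N by simp
  have D: "((\<lambda>\<sigma>. - psi t \<sigma>) has_real_derivative phi t x) (at x)" if "ereal N < ereal x" for x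
    using DERIV_minus[OF psi_deriv[OF t, of x]] that N0 by simp
  have "(LBINT x=ereal N..\<infinity>. phi t x) = 0 - (- psi t N)"
  proof (rule interval_integral_FTC_nonneg(2)[OF _ D])
    show "isCont (phi t) x" if "ereal N < ereal x" for x using that N0 phi_isCont by simp
    show "AE x in lborel. ereal N < ereal x \<longrightarrow> ereal x < \<infinity> \<longrightarrow> 0 \<le> phi t x" using phi_nonneg[OF t] N0 by auto
    have "((\<lambda>\<sigma>. - psi t \<sigma>) \<longlongrightarrow> - psi t N) (at N)"
      using psi_isCont[OF t N0] unfolding isCont_def by (rule tendsto_minus)
    then show "(((\<lambda>\<sigma>. - psi t \<sigma>) \<circ> real_of_ereal) \<longlongrightarrow> - psi t N) (at_right (ereal N))"
      unfolding ereal_tendsto_simps by (rule filterlim_mono[OF _ order_refl at_le]) simp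
    show "(((\<lambda>\<sigma>. - psi t \<sigma>) \<circ> real_of_ereal) \<longlongrightarrow> 0) (at_left \<infinity>)"
      unfolding ereal_tendsto_simps using tendsto_minus[OF psi_tendsto_0] by simp
  qed auto
  then show ?thesis unfolding interval_integral_to_infinity_eq by simp
qed

lemma phi_cell:
  assumes t: "t > 0" and n: "n > 0"
  shows "(LBINT x:cell n j. phi t x) = psi t (real j / real n) - psi t (real (Suc j) / real n)"
proof -
  define a b where "a = real j / real n" and "b = real (Suc j) / real n"
  have ab: "0 \<le> a" "a \<le> b" using n by (auto simp: a_def b_def field_simps)
  have i: "set_integrable lborel S (phi t)" if "S \<subseteq> {0<..}" "S \<in> sets borel" for S
    by (rule set_integrable_subset[OF phi_integral(1)[OF t]]) (use that in auto)
  have "(LBINT x:{a<..b} \<union> {b<..}. phi t x) = (LBINT x:{a<..b}. phi t x) + (LBINT x:{b<..}. phi t x)"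
    using ab by (intro set_integral_Un i) auto
  moreover have "{a<..b} \<union> {b<..} = {a<..}" using ab by auto
  ultimately show ?thesis using phi_tail[OF t, of a] phi_tail[OF t, of b] ab
    unfolding cell_def a_def[symmetric] b_def[symmetric] by simp
qed

definition U :: "real \<Rightarrow> 'a \<Rightarrow> 'a" where
  "U t y = (if t \<le> 0 then y else integral {0<..} (\<lambda>\<tau>. phi t \<tau> *\<^sub>R T \<tau> y))"

text \<open>For t > 0 the cell sum of \<open>U\<close>, with the cell masses of \<open>phi t\<close>
  written as increments of \<open>psi t\<close>. In this form it makes sense at t = 0 too and is
  continuous in t \<ge> 0.\<close>

definition V :: "nat \<Rightarrow> real \<Rightarrow> 'a \<Rightarrow> 'a" where
  "V n t y = (\<Sum>j<n * n. (psi t (real j / real n) - psi t (real (Suc j) / real n)) *\<^sub>R T (real j / real n) y)"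

lemma phi_abs_integral: "t > 0 \<Longrightarrow> (LBINT x:{0<..}. \<bar>phi t x\<bar>) = 1"
  using phi_integral(2)[of t] phi_nonneg[of t]
  by (subst set_lebesgue_integral_cong[of _ _ _ "phi t"]) auto

lemma U_le: assumes "t \<ge> 0" shows "norm (U t y) \<le> M * norm y"
proof (cases "t = 0")
  case True then show ?thesis using T_le[of 0 y] by (simp add: U_def)
next
  case False
  interpret bounded_uc "\<lambda>\<tau>. T \<tau> y" "M * norm y" by (rule orbit)
  show ?thesis using False assms weighted_norm_le[OF phi_integral(1)[of t]] phi_abs_integral[of t] by (simp add: U_def)
qed

lemma U_V:
  assumes t: "t \<ge> 0" and n: "n > 0"
  shows "norm (U t y - V n t y) \<le> bounded_uc.osc (\<lambda>\<tau>. T \<tau> y) n + M * norm y * psi t (real n)"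
proof -
  interpret bounded_uc "\<lambda>\<tau>. T \<tau> y" "M * norm y" by (rule orbit)
  show ?thesis
  proof (cases "t = 0")
    case True
    \<comment> \<open>At t = 0 \<open>psi\<close> is 1 at the point 0 and 0 at all positive points,
      so only the first cell contributes.\<close>
    have "V n 0 y = (\<Sum>j<n * n. if j = 0 then y else 0)"
      unfolding V_def using n by (intro sum.cong) (auto simp: psi_def divide_le_0_iff)
    also have "\<dots> = y" using n by (simp add: sum.delta)
    finally show ?thesis using True osc_nonneg[of n] M_nonneg n by (simp add: U_def psi_def)
  next
    case False
    then have t0: "t > 0" using t by simp
    have "cell_mean (phi t) n = V n t y" unfolding cell_mean_def V_def phi_cell[OF t0 n] ..
    moreover have "(LBINT x:{real n<..}. \<bar>phi t x\<bar>) = psi t (real n)"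
      using phi_nonneg[OF t0] n phi_tail[OF t0, of "real n"]
      by (subst set_lebesgue_integral_cong[of _ _ _ "phi t"]) auto
    ultimately show ?thesis
      using weighted_error[OF phi_integral(1)[OF t0] n] phi_abs_integral[OF t0] t0 by (simp add: U_def)
  qed
qed

lemma U_V_error_tendsto:
  "(\<lambda>n. bounded_uc.osc (\<lambda>\<tau>. T \<tau> y) n + M * norm y * psi b (real n)) \<longlonglongrightarrow> 0"
proof -
  interpret bounded_uc "\<lambda>\<tau>. T \<tau> y" "M * norm y" by (rule orbit)
  have "(\<lambda>n. osc n + M * norm y * psi b (real n)) \<longlonglongrightarrow> 0 + M * norm y * 0"
    by (intro tendsto_intros osc_tendsto filterlim_compose[OF psi_tendsto_0 filterlim_real_sequentially])
  then show ?thesis by simp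
qed

text \<open>Monotonicity of \<open>psi\<close> in time makes the error uniform on [0, b], so that
  \<open>U\<close> is continuous as a uniform limit of the sums \<open>V n\<close>.\<close>

lemma U_V':
  assumes t: "t \<ge> 0" "t \<le> b" and n: "n > 0"
  shows "norm (U t y - V n t y) \<le> bounded_uc.osc (\<lambda>\<tau>. T \<tau> y) n + M * norm y * psi b (real n)"
proof -
  have "M * norm y * psi t (real n) \<le> M * norm y * psi b (real n)"
    using psi_mono_t[OF t(2)] M_nonneg by (intro mult_left_mono) auto
  then show ?thesis using U_V[OF t(1) n, of y] by simp
qed

lemma U_continuous: "continuous_on {0..} (\<lambda>t. U t y)"
proof -
  have cb: "continuous_on {0..b} (\<lambda>t. U t y)" for b
  proof (rule uniform_limit_theorem)
    show "\<forall>\<^sub>F n in sequentially. continuous_on {0..b} (\<lambda>t. V n t y)"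
      unfolding V_def by (intro always_eventually allI continuous_intros continuous_on_subset[OF psi_continuous_t]) auto
    show "uniform_limit {0..b} (\<lambda>n t. V n t y) (\<lambda>t. U t y) sequentially"
      unfolding uniform_limit_iff
    proof (intro allI impI)
      fix e :: real assume "e > 0"
      then have "\<forall>\<^sub>F n in sequentially. bounded_uc.osc (\<lambda>\<tau>. T \<tau> y) n + M * norm y * psi b (real n) < e"
        using order_tendstoD(2)[OF U_V_error_tendsto] by blast
      then show "\<forall>\<^sub>F n in sequentially. \<forall>t\<in>{0..b}. dist (V n t y) (U t y) < e"
        using eventually_gt_at_top[of 0]
      proof eventually_elim
        case (elim n)
        show ?case
        proof
          fix t assume "t \<in> {0..b}"
          then have "norm (U t y - V n t y) \<le> bounded_uc.osc (\<lambda>\<tau>. T \<tau> y) n + M * norm y * psi b (real n)"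
            using elim by (intro U_V') auto
          then show "dist (V n t y) (U t y) < e" using elim by (simp add: dist_norm norm_minus_commute)
        qed
      qed
    qed
  qed simp
  show ?thesis
    unfolding continuous_on_eq_continuous_within
  proof
    fix x :: real assume x: "x \<in> {0..}"
    have "continuous (at x within {0..x + 1}) (\<lambda>t. U t y)"
      using cb[of "x + 1"] x by (simp add: continuous_on_eq_continuous_within)
    moreover have "at x within {0..x + 1} = at x within {0..}"
      by (rule at_within_nhd[of _ "{..<x + 1}"]) auto
    ultimately show "continuous (at x within {0..}) (\<lambda>t. U t y)" by simp
  qed
qed

lemma phi_T_integrable: "t > 0 \<Longrightarrow> (\<lambda>\<tau>. phi t \<tau> *\<^sub>R T \<tau> y) integrable_on {0<..}"
  using bounded_uc.weighted_limit(1)[OF orbit phi_integral(1)] .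

lemma U_diff: "U t (x - y) = U t x - U t y"
  using Henstock_Kurzweil_Integration.integral_diff[OF phi_T_integrable phi_T_integrable, of t t x y]
  by (simp add: U_def blinfun.diff_right scaleR_diff_right)

lemma U_scaleR: "U t (c *\<^sub>R x) = c *\<^sub>R U t x"
proof -
  have "(\<lambda>\<tau>. phi t \<tau> *\<^sub>R T \<tau> (c *\<^sub>R x)) = (\<lambda>\<tau>. c *\<^sub>R (phi t \<tau> *\<^sub>R T \<tau> x))"
    by (simp add: blinfun.scaleR_right mult.commute)
  then show ?thesis unfolding U_def by (simp only: integral_cmul split: if_split) simp
qed

lemma T_U: assumes "r \<ge> 0" shows "T r (U t y) = U t (T r y)"
proof (cases "t > 0")
  case True
  have "T r (integral {0<..} (\<lambda>\<tau>. phi t \<tau> *\<^sub>R T \<tau> y)) = integral {0<..} (\<lambda>\<tau>. T r (phi t \<tau> *\<^sub>R T \<tau> y))"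
    using integral_linear[OF phi_T_integrable[OF True] blinfun.bounded_linear_right[of "T r"]] by (simp add: o_def)
  also have "\<dots> = integral {0<..} (\<lambda>\<tau>. phi t \<tau> *\<^sub>R T \<tau> (T r y))"
    by (rule Henstock_Kurzweil_Integration.integral_cong)
       (use T_add[OF assms] T_add[OF _ assms] in \<open>auto simp: blinfun.scaleR_right add.commute simp flip: T_add\<close>)
  finally show ?thesis using True by (simp add: U_def)
qed (simp add: U_def)

text \<open>\<open>U t\<close> is linear, bounded and commutes with \<open>T r\<close>, so the
  difference quotient of \<open>U t a\<close> is \<open>U t\<close> applied to the difference
  quotient of a.\<close>

lemma U_domain:
  assumes a: "a \<in> D" and t: "t \<ge> 0"
  shows "U t a \<in> D" "A (U t a) = U t (A a)"
proof -
  have "((\<lambda>r. (T r (U t a) - U t a) /\<^sub>R r) \<longlongrightarrow> U t (A a)) (at_right 0)"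
  proof (rule LIM_zero_cancel, rule Lim_null_comparison)
    have l: "((\<lambda>r. (T r a - a) /\<^sub>R r - A a) \<longlongrightarrow> 0) (at_right 0)"
      using generator_limit[OF a] by (rule LIM_zero)
    show "((\<lambda>r. M * norm ((T r a - a) /\<^sub>R r - A a)) \<longlongrightarrow> 0) (at_right 0)"
      using tendsto_mult[OF tendsto_const[of M] tendsto_norm[OF l]] by simp
    have "norm ((T r (U t a) - U t a) /\<^sub>R r - U t (A a)) \<le> M * norm ((T r a - a) /\<^sub>R r - A a)" if "r > 0" for r
    proof -
      have "(T r (U t a) - U t a) /\<^sub>R r - U t (A a) = U t ((T r a - a) /\<^sub>R r - A a)"
        using T_U[of r t a] that by (simp add: U_diff U_scaleR)
      then show ?thesis using U_le[OF t] by simp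
    qed
    then show "\<forall>\<^sub>F r in at_right 0. norm ((T r (U t a) - U t a) /\<^sub>R r - U t (A a)) \<le> M * norm ((T r a - a) /\<^sub>R r - A a)"
      by (auto simp: eventually_at_filter)
  qed
  from generatorI[OF this] show "U t a \<in> D" "A (U t a) = U t (A a)" by auto
qed

lemma psi_integrable:
  assumes t: "t > 0" shows "set_integrable lborel {0<..} (psi t)"
  unfolding set_integrable_def
proof (rule Bochner_Integration.integrable_bound)
  have lap: "has_laplace (\<lambda>_. exp t) (gr 1) (exp t / gr 1)" by (rule has_laplace_const[OF gr_pos]) simp
  then show "integrable lborel (\<lambda>\<sigma>. indicator {0<..} \<sigma> *\<^sub>R (exp (- gr 1 * \<sigma>) * exp t))"
    by (simp add: has_laplace_def set_integrable_def)
  have "continuous_on {0<..} (psi t)"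
    using psi_isCont[OF t] by (intro continuous_at_imp_continuous_on) auto
  then show "(\<lambda>\<sigma>. indicator {0<..} \<sigma> *\<^sub>R psi t \<sigma>) \<in> borel_measurable lborel"
    using borel_measurable_continuous_on_indicator[of "{0<..}" "psi t"] by simp
  show "AE \<sigma> in lborel. norm (indicator {0<..} \<sigma> *\<^sub>R psi t \<sigma>) \<le> norm (indicator {0<..} \<sigma> *\<^sub>R (exp (- gr 1 * \<sigma>) * exp t))"
  proof (rule AE_I2)
    fix \<sigma> :: real
    have "psi t \<sigma> \<le> exp (- gr 1 * \<sigma>) * exp t" if "\<sigma> > 0"
      using psi_le_exp[of 1 t \<sigma>] t that by (simp add: exp_add[symmetric] algebra_simps)
    then show "norm (indicator {0<..} \<sigma> *\<^sub>R psi t \<sigma>) \<le> norm (indicator {0<..} \<sigma> *\<^sub>R (exp (- gr 1 * \<sigma>) * exp t))"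
      using psi_nonneg[of t \<sigma>] by (auto simp: indicator_def)
  qed
qed

text \<open>Integration by parts for the product of \<open>psi t\<close> with T a - a: subtracting a
  makes the boundary term vanish at 0, and the decay of \<open>psi\<close> makes it vanish at
  infinity. The term a on the left side reappears because \<open>phi t\<close> has mass 1.\<close>

lemma U_by_parts:
  assumes a: "a \<in> D" and t: "t > 0"
  shows "U t a - a = integral {0<..} (\<lambda>\<tau>. psi t \<tau> *\<^sub>R T \<tau> (A a))"
proof -
  define y where "y = A a"
  define P where "P \<tau> = psi t \<tau> *\<^sub>R T \<tau> y - phi t \<tau> *\<^sub>R (T \<tau> a - a)" for \<tau>
  define Q where "Q \<tau> = psi t \<tau> *\<^sub>R (T \<tau> a - a)" for \<tau>
  define W where "W \<tau> = psi t \<tau> * (M * norm y) + phi t \<tau> * ((M + 1) * norm a)" for \<tau>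
  have W: "set_integrable lborel {0<..} W" unfolding W_def
    by (intro set_integral_add set_integrable_mult_left psi_integrable phi_integral t)
  have Ta: "norm (T \<tau> a - a) \<le> (M + 1) * norm a" if "\<tau> \<ge> 0" for \<tau>
    using norm_triangle_ineq4[of "T \<tau> a" a] T_le[OF that, of a] by (simp add: distrib_right)
  have PW: "norm (P \<tau>) \<le> W \<tau>" if "\<tau> > 0" for \<tau>
  proof -
    have "norm (P \<tau>) \<le> psi t \<tau> * norm (T \<tau> y) + phi t \<tau> * norm (T \<tau> a - a)"
      unfolding P_def using norm_triangle_ineq4[of "psi t \<tau> *\<^sub>R T \<tau> y" "phi t \<tau> *\<^sub>R (T \<tau> a - a)"]
        psi_nonneg[of t \<tau>] phi_nonneg[OF t that] by simp
    also have "\<dots> \<le> W \<tau>" unfolding W_def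
      using T_le[of \<tau> y] Ta[of \<tau>] that psi_nonneg[of t \<tau>] phi_nonneg[OF t that]
      by (intro add_mono mult_left_mono) auto
    finally show ?thesis .
  qed
  \<comment> \<open>Complement of the truncation interval; the integral of the majorant
    \<open>W\<close> over it controls the error of cutting off the integral of
    \<open>P\<close>.\<close>
  define E where "E n = {0<..} - {1 / real (Suc n)..real (Suc n)}" for n
  define w where "w n = (LBINT x:E n. W x)" for n
  have Wi: "integrable lborel (\<lambda>x. indicator {0<..} x *\<^sub>R W x)" using W by (simp add: set_integrable_def)
  have w0: "w \<longlonglongrightarrow> 0"
  proof -
    have "(\<lambda>n. \<integral>x. indicator (E n) x *\<^sub>R W x \<partial>lborel) \<longlonglongrightarrow> (\<integral>x. 0 \<partial>(lborel :: real measure))"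
    proof (rule integral_dominated_convergence[where w="\<lambda>x. norm (indicator {0<..} x *\<^sub>R W x)"])
      show "(\<lambda>x. indicator (E n) x *\<^sub>R W x) \<in> borel_measurable lborel" for n
      proof -
        have "set_integrable lborel (E n) W" by (rule set_integrable_subset[OF W]) (auto simp: E_def)
        then show ?thesis by (auto simp: set_integrable_def)
      qed
      show "AE x in lborel. (\<lambda>n. indicator (E n) x *\<^sub>R W x) \<longlonglongrightarrow> 0"
      proof (intro AE_I2 tendsto_eventually)
        fix x :: real
        show "\<forall>\<^sub>F n in sequentially. indicator (E n) x *\<^sub>R W x = 0"
        proof (cases "x > 0")
          case True
          have "\<forall>\<^sub>F n in sequentially. real (Suc n) \<ge> x" by real_asymp
          moreover have "\<forall>\<^sub>F n in sequentially. 1 / real (Suc n) \<le> x" using True by real_asymp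
          ultimately show ?thesis by eventually_elim (simp add: E_def indicator_def)
        qed (simp add: E_def)
      qed
      show "AE x in lborel. norm (indicator (E n) x *\<^sub>R W x) \<le> norm (indicator {0<..} x *\<^sub>R W x)" for n
        by (auto simp: E_def indicator_def)
    qed (use Wi in auto)
    moreover have "w = (\<lambda>n. \<integral>x. indicator (E n) x *\<^sub>R W x \<partial>lborel)"
      by (simp add: fun_eq_iff w_def set_lebesgue_integral_def)
    ultimately show ?thesis by simp
  qed
  have FTC: "(P has_integral (Q (real (Suc n)) - Q (1 / real (Suc n)))) {1 / real (Suc n)..real (Suc n)}" for n
  proof (rule fundamental_theorem_of_calculus)
    have "1 / real (Suc n) \<le> 1" by simp
    then show "1 / real (Suc n) \<le> real (Suc n)" by linarith
    fix x assume x: "x \<in> {1 / real (Suc n)..real (Suc n)}"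
    then have x0: "x > 0" by (auto intro: less_le_trans[rotated])
    have "((\<lambda>\<tau>. T \<tau> a - a) has_vector_derivative T x y) (at x within {1 / real (Suc n)..real (Suc n)})"
      unfolding y_def has_vector_derivative_diff_const
      by (rule has_vector_derivative_within_subset[OF orbit_deriv[OF a]])
        (use x0 in \<open>auto intro: order.trans[rotated]\<close>)
    moreover have "(psi t has_real_derivative - phi t x) (at x within {1 / real (Suc n)..real (Suc n)})"
      using psi_deriv[OF t x0] by (rule has_field_derivative_at_within)
    ultimately show "(Q has_vector_derivative P x) (at x within {1 / real (Suc n)..real (Suc n)})"
      unfolding Q_def P_def using has_vector_derivative_scaleR by fastforce
  qed
  have lim: "(\<lambda>n. Q (real (Suc n)) - Q (1 / real (Suc n))) \<longlonglongrightarrow> 0 - 0"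
  proof (rule tendsto_diff; rule Lim_null_comparison)
    show "\<forall>\<^sub>F n in sequentially. norm (Q (real (Suc n))) \<le> psi t (real (Suc n)) * ((M + 1) * norm a)"
      unfolding Q_def using Ta psi_nonneg by (intro always_eventually allI) (simp add: mult_left_mono)
    have "filterlim (\<lambda>n. real (Suc n)) at_top sequentially" by real_asymp
    from filterlim_compose[OF psi_tendsto_0 this]
    have "(\<lambda>n. psi t (real (Suc n)) * ((M + 1) * norm a)) \<longlonglongrightarrow> 0 * ((M + 1) * norm a)"
      by (intro tendsto_intros)
    then show "(\<lambda>n. psi t (real (Suc n)) * ((M + 1) * norm a)) \<longlonglongrightarrow> 0" by simp
    show "\<forall>\<^sub>F n in sequentially. norm (Q (1 / real (Suc n))) \<le> norm (T (1 / real (Suc n)) a - a)"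
      unfolding Q_def using psi_nonneg psi_le_1 by (intro always_eventually allI) (simp add: mult_left_le_one_le)
    have "filterlim (\<lambda>n. 1 / real (Suc n)) (at_right 0) sequentially" by real_asymp
    from filterlim_compose[OF T_right this] have "(\<lambda>n. norm (T (1 / real (Suc n)) a - a)) \<longlonglongrightarrow> norm (a - a)"
      by (intro tendsto_intros)
    then show "(\<lambda>n. norm (T (1 / real (Suc n)) a - a)) \<longlonglongrightarrow> 0" by simp
  qed
  define G where "G n \<tau> = (if \<tau> \<in> {1 / real (Suc n)..real (Suc n)} then P \<tau> else 0)" for n \<tau>
  define W' where "W' n \<tau> = (if \<tau> \<in> E n then W \<tau> else 0)" for n \<tau>
  have "(\<lambda>n. Q (real (Suc n)) - Q (1 / real (Suc n))) \<longlonglongrightarrow> integral {0<..} P"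
  proof (rule L1_limit(2)[where G=G and W=W', OF _ _ _ w0])
    show "(G n has_integral (Q (real (Suc n)) - Q (1 / real (Suc n)))) {0<..}" for n
    proof -
      have "{1 / real (Suc n)..real (Suc n)} \<subseteq> {0<..}" by (auto intro: less_le_trans[rotated])
      then show ?thesis unfolding G_def using FTC by (simp only: has_integral_restrict)
    qed
    show "(W' n has_integral w n) {0<..}" for n
    proof -
      have "set_integrable lborel (E n) W" by (rule set_integrable_subset[OF W]) (auto simp: E_def)
      from set_borel_integral_eq_integral[OF this] have "(W has_integral w n) (E n)" by (simp add: has_integral_iff w_def)
      moreover have "E n \<subseteq> {0<..}" by (auto simp: E_def)
      ultimately show ?thesis unfolding W'_def by (simp only: has_integral_restrict)
    qed
    show "\<forall>\<^sub>F n in sequentially. \<forall>x\<in>{0<..}. norm (P x - G n x) \<le> W' n x"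
      using PW by (intro always_eventually allI) (auto simp: G_def W'_def E_def)
  qed
  then have P0: "integral {0<..} P = 0" using lim LIMSEQ_unique by fastforce
  have i1: "(\<lambda>\<tau>. psi t \<tau> *\<^sub>R T \<tau> y) integrable_on {0<..}"
    by (rule bounded_uc.weighted_limit(1)[OF orbit psi_integrable[OF t]])
  have "(phi t has_integral 1) {0<..}"
    using set_borel_integral_eq_integral[OF phi_integral(1)[OF t]] phi_integral(2)[OF t] by (simp add: has_integral_iff)
  then have i2: "((\<lambda>\<tau>. phi t \<tau> *\<^sub>R a) has_integral 1 *\<^sub>R a) {0<..}" by (rule has_integral_scaleR_left)
  have i3: "((\<lambda>\<tau>. phi t \<tau> *\<^sub>R T \<tau> a) has_integral U t a) {0<..}"
    using phi_T_integrable[OF t, of a] t by (simp add: U_def has_integral_iff)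
  have "(P has_integral (integral {0<..} (\<lambda>\<tau>. psi t \<tau> *\<^sub>R T \<tau> y) - (U t a - 1 *\<^sub>R a))) {0<..}"
    unfolding P_def scaleR_diff_right by (intro has_integral_diff integrable_integral i1 i2 i3)
  from integral_unique[OF this] show ?thesis using P0 by (simp add: y_def)
qed

end

section \<open>The Volterra equation\<close>

text \<open>Extension by zero, so that a convolution over [0, t] becomes one over the whole
  line.\<close>

definition causal :: "(real \<Rightarrow> real) \<Rightarrow> real \<Rightarrow> real" where
  "causal f t = indicator {0<..} t * f t"

definition causal_conv :: "(real \<Rightarrow> real) \<Rightarrow> (real \<Rightarrow> real) \<Rightarrow> real \<Rightarrow> real" where
  "causal_conv k P t = (\<integral>r. causal k (t - r) * causal P r \<partial>lborel)"

lemma causal_measurable: "has_laplace f s L \<Longrightarrow> causal f \<in> borel_measurable borel"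
  using has_laplace_measurable[of f s L] unfolding causal_def[abs_def] by simp

text \<open>Fubini for \<open>\<pi> r * \<kappa> (t - r)\<close>, with exp(-s t) distributed as
  exp(-s r) exp(-s (t - r)) over the two factors.\<close>

lemma has_laplace_causal_conv:
  assumes k: "has_laplace k s K" and P: "has_laplace P s L"
  shows "has_laplace (causal_conv k P) s (K * L)"
proof -
  note [measurable] = causal_measurable[OF k] causal_measurable[OF P]
  define \<kappa> where "\<kappa> u = exp (- s * u) * causal k u" for u
  define \<pi> where "\<pi> u = exp (- s * u) * causal P u" for u
  have mk[measurable]: "\<kappa> \<in> borel_measurable borel" "\<pi> \<in> borel_measurable borel"
    unfolding \<kappa>_def \<pi>_def by measurable
  have ik: "integrable lborel \<kappa>" "integral\<^sup>L lborel \<kappa> = K"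
    using k unfolding \<kappa>_def causal_def has_laplace_def set_integrable_def set_lebesgue_integral_def
    by (simp_all add: mult.left_commute)
  have ip: "integrable lborel \<pi>" "integral\<^sup>L lborel \<pi> = L"
    using P unfolding \<pi>_def causal_def has_laplace_def set_integrable_def set_lebesgue_integral_def
    by (simp_all add: mult.left_commute)
  define f where "f = (\<lambda>(r, t). \<pi> r * \<kappa> (t - r))"
  have shift: "integrable lborel (\<lambda>t. \<kappa> (t - r))" "(\<integral>t. \<kappa> (t - r) \<partial>lborel) = K"
    "(\<integral>t. \<bar>\<kappa> (t - r)\<bar> \<partial>lborel) = (\<integral>t. \<bar>\<kappa> t\<bar> \<partial>lborel)" for r
    using lborel_integrable_real_affine[OF ik(1), of 1 "- r"] lborel_integral_real_affine[of 1 \<kappa> "- r"] ik(2)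
      lborel_integral_real_affine[of 1 "\<lambda>t. \<bar>\<kappa> t\<bar>" "- r"] by auto
  have fi: "integrable (lborel \<Otimes>\<^sub>M lborel) f"
  proof (rule lborel_pair.Fubini_integrable)
    show "f \<in> borel_measurable (lborel \<Otimes>\<^sub>M lborel)" unfolding f_def by measurable
    show "integrable lborel (\<lambda>r. \<integral>t. norm (f (r, t)) \<partial>lborel)"
      using integrable_abs[OF ip(1)] by (simp add: f_def abs_mult shift(3))
    show "AE r in lborel. integrable lborel (\<lambda>t. f (r, t))"
      using shift(1) by (simp add: f_def)
  qed
  have inner: "(\<integral>r. f (r, t) \<partial>lborel) = indicator {0<..} t *\<^sub>R (exp (- s * t) * causal_conv k P t)" for t
  proof -
    have "f (r, t) = exp (- s * t) * (causal k (t - r) * causal P r)" for r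
      by (simp add: f_def \<kappa>_def \<pi>_def exp_add[symmetric] algebra_simps)
    then have 1: "(\<integral>r. f (r, t) \<partial>lborel) = exp (- s * t) * causal_conv k P t" by (simp add: causal_conv_def)
    have "(\<lambda>r. causal k (t - r) * causal P r) = (\<lambda>r. 0)" if "t \<le> 0"
      using that by (auto simp: causal_def indicator_def)
    then have "causal_conv k P t = 0" if "t \<le> 0" using that by (simp add: causal_conv_def)
    then show ?thesis using 1 by (auto simp: indicator_def)
  qed
  have "integrable lborel (\<lambda>t. \<integral>r. f (r, t) \<partial>lborel)"
    using lborel_pair.integrable_snd[of "\<lambda>r t. f (r, t)"] fi by simp
  then have "set_integrable lborel {0<..} (\<lambda>t. exp (- s * t) * causal_conv k P t)"
    unfolding inner set_integrable_def .
  moreover have "(LBINT t:{0<..}. exp (- s * t) * causal_conv k P t) = K * L"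
  proof -
    have "(\<integral>t. \<integral>r. f (r, t) \<partial>lborel \<partial>lborel) = (\<integral>r. \<integral>t. f (r, t) \<partial>lborel \<partial>lborel)"
      using lborel_pair.Fubini_integral[of "\<lambda>r t. f (r, t)"] fi by simp
    also have "\<dots> = K * L" using shift ip(2) by (simp add: f_def mult.commute)
    finally show ?thesis unfolding inner set_lebesgue_integral_def .
  qed
  ultimately show ?thesis unfolding has_laplace_def by blast
qed

lemma has_laplace_locally_integrable:
  assumes k: "has_laplace k 1 K"
  shows "integrable lborel (\<lambda>u. indicator {0<..b} u * k u)"
proof (rule Bochner_Integration.integrable_bound)
  \<comment> \<open>On (0, b] the factor exp(b - u) is at least 1, so integrability of the transform
    at 1 gives local integrability.\<close>
  show "integrable lborel (\<lambda>u. exp b * (indicator {0<..} u *\<^sub>R (exp (- 1 * u) * k u)))"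
    using k by (intro integrable_mult_right) (simp add: has_laplace_def set_integrable_def)
  have "(\<lambda>u. indicator {0<..b} u * causal k u) \<in> borel_measurable lborel"
    using causal_measurable[OF k] by measurable
  moreover have "(\<lambda>u. indicator {0<..b} u * causal k u) = (\<lambda>u. indicator {0<..b} u * k u)"
    by (auto simp: causal_def indicator_def)
  ultimately show "(\<lambda>u. indicator {0<..b} u * k u) \<in> borel_measurable lborel" by simp
  show "AE u in lborel. norm (indicator {0<..b} u * k u) \<le> norm (exp b * (indicator {0<..} u *\<^sub>R (exp (- 1 * u) * k u)))"
  proof (rule AE_I2)
    fix u :: real
    show "norm (indicator {0<..b} u * k u) \<le> norm (exp b * (indicator {0<..} u *\<^sub>R (exp (- 1 * u) * k u)))"
    proof (cases "u \<in> {0<..b}")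
      case True
      then have "1 * \<bar>k u\<bar> \<le> exp (b - u) * \<bar>k u\<bar>" by (intro mult_right_mono) auto
      then show ?thesis using True by (simp add: abs_mult exp_diff exp_minus field_simps)
    qed simp
  qed
qed

lemma causal_conv_integrable:
  assumes k: "has_laplace k 1 K" and P: "has_laplace P 1 L" and b: "\<And>r. r > 0 \<Longrightarrow> \<bar>P r\<bar> \<le> 1"
  shows "integrable lborel (\<lambda>r. causal k (t - r) * causal P r)"
proof (rule Bochner_Integration.integrable_bound)
  note [measurable] = causal_measurable[OF k] causal_measurable[OF P]
  show "integrable lborel (\<lambda>r. indicator {0<..t} (t + -1 * r) * k (t + -1 * r))"
    by (rule lborel_integrable_real_affine[OF has_laplace_locally_integrable[OF k]]) simp
  show "(\<lambda>r. causal k (t - r) * causal P r) \<in> borel_measurable lborel" by measurable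
  show "AE r in lborel. norm (causal k (t - r) * causal P r) \<le> norm (indicator {0<..t} (t + -1 * r) * k (t + -1 * r))"
  proof (rule AE_I2)
    fix r :: real
    show "norm (causal k (t - r) * causal P r) \<le> norm (indicator {0<..t} (t + -1 * r) * k (t + -1 * r))"
      using mult_left_mono[OF b[of r], of "\<bar>k (t - r)\<bar>"] by (auto simp: causal_def indicator_def abs_mult)
  qed
qed

text \<open>After the substitution that moves t from k into P, the integrand converges for every u
  other than t, where the extension of P by zero may jump; the local integrability of k supplies the
  majorant.\<close>

lemma causal_conv_isCont:
  assumes k: "has_laplace k 1 K" and P: "has_laplace P 1 L" and b: "\<And>r. r > 0 \<Longrightarrow> \<bar>P r\<bar> \<le> 1"
    and c: "\<And>r. r > 0 \<Longrightarrow> isCont P r"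
  shows "isCont (causal_conv k P) t"
proof -
  note [measurable] = causal_measurable[OF k] causal_measurable[OF P]
  have flip: "causal_conv k P t = (\<integral>u. causal k u * causal P (t - u) \<partial>lborel)" for t
    unfolding causal_conv_def
    using lborel_integral_real_affine[of "-1" "\<lambda>r. causal k (t - r) * causal P r" t] by simp
  show ?thesis unfolding continuous_at_sequentially
  proof (intro allI impI)
    fix X :: "nat \<Rightarrow> real" assume X: "X \<longlonglongrightarrow> t"
    then have "bounded (range X)" by (rule convergent_imp_bounded)
    then obtain B where B: "\<And>n. \<bar>X n\<bar> \<le> B" unfolding bounded_iff by auto
    have "(\<lambda>n. \<integral>u. causal k u * causal P (X n - u) \<partial>lborel) \<longlonglongrightarrow> (\<integral>u. causal k u * causal P (t - u) \<partial>lborel)"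
    proof (rule integral_dominated_convergence)
      show "integrable lborel (\<lambda>u. \<bar>indicator {0<..B} u * k u\<bar>)"
        by (rule integrable_abs[OF has_laplace_locally_integrable[OF k]])
      show "AE u in lborel. norm (causal k u * causal P (X n - u)) \<le> \<bar>indicator {0<..B} u * k u\<bar>" for n
      proof (rule AE_I2)
        fix u
        have "u \<le> B" if "u < X n" using B[of n] that by linarith
        then show "norm (causal k u * causal P (X n - u)) \<le> \<bar>indicator {0<..B} u * k u\<bar>"
          using mult_left_mono[OF b[of "X n - u"], of "\<bar>k u\<bar>"] by (auto simp: causal_def indicator_def abs_mult)
      qed
      have "AE u in lborel. u \<noteq> t" by (rule AE_lborel_singleton)
      then show "AE u in lborel. (\<lambda>n. causal k u * causal P (X n - u)) \<longlonglongrightarrow> causal k u * causal P (t - u)"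
      proof eventually_elim
        case (elim u)
        have Xu: "(\<lambda>n. X n - u) \<longlonglongrightarrow> t - u" by (intro tendsto_intros X)
        have "(\<lambda>n. causal P (X n - u)) \<longlonglongrightarrow> causal P (t - u)"
        proof (cases "u < t")
          case True
          have "(\<lambda>n. P (X n - u)) \<longlonglongrightarrow> P (t - u)" by (rule isCont_tendsto_compose[OF c Xu]) (use True in simp)
          moreover have "\<forall>\<^sub>F n in sequentially. 0 < X n - u" using True by (intro order_tendstoD(1)[OF Xu]) simp
          then have "\<forall>\<^sub>F n in sequentially. P (X n - u) = causal P (X n - u)"
            by eventually_elim (simp add: causal_def)
          ultimately show ?thesis using True by (simp add: causal_def[of P "t - u"] Lim_transform_eventually)
        next
          case False
          then have "t - u < 0" using elim by simp
          then have "\<forall>\<^sub>F n in sequentially. X n - u < 0" by (rule order_tendstoD(2)[OF Xu])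
          then have "\<forall>\<^sub>F n in sequentially. causal P (X n - u) = causal P (t - u)"
            by eventually_elim (use \<open>t - u < 0\<close> in \<open>simp add: causal_def\<close>)
          then show ?thesis by (rule tendsto_eventually)
        qed
        then show ?case by (intro tendsto_intros)
      qed
      show "(\<lambda>u. causal k u * causal P (X n - u)) \<in> borel_measurable lborel" for n by measurable
      show "(\<lambda>u. causal k u * causal P (t - u)) \<in> borel_measurable lborel" by measurable
    qed
    then show "(causal_conv k P \<circ> X) \<longlonglongrightarrow> causal_conv k P t" unfolding o_def flip .
  qed
qed

text \<open>The given kernel is merely Lebesgue measurable. A Borel version agreeing with it almost
  everywhere on the positive axis makes convolutions measurable on the product space, as Fubini
  requires.\<close>

lemma borel_kernel:
  assumes "has_laplace_transform k F" and F: "\<And>s. s > 0 \<Longrightarrow> F (of_real s) = of_real (G s)"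
  shows "\<exists>kb. (AE x in lborel. 0 < x \<longrightarrow> kb x = k x) \<and> (\<forall>s>0. has_laplace kb s (G s))"
proof -
  define f where "f s t = indicator {0..} t *\<^sub>R (exp (- s * t) * k t)" for s t
  have f: "integrable lebesgue (f s)" "integral\<^sup>L lebesgue (f s) = G s" if "s > 0" for s
  proof -
    have "set_integrable lebesgue {0..} (\<lambda>t. exp (- s * t) * k t)"
      "complex_of_real (LINT t:{0..}|lebesgue. exp (- s * t) * k t) = of_real (G s)"
      using assms(1) F[OF that] that unfolding has_laplace_transform_def by auto
    then show "integrable lebesgue (f s)" "integral\<^sup>L lebesgue (f s) = G s"
      unfolding f_def set_integrable_def set_lebesgue_integral_def of_real_eq_iff by auto
  qed
  have "f 1 \<in> borel_measurable (completion lborel)"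
    using f(1)[of 1] by (auto intro: borel_measurable_integrable)
  from completion_ex_borel_measurable_real[OF this]
  obtain f' where f': "f' \<in> borel_measurable lborel" "AE x in lborel. f 1 x = f' x" by blast
  define kb where "kb x = exp x * f' x" for x
  have kb: "AE x in lborel. 0 < x \<longrightarrow> kb x = k x"
    using f'(2)
  proof eventually_elim
    case (elim x)
    show ?case
    proof
      assume "0 < x"
      then have "f' x = exp (- x) * k x" using elim by (simp add: f_def)
      then show "kb x = k x" by (simp add: kb_def mult.assoc[symmetric] exp_add[symmetric])
    qed
  qed
  have "has_laplace kb s (G s)" if s: "s > 0" for s
  proof -
    define g where "g t = indicator {0<..} t *\<^sub>R (exp (- s * t) * kb t)" for t
    have gm: "g \<in> borel_measurable lborel" unfolding g_def kb_def using f'(1) by measurable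
    have "AE t in lborel. t \<noteq> 0" by (rule AE_lborel_singleton)
    then have "AE t in lborel. f s t = g t" using kb
      by eventually_elim (auto simp: f_def g_def indicator_def)
    then have ae: "AE t in lebesgue. f s t = g t" by (rule AE_completion)
    have gl: "g \<in> borel_measurable lebesgue" using gm by (rule measurable_completion)
    have "integrable lebesgue g"
      using integrable_cong_AE_imp[OF f(1)[OF s] gl] ae by (auto elim: eventually_mono)
    moreover have "integral\<^sup>L lebesgue g = G s"
      using integral_cong_AE[OF _ gl ae] f[OF s] by (auto intro: borel_measurable_integrable)
    ultimately have "integrable lborel g" "integral\<^sup>L lborel g = G s"
      using integrable_completion[OF gm] integral_completion[OF gm] by auto
    then show ?thesis unfolding g_def has_laplace_def set_integrable_def set_lebesgue_integral_def by auto
  qed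
  then show ?thesis using kb by blast
qed

lemma AE_lborel_reflect:
  assumes "AE x in lborel. Q x" shows "AE r in lborel. Q (t - r :: real)"
proof -
  obtain N where N: "{x\<in>space lborel. \<not> Q x} \<subseteq> N" "emeasure lborel N = 0" "N \<in> sets lborel"
    using AE_E[OF assms] by blast
  have Nb[measurable]: "N \<in> sets borel" using N(3) by simp
  have "(\<lambda>r. t - r) -` N \<inter> space borel \<in> sets borel" by (rule measurable_sets[OF _ Nb]) simp
  then have S: "{r. t - r \<in> N} \<in> sets lborel" by (simp add: vimage_def)
  have "emeasure lborel {r. t - r \<in> N} = (\<integral>\<^sup>+r. indicator {r. t - r \<in> N} r \<partial>lborel)"
    by (rule nn_integral_indicator[OF S, symmetric])
  also have "\<dots> = (\<integral>\<^sup>+r. indicator N (t + -1 * r) \<partial>lborel)"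
    by (intro nn_integral_cong) (simp add: indicator_def)
  also have "\<dots> = (\<integral>\<^sup>+r. indicator N r \<partial>lborel)"
    using nn_integral_real_affine[of "indicator N" "-1" t] by simp
  also have "\<dots> = 0" using N by simp
  finally have "emeasure lborel {r. t - r \<in> N} = 0" .
  then show ?thesis using N(1)
    by (intro AE_I[where N="{r. t - r \<in> N}"] S) auto
qed

text \<open>Carries an integral over the line, computed with the Borel version \<open>kb\<close>,
  over to the original kernel on [0, t]: the reflected exceptional set and the two end points are
  negligible.\<close>

lemma has_integral_causal_spike:
  fixes f g :: "real \<Rightarrow> real"
  assumes kb: "AE x in lborel. 0 < x \<longrightarrow> kb x = k x" and f: "(f has_integral I) UNIV"
    and z: "\<And>r. r \<notin> {0<..<t} \<Longrightarrow> f r = 0" and eq: "\<And>r. r \<in> {0<..<t} \<Longrightarrow> kb (t - r) = k (t - r) \<Longrightarrow> g r = f r"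
  shows "(g has_integral I) {0..t}"
proof -
  have "(f has_integral I) {0..t}"
  proof -
    have "(\<lambda>r. if r \<in> {0..t} then f r else 0) = f"
    proof
      fix r show "(if r \<in> {0..t} then f r else 0) = f r" using z[of r] by auto
    qed
    then show ?thesis using f has_integral_restrict_UNIV[of "{0..t}" f I] by simp
  qed
  define E where "E = {r. \<not> (0 < t - r \<longrightarrow> kb (t - r) = k (t - r))}"
  have "AE r in lebesgue. 0 < t - r \<longrightarrow> kb (t - r) = k (t - r)"
    using AE_lborel_reflect[OF kb] by (rule AE_completion)
  then obtain N where N: "{r\<in>space lebesgue. \<not> (0 < t - r \<longrightarrow> kb (t - r) = k (t - r))} \<subseteq> N"
    "emeasure lebesgue N = 0" "N \<in> sets lebesgue" by (rule AE_E)
  then have "negligible N" by (simp add: negligible_iff_null_sets null_sets_def)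
  then have "negligible E" by (rule negligible_subset) (use N(1) in \<open>auto simp: E_def\<close>)
  then have "negligible (E \<union> {0, t})" by (intro negligible_Un) auto
  then show ?thesis
  proof (rule has_integral_spike[OF _ _ \<open>(f has_integral I) {0..t}\<close>])
    fix r assume "r \<in> {0..t} - (E \<union> {0, t})"
    then have "r \<in> {0<..<t}" "kb (t - r) = k (t - r)" by (auto simp: E_def)
    then show "g r = f r" by (rule eq)
  qed
qed

section \<open>The Volterra equation for the subordinated operators\<close>

context subordination
begin

lemma psi_diff_bound: "\<sigma>1 \<le> \<sigma>2 \<Longrightarrow> \<bar>psi r \<sigma>1 - psi r \<sigma>2\<bar> \<le> 1"
  using psi_nonneg[of r \<sigma>1] psi_nonneg[of r \<sigma>2] psi_le_1[of r \<sigma>1] psi_le_1[of r \<sigma>2] by linarith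

lemma psi_diff_laplace:
  "0 \<le> \<sigma>1 \<Longrightarrow> 0 \<le> \<sigma>2 \<Longrightarrow> s > 0 \<Longrightarrow>
    has_laplace (\<lambda>r. psi r \<sigma>1 - psi r \<sigma>2) s (exp (- \<sigma>1 * gr s) / s - exp (- \<sigma>2 * gr s) / s)"
  by (intro has_laplace_diff psi_laplace)

text \<open>Both sides equal \<open>chi t \<sigma>1 - chi t \<sigma>2\<close>. For the left side
  this is seen on transforms: the factor \<open>1 / gr s\<close> of k turns the multiplier 1 of
  \<open>psi\<close> into \<open>1 / g\<close>. A positive \<open>\<sigma>1\<close> retains the
  damping that makes the integral for \<open>chi\<close> converge.\<close>

lemma conv_psi_pos:
  assumes k: "\<And>s. s > 0 \<Longrightarrow> has_laplace k s (1 / gr s)" and \<sigma>: "0 < \<sigma>1" "\<sigma>1 < \<sigma>2" and t: "t > 0"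
  shows "causal_conv k (\<lambda>r. psi r \<sigma>1 - psi r \<sigma>2) t = (LBINT \<sigma>:{\<sigma>1<..\<sigma>2}. psi t \<sigma>)"
proof -
  have "causal_conv k (\<lambda>r. psi r \<sigma>1 - psi r \<sigma>2) t = chi t \<sigma>1 - chi t \<sigma>2"
  proof (rule laplace_unique[where f="causal_conv k (\<lambda>r. psi r \<sigma>1 - psi r \<sigma>2)"
        and g="\<lambda>t. chi t \<sigma>1 - chi t \<sigma>2" and ?s0.0=0 and F="\<lambda>s. 1 / gr s * (exp (- \<sigma>1 * gr s) / s - exp (- \<sigma>2 * gr s) / s)"])
    fix s :: real assume s: "s > 0"
    show "has_laplace (causal_conv k (\<lambda>r. psi r \<sigma>1 - psi r \<sigma>2)) s (1 / gr s * (exp (- \<sigma>1 * gr s) / s - exp (- \<sigma>2 * gr s) / s))"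
      using \<sigma> s by (intro has_laplace_causal_conv k psi_diff_laplace) auto
    have "has_laplace (\<lambda>t. chi t \<sigma>1 - chi t \<sigma>2) s (exp (- \<sigma>1 * gr s) / (s * gr s) - exp (- \<sigma>2 * gr s) / (s * gr s))"
      using \<sigma> s by (intro has_laplace_diff chi_laplace) auto
    then show "has_laplace (\<lambda>t. chi t \<sigma>1 - chi t \<sigma>2) s (1 / gr s * (exp (- \<sigma>1 * gr s) / s - exp (- \<sigma>2 * gr s) / s))"
      by (simp add: right_diff_distrib mult.commute)
  next
    have k1: "has_laplace k 1 (1 / gr 1)" by (rule k) simp
    show "isCont (causal_conv k (\<lambda>r. psi r \<sigma>1 - psi r \<sigma>2)) t"
      by (rule causal_conv_isCont[OF k1 psi_diff_laplace])
         (use \<sigma> psi_diff_bound psi_isCont_t in \<open>auto intro!: continuous_intros\<close>)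
    show "isCont (\<lambda>t. chi t \<sigma>1 - chi t \<sigma>2) t"
      unfolding chi_def using \<sigma> by (intro continuous_intros J_cont_t multiplier_inverse) auto
  qed (rule t)
  moreover have "(LBINT \<sigma>:{\<sigma>1<..\<sigma>2}. psi t \<sigma>) = chi t \<sigma>1 - chi t \<sigma>2"
  proof -
    have "(psi t has_integral (chi t \<sigma>1 - chi t \<sigma>2)) {\<sigma>1<..\<sigma>2}"
    proof (rule iffD1[OF has_integral_spike_set_eq[of "{\<sigma>1..\<sigma>2}" "{\<sigma>1<..\<sigma>2}"]])
      show "(psi t has_integral (chi t \<sigma>1 - chi t \<sigma>2)) {\<sigma>1..\<sigma>2}"
        using \<sigma> by (intro psi_has_integral t) auto
      show "negligible {x \<in> {\<sigma>1..\<sigma>2} - {\<sigma>1<..\<sigma>2}. psi t x \<noteq> 0}"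
        by (rule negligible_subset[OF negligible_sing[of \<sigma>1]]) auto
      show "negligible {x \<in> {\<sigma>1<..\<sigma>2} - {\<sigma>1..\<sigma>2}. psi t x \<noteq> 0}"
        by (rule negligible_subset[OF negligible_sing[of \<sigma>1]]) auto
    qed
    moreover have "set_integrable lborel {\<sigma>1<..\<sigma>2} (psi t)"
      by (rule set_integrable_subset[OF psi_integrable[OF t]]) (use \<sigma> in auto)
    ultimately show ?thesis using set_borel_integral_eq_integral(2) integral_unique by metis
  qed
  ultimately show ?thesis by simp
qed

lemma conv_psi:
  assumes k: "\<And>s. s > 0 \<Longrightarrow> has_laplace k s (1 / gr s)" and \<sigma>: "0 \<le> \<sigma>1" "\<sigma>1 < \<sigma>2" and t: "t > 0"
  shows "causal_conv k (\<lambda>r. psi r \<sigma>1 - psi r \<sigma>2) t = (LBINT \<sigma>:{\<sigma>1<..\<sigma>2}. psi t \<sigma>)"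
proof (cases "\<sigma>1 = 0")
  case False
  then show ?thesis using conv_psi_pos[OF k _ \<sigma>(2) t] \<sigma> by simp
next
  case True
  then have \<sigma>2: "\<sigma>2 > 0" using \<sigma> by simp
  \<comment> \<open>The end point 0 is approached by points strictly inside (0,
    \<open>\<sigma>2\<close>); the offset 2 keeps them below \<open>\<sigma>2\<close> already for n
    = 0. Dominated convergence applies to both sides.\<close>
  define \<sigma>n where "\<sigma>n n = \<sigma>2 / (real n + 2)" for n
  have \<sigma>n: "0 < \<sigma>n n" "\<sigma>n n < \<sigma>2" for n using \<sigma>2 by (auto simp: \<sigma>n_def field_simps intro: add_pos_nonneg)
  have lim_right: "filterlim \<sigma>n (at_right 0) sequentially" unfolding \<sigma>n_def using \<sigma>2 by real_asymp
  have lim0: "\<sigma>n \<longlonglongrightarrow> 0" unfolding \<sigma>n_def using \<sigma>2 by real_asymp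
  have k1: "has_laplace k 1 (1 / gr 1)" by (rule k) simp
  have one: "has_laplace (\<lambda>_. 1) 1 (1 / 1)" by (rule has_laplace_const) simp
  have P1: "has_laplace (\<lambda>r. psi r \<sigma> - psi r \<sigma>') 1 (exp (- \<sigma> * gr 1) / 1 - exp (- \<sigma>' * gr 1) / 1)"
    if "\<sigma> \<ge> 0" "\<sigma>' \<ge> 0" for \<sigma> \<sigma>' using that by (intro psi_diff_laplace) auto
  have "(\<lambda>n. causal_conv k (\<lambda>r. psi r (\<sigma>n n) - psi r \<sigma>2) t) \<longlonglongrightarrow> causal_conv k (\<lambda>r. psi r 0 - psi r \<sigma>2) t"
    unfolding causal_conv_def
  proof (rule integral_dominated_convergence)
    show "integrable lborel (\<lambda>r. \<bar>causal k (t - r) * causal (\<lambda>_. 1) r\<bar>)"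
      by (rule integrable_abs[OF causal_conv_integrable[OF k1 one]]) simp
    show "AE r in lborel. (\<lambda>n. causal k (t - r) * causal (\<lambda>r. psi r (\<sigma>n n) - psi r \<sigma>2) r) \<longlonglongrightarrow>
        causal k (t - r) * causal (\<lambda>r. psi r 0 - psi r \<sigma>2) r"
    proof (rule AE_I2)
      fix r :: real
      show "(\<lambda>n. causal k (t - r) * causal (\<lambda>r. psi r (\<sigma>n n) - psi r \<sigma>2) r) \<longlonglongrightarrow>
          causal k (t - r) * causal (\<lambda>r. psi r 0 - psi r \<sigma>2) r"
      proof (cases "r > 0")
        case True
        have "(\<lambda>n. psi r (\<sigma>n n)) \<longlonglongrightarrow> psi r 0"
          using filterlim_compose[OF psi_tendsto_1[OF True] lim_right] by simp
        then show ?thesis unfolding causal_def by (intro tendsto_intros)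
      qed (simp add: causal_def)
    qed
    show "AE r in lborel. norm (causal k (t - r) * causal (\<lambda>r. psi r (\<sigma>n n) - psi r \<sigma>2) r)
        \<le> \<bar>causal k (t - r) * causal (\<lambda>_. 1) r\<bar>" for n
    proof (rule AE_I2)
      fix r :: real
      show "norm (causal k (t - r) * causal (\<lambda>r. psi r (\<sigma>n n) - psi r \<sigma>2) r) \<le> \<bar>causal k (t - r) * causal (\<lambda>_. 1) r\<bar>"
        using mult_left_mono[OF psi_diff_bound[OF less_imp_le[OF \<sigma>n(2)[of n]], of r], of "\<bar>causal k (t - r)\<bar>"]
        by (auto simp: causal_def[of _ r] indicator_def abs_mult)
    qed
    show "(\<lambda>r. causal k (t - r) * causal (\<lambda>r. psi r (\<sigma>n n) - psi r \<sigma>2) r) \<in> borel_measurable lborel" for n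
      by (rule borel_measurable_integrable, rule causal_conv_integrable[OF k1 P1 psi_diff_bound])
         (use \<sigma>n[of n] \<sigma>2 in auto)
    show "(\<lambda>r. causal k (t - r) * causal (\<lambda>r. psi r 0 - psi r \<sigma>2) r) \<in> borel_measurable lborel"
      by (rule borel_measurable_integrable, rule causal_conv_integrable[OF k1 P1 psi_diff_bound]) (use \<sigma>2 in auto)
  qed
  then have L: "(\<lambda>n. LBINT \<sigma>:{\<sigma>n n<..\<sigma>2}. psi t \<sigma>) \<longlonglongrightarrow> causal_conv k (\<lambda>r. psi r 0 - psi r \<sigma>2) t"
    using conv_psi_pos[OF k \<sigma>n t] by simp
  have "(\<lambda>n. LBINT \<sigma>:{\<sigma>n n<..\<sigma>2}. psi t \<sigma>) \<longlonglongrightarrow> (LBINT \<sigma>:{0<..\<sigma>2}. psi t \<sigma>)"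
    unfolding set_lebesgue_integral_def
  proof (rule integral_dominated_convergence)
    have i: "integrable lborel (\<lambda>\<sigma>. indicator S \<sigma> *\<^sub>R psi t \<sigma>)" if "S \<subseteq> {0<..}" "S \<in> sets borel" for S
      using set_integrable_subset[OF psi_integrable[OF t], of S] that by (simp add: set_integrable_def)
    show "integrable lborel (\<lambda>\<sigma>. norm (indicator {0<..} \<sigma> *\<^sub>R psi t \<sigma>))"
      by (rule integrable_norm[OF i]) auto
    show "(\<lambda>\<sigma>. indicator {\<sigma>n n<..\<sigma>2} \<sigma> *\<^sub>R psi t \<sigma>) \<in> borel_measurable lborel" for n
      by (rule borel_measurable_integrable[OF i]) (use \<sigma>n[of n] in auto)
    show "(\<lambda>\<sigma>. indicator {0<..\<sigma>2} \<sigma> *\<^sub>R psi t \<sigma>) \<in> borel_measurable lborel"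
      by (rule borel_measurable_integrable[OF i]) auto
    show "AE \<sigma> in lborel. norm (indicator {\<sigma>n n<..\<sigma>2} \<sigma> *\<^sub>R psi t \<sigma>) \<le> norm (indicator {0<..} \<sigma> *\<^sub>R psi t \<sigma>)" for n
      using \<sigma>n[of n] by (auto simp: indicator_def)
    show "AE \<sigma> in lborel. (\<lambda>n. indicator {\<sigma>n n<..\<sigma>2} \<sigma> *\<^sub>R psi t \<sigma>) \<longlonglongrightarrow> indicator {0<..\<sigma>2} \<sigma> *\<^sub>R psi t \<sigma>"
    proof (intro AE_I2 tendsto_eventually)
      fix \<sigma> :: real
      show "\<forall>\<^sub>F n in sequentially. indicator {\<sigma>n n<..\<sigma>2} \<sigma> *\<^sub>R psi t \<sigma> = indicator {0<..\<sigma>2} \<sigma> *\<^sub>R psi t \<sigma>"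
      proof (cases "\<sigma> > 0")
        case True
        then have "\<forall>\<^sub>F n in sequentially. \<sigma>n n < \<sigma>" by (rule order_tendstoD(2)[OF lim0])
        then show ?thesis by eventually_elim (use True in \<open>auto simp: indicator_def\<close>)
      next
        case False
        have "\<sigma> \<notin> {\<sigma>n n<..\<sigma>2}" for n using \<sigma>n(1)[of n] False by auto
        then show ?thesis using False by (simp add: indicator_def)
      qed
    qed
  qed
  then show ?thesis using LIMSEQ_unique[OF L] True by simp
qed

text \<open>Applied to each cell, \<open>conv_psi\<close> shows that the Volterra integral of
  \<open>V n\<close> at \<open>A a\<close> is exactly the cell sum for \<open>psi t\<close>. As n
  grows, one side tends to the Volterra integral of \<open>U\<close>, the other to the integral of
  \<open>U_by_parts\<close>.\<close>

lemma volterra: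
  assumes k: "has_laplace_transform k F" and F: "\<And>s. s > 0 \<Longrightarrow> F (of_real s) = 1 / g (of_real s)"
    and a: "a \<in> D" and t: "t \<ge> 0"
  shows "((\<lambda>\<tau>. k (t - \<tau>) *\<^sub>R A (U \<tau> a)) has_integral (U t a - a)) {0..t}"
proof (cases "t = 0")
  case True
  then show ?thesis by (simp add: U_def has_integral_refl)
next
  case False
  then have t0: "t > 0" using t by simp
  define y where "y = A a"
  have "F (of_real s) = of_real (1 / gr s)" if "s > 0" for s using F[OF that] g_of_real[OF that] by simp
  from borel_kernel[OF k this] obtain kb where kb: "AE x in lborel. 0 < x \<longrightarrow> kb x = k x"
    "\<And>s. s > 0 \<Longrightarrow> has_laplace kb s (1 / gr s)" by blast
  have kb1: "has_laplace kb 1 (1 / gr 1)" by (rule kb(2)) simp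
  interpret bounded_uc "\<lambda>\<tau>. T \<tau> y" "M * norm y" by (rule orbit)
  have scalar: "((\<lambda>r. k (t - r) * (psi r \<sigma>1 - psi r \<sigma>2)) has_integral (LBINT \<sigma>:{\<sigma>1<..\<sigma>2}. psi t \<sigma>)) {0..t}"
    if \<sigma>: "0 \<le> \<sigma>1" "\<sigma>1 < \<sigma>2" for \<sigma>1 \<sigma>2
  proof (rule has_integral_causal_spike[OF kb(1)])
    have "integrable lborel (\<lambda>r. causal kb (t - r) * causal (\<lambda>r. psi r \<sigma>1 - psi r \<sigma>2) r)"
      by (rule causal_conv_integrable[OF kb1 psi_diff_laplace psi_diff_bound]) (use \<sigma> in auto)
    from has_integral_integral_lborel[OF this]
    show "((\<lambda>r. causal kb (t - r) * causal (\<lambda>r. psi r \<sigma>1 - psi r \<sigma>2) r) has_integral (LBINT \<sigma>:{\<sigma>1<..\<sigma>2}. psi t \<sigma>)) UNIV"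
      using conv_psi[OF kb(2) \<sigma> t0] by (simp add: causal_conv_def)
  qed (auto simp: causal_def)
  have one: "has_laplace (\<lambda>_. 1) 1 (1 / 1)" by (rule has_laplace_const) simp
  obtain c where c: "((\<lambda>r. \<bar>k (t - r)\<bar>) has_integral c) {0..t}"
  proof -
    have ia: "integrable lborel (\<lambda>r. \<bar>causal kb (t - r) * causal (\<lambda>_. 1) r\<bar>)"
      by (rule integrable_abs[OF causal_conv_integrable[OF kb1 one]]) simp
    show ?thesis
      by (rule that, rule has_integral_causal_spike[OF kb(1) has_integral_integral_lborel[OF ia]])
        (auto simp: causal_def)
  qed
  \<comment> \<open>This error holds for all r in [0, t] at once, so it can be multiplied by |k(t -
    r)| and integrated.\<close>
  define err where "err n = osc n + M * norm y * psi t (real n)" for n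
  have err: "err \<longlonglongrightarrow> 0" unfolding err_def using U_V_error_tendsto by blast
  define G where "G n r = (\<Sum>j<n * n. (k (t - r) * (psi r (real j / real n) - psi r (real (Suc j) / real n))) *\<^sub>R T (real j / real n) y)" for n r
  have GV: "G n r = k (t - r) *\<^sub>R V n r y" for n r
    unfolding G_def V_def by (simp add: scaleR_sum_right)
  have lims: "(\<lambda>r. k (t - r) *\<^sub>R U r y) integrable_on {0..t}"
    "(\<lambda>n. cell_mean (psi t) (Suc n)) \<longlonglongrightarrow> integral {0..t} (\<lambda>r. k (t - r) *\<^sub>R U r y)"
  proof -
    have G: "(G (Suc n) has_integral cell_mean (psi t) (Suc n)) {0..t}" for n
      unfolding G_def cell_mean_def cell_def
      by (intro has_integral_sum has_integral_scaleR_left scalar) (auto simp: divide_strict_right_mono)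
    have W: "((\<lambda>r. \<bar>k (t - r)\<bar> * err (Suc n)) has_integral (c * err (Suc n))) {0..t}" for n
      by (rule has_integral_mult_left[OF c])
    have le: "\<forall>\<^sub>F n in sequentially. \<forall>r\<in>{0..t}. norm (k (t - r) *\<^sub>R U r y - G (Suc n) r) \<le> \<bar>k (t - r)\<bar> * err (Suc n)"
    proof (intro always_eventually allI ballI)
      fix n r assume "r \<in> {0..t}"
      then have "norm (U r y - V (Suc n) r y) \<le> err (Suc n)" unfolding err_def by (intro U_V') auto
      then show "norm (k (t - r) *\<^sub>R U r y - G (Suc n) r) \<le> \<bar>k (t - r)\<bar> * err (Suc n)"
        unfolding GV scaleR_diff_right[symmetric] norm_scaleR by (rule mult_left_mono) simp
    qed
    have "(\<lambda>n. c * err (Suc n)) \<longlonglongrightarrow> c * 0" by (intro tendsto_intros LIMSEQ_Suc[OF err])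
    then have lim: "(\<lambda>n. c * err (Suc n)) \<longlonglongrightarrow> 0" by simp
    note L = L1_limit[where G="\<lambda>n. G (Suc n)" and W="\<lambda>n r. \<bar>k (t - r)\<bar> * err (Suc n)", OF G W le lim]
    show "(\<lambda>r. k (t - r) *\<^sub>R U r y) integrable_on {0..t}"
      "(\<lambda>n. cell_mean (psi t) (Suc n)) \<longlonglongrightarrow> integral {0..t} (\<lambda>r. k (t - r) *\<^sub>R U r y)" by (rule L)+
  qed
  have "(\<lambda>n. cell_mean (psi t) (Suc n)) \<longlonglongrightarrow> U t a - a"
    using LIMSEQ_Suc[OF weighted_limit(2)[OF psi_integrable[OF t0]]] U_by_parts[OF a t0] by (simp add: y_def)
  then have "integral {0..t} (\<lambda>r. k (t - r) *\<^sub>R U r y) = U t a - a" using LIMSEQ_unique[OF lims(2)] by blast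
  then have "((\<lambda>r. k (t - r) *\<^sub>R U r y) has_integral (U t a - a)) {0..t}" using lims(1) by (simp add: has_integral_iff)
  then show ?thesis
    by (rule has_integral_eq[rotated]) (use U_domain(2)[OF a] in \<open>auto simp: y_def\<close>)
qed

text \<open>For a in the domain \<open>U\<close> is a strong solution, hence equal to
  \<open>S\<close> by uniqueness. At fixed t both are continuous in the initial value, and the
  domain is dense.\<close>

theorem subordination_identity:
  assumes k: "has_laplace_transform k F" and F: "\<And>s. s > 0 \<Longrightarrow> F (of_real s) = 1 / g (of_real s)"
    and S: "volterra_solution_operator D A k S" and t: "t > 0"
  shows "((\<lambda>\<tau>. phi t \<tau> *\<^sub>R T \<tau> x) has_integral S t x) {0<..}"
proof -
  have D: "S t a = U t a" if a: "a \<in> D" for a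
  proof -
    have "strong_solution D A k a (\<lambda>t. U t a)"
      unfolding strong_solution_def
    proof (intro conjI allI impI)
      show "U t a \<in> D" if "t \<ge> 0" for t using U_domain(1)[OF a that] .
      show "continuous_on {0..} (\<lambda>t. U t a)" by (rule U_continuous)
      show "continuous_on {0..} (\<lambda>t. A (U t a))"
        by (rule continuous_on_eq[OF U_continuous[of "A a"]]) (use U_domain(2)[OF a] in auto)
      show "((\<lambda>\<tau>. k (t - \<tau>) *\<^sub>R A (U \<tau> a)) has_integral (U t a - a)) {0..t}" if "t \<ge> 0" for t
        by (rule volterra[OF k F a that])
    qed
    then show ?thesis using S a t unfolding volterra_solution_operator_def by auto
  qed
  obtain a where a: "\<And>n::nat. a n \<in> D" "a \<longlonglongrightarrow> x" using dense_domain by blast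
  have "(\<lambda>n. S t (a n)) \<longlonglongrightarrow> S t x" by (intro tendsto_intros a)
  moreover have "(\<lambda>n. U t (a n)) \<longlonglongrightarrow> U t x"
  proof (rule LIM_zero_cancel, rule Lim_null_comparison)
    have "(\<lambda>n. M * norm (a n - x)) \<longlonglongrightarrow> M * norm (x - x)" by (intro tendsto_intros a)
    then show "(\<lambda>n. M * norm (a n - x)) \<longlonglongrightarrow> 0" by simp
    show "\<forall>\<^sub>F n in sequentially. norm (U t (a n) - U t x) \<le> M * norm (a n - x)"
      using U_le[of t "a _ - x"] t by (intro always_eventually allI) (simp add: U_diff[symmetric])
  qed
  ultimately have "S t x = U t x" using D[OF a(1)] LIMSEQ_unique by auto
  then show ?thesis using phi_T_integrable[OF t, of x] t by (simp add: U_def has_integral_iff)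
qed

end

section \<open>Weights supported away from 0 and 1\<close>

text \<open>The setting of the discrete weights: all exponents lie in an interval [p, q] inside
  (0,1). The distance to 0 and 1 is what leaves room for a sector larger than the half
  plane.\<close>

locale sector_weight = finite_measure N for N :: "real measure" +
  fixes p q :: real
  assumes sets_N: "sets N = sets borel"
    and nz: "measure N (space N) > 0"
    and pq: "0 < p" "q < 1"
    and supp_pq: "AE b in N. p \<le> b \<and> b \<le> q"
begin

lemma p_le_q: "p \<le> q"
proof (rule ccontr)
  assume "\<not> p \<le> q"
  then have "AE b in N. False" using supp_pq by auto
  then have "ae_filter N = bot" by (simp only: eventually_False)
  then show False using nz by (simp add: ae_filter_eq_bot_iff measure_def)
qed

lemma integrable_pq:
  fixes f :: "real \<Rightarrow> real"
  assumes "f \<in> borel_measurable borel" "\<And>b. p \<le> b \<Longrightarrow> b \<le> q \<Longrightarrow> \<bar>f b\<bar> \<le> B"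
  shows "integrable N f"
proof (rule integrable_const_bound)
  show "AE b in N. norm (f b) \<le> B" using supp_pq by eventually_elim (use assms in auto)
  show "f \<in> borel_measurable N" using assms(1) measurable_cong_sets[OF sets_N refl] by blast
qed

lemma integral_mono_pq:
  fixes f k :: "real \<Rightarrow> real"
  assumes "integrable N f" "integrable N k" "\<And>b. p \<le> b \<Longrightarrow> b \<le> q \<Longrightarrow> f b \<le> k b"
  shows "(\<integral>b. f b \<partial>N) \<le> (\<integral>b. k b \<partial>N)"
proof (rule integral_mono_AE[OF assms(1,2)])
  show "AE b in N. f b \<le> k b" using supp_pq by eventually_elim (use assms in auto)
qed

definition m :: real where "m = measure N (space N)"

lemma m_pos: "m > 0" using nz by (simp add: m_def)

lemma powr_between:
  assumes "r \<ge> 1" "p \<le> b" "b \<le> q" shows "r powr p \<le> r powr b" "r powr b \<le> r powr q"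
  using assms by (auto intro: powr_mono)

lemma powr_between':
  assumes "0 < r" "r \<le> 1" "p \<le> b" "b \<le> q" shows "r powr q \<le> r powr b" "r powr b \<le> r powr p"
  using assms by (auto intro: powr_mono')

lemma int_powr_pq: "r > 0 \<Longrightarrow> integrable N (\<lambda>b. r powr b)"
proof -
  assume r: "r > 0"
  show ?thesis
  proof (cases "r \<ge> 1")
    case True
    then show ?thesis using powr_between by (intro integrable_pq[where B="r powr q"]) auto
  next
    case False
    then show ?thesis using r powr_between' by (intro integrable_pq[where B="r powr p"]) auto
  qed
qed

lemma const_le_integral:
  assumes "integrable N f" "\<And>b. p \<le> b \<Longrightarrow> b \<le> q \<Longrightarrow> x \<le> f b"
  shows "m * x \<le> (\<integral>b. f b \<partial>N)"
  using integral_mono_pq[of "\<lambda>_. x" f] assms by (simp add: m_def)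

lemma integral_le_const:
  assumes "integrable N f" "\<And>b. p \<le> b \<Longrightarrow> b \<le> q \<Longrightarrow> f b \<le> x"
  shows "(\<integral>b. f b \<partial>N) \<le> m * x"
  using integral_mono_pq[of f "\<lambda>_. x"] assms by (simp add: m_def)

lemma H_bounds:
  shows "r \<ge> 1 \<Longrightarrow> m * r powr p \<le> (\<integral>b. r powr b \<partial>N)" "r \<ge> 1 \<Longrightarrow> (\<integral>b. r powr b \<partial>N) \<le> m * r powr q"
    "0 < r \<Longrightarrow> r \<le> 1 \<Longrightarrow> m * r powr q \<le> (\<integral>b. r powr b \<partial>N)" "0 < r \<Longrightarrow> r \<le> 1 \<Longrightarrow> (\<integral>b. r powr b \<partial>N) \<le> m * r powr p"
  by (intro const_le_integral integral_le_const int_powr_pq powr_between powr_between'; simp)+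

lemma ln_le_powr: "r > 0 \<Longrightarrow> a > 0 \<Longrightarrow> ln r \<le> r powr a / (a::real)"
  using ln_le_minus_one[of "r powr a"] by (simp add: ln_powr field_simps)

sublocale weight_measure N
proof
  show "AE b in N. 0 < b \<and> b < 1" using supp_pq by eventually_elim (use pq in auto)
  have q1: "1 - q > 0" using pq by simp
  have p0: "p > 0" using pq by simp
  \<comment> \<open>The first summand compares \<open>ln r \<le> r powr p / p\<close> with the lower
    bound \<open>m * r powr p\<close> of the mixture; both summands use 1 - b \<ge> 1 - q on the
    support.\<close>
  define C1 where "C1 = 1 / (p * m * (1 - q)) + 1 / (1 - q)"
  have C1: "C1 \<ge> 0" using q1 p0 m_pos by (simp add: C1_def)
  show "\<exists>R C. \<forall>r\<ge>R. ln r \<le> C * (\<integral>b. (1 - b) * r powr b \<partial>N) \<and>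
      (\<integral>b. r powr b \<partial>N) \<le> C * (1 + (\<integral>b. (1 - b) * r powr b \<partial>N))\<^sup>2"
  proof (rule exI[of _ 1], rule exI[of _ C1], intro allI impI conjI)
    fix r :: real assume r: "r \<ge> 1"
    define Hr K where "Hr = (\<integral>b. r powr b \<partial>N)" and "K = (\<integral>b. (1 - b) * r powr b \<partial>N)"
    have "(\<integral>b. (1 - q) * r powr b \<partial>N) \<le> K" unfolding K_def
    proof (rule integral_mono_pq)
      show "integrable N (\<lambda>b. (1 - q) * r powr b)" using int_powr_pq[of r] r by simp
      show "integrable N (\<lambda>b. (1 - b) * r powr b)"
      proof (rule integrable_pq)
        fix b assume b: "p \<le> b" "b \<le> q"
        have "\<bar>1 - b\<bar> * r powr b \<le> 1 * r powr q"
          using powr_between(2)[OF r b] pq b by (intro mult_mono) auto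
        then show "\<bar>(1 - b) * r powr b\<bar> \<le> 1 * r powr q" by (simp add: abs_mult)
      qed simp
    qed (auto intro!: mult_right_mono)
    then have K: "(1 - q) * Hr \<le> K" by (simp add: Hr_def)
    have Hr: "m * r powr p \<le> Hr" unfolding Hr_def by (rule H_bounds(1)[OF r])
    have Hr0: "Hr > 0" using Hr m_pos r by (intro less_le_trans[OF _ Hr]) auto
    have K0: "K > 0" using K Hr0 q1 by (intro less_le_trans[OF _ K]) auto
    have HK: "Hr \<le> 1 / (1 - q) * K" using K q1 by (simp add: field_simps)
    have "ln r \<le> r powr p / p" using r p0 by (intro ln_le_powr) auto
    also have "\<dots> \<le> (Hr / m) / p" using Hr m_pos p0 by (intro divide_right_mono) (auto simp: field_simps)
    also have "\<dots> = Hr * (1 / (p * m))" by simp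
    also have "\<dots> \<le> (1 / (1 - q) * K) * (1 / (p * m))" using HK p0 m_pos by (intro mult_right_mono) auto
    also have "\<dots> = 1 / (p * m * (1 - q)) * K" by simp
    also have "\<dots> \<le> C1 * K" unfolding C1_def using q1 K0 by (intro mult_right_mono) auto
    finally show "ln r \<le> C1 * (\<integral>b. (1 - b) * r powr b \<partial>N)" unfolding K_def .
    note HK
    also have "1 / (1 - q) * K \<le> C1 * (1 + K)\<^sup>2"
      unfolding C1_def using q1 p0 m_pos K0 by (intro mult_mono) (auto simp: power2_eq_square algebra_simps)
    finally show "(\<integral>b. r powr b \<partial>N) \<le> C1 * (1 + (\<integral>b. (1 - b) * r powr b \<partial>N))\<^sup>2" unfolding K_def Hr_def .
  qed
  show "\<exists>R C. \<forall>r\<ge>R. (\<integral>b. r powr b \<partial>N) * ln r \<le> C * r"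
  proof (rule exI[of _ 1], rule exI[of _ "m / (1 - q)"], intro allI impI)
    fix r :: real assume r: "r \<ge> 1"
    have "(\<integral>b. r powr b \<partial>N) * ln r \<le> (m * r powr q) * (r powr (1 - q) / (1 - q))"
      using H_bounds(2)[OF r] ln_le_powr[of r "1 - q"] r q1 m_pos by (intro mult_mono) auto
    also have "\<dots> = m / (1 - q) * (r powr q * r powr (1 - q))" by simp
    also have "r powr q * r powr (1 - q) = r" using r by (simp add: powr_add[symmetric])
    finally show "(\<integral>b. r powr b \<partial>N) * ln r \<le> m / (1 - q) * r" .
  qed
qed (use sets_N nz in auto)

text \<open>Small enough that angles up to pi/2 + \<theta>0 stay below pi/2 after multiplication by
  q or by 1 - p. These products bound the arguments of \<open>z powr b\<close> and of
  \<open>z * cnj (z powr b)\<close>.\<close>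

definition \<theta>0 :: real where "\<theta>0 = min (1 - q) p * (pi / 4)"

definition c0 :: real where "c0 = min (cos (q * (pi / 2 + \<theta>0))) (cos ((1 - p) * (pi / 2 + \<theta>0)))"

lemma \<theta>0: "0 < \<theta>0" "\<theta>0 < pi / 2"
proof -
  show "0 < \<theta>0" using pq by (simp add: \<theta>0_def)
  have "min (1 - q) p < 1" using pq p_le_q by auto
  then have "\<theta>0 < 1 * (pi / 4)" unfolding \<theta>0_def by (intro mult_strict_right_mono) auto
  then show "\<theta>0 < pi / 2" using pi_gt_zero by linarith
qed

lemma angle_bounds: "q * (pi / 2 + \<theta>0) < pi / 2" "(1 - p) * (pi / 2 + \<theta>0) < pi / 2"
proof -
  have aux: "a * (pi / 2 + \<theta>0) < pi / 2" if "0 < a" "a < 1" "\<theta>0 \<le> (1 - a) * (pi / 4)" for a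
  proof -
    have "a * \<theta>0 \<le> 1 * \<theta>0" using that \<theta>0 by (intro mult_right_mono) auto
    also have "\<dots> \<le> (1 - a) * (pi / 4)" using that by simp
    also have "\<dots> < (1 - a) * (pi / 2)" using that by (intro mult_strict_left_mono) auto
    finally show ?thesis by (simp add: algebra_simps)
  qed
  have "\<theta>0 \<le> (1 - q) * (pi / 4)" "\<theta>0 \<le> p * (pi / 4)"
    unfolding \<theta>0_def by (intro mult_right_mono; simp)+
  then show "q * (pi / 2 + \<theta>0) < pi / 2" "(1 - p) * (pi / 2 + \<theta>0) < pi / 2"
    using pq p_le_q aux[of q] aux[of "1 - p"] by auto
qed

lemma c0_pos: "c0 > 0"
  unfolding c0_def using angle_bounds pq p_le_q \<theta>0 pi_gt_zero
  by (auto intro!: cos_gt_zero_pi intro: order.strict_trans2[of _ 0])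

lemma cos_ge_c0:
  assumes "\<bar>\<theta>\<bar> \<le> pi / 2 + \<theta>0" "p \<le> b" "b \<le> q"
  shows "c0 \<le> cos (b * \<theta>)" "c0 \<le> cos ((1 - b) * \<theta>)"
proof -
  have aux: "cos (d * (pi / 2 + \<theta>0)) \<le> cos (a * \<theta>)" if "0 \<le> a" "a \<le> d" "d * (pi / 2 + \<theta>0) < pi / 2" for a d
  proof -
    have "\<bar>a * \<theta>\<bar> \<le> d * (pi / 2 + \<theta>0)" unfolding abs_mult using that assms(1) by (intro mult_mono) auto
    then have "cos (d * (pi / 2 + \<theta>0)) \<le> cos \<bar>a * \<theta>\<bar>"
      using that(3) pi_gt_zero by (intro cos_monotone_0_pi_le) auto
    then show ?thesis by simp
  qed
  show "c0 \<le> cos (b * \<theta>)" using aux[of b q] assms angle_bounds pq by (simp add: c0_def)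
  show "c0 \<le> cos ((1 - b) * \<theta>)" using aux[of "1 - b" "1 - p"] assms angle_bounds pq by (simp add: c0_def)
qed

text \<open>The half-plane estimates again, with the constant cosine bound \<open>c0\<close> in
  place of 1 - b and of b.\<close>

lemma sector_Re_h:
  assumes z: "z \<noteq> 0" "\<bar>Arg z\<bar> \<le> pi / 2 + \<theta>0"
  shows "c0 * H (norm z) \<le> Re (h z)" "norm z * (c0 * H (norm z)) \<le> Re (z * cnj (h z))"
proof -
  have r: "norm z > 0" using z by simp
  have i: "integrable N (\<lambda>b. c0 * norm z powr b)" using int_powr(1)[OF r] by simp
  have e: "c0 * H (norm z) = (\<integral>b. c0 * norm z powr b \<partial>N)" by (simp add: H_def)
  show "c0 * H (norm z) \<le> Re (h z)"
    unfolding Re_h[OF z(1)] e using mult_left_mono[OF cos_ge_c0(1)[OF z(2)], of _ "norm z powr _"]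
    by (intro integral_mono_pq i int_powr_cos r) (simp add: mult.commute[of c0])
  have "c0 * H (norm z) \<le> (\<integral>b. norm z powr b * cos ((1 - b) * Arg z) \<partial>N)"
    unfolding e using mult_left_mono[OF cos_ge_c0(2)[OF z(2)], of _ "norm z powr _"]
    by (intro integral_mono_pq i int_powr_cos r) (simp add: mult.commute[of c0])
  then show "norm z * (c0 * H (norm z)) \<le> Re (z * cnj (h z))"
    unfolding Re_mult_cnj_h[OF z(1)] by (rule mult_left_mono) simp
qed

definition sector :: "complex set" where "sector = {z. z \<noteq> 0 \<and> \<bar>Arg z\<bar> \<le> pi / 2 + \<theta>0}"

lemma sector_slit: "sector \<subseteq> - \<real>\<^sub>\<le>\<^sub>0"
proof
  fix z assume z: "z \<in> sector"
  have "Arg z \<noteq> pi" using z \<theta>0 by (auto simp: sector_def)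
  then show "z \<in> - \<real>\<^sub>\<le>\<^sub>0" using z by (auto simp: sector_def complex_nonpos_Reals_iff Arg_eq_pi complex_eq_iff)
qed

lemma sector_h_nonzero: "z \<in> sector \<Longrightarrow> h z \<noteq> 0"
  using sector_Re_h(1)[of z] c0_pos H_pos[of "norm z"] unfolding sector_def
  by (metis (mono_tags, lifting) mem_Collect_eq mult_pos_pos not_le zero_complex.sel(1) zero_less_norm_iff)

lemma h_sectorial:
  assumes "z \<in> sector"
  shows "c0 * norm (h z) \<le> Re (h z)" "1 \<le> norm z \<Longrightarrow> c0 * m * norm z powr p \<le> norm (h z)"
    "norm z \<le> 1 \<Longrightarrow> norm (h z) \<le> m * norm z powr p"
proof -
  have z: "z \<noteq> 0" "\<bar>Arg z\<bar> \<le> pi / 2 + \<theta>0" using assms by (auto simp: sector_def)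
  have r: "norm z > 0" using z by simp
  have n: "norm (h z) \<le> H (norm z)" by (rule norm_h_le[OF z(1)])
  have R: "c0 * H (norm z) \<le> Re (h z)" by (rule sector_Re_h(1)[OF z])
  show "c0 * norm (h z) \<le> Re (h z)" using mult_left_mono[OF n, of c0] c0_pos R by linarith
  show "c0 * m * norm z powr p \<le> norm (h z)" if "1 \<le> norm z"
  proof -
    have "c0 * (m * norm z powr p) \<le> c0 * H (norm z)"
      unfolding H_def using c0_pos H_bounds(1)[OF that] by (intro mult_left_mono) auto
    then show ?thesis using R complex_Re_le_cmod[of "h z"] by (simp only: mult.assoc)
  qed
  show "norm (h z) \<le> m * norm z powr p" if "norm z \<le> 1"
    using n H_bounds(4)[OF r that] unfolding H_def by linarith
qed

lemma div_h_sectorial: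
  assumes "z \<in> sector"
  shows "c0 * norm (z / h z) \<le> Re (z / h z)" "1 \<le> norm z \<Longrightarrow> 1 / m * norm z powr (1 - q) \<le> norm (z / h z)"
    "norm z \<le> 1 \<Longrightarrow> norm (z / h z) \<le> 1 / (c0 * m) * norm z powr (1 - q)"
proof -
  have z: "z \<noteq> 0" "\<bar>Arg z\<bar> \<le> pi / 2 + \<theta>0" using assms by (auto simp: sector_def)
  have r: "norm z > 0" using z by simp
  have n: "norm (h z) \<le> H (norm z)" by (rule norm_h_le[OF z(1)])
  have h0: "norm (h z) > 0" using sector_h_nonzero[OF assms] by simp
  have R: "norm z * (c0 * H (norm z)) \<le> Re (z * cnj (h z))" by (rule sector_Re_h(2)[OF z])
  have "norm z * (c0 * norm (h z)) \<le> norm z * (c0 * H (norm z))"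
    using n c0_pos by (intro mult_left_mono) auto
  also note R
  finally have "norm z * (c0 * norm (h z)) / (norm (h z))\<^sup>2 \<le> Re (z * cnj (h z)) / (norm (h z))\<^sup>2"
    by (rule divide_right_mono) simp
  then show "c0 * norm (z / h z) \<le> Re (z / h z)"
    using h0 unfolding Re_div_h by (simp add: norm_divide power2_eq_square field_simps)
  show "1 / m * norm z powr (1 - q) \<le> norm (z / h z)" if "1 \<le> norm z"
  proof -
    have "norm (h z) \<le> m * norm z powr q" using n H_bounds(2)[OF that] unfolding H_def by linarith
    then have "norm z / (m * norm z powr q) \<le> norm z / norm (h z)"
      using h0 r by (intro divide_left_mono mult_pos_pos m_pos) auto
    then show ?thesis using r by (simp add: norm_divide powr_diff)
  qed
  show "norm (z / h z) \<le> 1 / (c0 * m) * norm z powr (1 - q)" if "norm z \<le> 1"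
  proof -
    have "c0 * (m * norm z powr q) \<le> c0 * H (norm z)"
      using H_bounds(3)[OF r that] c0_pos unfolding H_def by (intro mult_left_mono) auto
    also have "\<dots> \<le> norm (h z)" using sector_Re_h(1)[OF z] complex_Re_le_cmod[of "h z"] by linarith
    finally have "norm z / norm (h z) \<le> norm z / (c0 * (m * norm z powr q))"
      using h0 r c0_pos m_pos by (intro divide_left_mono mult_pos_pos) auto
    then show ?thesis using r by (simp add: norm_divide powr_diff)
  qed
qed

end

text \<open>Index 0 carries the unit mass at \<open>\<alpha>\<close> of the leading term, the
  indices from 1 to m the lower order terms.\<close>

definition discrete_weight_measure :: "real \<Rightarrow> nat \<Rightarrow> (nat \<Rightarrow> real) \<Rightarrow> (nat \<Rightarrow> real) \<Rightarrow> real measure" where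
  "discrete_weight_measure \<alpha> m b a =
     distr (point_measure {..m} (\<lambda>i. ennreal (if i = 0 then 1 else b i))) borel (\<lambda>i. if i = 0 then \<alpha> else a i)"

lemma discrete_weight:
  assumes adm: "admissible_weight (Discrete \<alpha> m b a)"
  shows "\<exists>p q. sector_weight (discrete_weight_measure \<alpha> m b a) p q"
    and "weight_symbol (Discrete \<alpha> m b a) z = (\<integral>\<beta>. z powr of_real \<beta> \<partial>discrete_weight_measure \<alpha> m b a)"
proof -
  define c e where "c i = (if i = 0 then 1 else b i)" and "e i = (if i = 0 then \<alpha> else a i)" for i
  define PM where "PM = point_measure {..m} (\<lambda>i. ennreal (c i))"
  define N where "N = distr PM borel e"
  have N: "discrete_weight_measure \<alpha> m b a = N" by (simp add: discrete_weight_measure_def N_def PM_def c_def e_def[abs_def])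
  have c: "c i > 0" if "i \<in> {..m}" for i using adm that by (auto simp: c_def)
  have e: "0 < e i" "e i \<le> \<alpha>" if "i \<in> {..m}" for i using adm that by (auto simp: e_def less_imp_le)
  have meas: "e \<in> measurable PM borel" by (simp add: PM_def)
  have int: "(\<integral>x. f x \<partial>N) = (\<Sum>i\<le>m. c i *\<^sub>R f (e i))" if "f \<in> borel_measurable borel" for f :: "real \<Rightarrow> 'c::{banach,second_countable_topology}"
  proof -
    have "(\<integral>x. f x \<partial>N) = (\<integral>i. f (e i) \<partial>PM)" unfolding N_def by (rule integral_distr[OF meas that])
    also have "\<dots> = (\<Sum>i\<le>m. c i *\<^sub>R f (e i))"
      unfolding PM_def using c by (intro lebesgue_integral_point_measure_finite) (auto intro: less_imp_le)
    finally show ?thesis .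
  qed
  have split: "{..m} = insert 0 {1..m}" by auto
  show "weight_symbol (Discrete \<alpha> m b a) z = (\<integral>\<beta>. z powr of_real \<beta> \<partial>discrete_weight_measure \<alpha> m b a)"
  proof -
    have "(\<lambda>\<beta>. z powr complex_of_real \<beta>) \<in> borel_measurable borel" unfolding powr_def by measurable
    from int[OF this] show ?thesis
      unfolding N split by (simp add: c_def e_def scaleR_conv_of_real)
  qed
  define p where "p = Min (e ` {..m})"
  have p: "0 < p" unfolding p_def using e by (subst Min_gr_iff) auto
  have pe: "p \<le> e i" if "i \<in> {..m}" for i unfolding p_def using that by (intro Min_le) auto
  have emPM: "emeasure PM (space PM) < \<infinity>"
    unfolding PM_def by (simp add: space_point_measure emeasure_point_measure_finite)
  have fin: "finite_measure N"
    unfolding N_def by (rule finite_measure.finite_measure_distr[OF finite_measureI meas]) (use emPM in auto)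
  have "sector_weight N p \<alpha>"
  proof (intro sector_weight.intro sector_weight_axioms.intro fin p)
    show "sets N = sets borel" by (simp add: N_def)
    show "\<alpha> < 1" using adm by simp
    have "measure N (space N) = (\<integral>x. 1 \<partial>N)" by simp
    also have "\<dots> = (\<Sum>i\<le>m. c i)" by (subst int) auto
    also have "\<dots> > 0" by (rule sum_pos) (use c in auto)
    finally show "measure N (space N) > 0" .
    show "AE x in N. p \<le> x \<and> x \<le> \<alpha>"
      unfolding N_def using e pe by (subst AE_distr_iff[OF meas]) (auto simp: PM_def space_point_measure intro!: AE_I2)
  qed
  then show "\<exists>p q. sector_weight (discrete_weight_measure \<alpha> m b a) p q" unfolding N by blast
qed

definition continuous_weight_measure :: "(real \<Rightarrow> real) \<Rightarrow> real measure" where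
  "continuous_weight_measure \<mu> = density lborel (\<lambda>b. ennreal (indicator {0..1} b * \<mu> b))"

lemma continuous_weight:
  assumes adm: "admissible_weight (Continuous \<mu>)"
  shows "weight_measure (continuous_weight_measure \<mu>)"
    and "weight_symbol (Continuous \<mu>) z = (\<integral>\<beta>. z powr of_real \<beta> \<partial>continuous_weight_measure \<mu>)"
proof -
  define v where "v b = indicator {0..1} b * \<mu> b" for b :: real
  define N where "N = density lborel (\<lambda>b. ennreal (v b))"
  have N: "continuous_weight_measure \<mu> = N" by (simp add: continuous_weight_measure_def N_def v_def)
  have cont: "continuous_on {0..1} \<mu>" and nn: "\<And>b. b \<in> {0..1} \<Longrightarrow> 0 \<le> \<mu> b" and \<mu>1: "\<mu> 1 \<noteq> 0"
    using adm by auto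
  have v0: "v b \<ge> 0" for b using nn by (auto simp: v_def indicator_def)
  have vm[measurable]: "v \<in> borel_measurable borel"
    using borel_measurable_continuous_on_indicator[OF _ cont] by (simp add: v_def[abs_def])
  obtain bm where "\<forall>b\<in>{0..1}. \<mu> b \<le> \<mu> bm" using continuous_attains_sup[OF _ _ cont] by auto
  then obtain B where B: "\<And>b. b \<in> {0..1} \<Longrightarrow> \<mu> b \<le> B" by blast
  have vB: "v b \<le> max B 0 * indicator {0..1} b" for b using B[of b] by (auto simp: v_def indicator_def)
  have vi: "integrable lborel v"
    using borel_integrable_atLeastAtMost'[OF cont] by (simp add: set_integrable_def v_def[abs_def])
  have dens: "(\<integral>b. f b \<partial>N) = (\<integral>b. v b *\<^sub>R f b \<partial>lborel)" if "f \<in> borel_measurable borel"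
    for f :: "real \<Rightarrow> 'c::{banach,second_countable_topology}"
    unfolding N_def using that v0 by (intro integral_density) auto
  show "weight_symbol (Continuous \<mu>) z = (\<integral>\<beta>. z powr of_real \<beta> \<partial>continuous_weight_measure \<mu>)"
  proof (cases "z = 0")
    case True
    then show ?thesis by simp
  next
    case False
    have "continuous_on {0..1} (\<lambda>\<beta>. complex_of_real (\<mu> \<beta>) * z powr complex_of_real \<beta>)"
      using False unfolding powr_def by (auto intro!: continuous_intros cont)
    from borel_integrable_atLeastAtMost'[OF this]
    have "set_integrable lborel {0..1} (\<lambda>\<beta>. complex_of_real (\<mu> \<beta>) * z powr complex_of_real \<beta>)" .
    from set_borel_integral_eq_integral(2)[OF this]
    have "weight_symbol (Continuous \<mu>) z = (\<integral>\<beta>. indicator {0..1} \<beta> *\<^sub>R (complex_of_real (\<mu> \<beta>) * z powr complex_of_real \<beta>) \<partial>lborel)"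
      by (simp add: set_lebesgue_integral_def)
    also have "\<dots> = (\<integral>\<beta>. v \<beta> *\<^sub>R (z powr complex_of_real \<beta>) \<partial>lborel)"
      by (intro Bochner_Integration.integral_cong) (auto simp: v_def scaleR_conv_of_real)
    also have "\<dots> = (\<integral>\<beta>. z powr of_real \<beta> \<partial>N)"
      by (rule dens[symmetric]) (unfold powr_def, measurable)
    finally show ?thesis unfolding N .
  qed
  have "\<mu> 1 > 0" using nn[of 1] \<mu>1 by simp
  moreover have "(\<mu> \<longlongrightarrow> \<mu> 1) (at 1 within {0..1})" using cont by (auto simp: continuous_on)
  ultimately have "\<forall>\<^sub>F b in at 1 within {0..1}. \<mu> 1 / 2 < \<mu> b" by (intro order_tendstoD(1)) auto
  then obtain d where d: "d > 0" "\<And>b. b \<in> {0..1} \<Longrightarrow> b \<noteq> 1 \<Longrightarrow> dist b 1 < d \<Longrightarrow> \<mu> 1 / 2 < \<mu> b"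
    unfolding eventually_at by blast
  \<comment> \<open>Continuity and a positive value at 1 give density at least \<open>k\<close> on
    [1 - \<eta>, 1 - \<eta>/2], an interval inside [1/2, 1). There r^b \<ge> r^(1/2) for r \<ge> 1,
    while 1 - b \<ge> \<eta>/2 stays away from 0.\<close>
  define \<eta> where "\<eta> = min (1 / 2) (d / 2)"
  define k where "k = \<mu> 1 / 2"
  have \<eta>: "0 < \<eta>" "\<eta> \<le> 1 / 2" "\<eta> < d" using d(1) by (auto simp: \<eta>_def)
  have k: "k > 0" using \<open>\<mu> 1 > 0\<close> by (simp add: k_def)
  have low: "k \<le> v b" if "b \<in> {1 - \<eta>..1 - \<eta> / 2}" for b
  proof -
    have "b \<in> {0..1}" "b \<noteq> 1" "dist b 1 < d" using that \<eta> by (auto simp: dist_real_def)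
    then show ?thesis using d(2)[of b] by (simp add: v_def k_def)
  qed
  have fin: "finite_measure N"
  proof (rule finite_measureI)
    have "emeasure N (space N) = (\<integral>\<^sup>+b. ennreal (v b) \<partial>lborel)"
      unfolding N_def by (simp add: emeasure_density)
    also have "\<dots> = ennreal (\<integral>b. v b \<partial>lborel)" using vi v0 by (intro nn_integral_eq_integral) auto
    finally show "emeasure N (space N) \<noteq> \<infinity>" by simp
  qed
  have kint: "(\<integral>b. indicator {1 - \<eta>..1 - \<eta> / 2} b * x \<partial>lborel) = \<eta> / 2 * x" for x :: real using \<eta> by simp
  have ki: "integrable lborel (\<lambda>b. indicator {1 - \<eta>..1 - \<eta> / 2} b * x)" for x :: real
    by (intro integrable_mult_left) (auto intro!: integrable_real_indicator simp: emeasure_lborel_Icc_eq)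
  have vri: "integrable lborel (\<lambda>b. v b * f b)" if "f \<in> borel_measurable borel" "\<And>b. b \<in> {0..1} \<Longrightarrow> \<bar>f b\<bar> \<le> K" for f K
  proof (rule Bochner_Integration.integrable_bound)
    show "integrable lborel (\<lambda>b. v b * K)" using vi by simp
    show "(\<lambda>b. v b * f b) \<in> borel_measurable lborel" using that(1) by measurable
    show "AE b in lborel. norm (v b * f b) \<le> norm (v b * K)"
      using that(2) v0 by (intro AE_I2) (force simp: v_def indicator_def abs_mult intro!: mult_left_mono)
  qed
  have powr_bd: "r powr b \<le> r" "\<bar>(1 - b) * r powr b\<bar> \<le> r" if "r \<ge> 1" "b \<in> {0..1}" for r b :: real
  proof -
    show 1: "r powr b \<le> r" using powr_mono[of b 1 r] that by simp
    have "\<bar>1 - b\<bar> * r powr b \<le> 1 * r" using that 1 by (intro mult_mono) auto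
    then show "\<bar>(1 - b) * r powr b\<bar> \<le> r" by (simp add: abs_mult)
  qed
  define m where "m = measure N (space N)"
  have m_eq: "m = (\<integral>b. v b \<partial>lborel)" using dens[of "\<lambda>_. 1::real"] by (simp add: m_def)
  have "weight_measure N"
  proof (intro weight_measure.intro weight_measure_axioms.intro fin)
    show "sets N = sets borel" by (simp add: N_def)
    have "AE b in lborel. b \<noteq> (0::real)" "AE b in lborel. b \<noteq> (1::real)" by (rule AE_lborel_singleton)+
    then have "AE b in lborel. 0 < ennreal (v b) \<longrightarrow> 0 < b \<and> b < 1"
      by eventually_elim (auto simp: v_def indicator_def)
    then show "AE b in N. 0 < b \<and> b < 1"
      unfolding N_def by (subst AE_density) auto
    have "0 < \<eta> / 2 * k" using \<eta> k by simp
    also have "\<dots> = (\<integral>b. indicator {1 - \<eta>..1 - \<eta> / 2} b * k \<partial>lborel)" by (rule kint[symmetric])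
    also have "\<dots> \<le> (\<integral>b. v b \<partial>lborel)"
      by (rule integral_mono[OF ki vi]) (use low v0 in \<open>auto simp: indicator_def\<close>)
    finally show m0: "0 < measure N (space N)" using m_eq by (simp add: m_def)
    \<comment> \<open>Length of that interval times a lower bound of \<open>v b * (1 - b)\<close> on
      it.\<close>
    define l where "l = \<eta> / 2 * (k * (\<eta> / 2))"
    have l: "l > 0" using \<eta> k by (simp add: l_def)
    show "\<exists>R C. \<forall>r\<ge>R. ln r \<le> C * (\<integral>b. (1 - b) * r powr b \<partial>N) \<and>
       (\<integral>b. r powr b \<partial>N) \<le> C * (1 + (\<integral>b. (1 - b) * r powr b \<partial>N))\<^sup>2"
    \<comment> \<open>\<open>2 / l\<close> stems from ln r \<le> 2 r^(1/2), and the other summand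
      from bounding the mixture by m r, the square of r^(1/2) times m.\<close>
    proof (rule exI[of _ 1], rule exI[of _ "2 / l + m / l\<^sup>2"], intro allI impI conjI)
      fix r :: real assume r: "r \<ge> 1"
      define K where "K = (\<integral>b. (1 - b) * r powr b \<partial>N)"
      have "l * r powr (1 / 2) = (\<integral>b. indicator {1 - \<eta>..1 - \<eta> / 2} b * (k * (\<eta> / 2) * r powr (1 / 2)) \<partial>lborel)"
        unfolding kint by (simp add: l_def)
      also have "\<dots> \<le> (\<integral>b. v b * ((1 - b) * r powr b) \<partial>lborel)"
      proof (rule integral_mono[OF ki vri])
        show "\<bar>(1 - b) * r powr b\<bar> \<le> r" if "b \<in> {0..1}" for b using powr_bd(2)[OF r that] .
        fix b :: real
        show "indicator {1 - \<eta>..1 - \<eta> / 2} b * (k * (\<eta> / 2) * r powr (1 / 2)) \<le> v b * ((1 - b) * r powr b)"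
        proof (cases "b \<in> {1 - \<eta>..1 - \<eta> / 2}")
          case True
          have "k * ((\<eta> / 2) * r powr (1 / 2)) \<le> v b * ((1 - b) * r powr b)"
            using True low[OF True] \<eta> k r by (intro mult_mono powr_mono) auto
          then show ?thesis using True by (simp add: mult.assoc)
        next
          case False
          then show ?thesis by (auto simp: v_def indicator_def nn intro!: mult_nonneg_nonneg)
        qed
      qed measurable
      also have "\<dots> = K" unfolding K_def by (subst dens) auto
      finally have K: "l * r powr (1 / 2) \<le> K" .
      have r2: "r powr (1 / 2) \<ge> 1" using r by (simp add: ge_one_powr_ge_zero)
      have K0: "K > 0" using K l r2 by (smt (verit) mult_pos_pos)
      have "ln r = 2 * ln (r powr (1 / 2))" using r by (simp add: ln_powr)
      also have "\<dots> \<le> 2 * r powr (1 / 2)" using ln_le_minus_one[of "r powr (1/2)"] r by simp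
      also have "\<dots> \<le> 2 * (K / l)" using K l by (simp add: field_simps)
      also have "\<dots> = 2 / l * K" by simp
      also have "\<dots> \<le> (2 / l + m / l\<^sup>2) * K" using K0 l m0 by (intro mult_right_mono) (auto simp: m_def)
      finally show "ln r \<le> (2 / l + m / l\<^sup>2) * (\<integral>b. (1 - b) * r powr b \<partial>N)" unfolding K_def .
      have "(\<integral>b. r powr b \<partial>N) = (\<integral>b. v b * r powr b \<partial>lborel)" by (subst dens) auto
      also have "\<dots> \<le> (\<integral>b. v b * r \<partial>lborel)"
      proof (rule integral_mono[OF vri])
        show "\<bar>r powr b\<bar> \<le> r" if "b \<in> {0..1}" for b using powr_bd(1)[OF r that] by simp
        show "integrable lborel (\<lambda>b. v b * r)" using vi by simp
        show "v b * r powr b \<le> v b * r" for b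
          using powr_bd(1)[OF r, of b] nn[of b] by (auto simp: v_def indicator_def intro!: mult_left_mono)
      qed measurable
      also have "\<dots> = m * r" using m_eq by simp
      also have "m * r = m * (r powr (1 / 2))\<^sup>2" using r by (simp add: power2_eq_square powr_add[symmetric])
      also have "m * (r powr (1 / 2))\<^sup>2 = m / l\<^sup>2 * (l * r powr (1 / 2))\<^sup>2" using l by (simp add: power_mult_distrib)
      also have "\<dots> \<le> (2 / l + m / l\<^sup>2) * (1 + K)\<^sup>2"
        using K K0 l m0 by (intro mult_mono power_mono) (auto simp: m_def)
      finally show "(\<integral>b. r powr b \<partial>N) \<le> (2 / l + m / l\<^sup>2) * (1 + (\<integral>b. (1 - b) * r powr b \<partial>N))\<^sup>2" unfolding K_def .
    qed
    show "\<exists>R C. \<forall>r\<ge>R. (\<integral>b. r powr b \<partial>N) * ln r \<le> C * r"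
    \<comment> \<open>The mixture is of exact order r / ln r, so no power can be gained: the density
      is at most B, and the integral of r^b over [0,1] is (r - 1) / ln r. Starting at r = 2 keeps
      the logarithm positive.\<close>
    proof (rule exI[of _ 2], rule exI[of _ "max B 0"], intro allI impI)
      fix r :: real assume r: "r \<ge> 2"
      have lnr: "ln r > 0" using r by simp
      have cr: "continuous_on {0..1} (\<lambda>b. r powr b)" using r by (intro continuous_intros) auto
      have "((\<lambda>b. r powr b) has_integral (r powr 1 / ln r - r powr 0 / ln r)) {0..1}"
      proof (rule fundamental_theorem_of_calculus)
        fix b :: real
        have "((\<lambda>b. r powr b / ln r) has_real_derivative r powr b) (at b within {0..1})"
          using lnr r by (auto intro!: derivative_eq_intros simp: powr_def)
        then show "((\<lambda>b. r powr b / ln r) has_vector_derivative r powr b) (at b within {0..1})"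
          by (simp add: has_real_derivative_iff_has_vector_derivative)
      qed simp
      then have I: "(LBINT b:{0..1}. r powr b) = (r - 1) / ln r"
        using set_borel_integral_eq_integral(2)[OF borel_integrable_atLeastAtMost'[OF cr]] r
        by (simp add: integral_unique diff_divide_distrib)
      have ii: "integrable lborel (\<lambda>b. indicator {0..1} b * r powr b)"
        using borel_integrable_atLeastAtMost'[OF cr] by (simp add: set_integrable_def)
      have "(\<integral>b. r powr b \<partial>N) = (\<integral>b. v b * r powr b \<partial>lborel)" by (subst dens) auto
      also have "\<dots> \<le> (\<integral>b. max B 0 * (indicator {0..1} b * r powr b) \<partial>lborel)"
      proof (rule integral_mono[OF vri])
        show "\<bar>r powr b\<bar> \<le> r" if "b \<in> {0..1}" for b using powr_bd(1)[of r b] that r by simp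
        show "integrable lborel (\<lambda>b. max B 0 * (indicator {0..1} b * r powr b))" using ii by simp
        show "v b * r powr b \<le> max B 0 * (indicator {0..1} b * r powr b)" for b
          using mult_right_mono[OF vB[of b], of "r powr b"] by (simp add: mult.assoc)
      qed measurable
      also have "\<dots> = max B 0 * ((r - 1) / ln r)" using I by (simp add: set_lebesgue_integral_def)
      finally have "(\<integral>b. r powr b \<partial>N) * ln r \<le> max B 0 * ((r - 1) / ln r) * ln r"
        using lnr by (intro mult_right_mono) auto
      also have "\<dots> = max B 0 * (r - 1)" using lnr by simp
      also have "\<dots> \<le> max B 0 * r" by (intro mult_left_mono) auto
      finally show "(\<integral>b. r powr b \<partial>N) * ln r \<le> max B 0 * r" .
    qed
  qed
  then show "weight_measure (continuous_weight_measure \<mu>)" unfolding N .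
qed

section \<open>Analytic extension of the density\<close>

text \<open>\<open>\<theta>0\<close> is the angle gained beyond the half plane.
  \<open>sectorial\<close> confines g to a sector around the positive axis, where Re g and |g| are
  comparable; \<open>sector_large\<close> gives decay at infinity, and \<open>sector_small\<close>
  makes g(z) / z integrable along rays at the origin.\<close>

locale sectorial_symbol = subordinator_symbol g for g +
  fixes \<theta>0 \<rho> c C :: real
  assumes \<theta>0: "0 < \<theta>0" "\<theta>0 < pi / 2" and \<rho>: "0 < \<rho>" "\<rho> < 1" and c: "c > 0"
    and sector_holo: "g holomorphic_on {z. z \<noteq> 0 \<and> \<bar>Arg z\<bar> \<le> pi / 2 + \<theta>0}"
    and sectorial: "\<And>z. z \<noteq> 0 \<Longrightarrow> \<bar>Arg z\<bar> \<le> pi / 2 + \<theta>0 \<Longrightarrow> c * norm (g z) \<le> Re (g z)"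
    and sector_large: "\<And>z. \<bar>Arg z\<bar> \<le> pi / 2 + \<theta>0 \<Longrightarrow> 1 \<le> norm z \<Longrightarrow> c * norm z powr \<rho> \<le> norm (g z)"
    and sector_small: "\<And>z. z \<noteq> 0 \<Longrightarrow> \<bar>Arg z\<bar> \<le> pi / 2 + \<theta>0 \<Longrightarrow> norm z \<le> 1 \<Longrightarrow> norm (g z) \<le> C * norm z powr \<rho>"
begin

definition SEC :: "complex set" where "SEC = {z. z \<noteq> 0 \<and> \<bar>Arg z\<bar> \<le> pi / 2 + \<theta>0}"

text \<open>The closed upper half of the enlarged sector together with 0, written as an intersection
  of two half planes so that its convexity is visible.\<close>

definition HS :: "complex set" where "HS = {z. 0 \<le> Im z \<and> 0 \<le> Re (z * cis (- \<theta>0))}"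

lemma HS_SEC: "z \<in> HS \<Longrightarrow> z \<noteq> 0 \<Longrightarrow> z \<in> SEC"
proof -
  assume z: "z \<in> HS" "z \<noteq> 0"
  have A: "0 \<le> Arg z" "Arg z \<le> pi"
    using z Arg_le_pi[of z] Arg_less_0[of z] by (auto simp: HS_def not_less[symmetric])
  have "z = of_real (norm z) * cis (Arg z)" using rcis_cmod_Arg[of z] by (simp add: rcis_def)
  then have "z * cis (- \<theta>0) = of_real (norm z) * cis (Arg z - \<theta>0)"
    by (metis (no_types) cis_mult mult.assoc uminus_add_conv_diff add.commute)
  then have "Re (z * cis (- \<theta>0)) = norm z * cos (Arg z - \<theta>0)" by simp
  then have "0 \<le> cos (Arg z - \<theta>0)" using z by (simp add: HS_def zero_le_mult_iff)
  have "Arg z - \<theta>0 \<le> pi / 2"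
  proof (rule ccontr)
    assume "\<not> Arg z - \<theta>0 \<le> pi / 2"
    then have "cos (Arg z - \<theta>0) < cos (pi / 2)"
      using A \<theta>0 by (intro cos_monotone_0_pi) auto
    then show False using \<open>0 \<le> cos (Arg z - \<theta>0)\<close> by simp
  qed
  then show ?thesis using A z by (simp add: SEC_def)
qed

lemma HS_convex: "convex HS"
proof -
  have "HS = {z. 0 \<le> Im z} \<inter> {z. 0 \<le> inner (cis \<theta>0) z}"
    by (auto simp: HS_def inner_complex_def algebra_simps)
  then show ?thesis by (simp add: convex_Int convex_halfspace_Im_ge convex_halfspace_ge)
qed

definition u :: complex where "u = cis (pi / 2 + \<theta>0)"

lemma u_eq: "Re u = - sin \<theta>0" "Im u = cos \<theta>0" "norm u = 1"
  by (simp_all add: u_def cos_add sin_add)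

lemma cos_\<theta>0: "cos \<theta>0 > 0" using \<theta>0 by (intro cos_gt_zero_pi) auto

text \<open>\<open>\<i>\<close> belongs to the vertical line and \<open>u\<close> to the boundary
  ray of the sector; the estimates common to both are proved once.\<close>

definition direction :: "complex \<Rightarrow> bool" where "direction v \<longleftrightarrow> v = \<i> \<or> v = u"

lemma direction_simps: "direction v \<Longrightarrow> norm v = 1" "direction v \<Longrightarrow> cos \<theta>0 \<le> Im v" "direction v \<Longrightarrow> Re v \<le> 0"
  using \<theta>0 sin_ge_zero[of \<theta>0] by (auto simp: direction_def u_eq)

lemma direction_HS: assumes "direction v" shows "v \<in> HS"
proof -
  have "u * cis (- \<theta>0) = \<i>" by (simp add: u_def cis_mult)
  moreover have "0 \<le> sin \<theta>0" using \<theta>0 by (intro sin_ge_zero) auto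
  ultimately show ?thesis using assms cos_\<theta>0 by (auto simp: direction_def HS_def u_eq)
qed

lemma ray_HS:
  assumes "direction v" "\<gamma> \<ge> 0" "r \<ge> 0"
  shows "of_real \<gamma> + of_real r * v \<in> HS"
proof -
  have v: "v \<in> HS" by (rule direction_HS[OF assms(1)])
  have "of_real \<gamma> \<in> HS" using assms(2) cos_\<theta>0 by (simp add: HS_def)
  moreover have "of_real r * v \<in> HS"
  proof -
    have "0 \<le> r * Re (v * cis (- \<theta>0))" using v assms(3) by (intro mult_nonneg_nonneg) (simp_all only: HS_def mem_Collect_eq)
    moreover have "Re (of_real r * v * cis (- \<theta>0)) = r * Re (v * cis (- \<theta>0))" by (simp add: algebra_simps)
    ultimately have "0 \<le> Re (of_real r * v * cis (- \<theta>0))" by metis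
    moreover have "0 \<le> Im (of_real r * v)" using v assms(3) by (simp add: HS_def)
    ultimately show ?thesis unfolding HS_def by blast
  qed
  ultimately show ?thesis by (auto simp: HS_def distrib_right)
qed

lemma ray_norm_ge:
  assumes "direction v" "r \<ge> 0"
  shows "r * cos \<theta>0 \<le> norm (of_real \<gamma> + of_real r * v)"
proof -
  have "r * cos \<theta>0 \<le> r * Im v" using direction_simps(2)[OF assms(1)] assms(2) by (rule mult_left_mono)
  also have "\<dots> \<le> norm (of_real \<gamma> + of_real r * v)"
    using abs_Im_le_cmod[of "of_real \<gamma> + of_real r * v"] by simp
  finally show ?thesis .
qed

lemma ray_SEC:
  assumes "direction v" "\<gamma> \<ge> 0" "r \<ge> 0" "\<gamma> > 0 \<or> r > 0"
  shows "of_real \<gamma> + of_real r * v \<in> SEC"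
proof (rule HS_SEC[OF ray_HS[OF assms(1-3)]])
  show "of_real \<gamma> + of_real r * v \<noteq> 0"
  proof (cases "r > 0")
    case True
    then have "0 < r * cos \<theta>0" using cos_\<theta>0 by simp
    then show ?thesis using ray_norm_ge[OF assms(1,3), of \<gamma>] by auto
  next
    case False
    then show ?thesis using assms by auto
  qed
qed

text \<open>An integrable profile for |\<open>Jf g \<tau>\<close>| on the sector: division by z
  turns the bound of order \<rho> near 0 into \<rho> - 1, and decay of order -\<rho> at infinity
  into -1 - \<rho>.\<close>

definition maj :: "real \<Rightarrow> real" where "maj x = (if x \<le> 1 then x powr (\<rho> - 1) else x powr (- 1 - \<rho>))"

lemma maj_antimono: assumes "0 < x" "x \<le> y" shows "maj y \<le> maj x"
proof -
  have "y powr (\<rho> - 1) \<le> x powr (\<rho> - 1)" "y powr (- 1 - \<rho>) \<le> x powr (- 1 - \<rho>)"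
    using assms \<rho> by (auto intro!: powr_mono2')
  moreover have "y powr (- 1 - \<rho>) \<le> 1" if "1 < y" using that \<rho> powr_mono[of "-1-\<rho>" 0 y] by simp
  moreover have "1 \<le> x powr (\<rho> - 1)" if "x \<le> 1" using that assms \<rho> powr_mono'[of "\<rho> - 1" 0 x] by simp
  ultimately show ?thesis using assms by (fastforce simp: maj_def)
qed

lemma maj_nonneg: "maj x \<ge> 0" by (simp add: maj_def)

lemma maj_integrable: "integrable lborel (\<lambda>x. indicator {0<..} x * maj x)"
proof -
  have "(\<lambda>x::real. x powr (\<rho> - 1)) absolutely_integrable_on {0..1}"
    using has_integral_powr_from_0[of "\<rho> - 1" 1] \<rho>
    by (intro nonnegative_absolutely_integrable_1) (auto simp: has_integral_iff)
  then have "integrable lebesgue (\<lambda>x. indicator {0..1} x * x powr (\<rho> - 1))"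
    unfolding set_integrable_def by simp
  then have 1: "integrable lborel (\<lambda>x. indicator {0..1} x * x powr (\<rho> - 1))"
    by (subst (asm) integrable_completion) auto
  note Bochner_Integration.integrable_add[OF 1 powr_tail_integrable[OF \<rho>(1)]]
  then show ?thesis
  proof (rule Bochner_Integration.integrable_bound)
    show "(\<lambda>x. indicator {0<..} x * maj x) \<in> borel_measurable lborel" unfolding maj_def by measurable
  qed (auto simp: maj_def indicator_def)
qed

definition K :: "real \<Rightarrow> real" where "K \<tau> = max (max C 0) (2 / ((\<tau> * c)\<^sup>2 * c))"

lemma K_nonneg: "K \<tau> \<ge> 0" by (simp add: K_def)

text \<open>Near 0 the exponential is bounded by 1. For large |z| the inequality exp(-x) \<le> 2 /
  x^2 with x = \<tau> c |g z| leaves a multiple of 1 / |g z|, which \<open>sector_large\<close>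
  bounds; this is the origin of the second entry of \<open>K\<close>.\<close>

lemma Jf_sector_bound:
  assumes \<tau>: "\<tau> > 0" and z: "z \<in> SEC"
  shows "norm (Jf g \<tau> z) \<le> K \<tau> * maj (norm z)"
proof -
  have z': "z \<noteq> 0" "\<bar>Arg z\<bar> \<le> pi / 2 + \<theta>0" using z by (auto simp: SEC_def)
  have r: "norm z > 0" using z' by simp
  have R: "c * norm (g z) \<le> Re (g z)" by (rule sectorial[OF z'])
  have R0: "0 \<le> Re (g z)" using R c order.trans[of 0 "c * norm (g z)"] by simp
  have n: "norm (Jf g \<tau> z) = exp (- \<tau> * Re (g z)) * norm (g z) / norm z"
    by (simp add: Jf_def norm_mult norm_divide)
  show ?thesis
  proof (cases "norm z \<le> 1")
    case True
    have "exp (- \<tau> * Re (g z)) * norm (g z) \<le> 1 * (C * norm z powr \<rho>)"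
      using sector_small[OF z' True] R0 \<tau> by (intro mult_mono) auto
    also have "\<dots> \<le> K \<tau> * norm z powr \<rho>" by (simp add: K_def mult_right_mono)
    finally have "norm (Jf g \<tau> z) \<le> K \<tau> * norm z powr \<rho> / norm z"
      unfolding n by (rule divide_right_mono) simp
    then show ?thesis using True r by (simp add: maj_def powr_diff)
  next
    case False
    define y where "y = norm (g z)"
    have y: "c * norm z powr \<rho> \<le> y" unfolding y_def using False by (intro sector_large z') auto
    have y0: "y > 0" using y c r by (intro less_le_trans[OF _ y]) auto
    define x where "x = \<tau> * c * y"
    have x: "x > 0" using \<tau> c y0 by (simp add: x_def)
    have "x\<^sup>2 / 2 \<le> exp x" using exp_lower_Taylor_quadratic[of x] x by simp
    then have "exp (- x) \<le> 2 / x\<^sup>2" using x by (simp add: exp_minus field_simps)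
    moreover have "exp (- \<tau> * Re (g z)) \<le> exp (- x)"
      using mult_left_mono[OF R, of \<tau>] \<tau> by (simp add: x_def y_def mult.assoc)
    ultimately have "exp (- \<tau> * Re (g z)) \<le> 2 / x\<^sup>2" by linarith
    then have "exp (- \<tau> * Re (g z)) * y \<le> 2 / x\<^sup>2 * y" using y0 by (intro mult_right_mono) auto
    also have "\<dots> = 2 / (\<tau> * c)\<^sup>2 / y" using y0 by (simp add: x_def power2_eq_square field_simps)
    also have "\<dots> \<le> 2 / (\<tau> * c)\<^sup>2 / (c * norm z powr \<rho>)"
      using y y0 c r by (intro divide_left_mono mult_pos_pos) auto
    also have "\<dots> = 2 / ((\<tau> * c)\<^sup>2 * c) * norm z powr (- \<rho>)" by (simp add: powr_minus field_simps)
    also have "\<dots> \<le> K \<tau> * norm z powr (- \<rho>)" unfolding K_def by (intro mult_right_mono) auto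
    finally have "norm (Jf g \<tau> z) \<le> K \<tau> * norm z powr (- \<rho>) / norm z"
      unfolding n y_def by (rule divide_right_mono) simp
    moreover have "norm z powr (- \<rho>) / norm z = maj (norm z)"
      using r False by (simp add: maj_def powr_diff powr_minus field_simps)
    ultimately show ?thesis by (simp only: times_divide_eq_right[symmetric])
  qed
qed

lemma Jf_holo_SEC: "Jf g \<tau> holomorphic_on SEC"
  unfolding Jf_def using sector_holo unfolding SEC_def[symmetric]
  by (intro holomorphic_intros) (auto simp: SEC_def)

definition ray :: "complex \<Rightarrow> real \<Rightarrow> real \<Rightarrow> complex" where
  "ray v \<gamma> r = of_real \<gamma> + of_real r * v"

definition dom :: "real \<Rightarrow> real \<Rightarrow> real" where
  "dom \<tau> r = K \<tau> * (indicator {0<..} (r * cos \<theta>0) * maj (r * cos \<theta>0))"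

lemma dom_integrable: "integrable lborel (dom \<tau>)"
proof -
  have "integrable lborel (\<lambda>r. indicator {0<..} (0 + cos \<theta>0 * r) * maj (0 + cos \<theta>0 * r))"
    by (rule lborel_integrable_real_affine[OF maj_integrable]) (use cos_\<theta>0 in simp)
  then show ?thesis unfolding dom_def by (simp add: mult.commute)
qed

lemma Jf_ray_bound:
  assumes "\<tau> > 0" "direction v" "\<gamma> \<ge> 0" "r > 0"
  shows "norm (Jf g \<tau> (ray v \<gamma> r)) \<le> dom \<tau> r"
proof -
  have p: "r * cos \<theta>0 > 0" using assms cos_\<theta>0 by simp
  have "norm (Jf g \<tau> (ray v \<gamma> r)) \<le> K \<tau> * maj (norm (ray v \<gamma> r))"
    unfolding ray_def using assms by (intro Jf_sector_bound ray_SEC) auto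
  also have "\<dots> \<le> K \<tau> * maj (r * cos \<theta>0)"
    unfolding ray_def using ray_norm_ge[OF assms(2), of r \<gamma>] p assms(4)
    by (intro mult_left_mono maj_antimono K_nonneg) auto
  finally show ?thesis using p by (simp add: dom_def)
qed

text \<open>The direction v, the derivative of the ray, is left out of the integrand and restored
  outside, as in \<open>u * E u \<gamma> \<tau> t\<close>.\<close>

definition E :: "complex \<Rightarrow> real \<Rightarrow> real \<Rightarrow> complex \<Rightarrow> complex" where
  "E v \<gamma> \<tau> t = (\<integral>r. indicator {0<..} r *\<^sub>R (exp (ray v \<gamma> r * t) * Jf g \<tau> (ray v \<gamma> r)) \<partial>lborel)"

lemma ray_cont: "continuous_on S (ray v \<gamma>)"
  unfolding ray_def by (intro continuous_intros)

lemma Jf_ray_cont: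
  assumes "direction v" "\<gamma> \<ge> 0" "\<gamma> > 0 \<or> (\<forall>r\<in>S. r > 0)" "S \<subseteq> {0..}"
  shows "continuous_on S (\<lambda>r. Jf g \<tau> (ray v \<gamma> r))"
  by (rule continuous_on_compose2[OF holomorphic_on_imp_continuous_on[OF Jf_holo_SEC] ray_cont])
     (use assms in \<open>auto simp: ray_def intro!: ray_SEC\<close>)

lemma E_measurable:
  assumes "direction v" "\<gamma> \<ge> 0"
  shows "(\<lambda>r. indicator {0<..} r *\<^sub>R (exp (ray v \<gamma> r * t) * Jf g \<tau> (ray v \<gamma> r))) \<in> borel_measurable borel"
proof (rule borel_measurable_continuous_on_indicator)
  show "continuous_on {0<..} (\<lambda>r. exp (ray v \<gamma> r * t) * Jf g \<tau> (ray v \<gamma> r))"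
    by (intro continuous_intros ray_cont Jf_ray_cont) (use assms in auto)
qed simp

lemma E_bound:
  assumes "\<tau> > 0" "direction v" "\<gamma> \<ge> 0" "\<And>r. r > 0 \<Longrightarrow> Re (ray v \<gamma> r * t) \<le> b"
  shows "norm (indicator {0<..} r *\<^sub>R (exp (ray v \<gamma> r * t) * Jf g \<tau> (ray v \<gamma> r))) \<le> exp b * dom \<tau> r"
proof (cases "r > 0")
  case True
  have "exp (Re (ray v \<gamma> r * t)) * norm (Jf g \<tau> (ray v \<gamma> r)) \<le> exp b * dom \<tau> r"
    using assms True by (intro mult_mono Jf_ray_bound) auto
  then show ?thesis using True by (simp add: norm_mult)
qed (simp add: dom_def K_nonneg maj_nonneg)

lemma E_integrable:
  assumes "\<tau> > 0" "direction v" "\<gamma> \<ge> 0" "\<And>r. r > 0 \<Longrightarrow> Re (ray v \<gamma> r * t) \<le> b"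
  shows "integrable lborel (\<lambda>r. indicator {0<..} r *\<^sub>R (exp (ray v \<gamma> r * t) * Jf g \<tau> (ray v \<gamma> r)))"
proof (rule Bochner_Integration.integrable_bound)
  show "integrable lborel (\<lambda>r. exp b * dom \<tau> r)" using dom_integrable by simp
  show "(\<lambda>r. indicator {0<..} r *\<^sub>R (exp (ray v \<gamma> r * t) * Jf g \<tau> (ray v \<gamma> r))) \<in> borel_measurable lborel"
    using E_measurable[OF assms(2,3)] by simp
  show "AE r in lborel. norm (indicator {0<..} r *\<^sub>R (exp (ray v \<gamma> r * t) * Jf g \<tau> (ray v \<gamma> r))) \<le> norm (exp b * dom \<tau> r)"
    using E_bound[OF assms] by (intro AE_I2) (metis abs_ge_self order.trans real_norm_def)
qed

lemma real_ray_Re: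
  assumes "direction v" "r > 0" "t > 0" "\<gamma> \<ge> 0"
  shows "Re (ray v \<gamma> r * of_real t) \<le> \<gamma> * t"
proof -
  have "r * Re v * t \<le> 0" using direction_simps(3)[OF assms(1)] assms by (simp add: mult_nonneg_nonpos mult_nonpos_nonneg)
  then show ?thesis by (simp add: ray_def distrib_right)
qed

lemma segment_integral:
  assumes d: "direction v" and g: "\<gamma> > 0" and L: "L > 0" and f: "continuous_on SEC f"
  shows "contour_integral (linepath (of_real \<gamma>) (ray v \<gamma> L)) f = v * integral {0..L} (\<lambda>r. f (ray v \<gamma> r))"
proof -
  have c: "continuous_on {0..L} (\<lambda>r. f (ray v \<gamma> r))"
    by (rule continuous_on_compose2[OF f ray_cont]) (use d g in \<open>auto simp: ray_def intro!: ray_SEC\<close>)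
  then have "((\<lambda>r. f (ray v \<gamma> r)) has_integral integral {0..L} (\<lambda>r. f (ray v \<gamma> r))) (cbox 0 L)"
    by (simp add: integrable_integral integrable_continuous_interval)
  from has_integral_affinity'[OF this L, of 0]
  have "((\<lambda>x. f (ray v \<gamma> (L * x))) has_integral (integral {0..L} (\<lambda>r. f (ray v \<gamma> r)) /\<^sub>R L)) {0..1}"
    using L by simp
  from has_integral_mult_left[OF this, of "of_real L * v"]
  have "((\<lambda>x. f (ray v \<gamma> (L * x)) * (of_real L * v)) has_integral v * integral {0..L} (\<lambda>r. f (ray v \<gamma> r))) {0..1}"
    using L by (simp add: scaleR_conv_of_real field_simps)
  moreover have "linepath (of_real \<gamma>) (ray v \<gamma> L) x = ray v \<gamma> (L * x)" for x
    by (simp add: linepath_def ray_def scaleR_conv_of_real algebra_simps)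
  moreover have "ray v \<gamma> L - of_real \<gamma> = of_real L * v" by (simp add: ray_def)
  ultimately have "(f has_contour_integral v * integral {0..L} (\<lambda>r. f (ray v \<gamma> r))) (linepath (of_real \<gamma>) (ray v \<gamma> L))"
    by (simp add: has_contour_integral_linepath)
  then show ?thesis by (rule contour_integral_unique)
qed

lemma ray_integral_limit:
  assumes \<tau>: "\<tau> > 0" and d: "direction v" and g: "\<gamma> > 0" and t: "t > 0" and L: "filterlim L at_top sequentially"
  shows "(\<lambda>n. integral {0..L n} (\<lambda>r. exp (ray v \<gamma> r * of_real t) * Jf g \<tau> (ray v \<gamma> r))) \<longlonglongrightarrow> E v \<gamma> \<tau> (of_real t)"
proof -
  define f where "f r = exp (ray v \<gamma> r * of_real t) * Jf g \<tau> (ray v \<gamma> r)" for r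
  have b: "\<And>r. r > 0 \<Longrightarrow> Re (ray v \<gamma> r * of_real t) \<le> \<gamma> * t" using real_ray_Re[OF d _ t] g by simp
  have i: "integrable lborel (\<lambda>r. indicator {0<..} r *\<^sub>R f r)"
    unfolding f_def using E_integrable[OF \<tau> d _ b] g by simp
  have fc: "continuous_on {0..x} f" for x
    unfolding f_def by (intro continuous_intros ray_cont Jf_ray_cont d) (use g in auto)
  have eq: "integral {0..x} f = (\<integral>r. indicator {..x} r *\<^sub>R (indicator {0<..} r *\<^sub>R f r) \<partial>lborel)" for x
  proof -
    have "integral {0..x} f = (\<integral>r. indicator {0..x} r *\<^sub>R f r \<partial>lborel)"
      using set_borel_integral_eq_integral(2)[OF borel_integrable_atLeastAtMost'[OF fc]] by (simp add: set_lebesgue_integral_def)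
    also have "\<dots> = (\<integral>r. indicator {..x} r *\<^sub>R (indicator {0<..} r *\<^sub>R f r) \<partial>lborel)"
    proof (rule integral_cong_AE)
      show "(\<lambda>r. indicator {0..x} r *\<^sub>R f r) \<in> borel_measurable lborel"
        using borel_measurable_continuous_on_indicator[OF _ fc, of x] by simp
      show "(\<lambda>r. indicator {..x} r *\<^sub>R (indicator {0<..} r *\<^sub>R f r)) \<in> borel_measurable lborel"
        by (intro borel_measurable_scaleR borel_measurable_integrable[OF i]) auto
      have "AE r in lborel. r \<noteq> (0::real)" by (rule AE_lborel_singleton)
      then show "AE r in lborel. indicator {0..x} r *\<^sub>R f r = indicator {..x} r *\<^sub>R (indicator {0<..} r *\<^sub>R f r)"
        by eventually_elim (auto simp: indicator_def)
    qed
    finally show ?thesis .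
  qed
  have "(\<lambda>n. \<integral>r. indicator {..L n} r *\<^sub>R (indicator {0<..} r *\<^sub>R f r) \<partial>lborel) \<longlonglongrightarrow> (\<integral>r. indicator {0<..} r *\<^sub>R f r \<partial>lborel)"
  proof (rule integral_dominated_convergence[OF _ _ integrable_norm[OF i]])
    show "(\<lambda>r. indicator {..L n} r *\<^sub>R (indicator {0<..} r *\<^sub>R f r)) \<in> borel_measurable lborel" for n
      by (intro borel_measurable_scaleR borel_measurable_integrable[OF i]) auto
    show "AE r in lborel. (\<lambda>n. indicator {..L n} r *\<^sub>R (indicator {0<..} r *\<^sub>R f r)) \<longlonglongrightarrow> indicator {0<..} r *\<^sub>R f r"
    proof (intro AE_I2 tendsto_eventually)
      fix r :: real
      have "\<forall>\<^sub>F n in sequentially. L n \<ge> r" using L by (simp add: filterlim_at_top)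
      then show "\<forall>\<^sub>F n in sequentially. indicator {..L n} r *\<^sub>R (indicator {0<..} r *\<^sub>R f r) = indicator {0<..} r *\<^sub>R f r"
        by eventually_elim simp
    qed
  qed (use i in \<open>auto simp: indicator_def intro: borel_measurable_integrable\<close>)
  then show ?thesis unfolding E_def f_def[symmetric] eq .
qed

text \<open>The triangle with vertices \<open>\<gamma>\<close>, \<open>\<gamma> + \<i> R\<close> and \<open>\<gamma> + (R / cos \<theta>0) u\<close> avoids the origin, and the
  integral over its horizontal side vanishes as \<open>R\<close> grows.\<close>

lemma rotate_ray:
  assumes \<tau>: "\<tau> > 0" and g: "\<gamma> > 0" and t: "t > 0"
  shows "\<i> * E \<i> \<gamma> \<tau> (of_real t) = u * E u \<gamma> \<tau> (of_real t)"
proof -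
  define f where "f z = exp (z * of_real t) * Jf g \<tau> z" for z
  have fh: "f holomorphic_on SEC" unfolding f_def by (intro holomorphic_intros Jf_holo_SEC)
  have fc: "continuous_on SEC f" using fh by (rule holomorphic_on_imp_continuous_on)
  have di: "direction \<i>" "direction u" by (auto simp: direction_def)
  \<comment> \<open>Division by cos \<theta>0 = Im u puts both far vertices at the same
    height.\<close>
  define a b e where "a = complex_of_real \<gamma>" and "b n = ray \<i> \<gamma> (real (Suc n))" and "e n = ray u \<gamma> (real (Suc n) / cos \<theta>0)" for n
  have HSg: "z \<in> SEC" if "z \<in> HS" "z \<noteq> 0" for z using HS_SEC that .
  have inHS: "a \<in> HS" "b n \<in> HS" "e n \<in> HS" for n
    using ray_HS[OF di(1), of \<gamma> 0] ray_HS[OF di(1), of \<gamma> "real (Suc n)"] ray_HS[OF di(2), of \<gamma> "real (Suc n) / cos \<theta>0"] g cos_\<theta>0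
    by (auto simp: a_def b_def e_def ray_def)
  \<comment> \<open>The line through \<gamma> in direction u is where the inner product with cis
    \<theta>0 equals \<gamma> cos \<theta>0. The half plane on its far side contains the triangles
    but excludes 0.\<close>
  define HS' where "HS' = HS \<inter> {z. \<gamma> * cos \<theta>0 \<le> inner (cis \<theta>0) z}"
  have HS'_sub: "HS' \<subseteq> SEC"
  proof
    fix z assume z: "z \<in> HS'"
    have "0 < \<gamma> * cos \<theta>0" using g cos_\<theta>0 by simp
    then have "z \<noteq> 0" using z by (auto simp: HS'_def)
    then show "z \<in> SEC" using z HSg by (simp add: HS'_def)
  qed
  have HS'_conv: "convex HS'" unfolding HS'_def by (intro convex_Int HS_convex convex_halfspace_ge)
  have sin0: "0 \<le> sin \<theta>0" using \<theta>0 by (intro sin_ge_zero) auto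
  have "inner (cis \<theta>0) (e n) = \<gamma> * cos \<theta>0" for n
    using cos_\<theta>0 by (simp add: e_def ray_def inner_complex_def u_eq field_simps)
  then have verts: "{a, b n, e n} \<subseteq> HS'" for n
    using inHS(1) inHS(2,3)[of n] sin0 cos_\<theta>0 by (auto simp: HS'_def a_def b_def ray_def inner_complex_def algebra_simps)
  have hull: "convex hull {a, b n, e n} \<subseteq> SEC" for n
    using hull_minimal[of "{a, b n, e n}" HS' convex] verts HS'_conv HS'_sub by blast
  have seg: "closed_segment x y \<subseteq> SEC" if "{x, y} \<subseteq> {a, b n, e n}" for x y n
    using hull[of n] hull_mono[OF that, of convex] unfolding segment_convex_hull by blast
  have ci: "f contour_integrable_on (linepath x y)" if "{x, y} \<subseteq> {a, b n, e n}" for x y n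
    by (rule contour_integrable_continuous_linepath[OF continuous_on_subset[OF fc seg[OF that]]])
  have tri: "contour_integral (linepath a (b n)) f + contour_integral (linepath (b n) (e n)) f + contour_integral (linepath (e n) a) f = 0" for n
  proof -
    have "(f has_contour_integral 0) (linepath a (b n) +++ linepath (b n) (e n) +++ linepath (e n) a)"
      by (rule Cauchy_theorem_triangle[OF holomorphic_on_subset[OF fh hull]])
    then have "contour_integral (linepath a (b n) +++ linepath (b n) (e n) +++ linepath (e n) a) f = 0"
      by (rule contour_integral_unique)
    then show ?thesis using ci[of a "b n" n] ci[of "b n" "e n" n] ci[of "e n" a n] by (simp add: contour_integrable_joinI add.assoc)
  qed
  have rev: "contour_integral (linepath (e n) a) f = - contour_integral (linepath a (e n)) f" for n
    by (rule contour_integral_reverse_linepath[OF continuous_on_subset[OF fc seg[of _ _ n]]]) auto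
  have A: "contour_integral (linepath a (b n)) f = \<i> * integral {0..real (Suc n)} (\<lambda>r. f (ray \<i> \<gamma> r))" for n
    unfolding a_def b_def by (rule segment_integral[OF di(1) g _ fc]) simp
  have B: "contour_integral (linepath a (e n)) f = u * integral {0..real (Suc n) / cos \<theta>0} (\<lambda>r. f (ray u \<gamma> r))" for n
    unfolding a_def e_def using cos_\<theta>0 by (intro segment_integral[OF di(2) g _ fc]) simp
  have top: "norm (contour_integral (linepath (b n) (e n)) f) \<le>
      (exp (\<gamma> * t) * (K \<tau> * maj (real (Suc n)))) * (real (Suc n) * (sin \<theta>0 / cos \<theta>0))" for n
  proof -
    have Im_eq: "Im (b n) = real (Suc n)" "Im (e n) = real (Suc n)"
      using cos_\<theta>0 by (auto simp: b_def e_def ray_def u_eq)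
    have Re_le: "Re (b n) \<le> \<gamma>" "Re (e n) \<le> \<gamma>"
      using sin0 cos_\<theta>0 by (auto simp: b_def e_def ray_def u_eq)
    have dist: "norm (e n - b n) = real (Suc n) * (sin \<theta>0 / cos \<theta>0)"
    proof -
      have "e n - b n = of_real (- (real (Suc n) * (sin \<theta>0 / cos \<theta>0)))"
        using cos_\<theta>0 by (simp add: b_def e_def ray_def complex_eq_iff u_eq)
      then show ?thesis using sin0 cos_\<theta>0 by (simp del: of_real_minus of_real_mult of_real_divide)
    qed
    have "norm (contour_integral (linepath (b n) (e n)) f) \<le> (exp (\<gamma> * t) * (K \<tau> * maj (real (Suc n)))) * norm (e n - b n)"
    proof (rule contour_integral_bound_linepath)
      show "f contour_integrable_on linepath (b n) (e n)" by (rule ci[of _ _ n]) auto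
      show "0 \<le> exp (\<gamma> * t) * (K \<tau> * maj (real (Suc n)))" using K_nonneg maj_nonneg by simp
      fix z assume z: "z \<in> closed_segment (b n) (e n)"
      have zS: "z \<in> SEC" using seg[of "b n" "e n" n] z by auto
      have "closed_segment (b n) (e n) = {z. Im z = Im (b n) \<and> Re z \<in> closed_segment (Re (b n)) (Re (e n))}"
        by (rule closed_segment_same_Im) (simp add: Im_eq)
      then have "Im z = real (Suc n)" "Re z \<in> closed_segment (Re (b n)) (Re (e n))" using z Im_eq by auto
      moreover have "closed_segment (Re (b n)) (Re (e n)) \<subseteq> {..\<gamma>}"
        using Re_le by (intro closed_segment_subset) auto
      ultimately have zz: "Re z \<le> \<gamma>" "real (Suc n) \<le> norm z" using abs_Im_le_cmod[of z] by auto
      have "norm (Jf g \<tau> z) \<le> K \<tau> * maj (norm z)" by (rule Jf_sector_bound[OF \<tau> zS])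
      also have "\<dots> \<le> K \<tau> * maj (real (Suc n))" using zz by (intro mult_left_mono maj_antimono K_nonneg) auto
      finally have J: "norm (Jf g \<tau> z) \<le> K \<tau> * maj (real (Suc n))" .
      have "norm (f z) = exp (Re z * t) * norm (Jf g \<tau> z)" by (simp add: f_def norm_mult)
      also have "\<dots> \<le> exp (\<gamma> * t) * (K \<tau> * maj (real (Suc n)))"
        using zz t J by (intro mult_mono) auto
      finally show "norm (f z) \<le> exp (\<gamma> * t) * (K \<tau> * maj (real (Suc n)))" .
    qed
    then show ?thesis by (simp only: dist)
  qed
  have toplim: "(\<lambda>n. contour_integral (linepath (b n) (e n)) f) \<longlonglongrightarrow> 0"
  proof (rule Lim_null_comparison[OF always_eventually[OF allI[OF top]]])
    \<comment> \<open>The horizontal side grows in proportion to its height R, while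
      \<open>maj R\<close> decays with exponent -1 - \<rho>; the product still tends to 0.\<close>
    have "maj (real (Suc n)) * real (Suc n) = real (Suc n) powr (- \<rho>)" for n
    proof (cases "n = 0")
      case False
      then have "maj (real (Suc n)) * real (Suc n) = real (Suc n) powr (- 1 - \<rho>) * real (Suc n) powr 1"
        by (simp add: maj_def)
      also have "\<dots> = real (Suc n) powr (- \<rho>)" by (subst powr_add[symmetric]) simp
      finally show ?thesis .
    qed (simp add: maj_def)
    then have "(\<lambda>n. (exp (\<gamma> * t) * (K \<tau> * maj (real (Suc n)))) * (real (Suc n) * (sin \<theta>0 / cos \<theta>0)))
        = (\<lambda>n. (exp (\<gamma> * t) * K \<tau> * (sin \<theta>0 / cos \<theta>0)) * real (Suc n) powr (- \<rho>))"
      by (intro ext) (metis (no_types, opaque_lifting) mult.assoc mult.commute)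
    moreover have "(\<lambda>n. real (Suc n) powr (- \<rho>)) \<longlonglongrightarrow> 0" using \<rho>(1) by real_asymp
    from tendsto_mult[OF tendsto_const this]
    have "(\<lambda>n. (exp (\<gamma> * t) * K \<tau> * (sin \<theta>0 / cos \<theta>0)) * real (Suc n) powr (- \<rho>)) \<longlonglongrightarrow> (exp (\<gamma> * t) * K \<tau> * (sin \<theta>0 / cos \<theta>0)) * 0" .
    ultimately show "(\<lambda>n. (exp (\<gamma> * t) * (K \<tau> * maj (real (Suc n)))) * (real (Suc n) * (sin \<theta>0 / cos \<theta>0))) \<longlonglongrightarrow> 0" by simp
  qed
  have l1: "filterlim (\<lambda>n. real (Suc n)) at_top sequentially" by real_asymp
  have l2: "filterlim (\<lambda>n. real (Suc n) / cos \<theta>0) at_top sequentially" using cos_\<theta>0 by real_asymp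
  have "(\<lambda>n. contour_integral (linepath a (b n)) f + contour_integral (linepath (b n) (e n)) f - contour_integral (linepath a (e n)) f)
      \<longlonglongrightarrow> \<i> * E \<i> \<gamma> \<tau> (of_real t) + 0 - u * E u \<gamma> \<tau> (of_real t)"
    unfolding A B
    by (intro tendsto_intros toplim)
       (use ray_integral_limit[OF \<tau> di(1) g t l1] ray_integral_limit[OF \<tau> di(2) g t l2] in \<open>simp_all add: f_def\<close>)
  moreover have "(\<lambda>n. contour_integral (linepath a (b n)) f + contour_integral (linepath (b n) (e n)) f - contour_integral (linepath a (e n)) f) = (\<lambda>n. 0)"
    using tri rev by (simp add: fun_eq_iff)
  ultimately have "\<i> * E \<i> \<gamma> \<tau> (of_real t) + 0 - u * E u \<gamma> \<tau> (of_real t) = 0" using LIMSEQ_unique tendsto_const by metis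
  then show ?thesis by simp
qed

text \<open>Conjugation symmetry makes the lower half of the vertical line contribute the conjugate
  of the upper half, so the Bromwich integral is twice a real part; the factor \<i> of
  \<open>rotate_ray\<close> turns it into an imaginary part.\<close>

lemma phi_ray:
  assumes \<tau>: "\<tau> > 0" and g: "\<gamma> > 0" and t: "t > 0"
  shows "phi t \<tau> = Im (u * E u \<gamma> \<tau> (of_real t)) / pi"
proof -
  define f where "f \<omega> = exp (Complex \<gamma> \<omega> * of_real t) * Jf g \<tau> (Complex \<gamma> \<omega>)" for \<omega>
  interpret vertical_decay "Jf g \<tau>" by (rule vertical_decay_Jf[OF multiplier_g \<tau>])
  have f_cnj: "f (- \<omega>) = cnj (f \<omega>)" for \<omega>
  proof -
    have "Complex \<gamma> (- \<omega>) = cnj (Complex \<gamma> \<omega>)" by (simp add: complex_eq_iff)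
    then show ?thesis using cnj[of "Complex \<gamma> \<omega>"] g by (simp add: f_def exp_cnj)
  qed
  have fi: "integrable lborel f" unfolding f_def by (rule phi_formula(1)[OF g t \<tau>])
  have ray_i: "ray \<i> \<gamma> \<omega> = Complex \<gamma> \<omega>" for \<omega> by (simp add: ray_def complex_eq_iff)
  have EI: "E \<i> \<gamma> \<tau> (of_real t) = (\<integral>\<omega>. indicator {0<..} \<omega> *\<^sub>R f \<omega> \<partial>lborel)"
    by (simp add: E_def ray_i f_def)
  have i1: "integrable lborel (\<lambda>\<omega>. indicator {0<..} \<omega> *\<^sub>R f \<omega>)"
    using integrable_mult_indicator[OF _ fi, of "{0<..}"] by simp
  have i2: "integrable lborel (\<lambda>\<omega>. indicator {..<0} \<omega> *\<^sub>R f \<omega>)"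
    using integrable_mult_indicator[OF _ fi, of "{..<0}"] by simp
  have "(\<integral>\<omega>. f \<omega> \<partial>lborel) = (\<integral>\<omega>. indicator {0<..} \<omega> *\<^sub>R f \<omega> + indicator {..<0} \<omega> *\<^sub>R f \<omega> \<partial>lborel)"
  proof (rule integral_cong_AE)
    have "AE \<omega> in lborel. \<omega> \<noteq> (0::real)" by (rule AE_lborel_singleton)
    then show "AE \<omega> in lborel. f \<omega> = indicator {0<..} \<omega> *\<^sub>R f \<omega> + indicator {..<0} \<omega> *\<^sub>R f \<omega>"
      by eventually_elim (auto simp: indicator_def)
  qed (use fi i1 i2 in \<open>auto intro!: borel_measurable_integrable Bochner_Integration.integrable_add\<close>)
  also have "\<dots> = (\<integral>\<omega>. indicator {0<..} \<omega> *\<^sub>R f \<omega> \<partial>lborel) + (\<integral>\<omega>. indicator {..<0} \<omega> *\<^sub>R f \<omega> \<partial>lborel)"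
    by (rule Bochner_Integration.integral_add[OF i1 i2])
  also have "(\<integral>\<omega>. indicator {..<0} \<omega> *\<^sub>R f \<omega> \<partial>lborel) = (\<integral>\<omega>. indicator {..<0} (- \<omega>) *\<^sub>R f (- \<omega>) \<partial>lborel)"
    using lborel_integral_real_affine[of "-1" "\<lambda>\<omega>. indicator {..<0} \<omega> *\<^sub>R f \<omega>" 0] by simp
  also have "\<dots> = (\<integral>\<omega>. cnj (indicator {0<..} \<omega> *\<^sub>R f \<omega>) \<partial>lborel)"
    by (intro Bochner_Integration.integral_cong) (auto simp: f_cnj indicator_def)
  also have "\<dots> = cnj (\<integral>\<omega>. indicator {0<..} \<omega> *\<^sub>R f \<omega> \<partial>lborel)" by (rule Bochner_Integration.integral_cnj)
  finally have "(\<integral>\<omega>. f \<omega> \<partial>lborel) = of_real (2 * Re (E \<i> \<gamma> \<tau> (of_real t)))"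
    unfolding EI by (simp add: complex_add_cnj)
  then have "complex_of_real (phi t \<tau>) = of_real (Re (E \<i> \<gamma> \<tau> (of_real t)) / pi)"
    using phi_formula(2)[OF g t \<tau>] by (simp add: f_def)
  then have "phi t \<tau> = Re (E \<i> \<gamma> \<tau> (of_real t)) / pi" unfolding of_real_eq_iff .
  also have "Re (E \<i> \<gamma> \<tau> (of_real t)) = Im (\<i> * E \<i> \<gamma> \<tau> (of_real t))" by simp
  also have "\<dots> = Im (u * E u \<gamma> \<tau> (of_real t))" unfolding rotate_ray[OF \<tau> g t] ..
  finally show ?thesis .
qed

text \<open>Moving the vertex to the origin removes the factor exp(\<gamma> t), which would spoil
  boundedness for large t. The majorant \<open>dom\<close> is uniform in \<gamma> and integrable at
  0.\<close>

lemma phi_ray_0: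
  assumes \<tau>: "\<tau> > 0" and t: "t > 0"
  shows "phi t \<tau> = Im (u * E u 0 \<tau> (of_real t)) / pi"
proof -
  have du: "direction u" by (simp add: direction_def)
  define G where "G n = 1 / real (Suc n)" for n
  have G: "G n > 0" "G n \<le> 1" for n by (auto simp: G_def)
  have G0: "G \<longlonglongrightarrow> 0" unfolding G_def by real_asymp
  have "(\<lambda>n. E u (G n) \<tau> (of_real t)) \<longlonglongrightarrow> E u 0 \<tau> (of_real t)"
    unfolding E_def
  proof (rule integral_dominated_convergence)
    show "integrable lborel (\<lambda>r. exp t * dom \<tau> r)" using dom_integrable by simp
    show "(\<lambda>r. indicator {0<..} r *\<^sub>R (exp (ray u (G n) r * of_real t) * Jf g \<tau> (ray u (G n) r))) \<in> borel_measurable lborel" for n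
      using E_measurable[OF du less_imp_le[OF G(1)]] by simp
    show "(\<lambda>r. indicator {0<..} r *\<^sub>R (exp (ray u 0 r * of_real t) * Jf g \<tau> (ray u 0 r))) \<in> borel_measurable lborel"
      using E_measurable[OF du order_refl] by simp
    show "AE r in lborel. norm (indicator {0<..} r *\<^sub>R (exp (ray u (G n) r * of_real t) * Jf g \<tau> (ray u (G n) r))) \<le> exp t * dom \<tau> r" for n
    proof (rule AE_I2, rule E_bound[OF \<tau> du less_imp_le[OF G(1)]])
      fix r :: real assume "r > 0"
      then have "Re (ray u (G n) r * of_real t) \<le> G n * t" using real_ray_Re[OF du _ t] G(1)[of n] by (simp add: less_imp_le)
      also have "\<dots> \<le> 1 * t" using G(2)[of n] t by (intro mult_right_mono) auto
      finally show "Re (ray u (G n) r * of_real t) \<le> t" by simp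
    qed
    show "AE r in lborel. (\<lambda>n. indicator {0<..} r *\<^sub>R (exp (ray u (G n) r * of_real t) * Jf g \<tau> (ray u (G n) r)))
        \<longlonglongrightarrow> indicator {0<..} r *\<^sub>R (exp (ray u 0 r * of_real t) * Jf g \<tau> (ray u 0 r))"
    proof (rule AE_I2)
      fix r :: real
      have rl: "(\<lambda>n. ray u (G n) r) \<longlonglongrightarrow> ray u 0 r"
        unfolding ray_def by (intro tendsto_intros tendsto_of_real G0)
      show "(\<lambda>n. indicator {0<..} r *\<^sub>R (exp (ray u (G n) r * of_real t) * Jf g \<tau> (ray u (G n) r)))
        \<longlonglongrightarrow> indicator {0<..} r *\<^sub>R (exp (ray u 0 r * of_real t) * Jf g \<tau> (ray u 0 r))"
      proof (cases "r > 0")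
        case True
        have "(\<lambda>n. Jf g \<tau> (ray u (G n) r)) \<longlonglongrightarrow> Jf g \<tau> (ray u 0 r)"
          by (rule continuous_on_tendsto_compose[OF holomorphic_on_imp_continuous_on[OF Jf_holo_SEC] rl])
             (use True G in \<open>auto simp: ray_def less_imp_le intro!: ray_SEC[OF du] ray_SEC[OF du, of 0, simplified] always_eventually\<close>)
        then show ?thesis by (intro tendsto_intros rl)
      qed simp
    qed
  qed
  then have "(\<lambda>n. Im (u * E u (G n) \<tau> (of_real t)) / pi) \<longlonglongrightarrow> Im (u * E u 0 \<tau> (of_real t)) / pi"
    by (intro tendsto_divide tendsto_Im tendsto_mult tendsto_const) auto
  then have "(\<lambda>n. phi t \<tau>) \<longlonglongrightarrow> Im (u * E u 0 \<tau> (of_real t)) / pi"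
    unfolding phi_ray[OF \<tau> G(1) t, symmetric] .
  from LIMSEQ_unique[OF tendsto_const this] show ?thesis .
qed

text \<open>The angle of u t lies strictly between pi/2 and pi/2 + 2 \<theta>0, hence below 3
  pi/2.\<close>

lemma u_sector:
  assumes "t \<in> open_sector \<theta>0" shows "Re (u * t) < 0"
proof -
  have t: "t \<noteq> 0" "\<bar>Arg t\<bar> < \<theta>0" using assms by (auto simp: open_sector_def)
  have "t = of_real (norm t) * cis (Arg t)" using rcis_cmod_Arg[of t] by (simp add: rcis_def)
  then have "u * t = of_real (norm t) * cis (pi / 2 + (\<theta>0 + Arg t))"
    by (metis (no_types, opaque_lifting) u_def cis_mult mult.left_commute add.assoc)
  then have "Re (u * t) = - norm t * sin (\<theta>0 + Arg t)" by (simp add: cos_add)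
  moreover have "0 < sin (\<theta>0 + Arg t)" using t \<theta>0 by (intro sin_gt_zero) (auto simp: abs_less_iff)
  ultimately show ?thesis using t by simp
qed

lemma E_deriv:
  assumes \<tau>: "\<tau> > 0" and t: "Re (u * t) < 0"
  shows "\<exists>D. (E u 0 \<tau> has_field_derivative D) (at t)"
proof -
  have du: "direction u" by (simp add: direction_def)
  \<comment> \<open>Half of the distance of u t from the imaginary axis; as |u| = 1, the bound Re(u
    y) \<le> -k persists on the ball of this radius.\<close>
  define k where "k = - Re (u * t) / 2"
  have k: "k > 0" using t by (simp add: k_def)
  have ball: "Re (u * y) \<le> - k" if "y \<in> ball t k" for y
  proof -
    have "Re (u * y) = Re (u * t) + Re (u * (y - t))" by (simp add: algebra_simps)
    also have "Re (u * (y - t)) \<le> norm (u * (y - t))" by (rule complex_Re_le_cmod)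
    also have "\<dots> \<le> k" using that by (simp add: norm_mult u_eq dist_norm norm_minus_commute)
    finally show ?thesis unfolding k_def by linarith
  qed
  have rayt: "ray u 0 r * y = of_real r * (u * y)" for r y by (simp add: ray_def mult.assoc)
  have Re0: "Re (ray u 0 r * y) \<le> 0" if "r > 0" "y \<in> ball t k" for r y
    unfolding rayt using ball[OF that(2)] that(1) k by (simp add: mult_nonneg_nonpos)
  have "(E u 0 \<tau> has_field_derivative
     (\<integral>r. indicator {0<..} r *\<^sub>R (ray u 0 r * exp (ray u 0 r * t) * Jf g \<tau> (ray u 0 r)) \<partial>lborel)) (at t)"
    unfolding E_def
  proof (rule integral_has_field_derivative[OF k, where w="\<lambda>r. 1 / k * dom \<tau> r"])
    have "(\<lambda>r. indicator {0<..} r *\<^sub>R (exp (ray u 0 r * t) * Jf g \<tau> (ray u 0 r))) \<in> borel_measurable borel"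
      by (rule E_measurable[OF du]) simp
    then have "(\<lambda>r. ray u 0 r * (indicator {0<..} r *\<^sub>R (exp (ray u 0 r * t) * Jf g \<tau> (ray u 0 r)))) \<in> borel_measurable borel"
      by (intro borel_measurable_times borel_measurable_continuous_onI[OF ray_cont])
    then show "(\<lambda>r. indicator {0<..} r *\<^sub>R (ray u 0 r * exp (ray u 0 r * t) * Jf g \<tau> (ray u 0 r))) \<in> borel_measurable lborel"
      by (simp add: mult.assoc)
    show "(\<lambda>r. indicator {0<..} r *\<^sub>R (exp (ray u 0 r * y) * Jf g \<tau> (ray u 0 r))) \<in> borel_measurable lborel" for y
      using E_measurable[OF du, of 0 y] by simp
    show "integrable lborel (\<lambda>r. indicator {0<..} r *\<^sub>R (exp (ray u 0 r * t) * Jf g \<tau> (ray u 0 r)))"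
      using Re0[of _ t] k by (intro E_integrable[OF \<tau> du, where b=0]) auto
    show "integrable lborel (\<lambda>r. 1 / k * dom \<tau> r)" using dom_integrable by (intro integrable_mult_right)
    show "AE r in lborel. \<forall>y\<in>ball t k.
        ((\<lambda>y. indicator {0<..} r *\<^sub>R (exp (ray u 0 r * y) * Jf g \<tau> (ray u 0 r))) has_field_derivative
          indicator {0<..} r *\<^sub>R (ray u 0 r * exp (ray u 0 r * y) * Jf g \<tau> (ray u 0 r))) (at y) \<and>
        norm (indicator {0<..} r *\<^sub>R (ray u 0 r * exp (ray u 0 r * y) * Jf g \<tau> (ray u 0 r))) \<le> 1 / k * dom \<tau> r"
    proof (intro AE_I2 ballI conjI)
      fix r :: real and y assume y: "y \<in> ball t k"
      show "((\<lambda>y. indicator {0<..} r *\<^sub>R (exp (ray u 0 r * y) * Jf g \<tau> (ray u 0 r))) has_field_derivative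
          indicator {0<..} r *\<^sub>R (ray u 0 r * exp (ray u 0 r * y) * Jf g \<tau> (ray u 0 r))) (at y)"
        unfolding scaleR_conv_of_real by (auto intro!: derivative_eq_intros)
      show "norm (indicator {0<..} r *\<^sub>R (ray u 0 r * exp (ray u 0 r * y) * Jf g \<tau> (ray u 0 r))) \<le> 1 / k * dom \<tau> r"
      proof (cases "r > 0")
        case True
        \<comment> \<open>The derivative in t brings a factor r, which is compensated by r exp(-r k)
          \<le> 1 / k.\<close>
        have "r * k \<le> exp (r * k)" using exp_ge_add_one_self[of "r * k"] by linarith
        then have "r * exp (- (r * k)) \<le> 1 / k" using k by (simp add: exp_minus field_simps)
        moreover have "Re (ray u 0 r * y) \<le> - (r * k)"
          unfolding rayt using mult_left_mono[OF ball[OF y], of r] True by simp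
        then have "r * exp (Re (ray u 0 r * y)) \<le> r * exp (- (r * k))" using True by simp
        ultimately have 1: "r * exp (Re (ray u 0 r * y)) \<le> 1 / k" by linarith
        have "norm (ray u 0 r) = r" using True by (simp add: ray_def norm_mult u_eq)
        then have "norm (indicator {0<..} r *\<^sub>R (ray u 0 r * exp (ray u 0 r * y) * Jf g \<tau> (ray u 0 r)))
            = (r * exp (Re (ray u 0 r * y))) * norm (Jf g \<tau> (ray u 0 r))"
          using True by (simp add: norm_mult)
        also have "\<dots> \<le> 1 / k * dom \<tau> r"
          using 1 True k by (intro mult_mono Jf_ray_bound \<tau> du) auto
        finally show ?thesis .
      qed (use k in \<open>simp add: dom_def K_nonneg maj_nonneg\<close>)
    qed
  qed
  then show ?thesis by blast
qed

theorem phi_analytic_extension: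
  assumes \<tau>: "\<tau> > 0"
  shows "\<exists>\<Phi>. \<Phi> holomorphic_on open_sector \<theta>0 \<and> (\<forall>t>0. \<Phi> (of_real t) = of_real (phi t \<tau>)) \<and>
    (\<forall>\<theta><\<theta>0. bounded (\<Phi> ` closed_sector \<theta>))"
proof -
  have du: "direction u" by (simp add: direction_def)
  define F where "F t = u * E u 0 \<tau> t" for t
  \<comment> \<open>Im F / pi itself is not holomorphic. The Schwarz reflection t -> cnj (F (cnj t))
    is, and on the positive axis it agrees with the conjugate of F.\<close>
  define \<Phi> where "\<Phi> t = (F t - cnj (F (cnj t))) / (2 * of_real pi * \<i>)" for t
  have cnj_sec: "cnj t \<in> open_sector \<theta>0" if "t \<in> open_sector \<theta>0" for t
    using that by (auto simp: open_sector_def Arg_cnj split: if_splits)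
  have Fd: "\<exists>D. (F has_field_derivative D) (at t)" if "t \<in> open_sector \<theta>0" for t
    using E_deriv[OF \<tau> u_sector[OF that]] unfolding F_def by (auto intro: DERIV_cmult)
  have holo: "\<Phi> holomorphic_on open_sector \<theta>0"
    unfolding holomorphic_on_def
  proof
    fix t assume t: "t \<in> open_sector \<theta>0"
    obtain D1 where D1: "(F has_field_derivative D1) (at t)" using Fd[OF t] by blast
    obtain D2 where D2: "(F has_field_derivative D2) (at (cnj t))" using Fd[OF cnj_sec[OF t]] by blast
    have "(cnj \<circ> F \<circ> cnj has_field_derivative cnj D2) (at t)"
      using has_field_derivative_cnj_cnj[of F D2 t] D2 by simp
    then have "((\<lambda>t. cnj (F (cnj t))) has_field_derivative cnj D2) (at t)" by (simp add: o_def)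
    from DERIV_cdivide[OF DERIV_diff[OF D1 this]]
    have "(\<Phi> has_field_derivative (D1 - cnj D2) / (2 * of_real pi * \<i>)) (at t)" unfolding \<Phi>_def .
    then show "\<Phi> field_differentiable at t within open_sector \<theta>0"
      using field_differentiable_def field_differentiable_at_within by blast
  qed
  have val: "\<Phi> (of_real t) = of_real (phi t \<tau>)" if "t > 0" for t
  proof -
    define w where "w = F (of_real t)"
    have "w - cnj w = of_real (2 * Im w) * \<i>" by (simp add: complex_diff_cnj)
    then have "\<Phi> (of_real t) = of_real (Im w / pi)" unfolding \<Phi>_def complex_cnj_complex_of_real w_def[symmetric] by simp
    then show ?thesis using phi_ray_0[OF \<tau> that] by (simp only: w_def F_def)
  qed
  \<comment> \<open>On the ray from the origin the exponential has modulus at most 1 for every t of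
    the open sector, so the integral of the majorant bounds F there.\<close>
  define B where "B = (\<integral>r. dom \<tau> r \<partial>lborel)"
  have FB: "norm (F t) \<le> B" if t: "t \<in> open_sector \<theta>0" for t
  proof -
    have r: "Re (ray u 0 r * t) \<le> 0" if "r > 0" for r
      using u_sector[OF t] that by (simp add: ray_def mult.assoc mult_nonneg_nonpos)
    have "norm (E u 0 \<tau> t) \<le> (\<integral>r. norm (indicator {0<..} r *\<^sub>R (exp (ray u 0 r * t) * Jf g \<tau> (ray u 0 r))) \<partial>lborel)"
      unfolding E_def by (rule integral_norm_bound)
    also have "\<dots> \<le> B" unfolding B_def
      using E_bound[OF \<tau> du order_refl r] E_integrable[OF \<tau> du order_refl r] dom_integrable
      by (intro integral_mono integrable_norm) auto
    finally show ?thesis by (simp add: F_def norm_mult u_eq)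
  qed
  have "bounded (\<Phi> ` closed_sector \<theta>)" if "\<theta> < \<theta>0" for \<theta>
  proof -
    have "norm (\<Phi> t) \<le> B / pi" if "t \<in> closed_sector \<theta>" for t
    proof -
      have t: "t \<in> open_sector \<theta>0" using that \<open>\<theta> < \<theta>0\<close> by (auto simp: open_sector_def closed_sector_def)
      have "norm (F t - cnj (F (cnj t))) \<le> norm (F t) + norm (cnj (F (cnj t)))" by (rule norm_triangle_ineq4)
      also have "\<dots> \<le> 2 * B" using FB[OF t] FB[OF cnj_sec[OF t]] by simp
      finally have "norm (F t - cnj (F (cnj t))) / (2 * pi) \<le> 2 * B / (2 * pi)" by (rule divide_right_mono) simp
      then show ?thesis by (simp add: \<Phi>_def norm_divide norm_mult)
    qed
    then show ?thesis by (auto simp: bounded_iff)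
  qed
  then show ?thesis using holo val by (intro exI[of _ \<Phi>]) auto
qed

end

section \<open>Symbols of admissible weights\<close>

context sector_weight
begin

lemma sectorial_symbol_h: "\<exists>\<rho> c C. sectorial_symbol h \<theta>0 \<rho> c C"
proof -
  have "sectorial_symbol h \<theta>0 p (min c0 (c0 * m)) m"
  proof (intro sectorial_symbol.intro sectorial_symbol_axioms.intro symbol_h \<theta>0 pq(1))
    show "p < 1" using p_le_q pq by linarith
    show "min c0 (c0 * m) > 0" using c0_pos m_pos by simp
    show "h holomorphic_on {z. z \<noteq> 0 \<and> \<bar>Arg z\<bar> \<le> pi / 2 + \<theta>0}"
      using holomorphic_on_subset[OF h_holo sector_slit] by (simp only: sector_def)
  next
    fix z :: complex
    assume z: "z \<noteq> 0" "\<bar>Arg z\<bar> \<le> pi / 2 + \<theta>0"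
    then have zs: "z \<in> sector" by (simp add: sector_def)
    have "min c0 (c0 * m) * norm (h z) \<le> c0 * norm (h z)" by (intro mult_right_mono) auto
    then show "min c0 (c0 * m) * norm (h z) \<le> Re (h z)" using h_sectorial(1)[OF zs] by linarith
    show "norm (h z) \<le> m * norm z powr p" if "norm z \<le> 1" by (rule h_sectorial(3)[OF zs that])
  next
    fix z :: complex
    assume z: "\<bar>Arg z\<bar> \<le> pi / 2 + \<theta>0" "1 \<le> norm z"
    then have zs: "z \<in> sector" by (auto simp: sector_def)
    have "min c0 (c0 * m) * norm z powr p \<le> c0 * m * norm z powr p" by (intro mult_right_mono) auto
    then show "min c0 (c0 * m) * norm z powr p \<le> norm (h z)" using h_sectorial(2)[OF zs z(2)] by linarith
  qed
  then show ?thesis by blast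
qed

lemma sectorial_symbol_div_h: "\<exists>\<rho> c C. sectorial_symbol (\<lambda>z. z / h z) \<theta>0 \<rho> c C"
proof -
  have "sectorial_symbol (\<lambda>z. z / h z) \<theta>0 (1 - q) (min c0 (1 / m)) (1 / (c0 * m))"
  proof (intro sectorial_symbol.intro sectorial_symbol_axioms.intro symbol_div_h \<theta>0)
    show "0 < 1 - q" "1 - q < 1" using p_le_q pq by linarith+
    show "min c0 (1 / m) > 0" using c0_pos m_pos by simp
    have "(\<lambda>z. z / h z) holomorphic_on sector"
      using holomorphic_on_subset[OF h_holo sector_slit] sector_h_nonzero
      by (intro holomorphic_intros) auto
    then show "(\<lambda>z. z / h z) holomorphic_on {z. z \<noteq> 0 \<and> \<bar>Arg z\<bar> \<le> pi / 2 + \<theta>0}"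
      by (simp only: sector_def)
  next
    fix z :: complex
    assume z: "z \<noteq> 0" "\<bar>Arg z\<bar> \<le> pi / 2 + \<theta>0"
    then have zs: "z \<in> sector" by (simp add: sector_def)
    have "min c0 (1 / m) * norm (z / h z) \<le> c0 * norm (z / h z)" by (intro mult_right_mono) auto
    then show "min c0 (1 / m) * norm (z / h z) \<le> Re (z / h z)" using div_h_sectorial(1)[OF zs] by linarith
    show "norm (z / h z) \<le> 1 / (c0 * m) * norm z powr (1 - q)" if "norm z \<le> 1"
      by (rule div_h_sectorial(3)[OF zs that])
  next
    fix z :: complex
    assume z: "\<bar>Arg z\<bar> \<le> pi / 2 + \<theta>0" "1 \<le> norm z"
    then have zs: "z \<in> sector" by (auto simp: sector_def)
    have "min c0 (1 / m) * norm z powr (1 - q) \<le> 1 / m * norm z powr (1 - q)" by (intro mult_right_mono) auto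
    then show "min c0 (1 / m) * norm z powr (1 - q) \<le> norm (z / h z)" using div_h_sectorial(2)[OF zs z(2)] by linarith
  qed
  then show ?thesis by blast
qed

end

lemma weight_symbol_subordinator:
  assumes "admissible_weight \<mu>"
  shows "subordinator_symbol (weight_symbol \<mu>)" "subordinator_symbol (\<lambda>s. s / weight_symbol \<mu> s)"
proof -
  obtain N where N: "weight_measure N" "weight_symbol \<mu> = weight_measure.h N"
  proof (cases \<mu>)
    case (Discrete \<alpha> m b a)
    obtain p q where "sector_weight (discrete_weight_measure \<alpha> m b a) p q"
      using discrete_weight(1) assms Discrete by blast
    then interpret sector_weight "discrete_weight_measure \<alpha> m b a" p q .
    show ?thesis
      using that[OF weight_measure_axioms] discrete_weight(2)[OF assms[unfolded Discrete]]
      by (simp add: Discrete h_def fun_eq_iff)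
  next
    case (Continuous f)
    interpret weight_measure "continuous_weight_measure f"
      using continuous_weight(1) assms Continuous by blast
    show ?thesis
      using that[OF weight_measure_axioms] continuous_weight(2)[OF assms[unfolded Continuous]]
      by (simp add: Continuous h_def fun_eq_iff)
  qed
  show "subordinator_symbol (weight_symbol \<mu>)" "subordinator_symbol (\<lambda>s. s / weight_symbol \<mu> s)"
    unfolding N(2) by (rule weight_measure.symbol_h[OF N(1)] weight_measure.symbol_div_h[OF N(1)])+
qed

lemma weight_symbol_sectorial:
  assumes "admissible_weight \<mu>" "is_Discrete \<mu>" "g = weight_symbol \<mu> \<or> g = (\<lambda>s. s / weight_symbol \<mu> s)"
  shows "\<exists>\<theta>0 \<rho> c C. sectorial_symbol g \<theta>0 \<rho> c C"
proof -
  obtain \<alpha> m b a where \<mu>: "\<mu> = Discrete \<alpha> m b a" using assms(2) by (cases \<mu>) auto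
  obtain p q where "sector_weight (discrete_weight_measure \<alpha> m b a) p q"
    using discrete_weight(1) assms(1) \<mu> by blast
  then interpret sector_weight "discrete_weight_measure \<alpha> m b a" p q .
  have "weight_symbol \<mu> = h"
    using discrete_weight(2)[OF assms(1)[unfolded \<mu>]] by (simp add: \<mu> h_def fun_eq_iff)
  then show ?thesis using assms(3) sectorial_symbol_h sectorial_symbol_div_h by auto
qed

theorem theorem5p1:
  fixes \<mu> :: weight
    and D :: "'a::banach set" and A :: "'a \<Rightarrow> 'a"
    and T S :: "real \<Rightarrow> 'a \<Rightarrow>\<^sub>L 'a"
    and g :: "complex \<Rightarrow> complex"
  assumes "admissible_weight \<mu>"
    and "bounded_C0_semigroup T"
    and "is_generator D A T"
    and "(caputo_solution_operator \<mu> D A S \<and> g = weight_symbol \<mu>) \<or>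
         (riemann_liouville_solution_operator \<mu> D A S \<and> g = (\<lambda>s. s / weight_symbol \<mu> s))"
  shows "\<exists>\<phi> :: real \<Rightarrow> real \<Rightarrow> real.
    (\<forall>\<gamma>>0. \<forall>t>0. \<forall>\<tau>>0.
       vertical_integrable \<gamma>
         (\<lambda>s. exp (s * complex_of_real t - complex_of_real \<tau> * g s) * (g s / s)) \<and>
       complex_of_real (\<phi> t \<tau>) =
         1 / (2 * complex_of_real pi * \<i>) * vertical_integral \<gamma>
           (\<lambda>s. exp (s * complex_of_real t - complex_of_real \<tau> * g s) * (g s / s))) \<and>
    (\<forall>t>0. \<forall>x. ((\<lambda>\<tau>. \<phi> t \<tau> *\<^sub>R T \<tau> x) has_integral S t x) {0<..}) \<and>
    (\<forall>t>0. \<forall>\<tau>>0. 0 \<le> \<phi> t \<tau>) \<and>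
    (\<forall>t>0. set_integrable lborel {0<..} (\<phi> t) \<and> (LBINT \<tau>:{0<..}. \<phi> t \<tau>) = 1) \<and>
    (is_Discrete \<mu> \<longrightarrow>
       (\<exists>\<theta>\<^sub>0. 0 < \<theta>\<^sub>0 \<and> \<theta>\<^sub>0 < pi / 2 \<and>
          (\<forall>\<tau>>0. \<exists>\<Phi> :: complex \<Rightarrow> complex.
             \<Phi> holomorphic_on open_sector \<theta>\<^sub>0 \<and>
             (\<forall>t>0. \<Phi> (complex_of_real t) = complex_of_real (\<phi> t \<tau>)) \<and>
             (\<forall>\<theta><\<theta>\<^sub>0. bounded (\<Phi> ` closed_sector \<theta>)))))"
proof -
  \<comment> \<open>Both problems share the relation that the kernel has transform 1 / g: in the
    Caputo case this is 1 / h, in the Riemann-Liouville case h / s is the reciprocal of s /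
    h.\<close>
  obtain k F where F: "has_laplace_transform k F" "volterra_solution_operator D A k S" "\<And>s. s > 0 \<Longrightarrow> F (of_real s) = 1 / g (of_real s)"
    using assms(4) unfolding caputo_solution_operator_def riemann_liouville_solution_operator_def by force
  have "subordinator_symbol g" using weight_symbol_subordinator[OF assms(1)] assms(4) by blast
  then interpret subordination T D A g
    using assms(2,3) by (intro subordination.intro semigroup_generator.intro bounded_semigroup.intro semigroup_generator_axioms.intro)
  have kernel: "exp (s * complex_of_real t - complex_of_real \<tau> * g s) * (g s / s) = exp (s * complex_of_real t) * Jf g \<tau> s" for s t \<tau>
    by (simp add: Jf_def mult_exp_exp mult.assoc[symmetric])
  have formula: "vertical_integrable \<gamma> (\<lambda>s. exp (s * complex_of_real t - complex_of_real \<tau> * g s) * (g s / s))"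
    "complex_of_real (phi t \<tau>) = 1 / (2 * complex_of_real pi * \<i>) * vertical_integral \<gamma>
       (\<lambda>s. exp (s * complex_of_real t - complex_of_real \<tau> * g s) * (g s / s))"
    if "\<gamma> > 0" "t > 0" "\<tau> > 0" for \<gamma> t \<tau>
    using phi_formula[OF that] unfolding kernel vertical_integrable_def vertical_integral_def by simp_all
  have identity: "((\<lambda>\<tau>. phi t \<tau> *\<^sub>R T \<tau> x) has_integral S t x) {0<..}" if "t > 0" for t x
    using that by (intro subordination_identity[OF F(1) F(3) F(2)])
  have analytic: "\<exists>\<theta>\<^sub>0. 0 < \<theta>\<^sub>0 \<and> \<theta>\<^sub>0 < pi / 2 \<and>
      (\<forall>\<tau>>0. \<exists>\<Phi> :: complex \<Rightarrow> complex. \<Phi> holomorphic_on open_sector \<theta>\<^sub>0 \<and>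
        (\<forall>t>0. \<Phi> (complex_of_real t) = complex_of_real (phi t \<tau>)) \<and>
        (\<forall>\<theta><\<theta>\<^sub>0. bounded (\<Phi> ` closed_sector \<theta>)))" if discrete: "is_Discrete \<mu>"
  proof -
    obtain \<theta>0 \<rho> c C where "sectorial_symbol g \<theta>0 \<rho> c C"
      using weight_symbol_sectorial[OF assms(1) discrete] assms(4) by blast
    then interpret sectorial_symbol g \<theta>0 \<rho> c C .
    show ?thesis using phi_analytic_extension \<theta>0 by (intro exI[of _ \<theta>0]) auto
  qed
  show ?thesis
    by (rule exI[of _ phi], intro conjI allI impI formula identity phi_nonneg phi_integral analytic)
qed

end
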